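(* Let the setting, data, triangulation $\mathcal{T}_h$, space $V_{0h}$, forms $a_h,l_h$ and norms $\|\cdot\|_h,\|\cdot\|_{h,*}$ be as described in the context. Let $u\in H^{\mathcal{L}}_0(\mathcal{Q})$ be the solution of the parabolic initial-boundary value problem in its space-time variational form $$\int_{Q} (-u\, \partial_{t}v + \nu \nabla_{x}u\cdot\nabla_{x}v) \,\mathrm{d}Q = \int_{Q} (f v + \mathbf{f}\cdot\nabla_{x}v)\,\mathrm{d}Q + \int_\Omega u_0(x)\,v(x,0)\,\mathrm{d}x\quad \forall v \in H^{1,1}_{0,\overline{0}}(Q),$$ and let $u_h\in V_{0h}$ be the solution of the space-time finite element scheme $a_h(u_h,v_h)=l_h(v_h)$ for all $v_h\in V_{0h}$. Let $\theta_K$, $K\in\mathcal{T}_h$, be chosen sufficiently small, so that the coercivity estimate $a_h(v_h,v_h)\ge\mu_c\|v_h\|_h^2$ holds for all $v_h\in V_{0h}$ with a positive constant $\mu_c$ (more precisely, if $\theta_K\le h_K/c_{I,K,\nu}^2$ for all $K\in\mathcal{T}_h$, then $\mu_c$ can be chosen as $1/2$), and let $\mu_b=1$, the constant in the boundedness estimate $|a_h(w,v_h)|\le\mu_b\|w\|_{h,*}\|v_h\|_h$ for all $w\in V_{0h,*}$, $v_h\in V_{0h}$. Then the discretization error estimate $$\|u-u_h\|_h \leq \inf_{v_h\in V_{0h}} \Big(\|u-v_h\|_h + \frac{\mu_b}{\mu_c}\|u-v_h\|_{h,*}\Big)$$ holds.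
   Context: Domain and data: $\Omega\subset\mathbb{R}^d$, $d\in\{1,2,3\}$, is a bounded Lipschitz domain, $T>0$, $Q=\Omega\times(0,T)$, $\Sigma=\partial\Omega\times(0,T)$, $\Sigma_T=\Omega\times\{T\}$. The coefficient $\nu\in L_\infty(Q)$ satisfies $\underline\nu\le\nu(x,t)\le\overline\nu$ for almost all $(x,t)\in Q$ with positive constants $\underline\nu,\overline\nu$; $f\in L_2(Q)$, $\mathbf{f}\in[L_2(Q)]^d$, $u_0\in L_2(\Omega)$. There is a decomposition $\overline Q=\bigcup_{i=1}^m\overline{Q_i}$ into non-overlapping Lipschitz domains $Q_1,\dots,Q_m$ such that $\mathbf{f}|_{Q_i}\in H(\mathrm{div}_x,Q_i)$ (i.e. $\mathrm{div}_x\mathbf{f}\in L_2(Q_i)$) for all $i$; $\mathbf{f}$ may jump across the interfaces. Here $\nabla_x,\mathrm{div}_x$ are the spatial gradient and divergence, and $\mathrm{div}$ is the (weak) space-time divergence, so formally $\mathrm{div}\begin{pmatrix}-\nu\nabla_xw\\ w\end{pmatrix}=\partial_tw-\mathrm{div}_x(\nu\nabla_xw)$. Function spaces: $H^{1,0}_0(Q)=\{v\in L_2(Q):\nabla_xv\in[L_2(Q)]^d,\ v=0\text{ on }\Sigma\}$; $H^{1,1}_{0,\overline 0}(Q)=\{v\in L_2(Q):\nabla_xv\in[L_2(Q)]^d,\ \partial_tv\in L_2(Q),\ v=0\text{ on }\Sigma,\ v=0\text{ on }\Sigma_T\}$; $H^{\mathcal{L}}_0(\mathcal{Q})=\{v\in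 H^{1,0}_0(Q): \mathrm{div}\begin{pmatrix}-\nu\nabla_xv\\ v\end{pmatrix}\in L_2(Q_i),\ i=1,\dots,m\}$. The variational problem has a unique solution $u\in H^{1,0}_0(Q)$, and $\|u(\cdot,t)\|_{L_2(\Omega)}$ is continuous with respect to $t$. Discretization: $\mathcal{T}_h$ is a shape-regular triangulation of $Q$ into non-overlapping simplices $K$ with mesh size $h_K$ (affine-linear maps $x_K$ from the reference simplex $\hat K$ onto $K$), aligned with the decomposition, i.e. each $\overline{Q_i}$ is a union of closures of elements of $\mathcal{T}_h$. For a polynomial degree $p\ge1$, $V_{0h}=\{v\in C(\overline Q): v(x_K(\cdot))\in\mathbb{P}_p(\hat K)\ \forall K\in\mathcal{T}_h,\ v=0\text{ on }\overline\Sigma\}$. The constant $c_{I,K,\nu}$ is the one from the inverse inequality $\|\mathrm{div}_x(\nu\nabla_xv_h)\|_{L_2(K)}\le c_{I,K,\nu}h_K^{-1}\|\nu^{1/2}\nabla_xv_h\|_{L_2(K)}$, which holds for all $v_h\in V_{0h}$ and $K\in\mathcal{T}_h$. Further $V_{0h,*}=H^{\mathcal{L}}_0(\mathcal{Q})+V_{0h}$. Forms, with stabilization parameters $\theta_K>0$: $$a_h(w,v_h)=\sum_{K\in\mathcal{T}_h}\int_K\Big[\nu\nabla_xw\cdot\nabla_xv_h-w\,\partial_tv_h+\theta_Kh_K\,\mathrm{div}\begin{pmatrix}-\nu\nabla_xw\\ w\end{pmatrix}\partial_tv_h\Big]\mathrm{d}Q+\int_\Omega w(x,T)v_h(x,T)\,\mathrm{d}x,$$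 $$l_h(v_h)=\sum_{K\in\mathcal{T}_h}\int_K\big[fv_h+\mathbf{f}\cdot\nabla_xv_h+\theta_Kh_Kf\,\partial_tv_h-\theta_Kh_K\,\mathrm{div}_x(\mathbf{f})\,\partial_tv_h\big]\mathrm{d}Q+\int_\Omega u_0(x)v_h(x,0)\,\mathrm{d}x.$$ Norms: $$\|w\|_h^2=\sum_{K\in\mathcal{T}_h}\big[\|\nu^{1/2}\nabla_xw\|_{L_2(K)}^2+\theta_Kh_K\|\partial_tw\|_{L_2(K)}^2\big]+\|w(\cdot,T)\|_{L_2(\Omega)}^2+\|w(\cdot,0)\|_{L_2(\Omega)}^2,$$ $$\|w\|_{h,*}^2=\sum_{K\in\mathcal{T}_h}\Big[\|\nu^{1/2}\nabla_xw\|_{L_2(K)}^2+(\theta_Kh_K)^{-1}\|w\|_{L_2(K)}^2+\theta_Kh_K\Big\|\mathrm{div}\begin{pmatrix}-\nu\nabla_xw\\ w\end{pmatrix}\Big\|_{L_2(K)}^2\Big]+\|w(\cdot,T)\|_{L_2(\Omega)}^2.$$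
   Formalization: The boundedness estimate with μ_b = 1 is taken as a hypothesis of the error estimate: with these norms it can fail (e.g. for very small ν with θ_K h_K = T = 1; Cauchy–Schwarz gives only √2), so it is not available unconditionally. *)

theory Defs
  imports "HOL-Analysis.Analysis"
begin

text \<open>
  Points of space-time are pairs \<open>(x, t)\<close>. Elements of \<open>L\<^sub>2\<close> are represented by functions that
  are Borel measurable on the set in question (every Lebesgue class has such a representative);
  values outside that set are irrelevant.
\<close>

type_synonym 'd spacetime = "(real ^ 'd) \<times> real"

subsection \<open>Lipschitz domains\<close>

definition lipschitz_domain :: "'a::euclidean_space set \<Rightarrow> bool" where
  "lipschitz_domain S \<longleftrightarrow>
     open S \<and> connected S \<and> S \<noteq> {} \<and> bounded S \<and>
     (\<forall>p\<in>frontier S. \<exists>e r L (g :: 'a \<Rightarrow> real). norm e = 1 \<and> r > 0 \<and> L-lipschitz_on UNIV g \<and>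
        (\<forall>x\<in>ball p r. x \<in> S \<longleftrightarrow> g (x - (x \<bullet> e) *\<^sub>R e) < x \<bullet> e))"

subsection \<open>Square-integrable functions and test functions\<close>

definition L2_on :: "'a::euclidean_space set \<Rightarrow> ('a \<Rightarrow> 'b::euclidean_space) \<Rightarrow> bool" where
  "L2_on S f \<longleftrightarrow> set_borel_measurable lborel S f \<and> set_integrable lborel S (\<lambda>z. (norm (f z))\<^sup>2)"

definition L2_sq :: "'a::euclidean_space set \<Rightarrow> ('a \<Rightarrow> 'b::euclidean_space) \<Rightarrow> ennreal" where
  "L2_sq S f = (\<integral>\<^sup>+z\<in>S. ennreal ((norm (f z))\<^sup>2) \<partial>lborel)"

definition sqrt_ennreal :: "ennreal \<Rightarrow> ennreal" where
  "sqrt_ennreal a = (if a = \<infinity> then \<infinity> else ennreal (sqrt (enn2real a)))"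

definition L2_norm_on :: "'a::euclidean_space set \<Rightarrow> ('a \<Rightarrow> 'b::euclidean_space) \<Rightarrow> ennreal" where
  "L2_norm_on S f = sqrt_ennreal (L2_sq S f)"

primrec C_k :: "nat \<Rightarrow> ('a::euclidean_space \<Rightarrow> real) \<Rightarrow> bool" where
  "C_k 0 f \<longleftrightarrow> continuous_on UNIV f"
| "C_k (Suc k) f \<longleftrightarrow> (\<forall>z. f differentiable (at z)) \<and>
     (\<forall>b\<in>Basis. C_k k (\<lambda>z. frechet_derivative f (at z) b))"

definition smooth :: "('a::euclidean_space \<Rightarrow> real) \<Rightarrow> bool" where
  "smooth f \<longleftrightarrow> (\<forall>k. C_k k f)"

definition test_function :: "'a::euclidean_space set \<Rightarrow> ('a \<Rightarrow> real) \<Rightarrow> bool" where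
  "test_function S \<phi> \<longleftrightarrow>
     smooth \<phi> \<and> (\<exists>C. compact C \<and> C \<subseteq> S \<and> (\<forall>z. z \<notin> C \<longrightarrow> \<phi> z = 0))"

definition dt :: "('d::finite spacetime \<Rightarrow> real) \<Rightarrow> 'd spacetime \<Rightarrow> real" where
  "dt \<phi> z = frechet_derivative \<phi> (at z) (0, 1)"

definition grad_x :: "('d::finite spacetime \<Rightarrow> real) \<Rightarrow> 'd spacetime \<Rightarrow> real ^ 'd" where
  "grad_x \<phi> z = (\<chi> i. frechet_derivative \<phi> (at z) (axis i 1, 0))"

subsection \<open>Weak derivatives in \<open>L\<^sub>2\<close> of an open set\<close>

definition has_weak_grad_x ::
    "'d::finite spacetime set \<Rightarrow> ('d spacetime \<Rightarrow> real) \<Rightarrow> ('d spacetime \<Rightarrow> real ^ 'd) \<Rightarrow> bool" where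
  "has_weak_grad_x S w G \<longleftrightarrow> L2_on S w \<and> L2_on S G \<and>
     (\<forall>\<phi>. test_function S \<phi> \<longrightarrow>
        (LINT z:S|lborel. w z *\<^sub>R grad_x \<phi> z) = - (LINT z:S|lborel. \<phi> z *\<^sub>R G z))"

definition has_weak_dt ::
    "'d::finite spacetime set \<Rightarrow> ('d spacetime \<Rightarrow> real) \<Rightarrow> ('d spacetime \<Rightarrow> real) \<Rightarrow> bool" where
  "has_weak_dt S w g \<longleftrightarrow> L2_on S w \<and> L2_on S g \<and>
     (\<forall>\<phi>. test_function S \<phi> \<longrightarrow>
        (LINT z:S|lborel. w z * dt \<phi> z) = - (LINT z:S|lborel. \<phi> z * g z))"

definition has_weak_div_x ::
    "'d::finite spacetime set \<Rightarrow> ('d spacetime \<Rightarrow> real ^ 'd) \<Rightarrow> ('d spacetime \<Rightarrow> real) \<Rightarrow> bool" where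
  "has_weak_div_x S V g \<longleftrightarrow> L2_on S V \<and> L2_on S g \<and>
     (\<forall>\<phi>. test_function S \<phi> \<longrightarrow>
        (LINT z:S|lborel. V z \<bullet> grad_x \<phi> z) = - (LINT z:S|lborel. \<phi> z * g z))"

definition has_weak_div ::
    "'d::finite spacetime set \<Rightarrow> ('d spacetime \<Rightarrow> 'd spacetime) \<Rightarrow> ('d spacetime \<Rightarrow> real) \<Rightarrow> bool" where
  "has_weak_div S V g \<longleftrightarrow> L2_on S V \<and> L2_on S g \<and>
     (\<forall>\<phi>. test_function S \<phi> \<longrightarrow>
        (LINT z:S|lborel. V z \<bullet> (grad_x \<phi> z, dt \<phi> z)) = - (LINT z:S|lborel. \<phi> z * g z))"

text \<open>
  Weak derivatives are unique up to null sets, so the choices below do not affect any integral.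
\<close>

definition weak_grad_x ::
    "'d::finite spacetime set \<Rightarrow> ('d spacetime \<Rightarrow> real) \<Rightarrow> 'd spacetime \<Rightarrow> real ^ 'd" where
  "weak_grad_x S w = (SOME G. has_weak_grad_x S w G)"

definition weak_dt ::
    "'d::finite spacetime set \<Rightarrow> ('d spacetime \<Rightarrow> real) \<Rightarrow> 'd spacetime \<Rightarrow> real" where
  "weak_dt S w = (SOME g. has_weak_dt S w g)"

definition weak_div_x ::
    "'d::finite spacetime set \<Rightarrow> ('d spacetime \<Rightarrow> real ^ 'd) \<Rightarrow> 'd spacetime \<Rightarrow> real" where
  "weak_div_x S V = (SOME g. has_weak_div_x S V g)"

text \<open>The weak space-time divergence of \<open>(- \<nu> \<nabla>\<^sub>x w, w)\<close>.\<close>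

definition has_parabolic_div ::
    "'d::finite spacetime set \<Rightarrow> ('d spacetime \<Rightarrow> real) \<Rightarrow> ('d spacetime \<Rightarrow> real) \<Rightarrow>
      ('d spacetime \<Rightarrow> real) \<Rightarrow> bool" where
  "has_parabolic_div S \<nu> w g \<longleftrightarrow> (\<exists>G. has_weak_grad_x S w G) \<and>
     has_weak_div S (\<lambda>z. (- (\<nu> z *\<^sub>R weak_grad_x S w z), w z)) g"

definition parabolic_div ::
    "'d::finite spacetime set \<Rightarrow> ('d spacetime \<Rightarrow> real) \<Rightarrow> ('d spacetime \<Rightarrow> real) \<Rightarrow>
      'd spacetime \<Rightarrow> real" where
  "parabolic_div S \<nu> w = (SOME g. has_parabolic_div S \<nu> w g)"

subsection \<open>Function spaces on the space-time cylinder\<close>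

definition cylinder :: "(real ^ 'd) set \<Rightarrow> real \<Rightarrow> 'd::finite spacetime set" where
  "cylinder \<Omega> T = \<Omega> \<times> {0<..<T}"

text \<open>
  \<open>w(\<cdot>, s) = g\<close> for \<open>s \<in> [0, T]\<close>: the slices \<open>w(\<cdot>, t)\<close> tend to \<open>g\<close> in \<open>L\<^sub>2(\<Omega>)\<close> as \<open>t \<rightarrow> s\<close>,
  up to a null set of times. For \<open>w \<in> C([0, T]; L\<^sub>2(\<Omega>))\<close> this is the value at \<open>s\<close>
  of the continuous representative.
\<close>

definition has_time_trace ::
    "(real ^ 'd) set \<Rightarrow> real \<Rightarrow> ('d::finite spacetime \<Rightarrow> real) \<Rightarrow> real \<Rightarrow>
      (real ^ 'd \<Rightarrow> real) \<Rightarrow> bool" where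
  "has_time_trace \<Omega> T w s g \<longleftrightarrow> L2_on \<Omega> g \<and>
     (\<forall>e>0. \<exists>\<delta>>0. AE t in lborel. 0 < t \<and> t < T \<and> \<bar>t - s\<bar> < \<delta> \<longrightarrow>
        L2_norm_on \<Omega> (\<lambda>x. w (x, t) - g x) < ennreal e)"

definition time_trace ::
    "(real ^ 'd) set \<Rightarrow> real \<Rightarrow> ('d::finite spacetime \<Rightarrow> real) \<Rightarrow> real \<Rightarrow> real ^ 'd \<Rightarrow> real" where
  "time_trace \<Omega> T w s = (SOME g. has_time_trace \<Omega> T w s g)"

text \<open>
  \<open>v = 0\<close> on \<open>\<Sigma>\<close> in the trace sense: \<open>v\<close> is a limit in \<open>H\<^sup>1\<^sup>,\<^sup>0(Q)\<close> of smooth functions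
  vanishing near \<open>\<Sigma>\<close>. No condition is imposed at \<open>t = 0\<close> and \<open>t = T\<close>.
\<close>

definition H10_0 :: "(real ^ 'd) set \<Rightarrow> real \<Rightarrow> ('d::finite spacetime \<Rightarrow> real) set" where
  "H10_0 \<Omega> T = {v. (\<exists>G. has_weak_grad_x (cylinder \<Omega> T) v G) \<and>
     (\<exists>\<phi> :: nat \<Rightarrow> 'd spacetime \<Rightarrow> real.
        (\<forall>n. smooth (\<phi> n) \<and> (\<exists>C. compact C \<and> C \<subseteq> \<Omega> \<and> (\<forall>x t. x \<notin> C \<longrightarrow> \<phi> n (x, t) = 0))) \<and>
        (\<lambda>n. L2_norm_on (cylinder \<Omega> T) (\<lambda>z. v z - \<phi> n z)) \<longlonglongrightarrow> 0 \<and>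
        (\<lambda>n. L2_norm_on (cylinder \<Omega> T)
               (\<lambda>z. weak_grad_x (cylinder \<Omega> T) v z - grad_x (\<phi> n) z)) \<longlonglongrightarrow> 0)}"

definition H11_0_0 :: "(real ^ 'd) set \<Rightarrow> real \<Rightarrow> ('d::finite spacetime \<Rightarrow> real) set" where
  "H11_0_0 \<Omega> T = {v \<in> H10_0 \<Omega> T.
     (\<exists>g. has_weak_dt (cylinder \<Omega> T) v g) \<and> has_time_trace \<Omega> T v T (\<lambda>x. 0)}"

definition HL_0 ::
    "(real ^ 'd) set \<Rightarrow> real \<Rightarrow> ('d::finite spacetime \<Rightarrow> real) \<Rightarrow> nat \<Rightarrow>
      (nat \<Rightarrow> 'd spacetime set) \<Rightarrow> ('d spacetime \<Rightarrow> real) set" where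
  "HL_0 \<Omega> T \<nu> m Qs = {v \<in> H10_0 \<Omega> T. \<forall>i\<in>{1..m}. \<exists>g. has_parabolic_div (Qs i) \<nu> v g}"

definition variational_solution ::
    "(real ^ 'd) set \<Rightarrow> real \<Rightarrow> ('d::finite spacetime \<Rightarrow> real) \<Rightarrow> ('d spacetime \<Rightarrow> real) \<Rightarrow>
      ('d spacetime \<Rightarrow> real ^ 'd) \<Rightarrow> (real ^ 'd \<Rightarrow> real) \<Rightarrow> ('d spacetime \<Rightarrow> real) \<Rightarrow> bool" where
  "variational_solution \<Omega> T \<nu> f F u0 u \<longleftrightarrow> (let Q = cylinder \<Omega> T in
     \<forall>v\<in>H11_0_0 \<Omega> T.
       (LINT z:Q|lborel. - (u z * weak_dt Q v z) + \<nu> z * (weak_grad_x Q u z \<bullet> weak_grad_x Q v z)) =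
       (LINT z:Q|lborel. f z * v z + F z \<bullet> weak_grad_x Q v z) +
       (LINT x:\<Omega>|lborel. u0 x * time_trace \<Omega> T v 0 x))"

subsection \<open>Decomposition, mesh and finite element space\<close>

definition decomposition_of ::
    "'d::finite spacetime set \<Rightarrow> nat \<Rightarrow> (nat \<Rightarrow> 'd spacetime set) \<Rightarrow> bool" where
  "decomposition_of Q m Qs \<longleftrightarrow>
     (\<forall>i\<in>{1..m}. lipschitz_domain (Qs i) \<and> Qs i \<subseteq> Q) \<and>
     disjoint_family_on Qs {1..m} \<and> closure Q = (\<Union>i\<in>{1..m}. closure (Qs i))"

definition reference_simplex :: "'a::euclidean_space set" where
  "reference_simplex = convex hull (insert 0 Basis)"

text \<open>
  The elements \<open>K\<close> are closed simplices; any two of them meet in a common face, so their interiors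
  are disjoint. Weak derivatives on an element are taken on \<open>interior K\<close>. The mesh size \<open>h\<^sub>K\<close> is
  \<open>diameter K\<close>, and \<open>\<sigma>\<close> is the shape-regularity constant.
\<close>

definition simplicial_mesh ::
    "'d::finite spacetime set \<Rightarrow> real \<Rightarrow> 'd spacetime set set \<Rightarrow>
      ('d spacetime set \<Rightarrow> 'd spacetime \<Rightarrow> 'd spacetime) \<Rightarrow> bool" where
  "simplicial_mesh Q \<sigma> \<T> X \<longleftrightarrow>
     triangulation \<T> \<and> closure Q = \<Union>\<T> \<and>
     (\<forall>K\<in>\<T>. int DIM('d spacetime) simplex K \<and>
        (\<exists>z r. r > 0 \<and> cball z r \<subseteq> K \<and> diameter K \<le> \<sigma> * r) \<and>
        (\<exists>A b. linear A \<and> X K = (\<lambda>\<xi>. A \<xi> + b)) \<and> X K ` reference_simplex = K)"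

definition aligned_with ::
    "'d::finite spacetime set set \<Rightarrow> nat \<Rightarrow> (nat \<Rightarrow> 'd spacetime set) \<Rightarrow> bool" where
  "aligned_with \<T> m Qs \<longleftrightarrow> (\<forall>i\<in>{1..m}. \<exists>\<S>\<subseteq>\<T>. closure (Qs i) = \<Union>\<S>)"

text \<open>Polynomials of total degree at most \<open>p\<close>, with multi-indices \<open>\<alpha>\<close> on \<open>Basis\<close>.\<close>

definition polys :: "nat \<Rightarrow> ('a::euclidean_space \<Rightarrow> real) set" where
  "polys p = {P. \<exists>c :: ('a \<Rightarrow> nat) \<Rightarrow> real.
     P = (\<lambda>z. \<Sum>\<alpha> | \<alpha> \<in> Basis \<rightarrow>\<^sub>E {..p} \<and> sum \<alpha> Basis \<le> p. c \<alpha> * (\<Prod>b\<in>Basis. (z \<bullet> b) ^ \<alpha> b))}"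

definition V_0h ::
    "(real ^ 'd) set \<Rightarrow> real \<Rightarrow> nat \<Rightarrow> 'd::finite spacetime set set \<Rightarrow>
      ('d spacetime set \<Rightarrow> 'd spacetime \<Rightarrow> 'd spacetime) \<Rightarrow> ('d spacetime \<Rightarrow> real) set" where
  "V_0h \<Omega> T p \<T> X = {v. continuous_on (closure (cylinder \<Omega> T)) v \<and>
     (\<forall>K\<in>\<T>. \<exists>P\<in>polys p. \<forall>\<xi>\<in>reference_simplex. v (X K \<xi>) = P \<xi>) \<and>
     (\<forall>z\<in>closure (frontier \<Omega> \<times> {0<..<T}). v z = 0)}"

definition V_0h_star ::
    "(real ^ 'd) set \<Rightarrow> real \<Rightarrow> ('d::finite spacetime \<Rightarrow> real) \<Rightarrow> nat \<Rightarrow>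
      (nat \<Rightarrow> 'd spacetime set) \<Rightarrow> nat \<Rightarrow> 'd spacetime set set \<Rightarrow>
      ('d spacetime set \<Rightarrow> 'd spacetime \<Rightarrow> 'd spacetime) \<Rightarrow> ('d spacetime \<Rightarrow> real) set" where
  "V_0h_star \<Omega> T \<nu> m Qs p \<T> X =
     {\<lambda>z. w z + v z | w v. w \<in> HL_0 \<Omega> T \<nu> m Qs \<and> v \<in> V_0h \<Omega> T p \<T> X}"

definition inverse_inequality ::
    "('d::finite spacetime \<Rightarrow> real) \<Rightarrow> ('d spacetime \<Rightarrow> real) set \<Rightarrow> 'd spacetime set \<Rightarrow> real \<Rightarrow> bool" where
  "inverse_inequality \<nu> V K c \<longleftrightarrow> (let E = interior K in
     \<forall>v\<in>V. (\<exists>g. has_weak_div_x E (\<lambda>z. \<nu> z *\<^sub>R weak_grad_x E v z) g) \<and>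
       L2_norm_on E (weak_div_x E (\<lambda>z. \<nu> z *\<^sub>R weak_grad_x E v z)) \<le>
         ennreal (c / diameter K) * L2_norm_on E (\<lambda>z. sqrt (\<nu> z) *\<^sub>R weak_grad_x E v z))"

subsection \<open>Discrete forms and norms\<close>

text \<open>
  The second argument of the bilinear form ranges over continuous functions on the closed cylinder,
  so its values at \<open>t = 0\<close> and \<open>t = T\<close> are taken pointwise.
\<close>

definition a_h ::
    "(real ^ 'd) set \<Rightarrow> real \<Rightarrow> ('d::finite spacetime \<Rightarrow> real) \<Rightarrow> 'd spacetime set set \<Rightarrow>
      ('d spacetime set \<Rightarrow> real) \<Rightarrow> ('d spacetime \<Rightarrow> real) \<Rightarrow> ('d spacetime \<Rightarrow> real) \<Rightarrow> real" where
  "a_h \<Omega> T \<nu> \<T> \<theta> w v =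
     (\<Sum>K\<in>\<T>. let E = interior K in
        LINT z:E|lborel. \<nu> z * (weak_grad_x E w z \<bullet> weak_grad_x E v z) - w z * weak_dt E v z
          + \<theta> K * diameter K * parabolic_div E \<nu> w z * weak_dt E v z) +
     (LINT x:\<Omega>|lborel. time_trace \<Omega> T w T x * v (x, T))"

definition l_h ::
    "(real ^ 'd) set \<Rightarrow> 'd::finite spacetime set set \<Rightarrow> ('d spacetime set \<Rightarrow> real) \<Rightarrow>
      ('d spacetime \<Rightarrow> real) \<Rightarrow> ('d spacetime \<Rightarrow> real ^ 'd) \<Rightarrow> (real ^ 'd \<Rightarrow> real) \<Rightarrow>
      ('d spacetime \<Rightarrow> real) \<Rightarrow> real" where
  "l_h \<Omega> \<T> \<theta> f F u0 v =
     (\<Sum>K\<in>\<T>. let E = interior K in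
        LINT z:E|lborel. f z * v z + F z \<bullet> weak_grad_x E v z
          + \<theta> K * diameter K * f z * weak_dt E v z
          - \<theta> K * diameter K * weak_div_x E F z * weak_dt E v z) +
     (LINT x:\<Omega>|lborel. u0 x * v (x, 0))"

text \<open>
  The norms are extended-valued: a term whose weak derivative or trace does not exist in \<open>L\<^sub>2\<close>
  is infinite. (Membership in \<^const>\<open>HL_0\<close> alone does not give \<open>\<partial>\<^sub>t w \<in> L\<^sub>2(K)\<close>.)
\<close>

definition sq_grad_term ::
    "('d::finite spacetime \<Rightarrow> real) \<Rightarrow> 'd spacetime set \<Rightarrow> ('d spacetime \<Rightarrow> real) \<Rightarrow> ennreal" where
  "sq_grad_term \<nu> E w =
     (if \<exists>G. has_weak_grad_x E w G then L2_sq E (\<lambda>z. sqrt (\<nu> z) *\<^sub>R weak_grad_x E w z) else \<infinity>)"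

definition sq_dt_term ::
    "'d::finite spacetime set \<Rightarrow> ('d spacetime \<Rightarrow> real) \<Rightarrow> ennreal" where
  "sq_dt_term E w = (if \<exists>g. has_weak_dt E w g then L2_sq E (weak_dt E w) else \<infinity>)"

definition sq_div_term ::
    "('d::finite spacetime \<Rightarrow> real) \<Rightarrow> 'd spacetime set \<Rightarrow> ('d spacetime \<Rightarrow> real) \<Rightarrow> ennreal" where
  "sq_div_term \<nu> E w =
     (if \<exists>g. has_parabolic_div E \<nu> w g then L2_sq E (parabolic_div E \<nu> w) else \<infinity>)"

definition sq_trace_term ::
    "(real ^ 'd) set \<Rightarrow> real \<Rightarrow> ('d::finite spacetime \<Rightarrow> real) \<Rightarrow> real \<Rightarrow> ennreal" where
  "sq_trace_term \<Omega> T w s =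
     (if \<exists>g. has_time_trace \<Omega> T w s g then L2_sq \<Omega> (time_trace \<Omega> T w s) else \<infinity>)"

definition norm_h ::
    "(real ^ 'd) set \<Rightarrow> real \<Rightarrow> ('d::finite spacetime \<Rightarrow> real) \<Rightarrow> 'd spacetime set set \<Rightarrow>
      ('d spacetime set \<Rightarrow> real) \<Rightarrow> ('d spacetime \<Rightarrow> real) \<Rightarrow> ennreal" where
  "norm_h \<Omega> T \<nu> \<T> \<theta> w = sqrt_ennreal (
     (\<Sum>K\<in>\<T>. sq_grad_term \<nu> (interior K) w
        + ennreal (\<theta> K * diameter K) * sq_dt_term (interior K) w)
     + sq_trace_term \<Omega> T w T + sq_trace_term \<Omega> T w 0)"

definition norm_h_star ::
    "(real ^ 'd) set \<Rightarrow> real \<Rightarrow> ('d::finite spacetime \<Rightarrow> real) \<Rightarrow> 'd spacetime set set \<Rightarrow>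
      ('d spacetime set \<Rightarrow> real) \<Rightarrow> ('d spacetime \<Rightarrow> real) \<Rightarrow> ennreal" where
  "norm_h_star \<Omega> T \<nu> \<T> \<theta> w = sqrt_ennreal (
     (\<Sum>K\<in>\<T>. sq_grad_term \<nu> (interior K) w
        + ennreal (1 / (\<theta> K * diameter K)) * L2_sq (interior K) w
        + ennreal (\<theta> K * diameter K) * sq_div_term \<nu> (interior K) w)
     + sq_trace_term \<Omega> T w T)"

definition coercivity_estimate ::
    "(real ^ 'd) set \<Rightarrow> real \<Rightarrow> ('d::finite spacetime \<Rightarrow> real) \<Rightarrow> 'd spacetime set set \<Rightarrow>
      ('d spacetime set \<Rightarrow> real) \<Rightarrow> ('d spacetime \<Rightarrow> real) set \<Rightarrow> real \<Rightarrow> bool" where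
  "coercivity_estimate \<Omega> T \<nu> \<T> \<theta> V \<mu> \<longleftrightarrow>
     (\<forall>v\<in>V. ereal (a_h \<Omega> T \<nu> \<T> \<theta> v v) \<ge> ereal \<mu> * enn2ereal ((norm_h \<Omega> T \<nu> \<T> \<theta> v)\<^sup>2))"

definition boundedness_estimate ::
    "(real ^ 'd) set \<Rightarrow> real \<Rightarrow> ('d::finite spacetime \<Rightarrow> real) \<Rightarrow> 'd spacetime set set \<Rightarrow>
      ('d spacetime set \<Rightarrow> real) \<Rightarrow> ('d spacetime \<Rightarrow> real) set \<Rightarrow> ('d spacetime \<Rightarrow> real) set \<Rightarrow>
      real \<Rightarrow> bool" where
  "boundedness_estimate \<Omega> T \<nu> \<T> \<theta> W V \<mu> \<longleftrightarrow>
     (\<forall>w\<in>W. \<forall>v\<in>V. ennreal \<bar>a_h \<Omega> T \<nu> \<T> \<theta> w v\<bar> \<le>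
        ennreal \<mu> * norm_h_star \<Omega> T \<nu> \<T> \<theta> w * norm_h \<Omega> T \<nu> \<T> \<theta> v)"

end

theory Submission imports Defs begin

text \<open>
  Finite element functions extend to Lipschitz functions on the whole space. By mollification these
  are limits of admissible smooth test functions, so the variational equation may be tested with
  \<open>v\<^sub>h\<close> cut off in time near \<open>T\<close>; removing the cut-off yields the trace of \<open>u\<close> at \<open>T\<close>. Testing with
  functions supported in one element identifies the space-time divergence of \<open>u\<close> there with
  \<open>f - div\<^sub>x F\<close>. Together this is the consistency \<open>a\<^sub>h(u, v\<^sub>h) = l\<^sub>h(v\<^sub>h)\<close>, hence Galerkin orthogonality.
  Coercivity follows from \<open>\<integral> v\<^sub>h \<partial>\<^sub>t v\<^sub>h = (\<parallel>v\<^sub>h(T)\<parallel>\<^sup>2 - \<parallel>v\<^sub>h(0)\<parallel>\<^sup>2) / 2\<close> and the inverse inequality, and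
  the estimate itself from \<open>\<mu>\<^sub>c \<parallel>v\<^sub>h - u\<^sub>h\<parallel>\<^sup>2 \<le> a\<^sub>h(v\<^sub>h - u\<^sub>h, v\<^sub>h - u\<^sub>h) = - a\<^sub>h(u - v\<^sub>h, v\<^sub>h - u\<^sub>h)\<close>, boundedness
  and the triangle inequality for a norm that may take the value \<open>\<infinity>\<close>.
\<close>

subsection \<open>Smooth functions\<close>

text \<open>The variational equation may be tested only with members of \<open>H11_0_0\<close>,
  whose lateral boundary condition is stated through smooth approximants vanishing near \<Sigma>.
  Finite element functions are merely continuous and piecewise polynomial, so such approximants have
  to be built. Hence the detour over Lipschitz functions: extension, products and clamping keep
  their constants under control, and partial integration for them follows from the translation
  invariance of Lebesgue measure. Differentiability almost everywhere is carried as a hypothesis and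
  supplied by the mesh, because element boundaries are null sets. Weak derivatives and traces are
  chosen by \<open>SOME\<close>, so they are known only up to null sets and integrands are compared
  almost everywhere. No trace of u at T is assumed: if a norm of u - v_h on the right is infinite,
  the estimate is trivial; otherwise the norm provides the trace. The inverse inequality serves
  twice, as a bound in the coercivity proof and through its assertion that \<nu> times the gradient
  of v_h has a weak divergence, which the additivity of the form relies on.\<close>

lemma C_k_Suc_imp: "C_k (Suc k) f \<Longrightarrow> C_k k f"
proof (induction k arbitrary: f)
  case 0
  then have "\<And>z. f differentiable (at z)" by simp
  then show ?case
    by (simp add: continuous_at_imp_continuous_on differentiable_imp_continuous_within)
next
  case (Suc k)
  show ?case
    unfolding C_k.simps
  proof (intro conjI ballI allI)
    fix z show "f differentiable at z" using Suc.prems by simp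
  next
    fix b :: 'a assume "b \<in> Basis"
    then have "C_k (Suc k) (\<lambda>z. frechet_derivative f (at z) b)" using Suc.prems
      by (simp only: C_k.simps) blast
    then show "C_k k (\<lambda>z. frechet_derivative f (at z) b)" by (rule Suc.IH)
  qed
qed

lemma frechet_derivative_eqI:
  "(f has_derivative f') (at z) \<Longrightarrow> frechet_derivative f (at z) = f'"
  by (metis frechet_derivative_at)

lemma differentiable_has_frechet:
  "f differentiable (at z) \<Longrightarrow> (f has_derivative frechet_derivative f (at z)) (at z)"
  by (simp add: frechet_derivative_works)

lemma C_k_const: "C_k k (\<lambda>z. c)"
proof (induction k arbitrary: c)
  case (Suc k)
  have "\<And>z. frechet_derivative (\<lambda>z::'a. c) (at z) = (\<lambda>_. 0)"
    by (rule frechet_derivative_eqI) simp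
  then show ?case using Suc by simp
qed simp

lemma C_k_add: "C_k k f \<Longrightarrow> C_k k g \<Longrightarrow> C_k k (\<lambda>z. f z + g z)"
proof (induction k arbitrary: f g)
  case 0 then show ?case by (auto intro: continuous_intros)
next
  case (Suc k)
  have d: "\<And>z. f differentiable (at z)" "\<And>z. g differentiable (at z)" using Suc.prems by auto
  have "\<And>z. frechet_derivative (\<lambda>z. f z + g z) (at z) =
      (\<lambda>b. frechet_derivative f (at z) b + frechet_derivative g (at z) b)"
    by (rule frechet_derivative_eqI) (intro has_derivative_add differentiable_has_frechet d)
  then show ?case using Suc d by (simp add: differentiable_add)
qed

lemma C_k_mult: "C_k k f \<Longrightarrow> C_k k g \<Longrightarrow> C_k k (\<lambda>z. f z * g z)"
proof (induction k arbitrary: f g)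
  case 0 then show ?case by (auto intro: continuous_intros)
next
  case (Suc k)
  have d: "\<And>z. f differentiable (at z)" "\<And>z. g differentiable (at z)" using Suc.prems by auto
  have lower: "C_k k f" "C_k k g" using C_k_Suc_imp Suc.prems by blast+
  have "\<And>z. frechet_derivative (\<lambda>z. f z * g z) (at z) =
      (\<lambda>b. f z * frechet_derivative g (at z) b + frechet_derivative f (at z) b * g z)"
    by (rule frechet_derivative_eqI) (intro has_derivative_mult differentiable_has_frechet d)
  then show ?case using Suc d lower by (auto intro!: C_k_add Suc.IH differentiable_mult)
qed

lemma smooth_const: "smooth (\<lambda>z. c)"
  by (simp add: smooth_def C_k_const)

lemma smooth_add: "smooth f \<Longrightarrow> smooth g \<Longrightarrow> smooth (\<lambda>z. f z + g z)"
  by (simp add: smooth_def C_k_add)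

lemma smooth_mult: "smooth f \<Longrightarrow> smooth g \<Longrightarrow> smooth (\<lambda>z. f z * g z)"
  by (simp add: smooth_def C_k_mult)

lemma smooth_prod:
  "finite I \<Longrightarrow> (\<And>i. i \<in> I \<Longrightarrow> smooth (f i)) \<Longrightarrow> smooth (\<lambda>z. \<Prod>i\<in>I. f i z)"
  by (induction I rule: finite_induct) (auto intro: smooth_const smooth_mult)

lemma smooth_differentiable: "smooth f \<Longrightarrow> f differentiable (at z)"
  unfolding smooth_def by (metis C_k.simps(2))

lemma smooth_continuous_on: "smooth f \<Longrightarrow> continuous_on S f"
  by (metis continuous_at_imp_continuous_on differentiable_imp_continuous_within smooth_differentiable)

lemma smooth_partial: "smooth f \<Longrightarrow> b \<in> Basis \<Longrightarrow> smooth (\<lambda>z. frechet_derivative f (at z) b)"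
  unfolding smooth_def by (metis C_k.simps(2))

text \<open>The derivative becomes a point of the Banach space of bounded linear maps: compactness
  then bounds its operator norm, and the Leibniz rule can be applied to it.\<close>

lemma smooth_continuous_derivative:
  assumes "smooth f" shows "continuous_on S (\<lambda>z. Blinfun (frechet_derivative f (at z)))"
proof (rule continuous_on_blinfun_componentwise)
  fix b :: 'a assume "b \<in> Basis"
  have "\<And>z. bounded_linear (frechet_derivative f (at z))"
    using differentiable_has_frechet has_derivative_bounded_linear smooth_differentiable assms by blast
  then show "continuous_on S (\<lambda>z. blinfun_apply (Blinfun (frechet_derivative f (at z))) b)"
    using smooth_continuous_on[OF smooth_partial[OF assms \<open>b \<in> Basis\<close>]]
    by (simp add: bounded_linear_Blinfun_apply)
qed

text \<open>Dilations are all the chain rule that is needed to rescale the mollifier.\<close>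

lemma C_k_compose_scale: "C_k k f \<Longrightarrow> C_k k (\<lambda>z. f (c *\<^sub>R z))"
proof (induction k arbitrary: f)
  case 0 then show ?case
    by (auto intro!: continuous_on_compose2[of UNIV f] continuous_intros)
next
  case (Suc k)
  have d: "\<And>z. f differentiable (at z)" using Suc.prems by auto
  have h: "\<And>z. ((\<lambda>z. f (c *\<^sub>R z)) has_derivative
      (\<lambda>b. frechet_derivative f (at (c *\<^sub>R z)) (c *\<^sub>R b))) (at z)"
    by (rule has_derivative_compose[of "\<lambda>z. c *\<^sub>R z" "\<lambda>z. c *\<^sub>R z"])
       (auto intro!: derivative_eq_intros differentiable_has_frechet d)
  have "\<And>z b. frechet_derivative (\<lambda>z. f (c *\<^sub>R z)) (at z) b =
      c * frechet_derivative f (at (c *\<^sub>R z)) b"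
    by (subst frechet_derivative_eqI[OF h])
       (simp add: linear_cmul[OF linear_frechet_derivative[OF d]])
  moreover have "\<And>z. (\<lambda>z. f (c *\<^sub>R z)) differentiable (at z)"
    using h differentiable_def by blast
  moreover have "C_k k (\<lambda>z. frechet_derivative f (at (c *\<^sub>R z)) b)" if "b \<in> Basis" for b
    using Suc.IH[of "\<lambda>w. frechet_derivative f (at w) b"] Suc.prems that by simp
  ultimately show ?case by (auto intro!: C_k_mult C_k_const)
qed

lemma smooth_compose_scale: "smooth f \<Longrightarrow> smooth (\<lambda>z. f (c *\<^sub>R z))"
  by (simp add: smooth_def C_k_compose_scale)

text \<open>
  The family \<open>P(1/s) exp (-1/s)\<close>, extended by zero to \<open>s \<le> 0\<close>, is closed under differentiation;
  this makes \<open>exp (-1/s)\<close> smooth.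
\<close>

definition flat :: "real poly \<Rightarrow> real \<Rightarrow> real" where
  "flat P s = (if s > 0 then poly P (1 / s) * exp (- (1 / s)) else 0)"

lemma poly_exp_tendsto_0: "((\<lambda>x::real. poly P x * exp (- x)) \<longlongrightarrow> 0) at_top"
proof -
  have "((\<lambda>x::real. \<Sum>i\<le>degree P. coeff P i * (x ^ i / exp x)) \<longlongrightarrow> (\<Sum>i\<le>degree P. coeff P i * 0)) at_top"
    by (intro tendsto_intros tendsto_power_div_exp_0)
  then show ?thesis
    by (simp add: poly_altdef exp_minus divide_inverse sum_distrib_right mult.assoc)
qed

lemma flat_tendsto_0: "(flat P \<longlongrightarrow> 0) (at 0)"
proof -
  have "((\<lambda>s. poly P (1 / s) * exp (- (1 / s))) \<longlongrightarrow> 0) (at_right (0::real))"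
    using filterlim_compose[OF poly_exp_tendsto_0[of P] filterlim_inverse_at_top_right]
    by (simp add: divide_inverse)
  then have "(flat P \<longlongrightarrow> 0) (at_right 0)"
    by (rule Lim_transform_eventually) (auto simp: flat_def eventually_at_filter)
  moreover have "(flat P \<longlongrightarrow> 0) (at_left 0)"
    by (rule Lim_transform_eventually[where f="\<lambda>_. 0"]) (auto simp: flat_def eventually_at_filter)
  ultimately show ?thesis by (simp add: filterlim_split_at_real)
qed

text \<open>With x = 1/s one has dx/ds = - x^2, so the derivative of P(x) exp(- x) is x^2 (P(x) -
  P'(x)) exp(- x).\<close>

definition flat_deriv :: "real poly \<Rightarrow> real poly" where
  "flat_deriv P = monom 1 2 * (P - pderiv P)"

lemma flat_has_derivative: "(flat P has_real_derivative flat (flat_deriv P) s) (at s)"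
proof -
  consider "s > 0" | "s < 0" | "s = 0" by linarith
  then show ?thesis
  proof cases
    case 1
    have "((\<lambda>s. poly P (1 / s) * exp (- (1 / s))) has_real_derivative flat (flat_deriv P) s) (at s)"
      using 1 by (auto intro!: derivative_eq_intros DERIV_chain2[OF poly_DERIV]
          simp: flat_def flat_deriv_def poly_monom field_simps power2_eq_square)
    then show ?thesis
    proof (rule has_field_derivative_transform_within_open[of _ _ _ "{0<..}"])
    qed (use 1 in \<open>auto simp: flat_def\<close>)
  next
    case 2
    have "((\<lambda>s. 0) has_real_derivative flat (flat_deriv P) s) (at s)"
      using 2 by (simp add: flat_def)
    then show ?thesis
    proof (rule has_field_derivative_transform_within_open[of _ _ _ "{..<0}"])
    qed (use 2 in \<open>auto simp: flat_def\<close>)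
  next
    case 3
    \<comment> \<open>Dividing by h multiplies the polynomial by its argument 1/h, so the difference
      quotient at 0 is again a member of the family and tends to 0.\<close>
    have "(\<lambda>h. (flat P (0 + h) - flat P 0) / h) = flat (monom 1 1 * P)"
      by (auto simp: flat_def poly_monom fun_eq_iff)
    then show ?thesis using flat_tendsto_0[of "monom 1 1 * P"] 3
      by (simp add: DERIV_def flat_def)
  qed
qed

lemma C_k_flat: "b \<in> Basis \<Longrightarrow> C_k k (\<lambda>z. flat P (c * (z \<bullet> b) + d))"
proof (induction k arbitrary: P)
  case 0
  have "continuous_on UNIV (flat P)"
    by (meson DERIV_isCont continuous_at_imp_continuous_on flat_has_derivative)
  then show ?case
    by (auto intro!: continuous_on_compose2[of UNIV "flat P"] continuous_intros)
next
  case (Suc k)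
  have h: "\<And>z. ((\<lambda>z. flat P (c * (z \<bullet> b) + d)) has_derivative
      (\<lambda>v. (c * (v \<bullet> b)) * flat (flat_deriv P) (c * (z \<bullet> b) + d))) (at z)"
    by (rule derivative_eq_intros DERIV_compose_FDERIV[OF flat_has_derivative] | simp)+
  have "\<And>z v. frechet_derivative (\<lambda>z. flat P (c * (z \<bullet> b) + d)) (at z) v =
      (c * (v \<bullet> b)) * flat (flat_deriv P) (c * (z \<bullet> b) + d)"
    by (subst frechet_derivative_eqI[OF h]) simp
  moreover have "\<And>z. (\<lambda>z. flat P (c * (z \<bullet> b) + d)) differentiable (at z)"
    using h differentiable_def by blast
  ultimately show ?case using Suc by (auto intro!: C_k_mult C_k_const)
qed

text \<open>Each coordinate contributes one factor per face, so the function is positive exactly on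
  an open box. Letting the steepness \<open>c\<close> grow sends every factor to 1 inside, hence the
  bump to the indicator of the box.\<close>

definition bump :: "real \<Rightarrow> 'a \<Rightarrow> 'a \<Rightarrow> 'a::euclidean_space \<Rightarrow> real" where
  "bump c p q z = (\<Prod>b\<in>Basis. flat 1 (c * (z \<bullet> b) - c * (p \<bullet> b)) * flat 1 (c * (q \<bullet> b) - c * (z \<bullet> b)))"

lemma smooth_bump: "smooth (bump c p q)"
proof -
  have "smooth (\<lambda>z::'a. flat 1 (c * (z \<bullet> b) + - c * (p \<bullet> b)) * flat 1 ((- c) * (z \<bullet> b) + c * (q \<bullet> b)))"
    if "b \<in> Basis" for b
    by (intro smooth_mult; unfold smooth_def; blast intro: C_k_flat that)
  then have "smooth (\<lambda>z::'a. \<Prod>b\<in>Basis. flat 1 (c * (z \<bullet> b) + - c * (p \<bullet> b)) * flat 1 ((- c) * (z \<bullet> b) + c * (q \<bullet> b)))"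
    by (intro smooth_prod) auto
  then show ?thesis by (simp add: bump_def[abs_def] algebra_simps)
qed

lemma flat_1_bounds: "0 \<le> flat 1 s" "flat 1 s \<le> 1" "flat 1 s = 0 \<longleftrightarrow> s \<le> 0"
  by (auto simp: flat_def)

lemma bump_nonneg: "0 \<le> bump c p q z"
  unfolding bump_def by (intro prod_nonneg) (auto simp: flat_1_bounds)

lemma bump_le_1: "bump c p q z \<le> 1"
  unfolding bump_def by (intro prod_le_1) (auto simp: flat_1_bounds mult_le_one)

lemma bump_eq_0_iff: "c > 0 \<Longrightarrow> bump c p q z = 0 \<longleftrightarrow> z \<notin> box p q"
  by (auto simp: bump_def flat_1_bounds mem_box not_less)

lemma test_function_bump:
  assumes "c > 0" "cbox p q \<subseteq> S" shows "test_function S (bump c p q)"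
  unfolding test_function_def
  using assms bump_eq_0_iff[of c p q] box_subset_cbox[of p q] smooth_bump
  by (metis compact_cbox subset_iff)

lemma bump_tendsto_indicator: "(\<lambda>n. bump (real (Suc n)) p q z) \<longlonglongrightarrow> indicator (box p q) z"
proof (cases "z \<in> box p q")
  case True
  have "(\<lambda>n. flat 1 (real (Suc n) * s)) \<longlonglongrightarrow> 1" if "s > 0" for s :: real
  proof -
    have "(\<lambda>n. exp (- (1 / s * inverse (real (Suc n))))) \<longlonglongrightarrow> exp (- (1 / s * 0))"
      by (intro tendsto_intros LIMSEQ_inverse_real_of_nat)
    then show ?thesis using that by (simp add: flat_def divide_inverse mult.commute)
  qed
  then have "(\<lambda>n. \<Prod>b\<in>Basis. flat 1 (real (Suc n) * (z \<bullet> b - p \<bullet> b)) * flat 1 (real (Suc n) * (q \<bullet> b - z \<bullet> b)))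
      \<longlonglongrightarrow> (\<Prod>b\<in>(Basis::'a set). 1 * 1)"
    using True by (intro tendsto_prod tendsto_mult) (auto simp: mem_box)
  then show ?thesis using True by (simp only: bump_def right_diff_distrib) simp
next
  case False
  then have "\<And>n. bump (real (Suc n)) p q z = 0" by (simp add: bump_eq_0_iff)
  then show ?thesis using False by simp
qed

subsection \<open>The fundamental lemma of the calculus of variations\<close>

text \<open>The positive and the negative part of \<open>h\<close>, taken as densities, give
  measures that agree on open boxes. These are stable under intersection and generate the Borel
  sets, so the measures coincide, and with them the densities almost everywhere.\<close>

lemma AE_zero_if_box_integrals_zero:
  fixes h :: "'a::euclidean_space \<Rightarrow> real"
  assumes h: "integrable lborel h" and z: "\<And>p q. (LINT z:box p q|lborel. h z) = 0"
  shows "AE z in lborel. h z = 0"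
proof -
  define f where "f z = ennreal (h z)" for z
  define g where "g z = ennreal (- h z)" for z
  have [measurable]: "h \<in> borel_measurable borel" using h by auto
  have [measurable]: "f \<in> borel_measurable borel" "g \<in> borel_measurable borel"
    unfolding f_def[abs_def] g_def[abs_def] by measurable
  have eq: "emeasure (density lborel f) (box p q) = emeasure (density lborel g) (box p q)" for p q
  proof -
    have i: "integrable lborel (\<lambda>z. indicator (box p q) z * h z)"
      using integrable_mult_indicator[of "box p q" lborel h] h by simp
    have "(LINT z|lborel. indicator (box p q) z * h z) =
        enn2real (\<integral>\<^sup>+z. ennreal (indicator (box p q) z * h z) \<partial>lborel) -
        enn2real (\<integral>\<^sup>+z. ennreal (- (indicator (box p q) z * h z)) \<partial>lborel)"
      by (rule real_lebesgue_integral_def[OF i])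
    moreover have "(\<integral>\<^sup>+z. ennreal (indicator (box p q) z * h z) \<partial>lborel) = emeasure (density lborel f) (box p q)"
      by (subst emeasure_density)
         (auto simp: f_def intro!: nn_integral_cong split: split_indicator)
    moreover have "(\<integral>\<^sup>+z. ennreal (- (indicator (box p q) z * h z)) \<partial>lborel) = emeasure (density lborel g) (box p q)"
      by (subst emeasure_density)
         (auto simp: g_def intro!: nn_integral_cong split: split_indicator)
    moreover have "(LINT z|lborel. indicator (box p q) z * h z) = 0"
      using z[of p q] by (simp add: set_lebesgue_integral_def)
    moreover have "(\<integral>\<^sup>+z. ennreal (indicator (box p q) z * h z) \<partial>lborel) < \<infinity>"
      "(\<integral>\<^sup>+z. ennreal (- (indicator (box p q) z * h z)) \<partial>lborel) < \<infinity>"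
      using i by (auto simp: real_integrable_def top.not_eq_extremum)
    ultimately have "enn2real (emeasure (density lborel f) (box p q)) = enn2real (emeasure (density lborel g) (box p q))"
        "emeasure (density lborel f) (box p q) < top" "emeasure (density lborel g) (box p q) < top"
      by simp_all
    then show ?thesis by (metis ennreal_enn2real)
  qed
  have "density lborel f = density lborel g"
  proof (rule measure_eqI_generator_eq)
    let ?E = "range (\<lambda>(a, b). box a b::'a set)"
    show "Int_stable ?E" by (auto simp: Int_stable_def box_Int_box)
    show "?E \<subseteq> Pow UNIV" "sets (density lborel f) = sigma_sets UNIV ?E"
      "sets (density lborel g) = sigma_sets UNIV ?E"
      by (simp_all add: borel_eq_box)
    let ?A = "\<lambda>n::nat. box (- (real n *\<^sub>R One)) (real n *\<^sub>R One) :: 'a set"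
    show "range ?A \<subseteq> ?E" "(\<Union>i. ?A i) = UNIV" unfolding UN_box_eq_UNIV by auto
    show "emeasure (density lborel f) (?A i) \<noteq> \<infinity>" for i
    proof -
      have "emeasure (density lborel f) (?A i) \<le> (\<integral>\<^sup>+z. ennreal (h z) \<partial>lborel)"
        by (subst emeasure_density)
           (auto simp: f_def intro!: nn_integral_mono split: split_indicator)
      then show ?thesis using h by (auto simp: real_integrable_def top_unique)
    qed
    show "emeasure (density lborel f) X = emeasure (density lborel g) X" if "X \<in> ?E" for X
      using that eq by auto
  qed
  then have "AE z in lborel. f z = g z"
    by (intro sigma_finite_measure.density_unique[OF sigma_finite_lborel]) measurable
  then show ?thesis
  proof eventually_elim
    case (elim z)
    \<comment> \<open>\<open>ennreal\<close> maps negative reals to 0, so one of the two equal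
      values is 0 and hence both are.\<close>
    then show ?case
      by (cases "h z \<ge> 0") (auto simp: f_def g_def ennreal_neg ennreal_eq_0_iff)
  qed
qed

lemma box_null: "AE z in lborel. z \<in> cbox p q \<longrightarrow> z \<in> box (p::'a::euclidean_space) q"
proof -
  have "negligible (cbox p q - box p q)" by (rule negligible_frontier_interval)
  then have "cbox p q - box p q \<in> null_sets lborel"
    by (simp add: negligible_iff_null_sets null_sets_completion_iff)
  then show ?thesis by (rule AE_I') auto
qed

text \<open>Bumps tending to the indicator of a box turn the hypothesis into vanishing box
  integrals. Inside a fixed closed box contained in \<open>S\<close>,
  \<open>AE_zero_if_box_integrals_zero\<close> then applies, and countably many such boxes cover
  \<open>S\<close>.\<close>

lemma fundamental_lemma:
  fixes h :: "'a::euclidean_space \<Rightarrow> real"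
  assumes S: "open S" and h: "set_integrable lborel S h"
    and z: "\<And>\<phi>. test_function S \<phi> \<Longrightarrow> (LINT z:S|lborel. \<phi> z * h z) = 0"
  shows "AE z in lborel. z \<in> S \<longrightarrow> h z = 0"
proof -
  have box0: "(LINT z:box p q|lborel. h z) = 0" if pq: "cbox p q \<subseteq> S" for p q
  proof -
    let ?s = "\<lambda>n z. bump (real (Suc n)) p q z * (indicator S z * h z)"
    have i: "integrable lborel (\<lambda>z. indicator S z * h z)"
      using h by (simp add: set_integrable_def)
    have [measurable]: "bump c p q \<in> borel_measurable borel" for c
      by (intro borel_measurable_continuous_onI smooth_continuous_on smooth_bump)
    have "(\<lambda>n. LINT z|lborel. ?s n z) \<longlonglongrightarrow> (LINT z|lborel. indicator (box p q) z * (indicator S z * h z))"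
    proof (rule integral_dominated_convergence[where w="\<lambda>z. norm (indicator S z * h z)"])
      show "AE z in lborel. (\<lambda>n. ?s n z) \<longlonglongrightarrow> indicator (box p q) z * (indicator S z * h z)"
        by (intro AE_I2 tendsto_mult bump_tendsto_indicator tendsto_const)
      show "AE z in lborel. norm (?s n z) \<le> norm (indicator S z * h z)" for n
        using bump_nonneg[of "real (Suc n)" p q] bump_le_1[of "real (Suc n)" p q]
        by (intro AE_I2) (auto simp: abs_mult intro!: mult_left_le_one_le)
    qed (use i in \<open>auto intro: integrable_norm borel_measurable_integrable\<close>)
    moreover have "(LINT z|lborel. ?s n z) = 0" for n
      using z[OF test_function_bump[OF _ pq, of "real (Suc n)"]]
      by (simp add: set_lebesgue_integral_def mult.left_commute)
    ultimately have "(LINT z|lborel. indicator (box p q) z * (indicator S z * h z)) = 0"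
      by (simp add: LIMSEQ_const_iff)
    moreover have "indicator (box p q) z * (indicator S z * h z) = indicator (box p q) z * h z" for z
      using pq box_subset_cbox[of p q] by (auto split: split_indicator)
    ultimately show ?thesis by (simp add: set_lebesgue_integral_def)
  qed
  have ae: "AE z in lborel. z \<in> cbox p q \<longrightarrow> h z = 0" if pq: "cbox p q \<subseteq> S" for p q
  proof -
    have "AE z in lborel. indicator (box p q) z * h z = 0"
    proof (rule AE_zero_if_box_integrals_zero)
      have "set_integrable lborel (box p q) h"
        using h pq box_subset_cbox[of p q] by (intro set_integrable_subset[OF h]) auto
      then show "integrable lborel (\<lambda>z. indicator (box p q) z * h z)"
        by (simp add: set_integrable_def)
      fix r s
      obtain a b where ab: "box r s \<inter> box p q = box a b" by (simp add: box_Int_box)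
      \<comment> \<open>An intersection of boxes is a box; if it is non-empty, its closure lies in
        \<open>cbox p q\<close>, hence in \<open>S\<close>, and \<open>box0\<close> applies.\<close>
      have "cbox a b \<subseteq> S \<or> box a b = {}"
      proof (cases "box a b = {}")
        case False
        have sub: "box a b \<subseteq> box p q" using ab by auto
        then have "box p q \<noteq> {}" using False by auto
        with closure_mono[OF sub] have "cbox a b \<subseteq> cbox p q" using False by (simp add: closure_box)
        then show ?thesis using pq by auto
      qed simp
      then have "(LINT z:box a b|lborel. h z) = 0" using box0 by (auto simp: set_lebesgue_integral_def)
      then show "(LINT z:box r s|lborel. indicator (box p q) z * h z) = 0"
        unfolding ab[symmetric]
        by (simp add: set_lebesgue_integral_def indicator_inter_arith mult.assoc)
    qed
    with box_null[of p q] show ?thesis by eventually_elim auto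
  qed
  obtain D where D: "countable D" "D \<subseteq> Pow S" "\<And>X. X \<in> D \<Longrightarrow> \<exists>a b. X = cbox a b" "\<Union>D = S"
    using open_countable_Union_open_cbox[OF S] by metis
  have "AE z in lborel. \<forall>X\<in>D. z \<in> X \<longrightarrow> h z = 0"
  proof (subst AE_ball_countable[OF D(1)], intro ballI)
    fix X assume "X \<in> D"
    then obtain a b where "X = cbox a b" "X \<subseteq> S" using D by blast
    then show "AE z in lborel. z \<in> X \<longrightarrow> h z = 0" using ae by simp
  qed
  then show ?thesis
  proof eventually_elim
    case (elim z) then show ?case using D(4) by blast
  qed
qed

subsection \<open>Square-integrable functions\<close>

lemma L2_on_measurable: "L2_on S f \<Longrightarrow> (\<lambda>z. indicator S z *\<^sub>R f z) \<in> borel_measurable borel"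
  by (simp add: L2_on_def set_borel_measurable_def)

lemma L2_on_sq_integrable: "L2_on S f \<Longrightarrow> integrable lborel (\<lambda>z. (norm (indicator S z *\<^sub>R f z))\<^sup>2)"
proof -
  have "(\<lambda>z. indicator S z *\<^sub>R (norm (f z))\<^sup>2) = (\<lambda>z. (norm (indicator S z *\<^sub>R f z))\<^sup>2)"
    by (auto split: split_indicator)
  then show "L2_on S f \<Longrightarrow> integrable lborel (\<lambda>z. (norm (indicator S z *\<^sub>R f z))\<^sup>2)" by (simp add: L2_on_def set_integrable_def)
qed

lemma L2_onI:
  assumes "(\<lambda>z. indicator S z *\<^sub>R f z) \<in> borel_measurable borel"
    and "integrable lborel (\<lambda>z. (norm (indicator S z *\<^sub>R f z))\<^sup>2)"
  shows "L2_on S f"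
proof -
  have "(\<lambda>z. indicator S z *\<^sub>R (norm (f z))\<^sup>2) = (\<lambda>z. (norm (indicator S z *\<^sub>R f z))\<^sup>2)"
    by (auto split: split_indicator)
  then show ?thesis using assms by (simp add: L2_on_def set_borel_measurable_def set_integrable_def)
qed

lemma L2_on_cong: "(\<And>z. z \<in> S \<Longrightarrow> f z = g z) \<Longrightarrow> L2_on S f = L2_on S g"
proof -
  assume "\<And>z. z \<in> S \<Longrightarrow> f z = g z"
  then have "(\<lambda>z. indicator S z *\<^sub>R f z) = (\<lambda>z. indicator S z *\<^sub>R g z)"
    "(\<lambda>z. indicator S z *\<^sub>R (norm (f z))\<^sup>2) = (\<lambda>z. indicator S z *\<^sub>R (norm (g z))\<^sup>2)"
    by (auto split: split_indicator)
  then show ?thesis by (simp add: L2_on_def set_borel_measurable_def set_integrable_def)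
qed

lemma L2_on_dominated:
  assumes "(\<lambda>z. indicator S z *\<^sub>R f z) \<in> borel_measurable borel"
    and "set_integrable lborel S w" "AE z in lborel. z \<in> S \<longrightarrow> (norm (f z))\<^sup>2 \<le> w z"
  shows "L2_on S f"
proof (rule L2_onI)
  show "integrable lborel (\<lambda>z. (norm (indicator S z *\<^sub>R f z))\<^sup>2)"
  proof (rule Bochner_Integration.integrable_bound)
    show "integrable lborel (\<lambda>z. indicator S z *\<^sub>R w z)" using assms(2) by (simp add: set_integrable_def)
    show "AE z in lborel. norm ((norm (indicator S z *\<^sub>R f z))\<^sup>2) \<le> norm (indicator S z *\<^sub>R w z)"
      using assms(3) by eventually_elim (auto split: split_indicator)
  qed (use assms(1) in measurable)
qed (fact assms(1))

lemma L2_on_add: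
  assumes f: "L2_on S f" and g: "L2_on S g" shows "L2_on S (\<lambda>z. f z + g z)"
proof (rule L2_on_dominated)
  show "set_integrable lborel S (\<lambda>z. 2 * (norm (f z))\<^sup>2 + 2 * (norm (g z))\<^sup>2)"
    using f g by (intro set_integral_add) (auto simp: L2_on_def)
  show "AE z in lborel. z \<in> S \<longrightarrow> (norm (f z + g z))\<^sup>2 \<le> 2 * (norm (f z))\<^sup>2 + 2 * (norm (g z))\<^sup>2"
  proof (intro AE_I2 impI)
    fix z
    have "(norm (f z + g z))\<^sup>2 \<le> (norm (f z) + norm (g z))\<^sup>2"
      by (intro power_mono norm_triangle_ineq) simp
    also have "\<dots> \<le> 2 * (norm (f z))\<^sup>2 + 2 * (norm (g z))\<^sup>2"
      using sum_squares_bound[of "norm (f z)" "norm (g z)"] by (simp add: power2_sum)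
    finally show "(norm (f z + g z))\<^sup>2 \<le> 2 * (norm (f z))\<^sup>2 + 2 * (norm (g z))\<^sup>2" .
  qed
  have "(\<lambda>z. indicator S z *\<^sub>R f z + indicator S z *\<^sub>R g z) \<in> borel_measurable borel"
    using f g by (intro borel_measurable_add L2_on_measurable)
  then show "(\<lambda>z. indicator S z *\<^sub>R (f z + g z)) \<in> borel_measurable borel"
    by (simp add: scaleR_add_right)
qed

lemma L2_on_mult_bounded:
  fixes c :: "'a::euclidean_space \<Rightarrow> real"
  assumes f: "L2_on S f" and c: "set_borel_measurable lborel S c"
    and b: "AE z in lborel. z \<in> S \<longrightarrow> \<bar>c z\<bar> \<le> B"
  shows "L2_on S (\<lambda>z. c z *\<^sub>R f z)"
proof (rule L2_on_dominated)
  show "set_integrable lborel S (\<lambda>z. B\<^sup>2 * (norm (f z))\<^sup>2)" using f by (auto simp: L2_on_def)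
  show "AE z in lborel. z \<in> S \<longrightarrow> (norm (c z *\<^sub>R f z))\<^sup>2 \<le> B\<^sup>2 * (norm (f z))\<^sup>2"
    using b
  proof eventually_elim
    case (elim z)
    show ?case
    proof
      assume "z \<in> S"
      then have "\<bar>c z\<bar>\<^sup>2 \<le> B\<^sup>2" using elim by (intro power_mono) auto
      then show "(norm (c z *\<^sub>R f z))\<^sup>2 \<le> B\<^sup>2 * (norm (f z))\<^sup>2"
        by (simp add: power_mult_distrib mult_right_mono)
    qed
  qed
  have "(\<lambda>z. (indicator S z *\<^sub>R c z) *\<^sub>R (indicator S z *\<^sub>R f z)) \<in> borel_measurable borel"
    using c unfolding set_borel_measurable_def
    by (intro borel_measurable_scaleR[OF _ L2_on_measurable[OF f]]) (simp only: measurable_lborel2)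
  also have "(\<lambda>z. (indicator S z *\<^sub>R c z) *\<^sub>R (indicator S z *\<^sub>R f z)) = (\<lambda>z. indicator S z *\<^sub>R (c z *\<^sub>R f z))"
    by (auto split: split_indicator)
  finally show "(\<lambda>z. indicator S z *\<^sub>R (c z *\<^sub>R f z)) \<in> borel_measurable borel" .
qed

lemma L2_on_scaleR: "L2_on S f \<Longrightarrow> L2_on S (\<lambda>z. c *\<^sub>R f z)"
proof -
  assume f: "L2_on S f"
  have "L2_on S (\<lambda>z. c *\<^sub>R f z)"
  proof (rule L2_on_dominated)
    show "set_integrable lborel S (\<lambda>z. c\<^sup>2 * (norm (f z))\<^sup>2)" using f by (auto simp: L2_on_def)
    have "(\<lambda>z. c *\<^sub>R (indicator S z *\<^sub>R f z)) \<in> borel_measurable borel"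
      by (intro borel_measurable_scaleR L2_on_measurable f) simp
    then show "(\<lambda>z. indicator S z *\<^sub>R (c *\<^sub>R f z)) \<in> borel_measurable borel"
      by (simp add: mult.commute)
  qed (auto simp: power_mult_distrib)
  then show ?thesis .
qed

lemma L2_on_mult: "L2_on S f \<Longrightarrow> L2_on S (\<lambda>z. c * f z)" for f :: "_ \<Rightarrow> real"
  using L2_on_scaleR[of S f c] by simp

lemma L2_on_uminus: "L2_on S f \<Longrightarrow> L2_on S (\<lambda>z. - f z)"
  using L2_on_scaleR[of S f "-1"] by simp

lemma L2_on_diff: "L2_on S f \<Longrightarrow> L2_on S g \<Longrightarrow> L2_on S (\<lambda>z. f z - g z)"
  using L2_on_add[of S f "\<lambda>z. - g z"] L2_on_uminus[of S g] by simp

lemma L2_on_subset: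
  assumes "L2_on S f" "E \<subseteq> S" "E \<in> sets borel" shows "L2_on E f"
proof -
  have "(\<lambda>z. indicator E z *\<^sub>R (indicator S z *\<^sub>R f z)) \<in> borel_measurable borel"
    by (rule borel_measurable_scaleR[OF _ L2_on_measurable[OF assms(1)]]) (use assms(3) in simp)
  moreover have "(\<lambda>z. indicator E z *\<^sub>R (indicator S z *\<^sub>R f z)) = (\<lambda>z. indicator E z *\<^sub>R f z)"
    using assms(2) by (intro ext) (auto simp: indicator_def)
  moreover have "set_integrable lborel E (\<lambda>z. (norm (f z))\<^sup>2)"
  proof (rule set_integrable_subset[of lborel S])
    show "set_integrable lborel S (\<lambda>z. (norm (f z))\<^sup>2)" using assms(1) unfolding L2_on_def by blast
  qed (use assms in simp_all)
  ultimately show ?thesis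
    unfolding L2_on_def set_borel_measurable_def by (simp only: measurable_lborel2)
qed

lemma mult_le_sum_squares: "a * b \<le> a\<^sup>2 + b\<^sup>2" for a b :: real
proof -
  have "0 \<le> a\<^sup>2 + b\<^sup>2" by simp
  then show ?thesis using sum_squares_bound[of a b] by linarith
qed

lemma L2_on_inner_integrable:
  assumes f: "L2_on S f" and g: "L2_on S g" shows "set_integrable lborel S (\<lambda>z. f z \<bullet> g z)"
proof -
  let ?f = "\<lambda>z. indicator S z *\<^sub>R f z" and ?g = "\<lambda>z. indicator S z *\<^sub>R g z"
  have "integrable lborel (\<lambda>z. ?f z \<bullet> ?g z)"
  proof (rule Bochner_Integration.integrable_bound)
    show "integrable lborel (\<lambda>z. (norm (?f z))\<^sup>2 + (norm (?g z))\<^sup>2)"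
      using f g by (intro Bochner_Integration.integrable_add L2_on_sq_integrable)
    show "AE z in lborel. norm (?f z \<bullet> ?g z) \<le> norm ((norm (?f z))\<^sup>2 + (norm (?g z))\<^sup>2)"
    proof (intro AE_I2)
      fix z
      have "norm (?f z \<bullet> ?g z) \<le> norm (?f z) * norm (?g z)" by (simp only: real_norm_def Cauchy_Schwarz_ineq2)
      also have "\<dots> \<le> (norm (?f z))\<^sup>2 + (norm (?g z))\<^sup>2"
        by (rule mult_le_sum_squares)
      finally show "norm (?f z \<bullet> ?g z) \<le> norm ((norm (?f z))\<^sup>2 + (norm (?g z))\<^sup>2)" by simp
    qed
    show "(\<lambda>z. ?f z \<bullet> ?g z) \<in> borel_measurable lborel"
      unfolding measurable_lborel2 by (intro borel_measurable_inner L2_on_measurable f g)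
  qed
  moreover have "(\<lambda>z. ?f z \<bullet> ?g z) = (\<lambda>z. indicator S z *\<^sub>R (f z \<bullet> g z))" by (auto split: split_indicator)
  ultimately show ?thesis by (simp add: set_integrable_def)
qed

lemma L2_on_mult_integrable:
  fixes f g :: "'a::euclidean_space \<Rightarrow> real"
  shows "L2_on S f \<Longrightarrow> L2_on S g \<Longrightarrow> set_integrable lborel S (\<lambda>z. f z * g z)"
  using L2_on_inner_integrable[of S f g] by simp

lemma L2_on_scaleR_integrable:
  fixes f :: "'a::euclidean_space \<Rightarrow> real"
  assumes f: "L2_on S f" and g: "L2_on S g" shows "set_integrable lborel S (\<lambda>z. f z *\<^sub>R g z)"
proof -
  let ?f = "\<lambda>z. indicator S z *\<^sub>R f z" and ?g = "\<lambda>z. indicator S z *\<^sub>R g z"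
  have "integrable lborel (\<lambda>z. ?f z *\<^sub>R ?g z)"
  proof (rule Bochner_Integration.integrable_bound)
    show "integrable lborel (\<lambda>z. (norm (?f z))\<^sup>2 + (norm (?g z))\<^sup>2)"
      using f g by (intro Bochner_Integration.integrable_add L2_on_sq_integrable)
    show "AE z in lborel. norm (?f z *\<^sub>R ?g z) \<le> norm ((norm (?f z))\<^sup>2 + (norm (?g z))\<^sup>2)"
    proof (intro AE_I2)
      fix z
      have "norm (?f z *\<^sub>R ?g z) = norm (?f z) * norm (?g z)" by (simp only: norm_scaleR real_norm_def)
      also have "\<dots> \<le> (norm (?f z))\<^sup>2 + (norm (?g z))\<^sup>2"
        by (rule mult_le_sum_squares)
      finally show "norm (?f z *\<^sub>R ?g z) \<le> norm ((norm (?f z))\<^sup>2 + (norm (?g z))\<^sup>2)" by simp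
    qed
    show "(\<lambda>z. ?f z *\<^sub>R ?g z) \<in> borel_measurable lborel"
      unfolding measurable_lborel2 by (intro borel_measurable_scaleR L2_on_measurable f g)
  qed
  moreover have "(\<lambda>z. ?f z *\<^sub>R ?g z) = (\<lambda>z. indicator S z *\<^sub>R (f z *\<^sub>R g z))" by (auto split: split_indicator)
  ultimately show ?thesis by (simp add: set_integrable_def)
qed

lemma L2_on_bounded:
  assumes S: "S \<in> sets borel" "bounded S" and m: "set_borel_measurable lborel S f"
    and b: "AE z in lborel. z \<in> S \<longrightarrow> norm (f z) \<le> B"
  shows "L2_on S f"
proof (rule L2_on_dominated)
  show "(\<lambda>z. indicator S z *\<^sub>R f z) \<in> borel_measurable borel" using m by (simp add: set_borel_measurable_def)
  have "emeasure lborel S < \<infinity>" using S emeasure_bounded_finite by blast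
  then show "set_integrable lborel S (\<lambda>z. B\<^sup>2)"
    using S by (simp add: set_integrable_def integrable_mult_indicator)
  show "AE z in lborel. z \<in> S \<longrightarrow> (norm (f z))\<^sup>2 \<le> B\<^sup>2"
    using b by eventually_elim (auto intro: power_mono)
qed

lemma set_lebesgue_integral_cong_AE':
  fixes f g :: "'a \<Rightarrow> 'b::{banach, second_countable_topology}"
  assumes "set_borel_measurable M S f" "set_borel_measurable M S g"
    and "AE z in M. z \<in> S \<longrightarrow> f z = g z"
  shows "(LINT z:S|M. f z) = (LINT z:S|M. g z)"
  unfolding set_lebesgue_integral_def using assms(1,2)
  by (intro integral_cong_AE) (use assms(3) in \<open>auto simp: set_borel_measurable_def split: split_indicator\<close>)

lemma L2_sq_eq_integral:
  assumes "L2_on S f"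
  shows "L2_sq S f = ennreal (LINT z:S|lborel. (norm (f z))\<^sup>2)"
proof -
  have "L2_sq S f = (\<integral>\<^sup>+z. ennreal ((norm (indicator S z *\<^sub>R f z))\<^sup>2) \<partial>lborel)"
    unfolding L2_sq_def by (intro nn_integral_cong) (auto split: split_indicator)
  also have "\<dots> = ennreal (LINT z|lborel. (norm (indicator S z *\<^sub>R f z))\<^sup>2)"
    by (intro nn_integral_eq_integral L2_on_sq_integrable assms) simp
  also have "(LINT z|lborel. (norm (indicator S z *\<^sub>R f z))\<^sup>2) = (LINT z:S|lborel. (norm (f z))\<^sup>2)"
    unfolding set_lebesgue_integral_def by (intro Bochner_Integration.integral_cong) (auto split: split_indicator)
  finally show ?thesis .
qed

lemma L2_sq_cong_AE:
  "(AE z in lborel. z \<in> S \<longrightarrow> f z = g z) \<Longrightarrow> L2_sq S f = L2_sq S g"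
  unfolding L2_sq_def by (intro nn_integral_cong_AE) (auto split: split_indicator)

lemma L2_norm_on_cong_AE:
  "(AE z in lborel. z \<in> S \<longrightarrow> f z = g z) \<Longrightarrow> L2_norm_on S f = L2_norm_on S g"
  by (simp add: L2_norm_on_def L2_sq_cong_AE)

subsection \<open>Weak derivatives\<close>

lemma test_function_mono: "test_function E \<phi> \<Longrightarrow> E \<subseteq> S \<Longrightarrow> test_function S \<phi>"
  unfolding test_function_def by blast

lemma frechet_derivative_outside:
  assumes "closed C" "\<And>z. z \<notin> C \<Longrightarrow> \<phi> z = 0" "z \<notin> C"
  shows "(\<phi> has_derivative (\<lambda>_. 0)) (at z)" "frechet_derivative \<phi> (at z) = (\<lambda>_. 0)"
proof -
  have "((\<lambda>_. 0) has_derivative (\<lambda>_. 0)) (at z)" by simp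
  then show "(\<phi> has_derivative (\<lambda>_. 0)) (at z)"
    by (rule has_derivative_transform_within_open[where s="- C"]) (use assms in auto)
  then show "frechet_derivative \<phi> (at z) = (\<lambda>_. 0)" by (rule frechet_derivative_eqI)
qed

lemma test_function_supportE:
  assumes "test_function S (\<phi> :: 'd::finite spacetime \<Rightarrow> real)"
  obtains C where "compact C" "C \<subseteq> S" "\<And>z. z \<notin> C \<Longrightarrow> \<phi> z = 0"
    "\<And>z. z \<notin> C \<Longrightarrow> dt \<phi> z = 0" "\<And>z. z \<notin> C \<Longrightarrow> grad_x \<phi> z = 0"
proof -
  obtain C where C: "compact C" "C \<subseteq> S" "\<And>z. z \<notin> C \<Longrightarrow> \<phi> z = 0"
    using assms unfolding test_function_def by blast
  moreover have "frechet_derivative \<phi> (at z) = (\<lambda>_. 0)" if "z \<notin> C" for z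
    by (rule frechet_derivative_outside[OF compact_imp_closed[OF C(1)] C(3) that])
  ultimately show ?thesis
    by (intro that[of C]) (auto simp: dt_def grad_x_def zero_vec_def)
qed

lemma test_function_smooth: "test_function S \<phi> \<Longrightarrow> smooth \<phi>"
  by (simp add: test_function_def)

lemma spatial_Basis: "(axis i (1::real), 0::real) \<in> Basis" "(0 :: real ^ 'd::finite, 1::real) \<in> Basis"
  by (auto simp: Basis_prod_def axis_in_Basis_iff)

text \<open>Time slices are null sets. This discards the instants at which the time cut-offs used
  later have a kink.\<close>

lemma AE_snd_neq: "AE z in lborel. snd (z :: 'd::finite spacetime) \<noteq> c"
proof -
  have eq: "{z :: 'd spacetime. z \<bullet> (0, 1) = c} = {z. snd z = c}" by (auto simp: inner_prod_def)
  have "negligible {z :: 'd spacetime. snd z = c}"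
    unfolding eq[symmetric] by (rule negligible_standard_hyperplane[OF spatial_Basis(2)])
  moreover have "closed {z :: 'd spacetime. snd z = c}" by (intro closed_Collect_eq continuous_intros)
  ultimately have "{z :: 'd spacetime. snd z = c} \<in> null_sets lborel"
    by (simp add: negligible_iff_null_sets null_sets_completion_iff)
  then show ?thesis by (rule AE_I') auto
qed

lemma continuous_on_dt: "smooth \<phi> \<Longrightarrow> continuous_on S (dt \<phi>)"
  unfolding dt_def[abs_def] by (intro smooth_continuous_on smooth_partial spatial_Basis)

lemma continuous_on_grad_x: "smooth \<phi> \<Longrightarrow> continuous_on S (grad_x \<phi>)"
  unfolding grad_x_def[abs_def]
  by (intro continuous_on_vec_lambda smooth_continuous_on smooth_partial spatial_Basis)

lemma L2_on_continuous_compact_support: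
  assumes f: "continuous_on UNIV f" and C: "compact C" "\<And>z. z \<notin> C \<Longrightarrow> f z = 0" and S: "S \<in> sets borel"
  shows "L2_on S f"
proof -
  obtain B where B: "\<And>z. z \<in> C \<Longrightarrow> norm (f z) \<le> B"
    using compact_imp_bounded[OF compact_continuous_image[OF continuous_on_subset[OF f subset_UNIV] C(1)]]
    unfolding bounded_iff by blast
  show ?thesis
  proof (rule L2_on_dominated)
  show "(\<lambda>z. indicator S z *\<^sub>R f z) \<in> borel_measurable borel"
    using S by (intro borel_measurable_scaleR borel_measurable_continuous_onI[OF f]) simp
  have "C \<in> sets borel" "emeasure lborel C < \<infinity>"
    using C(1) compact_imp_bounded emeasure_bounded_finite borel_compact by blast+
  then have i: "integrable lborel (indicator C :: _ \<Rightarrow> real)" by simp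
  have "integrable lborel (\<lambda>z. indicator S z *\<^sub>R (B\<^sup>2 * indicator C z))"
    using S by (intro integrable_mult_indicator integrable_mult_right i) auto
  then show "set_integrable lborel S (\<lambda>z. B\<^sup>2 * indicator C z)" by (simp add: set_integrable_def)
  show "AE z in lborel. z \<in> S \<longrightarrow> (norm (f z))\<^sup>2 \<le> B\<^sup>2 * indicator C z"
    using B C(2) by (auto simp: indicator_def intro!: power_mono)
  qed
qed

lemma test_function_L2:
  assumes "test_function S (\<phi> :: 'd::finite spacetime \<Rightarrow> real)" "E \<in> sets borel"
  shows "L2_on E \<phi>" "L2_on E (dt \<phi>)" "L2_on E (grad_x \<phi>)" "L2_on E (\<lambda>z. (grad_x \<phi> z, dt \<phi> z))"
proof -
  obtain C where C: "compact C" "C \<subseteq> S" "\<And>z. z \<notin> C \<Longrightarrow> \<phi> z = 0"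
    "\<And>z. z \<notin> C \<Longrightarrow> dt \<phi> z = 0" "\<And>z. z \<notin> C \<Longrightarrow> grad_x \<phi> z = 0"
    using test_function_supportE[OF assms(1)] by blast
  note s = test_function_smooth[OF assms(1)]
  show "L2_on E \<phi>" "L2_on E (dt \<phi>)" "L2_on E (grad_x \<phi>)"
    by (intro L2_on_continuous_compact_support[OF _ C(1) _ assms(2)] C
        smooth_continuous_on continuous_on_dt continuous_on_grad_x s; assumption)+
  show "L2_on E (\<lambda>z. (grad_x \<phi> z, dt \<phi> z))"
    by (intro L2_on_continuous_compact_support[OF _ C(1) _ assms(2)]
        continuous_on_Pair continuous_on_dt continuous_on_grad_x s) (simp add: C zero_prod_def)
qed

lemma L2_on_const_one: "S \<in> sets borel \<Longrightarrow> bounded S \<Longrightarrow> L2_on S (\<lambda>z. 1::real)"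
  by (rule L2_on_bounded[where B=1]) (auto simp: set_borel_measurable_def)

lemma L2_on_integrable:
  assumes "L2_on S f" "S \<in> sets borel" "bounded S" shows "set_integrable lborel S f"
  using L2_on_scaleR_integrable[OF L2_on_const_one assms(1)] assms by simp

lemma L2_on_nth:
  fixes G :: "'a::euclidean_space \<Rightarrow> real ^ 'd::finite"
  assumes "L2_on S G" shows "L2_on S (\<lambda>z. G z $ i)"
proof (rule L2_on_dominated)
  show "set_integrable lborel S (\<lambda>z. (norm (G z))\<^sup>2)" using assms unfolding L2_on_def by blast
  have "(\<lambda>z. (indicator S z *\<^sub>R G z) \<bullet> axis i 1) \<in> borel_measurable borel"
    by (rule borel_measurable_inner[OF L2_on_measurable[OF assms]]) simp
  then show "(\<lambda>z. indicator S z *\<^sub>R (G z $ i)) \<in> borel_measurable borel" by (simp add: inner_axis)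
  show "AE z in lborel. z \<in> S \<longrightarrow> (norm (G z $ i))\<^sup>2 \<le> (norm (G z))\<^sup>2"
    by (intro AE_I2 impI power_mono) (simp_all add: component_le_norm_cart)
qed

lemma L2_on_vec:
  fixes G :: "'a::euclidean_space \<Rightarrow> real ^ 'd::finite"
  assumes "\<And>i. L2_on S (\<lambda>z. G z $ i)" shows "L2_on S G"
proof (rule L2_on_dominated)
  show "set_integrable lborel S (\<lambda>z. \<Sum>i\<in>UNIV. (norm (G z $ i))\<^sup>2)"
    using assms unfolding L2_on_def set_integrable_def scaleR_sum_right by (intro Bochner_Integration.integrable_sum) auto
  show "AE z in lborel. z \<in> S \<longrightarrow> (norm (G z))\<^sup>2 \<le> (\<Sum>i\<in>UNIV. (norm (G z $ i))\<^sup>2)"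
    by (intro AE_I2) (simp add: norm_vec_def L2_set_def sum_nonneg)
  have "(\<lambda>z. indicator S z *\<^sub>R G z) = (\<lambda>z. \<Sum>i\<in>UNIV. (indicator S z *\<^sub>R (G z $ i)) *\<^sub>R axis i 1)"
    by (intro ext) (simp add: vec_eq_iff axis_def if_distrib cong: if_cong)
  then show "(\<lambda>z. indicator S z *\<^sub>R G z) \<in> borel_measurable borel"
    by (simp only:) (intro borel_measurable_sum borel_measurable_scaleR[OF L2_on_measurable[OF assms]]; simp)
qed

lemma L2_on_Pair:
  assumes f: "L2_on S f" and g: "L2_on S g" shows "L2_on S (\<lambda>z. (f z, g z))"
proof (rule L2_on_dominated)
  show "set_integrable lborel S (\<lambda>z. (norm (f z))\<^sup>2 + (norm (g z))\<^sup>2)"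
    using assms unfolding L2_on_def by (intro set_integral_add) auto
  have "(\<lambda>z. (indicator S z *\<^sub>R f z, indicator S z *\<^sub>R g z)) \<in> borel_measurable borel"
    using borel_measurable_Pair[OF L2_on_measurable[OF f] L2_on_measurable[OF g]] .
  then show "(\<lambda>z. indicator S z *\<^sub>R (f z, g z)) \<in> borel_measurable borel" by simp
qed (simp add: norm_Pair)

text \<open>Boundedness of \<open>S\<close> makes square-integrable functions integrable, as the
  fundamental lemma requires of the difference.\<close>

lemma L2_fundamental_lemma:
  fixes g1 g2 :: "'d::finite spacetime \<Rightarrow> real"
  assumes S: "open S" "bounded S" and g: "L2_on S g1" "L2_on S g2"
    and eq: "\<And>\<phi>. test_function S \<phi> \<Longrightarrow> (LINT z:S|lborel. \<phi> z * g1 z) = (LINT z:S|lborel. \<phi> z * g2 z)"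
  shows "AE z in lborel. z \<in> S \<longrightarrow> g1 z = g2 z"
proof -
  have "AE z in lborel. z \<in> S \<longrightarrow> g1 z - g2 z = 0"
  proof (rule fundamental_lemma[OF S(1)])
    show "set_integrable lborel S (\<lambda>z. g1 z - g2 z)"
      using S g by (intro L2_on_integrable L2_on_diff) auto
    fix \<phi> assume \<phi>: "test_function S \<phi>"
    have "set_integrable lborel S (\<lambda>z. \<phi> z * g1 z)" "set_integrable lborel S (\<lambda>z. \<phi> z * g2 z)"
      using S by (intro L2_on_mult_integrable test_function_L2[OF \<phi>] g; simp)+
    then show "(LINT z:S|lborel. \<phi> z * (g1 z - g2 z)) = 0"
      using eq[OF \<phi>] by (simp add: right_diff_distrib set_integral_diff)
  qed
  then show ?thesis by eventually_elim simp
qed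

lemma set_integral_nth:
  fixes G :: "'a \<Rightarrow> real ^ 'd::finite"
  assumes "set_integrable M S G" shows "(LINT z:S|M. G z) $ i = (LINT z:S|M. G z $ i)"
proof -
  have "(LINT z|M. (indicator S z *\<^sub>R G z) \<bullet> axis i 1) = (LINT z|M. indicator S z *\<^sub>R G z) \<bullet> axis i 1"
    using assms unfolding set_integrable_def by (intro integral_inner_left) simp
  then show ?thesis by (simp add: set_lebesgue_integral_def inner_axis)
qed

section \<open>Uniqueness of weak derivatives and their chosen representatives\<close>

lemma has_weak_grad_x_unique:
  assumes S: "open S" "bounded S" and G: "has_weak_grad_x S w G1" "has_weak_grad_x S w G2"
  shows "AE z in lborel. z \<in> S \<longrightarrow> G1 z = G2 z"
proof -
  have L: "L2_on S G1" "L2_on S G2" using G unfolding has_weak_grad_x_def by blast+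
  \<comment> \<open>The fundamental lemma is scalar, so the gradients are compared component by
    component.\<close>
  have "AE z in lborel. z \<in> S \<longrightarrow> G1 z $ i = G2 z $ i" for i
  proof (rule L2_fundamental_lemma[OF S L2_on_nth[OF L(1)] L2_on_nth[OF L(2)]])
    fix \<phi> assume \<phi>: "test_function S \<phi>"
    have i: "set_integrable lborel S (\<lambda>z. \<phi> z *\<^sub>R G1 z)" "set_integrable lborel S (\<lambda>z. \<phi> z *\<^sub>R G2 z)"
      using S by (intro L2_on_scaleR_integrable test_function_L2[OF \<phi>] L; simp)+
    have "(LINT z:S|lborel. \<phi> z *\<^sub>R G1 z) = (LINT z:S|lborel. \<phi> z *\<^sub>R G2 z)"
    proof -
      have "(LINT z:S|lborel. w z *\<^sub>R grad_x \<phi> z) = - (LINT z:S|lborel. \<phi> z *\<^sub>R G1 z)"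
        "(LINT z:S|lborel. w z *\<^sub>R grad_x \<phi> z) = - (LINT z:S|lborel. \<phi> z *\<^sub>R G2 z)"
        using G \<phi> unfolding has_weak_grad_x_def by blast+
      then show ?thesis by simp
    qed
    then show "(LINT z:S|lborel. \<phi> z * (G1 z $ i)) = (LINT z:S|lborel. \<phi> z * (G2 z $ i))"
      using set_integral_nth[OF i(1), of i] set_integral_nth[OF i(2), of i] by simp
  qed
  then have "AE z in lborel. \<forall>i. z \<in> S \<longrightarrow> G1 z $ i = G2 z $ i" by (subst AE_all_countable) blast
  then show ?thesis by eventually_elim (simp add: vec_eq_iff)
qed

lemma has_weak_dt_unique:
  assumes S: "open S" "bounded S" and g: "has_weak_dt S w g1" "has_weak_dt S w g2"
  shows "AE z in lborel. z \<in> S \<longrightarrow> g1 z = g2 z"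
proof (rule L2_fundamental_lemma[OF S])
  show "L2_on S g1" "L2_on S g2" using g unfolding has_weak_dt_def by blast+
  fix \<phi> assume "test_function S \<phi>"
  with g have "(LINT z:S|lborel. w z * dt \<phi> z) = - (LINT z:S|lborel. \<phi> z * g1 z)"
    "(LINT z:S|lborel. w z * dt \<phi> z) = - (LINT z:S|lborel. \<phi> z * g2 z)"
    unfolding has_weak_dt_def by blast+
  then show "(LINT z:S|lborel. \<phi> z * g1 z) = (LINT z:S|lborel. \<phi> z * g2 z)" by simp
qed

lemma has_weak_div_unique:
  assumes S: "open S" "bounded S" and g: "has_weak_div S w g1" "has_weak_div S w g2"
  shows "AE z in lborel. z \<in> S \<longrightarrow> g1 z = g2 z"
proof (rule L2_fundamental_lemma[OF S])
  show "L2_on S g1" "L2_on S g2" using g unfolding has_weak_div_def by blast+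
  fix \<phi> assume "test_function S \<phi>"
  with g have "(LINT z:S|lborel. w z \<bullet> (grad_x \<phi> z, dt \<phi> z)) = - (LINT z:S|lborel. \<phi> z * g1 z)"
    "(LINT z:S|lborel. w z \<bullet> (grad_x \<phi> z, dt \<phi> z)) = - (LINT z:S|lborel. \<phi> z * g2 z)"
    unfolding has_weak_div_def by blast+
  then show "(LINT z:S|lborel. \<phi> z * g1 z) = (LINT z:S|lborel. \<phi> z * g2 z)" by simp
qed

lemma has_parabolic_div_unique:
  assumes S: "open S" "bounded S" and g: "has_parabolic_div S \<nu> w g1" "has_parabolic_div S \<nu> w g2"
  shows "AE z in lborel. z \<in> S \<longrightarrow> g1 z = g2 z"
  using g unfolding has_parabolic_div_def by (intro has_weak_div_unique[OF S]) auto

lemma weak_grad_x: "has_weak_grad_x S w G \<Longrightarrow> has_weak_grad_x S w (weak_grad_x S w)"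
  unfolding weak_grad_x_def by (rule someI[of "has_weak_grad_x S w"])

lemma weak_dt: "has_weak_dt S w g \<Longrightarrow> has_weak_dt S w (weak_dt S w)"
  unfolding weak_dt_def by (rule someI[of "has_weak_dt S w"])

lemma weak_div_x: "has_weak_div_x S w g \<Longrightarrow> has_weak_div_x S w (weak_div_x S w)"
  unfolding weak_div_x_def by (rule someI[of "has_weak_div_x S w"])

lemma parabolic_div: "has_parabolic_div S \<nu> w g \<Longrightarrow> has_parabolic_div S \<nu> w (parabolic_div S \<nu> w)"
  unfolding parabolic_div_def by (rule someI[of "has_parabolic_div S \<nu> w"])

text \<open>The gradient picked by \<open>SOME\<close> can be replaced by a known one only up to a
  null set; this lemma and its analogues below are the way in which explicit derivatives enter the
  forms and norms.\<close>

lemma weak_grad_x_AE: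
  "open S \<Longrightarrow> bounded S \<Longrightarrow> has_weak_grad_x S w G \<Longrightarrow> AE z in lborel. z \<in> S \<longrightarrow> weak_grad_x S w z = G z"
  using has_weak_grad_x_unique weak_grad_x by blast

lemma weak_dt_AE:
  "open S \<Longrightarrow> bounded S \<Longrightarrow> has_weak_dt S w g \<Longrightarrow> AE z in lborel. z \<in> S \<longrightarrow> weak_dt S w z = g z"
  using has_weak_dt_unique weak_dt by blast

lemma parabolic_div_AE:
  "open S \<Longrightarrow> bounded S \<Longrightarrow> has_parabolic_div S \<nu> w g \<Longrightarrow>
    AE z in lborel. z \<in> S \<longrightarrow> parabolic_div S \<nu> w z = g z"
  using has_parabolic_div_unique parabolic_div by blast

section \<open>Locality and linearity of weak derivatives\<close>

lemma set_integral_eq_on: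
  assumes "\<And>z. z \<in> S \<Longrightarrow> f z = g z"
  shows "(LINT z:S|M. f z) = (LINT z:S|M. g z)"
  unfolding set_lebesgue_integral_def
  by (intro Bochner_Integration.integral_cong refl) (use assms in \<open>auto split: split_indicator\<close>)

lemma has_weak_grad_x_cong:
  assumes "\<And>z. z \<in> S \<Longrightarrow> v z = w z" shows "has_weak_grad_x S v = has_weak_grad_x S w"
proof -
  have "(LINT z:S|lborel. v z *\<^sub>R grad_x \<phi> z) = (LINT z:S|lborel. w z *\<^sub>R grad_x \<phi> z)" for \<phi>
    by (intro set_integral_eq_on) (simp add: assms)
  then show ?thesis using L2_on_cong[of S v w] assms by (auto simp: has_weak_grad_x_def fun_eq_iff)
qed

lemma has_weak_dt_cong:
  assumes "\<And>z. z \<in> S \<Longrightarrow> v z = w z" shows "has_weak_dt S v = has_weak_dt S w"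
proof -
  have "(LINT z:S|lborel. v z * dt \<phi> z) = (LINT z:S|lborel. w z * dt \<phi> z)" for \<phi>
    by (intro set_integral_eq_on) (simp add: assms)
  then show ?thesis using L2_on_cong[of S v w] assms by (auto simp: has_weak_dt_def fun_eq_iff)
qed

lemma set_integral_support:
  assumes "E \<subseteq> S" "\<And>z. z \<notin> E \<Longrightarrow> f z = 0"
  shows "(LINT z:S|M. f z) = (LINT z:E|M. f z)"
  unfolding set_lebesgue_integral_def
  by (intro Bochner_Integration.integral_cong refl) (use assms in \<open>auto split: split_indicator\<close>)

text \<open>A test function of \<open>E\<close> is one of \<open>S\<close>, and it vanishes with its
  derivatives outside \<open>E\<close>; the integrals over both sets therefore agree.\<close>

lemma has_weak_grad_x_subset:
  assumes w: "has_weak_grad_x S w G" and E: "open E" "E \<subseteq> S" shows "has_weak_grad_x E w G"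
  unfolding has_weak_grad_x_def
proof (intro conjI allI impI)
  have "L2_on S w" "L2_on S G" using w unfolding has_weak_grad_x_def by blast+
  then show "L2_on E w" "L2_on E G" using E by (simp_all add: L2_on_subset[of S])
  fix \<phi> assume \<phi>: "test_function E \<phi>"
  obtain C where C: "C \<subseteq> E" "\<And>z. z \<notin> C \<Longrightarrow> \<phi> z = 0" "\<And>z. z \<notin> C \<Longrightarrow> grad_x \<phi> z = 0"
    using test_function_supportE[OF \<phi>] by metis
  have "(LINT z:S|lborel. w z *\<^sub>R grad_x \<phi> z) = - (LINT z:S|lborel. \<phi> z *\<^sub>R G z)"
    using w test_function_mono[OF \<phi> E(2)] unfolding has_weak_grad_x_def by blast
  moreover have "(LINT z:S|lborel. w z *\<^sub>R grad_x \<phi> z) = (LINT z:E|lborel. w z *\<^sub>R grad_x \<phi> z)"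
    "(LINT z:S|lborel. \<phi> z *\<^sub>R G z) = (LINT z:E|lborel. \<phi> z *\<^sub>R G z)"
    using C by (intro set_integral_support[OF E(2)]; force)+
  ultimately show "(LINT z:E|lborel. w z *\<^sub>R grad_x \<phi> z) = - (LINT z:E|lborel. \<phi> z *\<^sub>R G z)"
    by simp
qed

lemma has_weak_div_x_subset:
  assumes w: "has_weak_div_x S V g" and E: "open E" "E \<subseteq> S" shows "has_weak_div_x E V g"
  unfolding has_weak_div_x_def
proof (intro conjI allI impI)
  have "L2_on S V" "L2_on S g" using w unfolding has_weak_div_x_def by blast+
  then show "L2_on E V" "L2_on E g" using E by (simp_all add: L2_on_subset[of S])
  fix \<phi> assume \<phi>: "test_function E \<phi>"
  obtain C where C: "C \<subseteq> E" "\<And>z. z \<notin> C \<Longrightarrow> \<phi> z = 0" "\<And>z. z \<notin> C \<Longrightarrow> grad_x \<phi> z = 0"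
    using test_function_supportE[OF \<phi>] by metis
  have "(LINT z:S|lborel. V z \<bullet> grad_x \<phi> z) = - (LINT z:S|lborel. \<phi> z * g z)"
    using w test_function_mono[OF \<phi> E(2)] unfolding has_weak_div_x_def by blast
  moreover have "(LINT z:S|lborel. V z \<bullet> grad_x \<phi> z) = (LINT z:E|lborel. V z \<bullet> grad_x \<phi> z)"
    "(LINT z:S|lborel. \<phi> z * g z) = (LINT z:E|lborel. \<phi> z * g z)"
    using C by (intro set_integral_support[OF E(2)]; force)+
  ultimately show "(LINT z:E|lborel. V z \<bullet> grad_x \<phi> z) = - (LINT z:E|lborel. \<phi> z * g z)"
    by simp
qed

text \<open>The scaled form covers sums with c = 1 and differences with c = - 1 at once; the same
  pattern recurs for traces, finite element functions and the bilinear form.\<close>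

lemma has_weak_grad_x_add_scaled:
  assumes S: "open S" and w: "has_weak_grad_x S w1 G1" "has_weak_grad_x S w2 G2"
  shows "has_weak_grad_x S (\<lambda>z. w1 z + c * w2 z) (\<lambda>z. G1 z + c *\<^sub>R G2 z)"
  unfolding has_weak_grad_x_def
proof (intro conjI allI impI)
  have L: "L2_on S w1" "L2_on S G1" "L2_on S w2" "L2_on S G2"
    using w unfolding has_weak_grad_x_def by blast+
  show "L2_on S (\<lambda>z. w1 z + c * w2 z)" "L2_on S (\<lambda>z. G1 z + c *\<^sub>R G2 z)"
    by (intro L2_on_add L2_on_mult L2_on_scaleR L)+
  fix \<phi> assume \<phi>: "test_function S \<phi>"
  have i: "set_integrable lborel S (\<lambda>z. w1 z *\<^sub>R grad_x \<phi> z)" "set_integrable lborel S (\<lambda>z. c *\<^sub>R (w2 z *\<^sub>R grad_x \<phi> z))"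
    "set_integrable lborel S (\<lambda>z. \<phi> z *\<^sub>R G1 z)" "set_integrable lborel S (\<lambda>z. c *\<^sub>R (\<phi> z *\<^sub>R G2 z))"
    using S by (intro set_integrable_scaleR_right L2_on_scaleR_integrable test_function_L2[OF \<phi>] L; simp)+
  have "(LINT z:S|lborel. (w1 z + c * w2 z) *\<^sub>R grad_x \<phi> z) =
      (LINT z:S|lborel. w1 z *\<^sub>R grad_x \<phi> z + c *\<^sub>R (w2 z *\<^sub>R grad_x \<phi> z))"
    by (simp add: scaleR_add_left)
  also have "\<dots> = (LINT z:S|lborel. w1 z *\<^sub>R grad_x \<phi> z) + c *\<^sub>R (LINT z:S|lborel. w2 z *\<^sub>R grad_x \<phi> z)"
    by (simp only: set_integral_add[OF i(1,2)] set_integral_scaleR_right)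
  also have "\<dots> = - ((LINT z:S|lborel. \<phi> z *\<^sub>R G1 z) + c *\<^sub>R (LINT z:S|lborel. \<phi> z *\<^sub>R G2 z))"
    using w \<phi> unfolding has_weak_grad_x_def by simp
  also have "(LINT z:S|lborel. \<phi> z *\<^sub>R G1 z) + c *\<^sub>R (LINT z:S|lborel. \<phi> z *\<^sub>R G2 z)
      = (LINT z:S|lborel. \<phi> z *\<^sub>R G1 z + c *\<^sub>R (\<phi> z *\<^sub>R G2 z))"
    by (simp only: set_integral_add[OF i(3,4)] set_integral_scaleR_right)
  also have "\<dots> = (LINT z:S|lborel. \<phi> z *\<^sub>R (G1 z + c *\<^sub>R G2 z))"
    by (simp add: scaleR_add_right mult.commute)
  finally show "(LINT z:S|lborel. (w1 z + c * w2 z) *\<^sub>R grad_x \<phi> z) = - (LINT z:S|lborel. \<phi> z *\<^sub>R (G1 z + c *\<^sub>R G2 z))" .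
qed

lemma has_weak_dt_add_scaled:
  assumes S: "open S" and w: "has_weak_dt S w1 g1" "has_weak_dt S w2 g2"
  shows "has_weak_dt S (\<lambda>z. w1 z + c * w2 z) (\<lambda>z. g1 z + c * g2 z)"
  unfolding has_weak_dt_def
proof (intro conjI allI impI)
  have L: "L2_on S w1" "L2_on S g1" "L2_on S w2" "L2_on S g2"
    using w unfolding has_weak_dt_def by blast+
  show "L2_on S (\<lambda>z. w1 z + c * w2 z)" "L2_on S (\<lambda>z. g1 z + c * g2 z)"
    by (intro L2_on_add L2_on_mult L)+
  fix \<phi> assume \<phi>: "test_function S \<phi>"
  have i: "set_integrable lborel S (\<lambda>z. w1 z * dt \<phi> z)" "set_integrable lborel S (\<lambda>z. c * (w2 z * dt \<phi> z))"
    "set_integrable lborel S (\<lambda>z. \<phi> z * g1 z)" "set_integrable lborel S (\<lambda>z. c * (\<phi> z * g2 z))"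
    using S by (intro set_integrable_mult_right L2_on_mult_integrable test_function_L2[OF \<phi>] L; simp)+
  have "(LINT z:S|lborel. (w1 z + c * w2 z) * dt \<phi> z) =
      (LINT z:S|lborel. w1 z * dt \<phi> z + c * (w2 z * dt \<phi> z))"
    by (simp add: algebra_simps)
  also have "\<dots> = (LINT z:S|lborel. w1 z * dt \<phi> z) + c * (LINT z:S|lborel. w2 z * dt \<phi> z)"
    by (simp add: set_integral_add[OF i(1,2)])
  also have "\<dots> = - ((LINT z:S|lborel. \<phi> z * g1 z) + c * (LINT z:S|lborel. \<phi> z * g2 z))"
    using w \<phi> unfolding has_weak_dt_def by simp
  also have "(LINT z:S|lborel. \<phi> z * g1 z) + c * (LINT z:S|lborel. \<phi> z * g2 z)
      = (LINT z:S|lborel. \<phi> z * g1 z + c * (\<phi> z * g2 z))"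
    by (simp add: set_integral_add[OF i(3,4)])
  also have "\<dots> = (LINT z:S|lborel. \<phi> z * (g1 z + c * g2 z))"
    by (simp add: algebra_simps)
  finally show "(LINT z:S|lborel. (w1 z + c * w2 z) * dt \<phi> z) = - (LINT z:S|lborel. \<phi> z * (g1 z + c * g2 z))" .
qed

lemma has_weak_div_add_scaled:
  assumes S: "open S" and w: "has_weak_div S V1 g1" "has_weak_div S V2 g2"
  shows "has_weak_div S (\<lambda>z. V1 z + c *\<^sub>R V2 z) (\<lambda>z. g1 z + c * g2 z)"
  unfolding has_weak_div_def
proof (intro conjI allI impI)
  have L: "L2_on S V1" "L2_on S g1" "L2_on S V2" "L2_on S g2"
    using w unfolding has_weak_div_def by blast+
  show "L2_on S (\<lambda>z. V1 z + c *\<^sub>R V2 z)" "L2_on S (\<lambda>z. g1 z + c * g2 z)"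
    by (intro L2_on_add L2_on_mult L2_on_scaleR L)+
  fix \<phi> assume \<phi>: "test_function S \<phi>"
  let ?D = "\<lambda>z. (grad_x \<phi> z, dt \<phi> z)"
  have i: "set_integrable lborel S (\<lambda>z. V1 z \<bullet> ?D z)" "set_integrable lborel S (\<lambda>z. c * (V2 z \<bullet> ?D z))"
    "set_integrable lborel S (\<lambda>z. \<phi> z * g1 z)" "set_integrable lborel S (\<lambda>z. c * (\<phi> z * g2 z))"
    using S by (intro set_integrable_mult_right L2_on_mult_integrable L2_on_inner_integrable test_function_L2[OF \<phi>] L; simp)+
  have "(LINT z:S|lborel. (V1 z + c *\<^sub>R V2 z) \<bullet> ?D z) =
      (LINT z:S|lborel. V1 z \<bullet> ?D z + c * (V2 z \<bullet> ?D z))"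
    by (simp only: inner_add_left inner_scaleR_left)
  also have "\<dots> = (LINT z:S|lborel. V1 z \<bullet> ?D z) + c * (LINT z:S|lborel. V2 z \<bullet> ?D z)"
    by (simp only: set_integral_add[OF i(1,2)] set_integral_mult_right)
  also have "\<dots> = - ((LINT z:S|lborel. \<phi> z * g1 z) + c * (LINT z:S|lborel. \<phi> z * g2 z))"
    using w \<phi> unfolding has_weak_div_def by simp
  also have "(LINT z:S|lborel. \<phi> z * g1 z) + c * (LINT z:S|lborel. \<phi> z * g2 z)
      = (LINT z:S|lborel. \<phi> z * g1 z + c * (\<phi> z * g2 z))"
    by (simp add: set_integral_add[OF i(3,4)])
  also have "\<dots> = (LINT z:S|lborel. \<phi> z * (g1 z + c * g2 z))"
    by (simp add: algebra_simps)
  finally show "(LINT z:S|lborel. (V1 z + c *\<^sub>R V2 z) \<bullet> ?D z) = - (LINT z:S|lborel. \<phi> z * (g1 z + c * g2 z))" .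
qed

subsection \<open>Lipschitz functions\<close>

text \<open>
  The limit is taken along a fixed sequence, which keeps the derivative of a continuous function
  Borel measurable.
\<close>

definition dird :: "('a::euclidean_space \<Rightarrow> real) \<Rightarrow> 'a \<Rightarrow> 'a \<Rightarrow> real" where
  "dird w b z = lim (\<lambda>n. (w (z + inverse (real (Suc n)) *\<^sub>R b) - w z) * real (Suc n))"

lemma difference_quotient_tendsto:
  fixes w :: "'a::euclidean_space \<Rightarrow> real"
  assumes "((\<lambda>s. w (z + s *\<^sub>R b)) has_real_derivative D) (at 0)"
  shows "(\<lambda>n. (w (z + inverse (real (Suc n)) *\<^sub>R b) - w z) * real (Suc n)) \<longlonglongrightarrow> D"
proof -
  have "filterlim (\<lambda>n. inverse (real (Suc n))) (at 0) sequentially"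
    using LIMSEQ_inverse_real_of_nat by (auto simp: filterlim_at)
  from filterlim_compose[OF assms[unfolded DERIV_def] this] show ?thesis
    by (simp add: divide_inverse)
qed

lemma dird_eq:
  assumes "((\<lambda>s. w (z + s *\<^sub>R b)) has_real_derivative D) (at 0)"
  shows "dird w b z = D"
  unfolding dird_def by (rule limI[OF difference_quotient_tendsto[OF assms]])

lemma borel_measurable_dird:
  assumes "continuous_on UNIV w" shows "dird w b \<in> borel_measurable borel"
  unfolding dird_def[abs_def]
proof (rule borel_measurable_lim_metric)
  fix n
  have "continuous_on UNIV (\<lambda>z. (w (z + inverse (real (Suc n)) *\<^sub>R b) - w z) * real (Suc n))"
    by (intro continuous_on_mult continuous_on_diff continuous_on_compose2[OF assms] assms continuous_intros) auto
  then show "(\<lambda>z. (w (z + inverse (real (Suc n)) *\<^sub>R b) - w z) * real (Suc n)) \<in> borel_measurable borel"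
    by (rule borel_measurable_continuous_onI)
qed

lemma lipschitz_difference_quotient:
  fixes w :: "'a::euclidean_space \<Rightarrow> real"
  assumes "L-lipschitz_on UNIV w"
  shows "\<bar>(w (z + inverse (real (Suc n)) *\<^sub>R b) - w z) * real (Suc n)\<bar> \<le> L * norm b"
proof -
  have "\<bar>w (z + inverse (real (Suc n)) *\<^sub>R b) - w z\<bar> \<le> L * (inverse (real (Suc n)) * norm b)"
    using lipschitz_onD[OF assms, of "z + inverse (real (Suc n)) *\<^sub>R b" z] by (simp add: dist_norm)
  then have "\<bar>w (z + inverse (real (Suc n)) *\<^sub>R b) - w z\<bar> * real (Suc n)
      \<le> L * (inverse (real (Suc n)) * norm b) * real (Suc n)"
    by (rule mult_right_mono) simp
  also have "\<dots> = L * norm b" by (simp del: of_nat_Suc)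
  finally show ?thesis by (simp add: abs_mult del: of_nat_Suc)
qed

lemma dird_bound:
  assumes "L-lipschitz_on UNIV w" "((\<lambda>s. w (z + s *\<^sub>R b)) has_real_derivative D) (at 0)"
  shows "\<bar>dird w b z\<bar> \<le> L * norm b"
  unfolding dird_eq[OF assms(2)]
  by (rule LIMSEQ_le_const2[OF tendsto_rabs[OF difference_quotient_tendsto[OF assms(2)]]])
     (use lipschitz_difference_quotient[OF assms(1)] in blast)

lemma has_derivative_imp_directional:
  assumes "(w has_derivative w') (at z)"
  shows "((\<lambda>s. w (z + s *\<^sub>R b)) has_real_derivative w' b) (at 0)"
proof -
  have "((\<lambda>s::real. z + s *\<^sub>R b) has_derivative (\<lambda>s. s *\<^sub>R b)) (at 0)"
    by (auto intro!: derivative_eq_intros)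
  then have "((\<lambda>s. w (z + s *\<^sub>R b)) has_derivative (\<lambda>s. w' (s *\<^sub>R b))) (at 0)"
    by (rule has_derivative_compose) (use assms in simp)
  moreover have "(\<lambda>s. w' (s *\<^sub>R b)) = (*) (w' b)"
    using linear_cmul[OF has_derivative_linear[OF assms]] by (auto simp: mult.commute)
  ultimately show ?thesis by (simp add: has_field_derivative_def)
qed

lemma integral_translation:
  fixes f :: "'a::euclidean_space \<Rightarrow> real"
  assumes "f \<in> borel_measurable borel"
  shows "(LINT z|lborel. f (z + c)) = (LINT z|lborel. f z)"
proof -
  have "(LINT z|lborel. f z) = (LINT z|distr lborel borel ((+) c). f z)" by (simp only: lborel_distr_plus)
  also have "\<dots> = (LINT z|lborel. f (c + z))" by (rule integral_distr) (use assms in auto)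
  finally show ?thesis by (simp add: add.commute)
qed

lemma integrable_continuous_compact_support:
  fixes f :: "'a::euclidean_space \<Rightarrow> real"
  assumes "continuous_on UNIV f" "compact C" "\<And>z. z \<notin> C \<Longrightarrow> f z = 0"
  shows "integrable lborel f"
proof -
  have "set_integrable lborel C f"
    using assms compact_imp_bounded borel_compact
    by (intro L2_on_integrable L2_on_continuous_compact_support[OF assms]) auto
  then show ?thesis using assms(3) unfolding set_integrable_def
    by (elim back_subst[of "integrable lborel"]) (auto simp: indicator_def fun_eq_iff)
qed

text \<open>
  Translation invariance makes the integrals of all difference quotients vanish.
\<close>

lemma integral_dird_eq_0:
  fixes \<psi> :: "'a::euclidean_space \<Rightarrow> real"
  assumes L: "L-lipschitz_on UNIV \<psi>" and C: "compact C" "\<And>z. z \<notin> C \<Longrightarrow> \<psi> z = 0"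
    and D: "AE z in lborel. ((\<lambda>s. \<psi> (z + s *\<^sub>R b)) has_real_derivative D z) (at 0)"
  shows "integrable lborel (dird \<psi> b)" "(LINT z|lborel. dird \<psi> b z) = 0"
proof -
  let ?s = "\<lambda>n z. (\<psi> (z + inverse (real (Suc n)) *\<^sub>R b) - \<psi> z) * real (Suc n)"
  note cont = lipschitz_on_continuous_on[OF L]
  obtain R where "\<forall>z\<in>C. norm z \<le> R" using compact_imp_bounded[OF C(1)] unfolding bounded_iff by blast
  then have R: "C \<subseteq> cball 0 R" by auto
  \<comment> \<open>The steps of the difference quotients have length at most \<open>norm b\<close>,
    so fattening the support by \<open>norm b\<close> yields one bounded set outside which all
    quotients vanish.\<close>
  let ?K = "cball (0::'a) (R + norm b)"
  let ?w = "\<lambda>z. L * norm b * indicator ?K z :: real"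
  have w: "integrable lborel ?w"
    using emeasure_bounded_finite[OF bounded_cball, of 0 "R + norm b"]
    by (intro integrable_mult_right integrable_real_indicator) auto
  have lim: "AE z in lborel. (\<lambda>n. ?s n z) \<longlonglongrightarrow> dird \<psi> b z"
    using D
  proof eventually_elim
    case (elim z)
    show ?case using difference_quotient_tendsto[OF elim] dird_eq[OF elim] by simp
  qed
  have bd: "AE z in lborel. norm (?s n z) \<le> ?w z" for n
  proof (rule AE_I2)
    fix z
    show "norm (?s n z) \<le> ?w z"
    proof (cases "z \<in> ?K")
      case True
      then show ?thesis using lipschitz_difference_quotient[OF L, of z n b] by simp
    next
      case False
      then have "norm z > R + norm b" by simp
      moreover have "norm (inverse (real (Suc n)) *\<^sub>R b) \<le> norm b"
        using mult_right_mono[of "inverse (real (Suc n))" 1 "norm b"] by (simp add: inverse_le_1_iff)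
      moreover have "norm z \<le> norm (z + inverse (real (Suc n)) *\<^sub>R b) + norm (inverse (real (Suc n)) *\<^sub>R b)"
        using norm_triangle_ineq4[of "z + inverse (real (Suc n)) *\<^sub>R b" "inverse (real (Suc n)) *\<^sub>R b"] by simp
      ultimately have "norm (z + inverse (real (Suc n)) *\<^sub>R b) > R" "norm z > R"
        using norm_ge_zero[of b] by linarith+
      then have "z + inverse (real (Suc n)) *\<^sub>R b \<notin> C" "z \<notin> C"
        using R by (metis (no_types) mem_cball_0 not_le subsetD)+
      then show ?thesis using C(2) False by simp
    qed
  qed
  have m: "dird \<psi> b \<in> borel_measurable lborel" using borel_measurable_dird[OF cont] by simp
  have \<psi>m[measurable]: "\<psi> \<in> borel_measurable borel" by (rule borel_measurable_continuous_onI[OF cont])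
  have sm: "?s n \<in> borel_measurable lborel" for n by measurable
  show "integrable lborel (dird \<psi> b)"
    by (rule integrable_dominated_convergence[OF m sm w lim bd])
  have \<psi>i: "integrable lborel \<psi>" by (rule integrable_continuous_compact_support[OF cont C])
  have "(LINT z|lborel. ?s n z) = 0" for n
  proof -
    let ?c = "inverse (real (Suc n)) *\<^sub>R b"
    have "integrable (distr lborel borel ((+) ?c)) \<psi>" using \<psi>i by (simp only: lborel_distr_plus)
    then have "integrable lborel (\<lambda>z. \<psi> (?c + z))"
      by (subst (asm) integrable_distr_eq) (use \<psi>m in auto)
    then have i: "integrable lborel (\<lambda>z. \<psi> (z + ?c))" by (simp add: add.commute)
    have "(LINT z|lborel. ?s n z) = (LINT z|lborel. \<psi> (z + ?c) - \<psi> z) * real (Suc n)"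
      by (rule integral_mult_left_zero)
    also have "(LINT z|lborel. \<psi> (z + ?c) - \<psi> z) = 0"
      by (subst Bochner_Integration.integral_diff[OF i \<psi>i]) (simp add: integral_translation[OF \<psi>m])
    finally show ?thesis by simp
  qed
  with integral_dominated_convergence[OF m sm w lim bd] show "(LINT z|lborel. dird \<psi> b z) = 0"
    by (simp add: LIMSEQ_const_iff)
qed

lemma bounded_on_compact:
  fixes f :: "'a::topological_space \<Rightarrow> 'b::real_normed_vector"
  assumes "continuous_on C f" "compact C" obtains B where "B \<ge> 0" "\<And>z. z \<in> C \<Longrightarrow> norm (f z) \<le> B"
proof -
  obtain B where "\<And>z. z \<in> C \<Longrightarrow> norm (f z) \<le> B"
    using compact_imp_bounded[OF compact_continuous_image[OF assms]] unfolding bounded_iff by blast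
  then show ?thesis by (intro that[of "max B 0"]) (auto simp: le_max_iff_disj)
qed

text \<open>The derivative is bounded on the compact \<open>C\<close> and vanishes off it; the mean
  value inequality on the whole space does the rest.\<close>

lemma smooth_compact_support_lipschitz:
  assumes \<phi>: "smooth \<phi>" and C: "compact C" "\<And>z. z \<notin> C \<Longrightarrow> \<phi> z = 0"
  obtains L where "L-lipschitz_on UNIV \<phi>"
proof -
  let ?D = "\<lambda>z. Blinfun (frechet_derivative \<phi> (at z))"
  obtain B where B: "B \<ge> 0" "\<And>z. z \<in> C \<Longrightarrow> norm (?D z) \<le> B"
    using bounded_on_compact[OF smooth_continuous_derivative[OF \<phi>, of C] C(1)] by blast
  have d: "\<And>z. (\<phi> has_derivative frechet_derivative \<phi> (at z)) (at z)"
    using differentiable_has_frechet smooth_differentiable[OF \<phi>] by blast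
  have "onorm (frechet_derivative \<phi> (at z)) \<le> B" for z
  proof (cases "z \<in> C")
    case True
    then show ?thesis using B(2)[OF True]
      by (simp add: norm_blinfun.rep_eq bounded_linear_Blinfun_apply[OF has_derivative_bounded_linear[OF d]])
  next
    case False
    then show ?thesis
      using frechet_derivative_outside(2)[OF compact_imp_closed[OF C(1)] C(2) False] B(1) by (simp add: onorm_zero)
  qed
  then have "B-lipschitz_on UNIV \<phi>"
    by (intro bounded_derivative_imp_lipschitz[OF d]) (use B in auto)
  then show ?thesis by (rule that)
qed

lemma lipschitz_mult_bounded:
  fixes f g :: "'a::metric_space \<Rightarrow> real"
  assumes f: "L-lipschitz_on UNIV f" "\<And>z. \<bar>f z\<bar> \<le> A" and g: "M-lipschitz_on UNIV g" "\<And>z. \<bar>g z\<bar> \<le> B"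
  shows "(A * M + B * L)-lipschitz_on UNIV (\<lambda>z. f z * g z)"
proof -
  fix z0 :: 'a
  have nn: "A \<ge> 0" "B \<ge> 0" "L \<ge> 0" "M \<ge> 0"
    using f(2)[of z0] g(2)[of z0] lipschitz_on_nonneg[OF f(1)] lipschitz_on_nonneg[OF g(1)] by linarith+
  show ?thesis
  proof (rule lipschitz_onI)
    fix x y
    have "\<bar>f x * g x - f y * g y\<bar> = \<bar>f x * (g x - g y) + g y * (f x - f y)\<bar>" by (simp add: algebra_simps)
    also have "\<dots> \<le> \<bar>f x\<bar> * \<bar>g x - g y\<bar> + \<bar>g y\<bar> * \<bar>f x - f y\<bar>"
      unfolding abs_mult[symmetric] by (rule abs_triangle_ineq)
    also have "\<dots> \<le> A * (M * dist x y) + B * (L * dist x y)"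
      using lipschitz_onD[OF f(1), of x y] lipschitz_onD[OF g(1), of x y] nn f(2) g(2)
      by (intro add_mono mult_mono) (auto simp: dist_real_def)
    finally show "dist (f x * g x) (f y * g y) \<le> (A * M + B * L) * dist x y"
      by (simp add: dist_real_def algebra_simps)
  qed (use nn in simp)
qed

text \<open>The factor \<open>w\<close> may be unbounded. Expanding the difference of products at a
  point of \<open>C\<close> evaluates \<open>w\<close> there only, and a pair with neither point in
  \<open>C\<close> contributes nothing.\<close>

lemma lipschitz_mult_compact_support:
  fixes w \<phi> :: "'a::euclidean_space \<Rightarrow> real"
  assumes w: "L-lipschitz_on UNIV w" and p: "M-lipschitz_on UNIV \<phi>"
    and C: "compact C" "\<And>z. z \<notin> C \<Longrightarrow> \<phi> z = 0"
  obtains N where "N-lipschitz_on UNIV (\<lambda>z. w z * \<phi> z)"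
proof -
  obtain B where B: "B \<ge> 0" "\<And>z. z \<in> C \<Longrightarrow> norm (w z) \<le> B"
    using bounded_on_compact[OF continuous_on_subset[OF lipschitz_on_continuous_on[OF w] subset_UNIV] C(1)] by blast
  obtain B' where B': "B' \<ge> 0" "\<And>z. z \<in> C \<Longrightarrow> norm (\<phi> z) \<le> B'"
    using bounded_on_compact[OF continuous_on_subset[OF lipschitz_on_continuous_on[OF p] subset_UNIV] C(1)] by blast
  have pb: "\<bar>\<phi> z\<bar> \<le> B'" for z using B' C(2)[of z] by (cases "z \<in> C") auto
  have LM: "0 \<le> L" "0 \<le> M" using w p lipschitz_on_nonneg by blast+
  have wd: "\<bar>w x - w y\<bar> \<le> L * dist x y" and pd: "\<bar>\<phi> x - \<phi> y\<bar> \<le> M * dist x y" for x y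
    using lipschitz_onD[OF w, of x y] lipschitz_onD[OF p, of x y] by (simp_all add: dist_real_def)
  have est: "\<bar>w x * \<phi> x - w y * \<phi> y\<bar> \<le> (B * M + B' * L) * dist x y" if "x \<in> C" for x y
  proof -
    have "\<bar>w x * \<phi> x - w y * \<phi> y\<bar> = \<bar>w x * (\<phi> x - \<phi> y) + \<phi> y * (w x - w y)\<bar>" by (simp add: algebra_simps)
    also have "\<dots> \<le> \<bar>w x\<bar> * \<bar>\<phi> x - \<phi> y\<bar> + \<bar>\<phi> y\<bar> * \<bar>w x - w y\<bar>"
      using abs_triangle_ineq[of "w x * (\<phi> x - \<phi> y)" "\<phi> y * (w x - w y)"] by (simp only: abs_mult)
    also have "\<dots> \<le> B * (M * dist x y) + B' * (L * dist x y)"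
      using B(2)[OF that] pb wd pd B(1) B'(1) LM by (intro add_mono mult_mono) auto
    finally show ?thesis by (simp add: algebra_simps)
  qed
  have "(B * M + B' * L)-lipschitz_on UNIV (\<lambda>z. w z * \<phi> z)"
  proof (rule lipschitz_onI)
    fix x y
    show "dist (w x * \<phi> x) (w y * \<phi> y) \<le> (B * M + B' * L) * dist x y"
    proof (cases "x \<in> C \<or> y \<in> C")
      case True
      then show ?thesis using est[of x y] est[of y x] by (auto simp: dist_real_def dist_commute abs_minus_commute)
    next
      case False
      then show ?thesis using C(2) B B' LM by simp
    qed
  qed (use B B' LM in simp)
  then show ?thesis by (rule that)
qed

lemma lipschitz_measurable: "L-lipschitz_on UNIV w \<Longrightarrow> w \<in> borel_measurable borel"
  for w :: "'a::euclidean_space \<Rightarrow> real"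
  by (intro borel_measurable_continuous_onI lipschitz_on_continuous_on)

lemma borel_set_measurable:
  fixes w :: "'a::euclidean_space \<Rightarrow> 'b::euclidean_space"
  shows "S \<in> sets borel \<Longrightarrow> w \<in> borel_measurable borel \<Longrightarrow> set_borel_measurable lborel S w"
  unfolding set_borel_measurable_def measurable_lborel2 by (intro borel_measurable_scaleR) auto

lemma continuous_L2_on:
  fixes w :: "'a::euclidean_space \<Rightarrow> real"
  assumes w: "continuous_on UNIV w" and S: "S \<in> sets borel" "bounded S"
  shows "L2_on S w"
proof -
  obtain B where B: "B \<ge> 0" "\<And>z. z \<in> closure S \<Longrightarrow> norm (w z) \<le> B"
    using bounded_on_compact[OF continuous_on_subset[OF w subset_UNIV], of "closure S"] S by auto
  show ?thesis
  proof (rule L2_on_bounded[OF S borel_set_measurable[OF S(1) borel_measurable_continuous_onI[OF w]]])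
    show "AE z in lborel. z \<in> S \<longrightarrow> norm (w z) \<le> B"
      using B(2) closure_subset[of S] by (intro AE_I2) blast
  qed
qed

lemma dird_L2_on:
  assumes w: "L-lipschitz_on UNIV w" and S: "S \<in> sets borel" "bounded S"
    and D: "AE z in lborel. z \<in> S \<longrightarrow> ((\<lambda>s. w (z + s *\<^sub>R b)) has_real_derivative D z) (at 0)"
  shows "L2_on S (dird w b)"
proof (rule L2_on_bounded[OF S borel_set_measurable[OF S(1) borel_measurable_dird]])
  show "continuous_on UNIV w" using w by (rule lipschitz_on_continuous_on)
  show "AE z in lborel. z \<in> S \<longrightarrow> norm (dird w b z) \<le> L * norm b"
    using D by eventually_elim (use dird_bound[OF w] in auto)
qed

text \<open>By \<open>integral_dird_eq_0\<close>, the directional derivative of w \<phi> has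
  integral 0. It is given by the product rule almost everywhere in \<open>S\<close> and is 0 off the
  support of \<phi>.\<close>

lemma lipschitz_integration_by_parts:
  assumes w: "L-lipschitz_on UNIV w" and S: "open S" "bounded S"
    and D: "AE z in lborel. z \<in> S \<longrightarrow> ((\<lambda>s. w (z + s *\<^sub>R b)) has_real_derivative D z) (at 0)"
    and \<phi>: "test_function S \<phi>" and b: "b \<in> Basis"
  shows "(LINT z:S|lborel. w z * frechet_derivative \<phi> (at z) b) = - (LINT z:S|lborel. \<phi> z * dird w b z)"
proof -
  obtain C where C: "compact C" "C \<subseteq> S" "\<And>z. z \<notin> C \<Longrightarrow> \<phi> z = 0" and s: "smooth \<phi>"
    using \<phi> unfolding test_function_def by blast
  obtain M where M: "M-lipschitz_on UNIV \<phi>" using smooth_compact_support_lipschitz[OF s C(1,3)] by blast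
  obtain N where N: "N-lipschitz_on UNIV (\<lambda>z. w z * \<phi> z)"
    using lipschitz_mult_compact_support[OF w M C(1,3)] by blast
  let ?d = "\<lambda>z. frechet_derivative \<phi> (at z) b"
  let ?D = "\<lambda>z. indicator S z * (w z * ?d z + \<phi> z * dird w b z)"
  have \<phi>d: "((\<lambda>s. \<phi> (z + s *\<^sub>R b)) has_real_derivative ?d z) (at 0)" for z
    by (intro has_derivative_imp_directional differentiable_has_frechet smooth_differentiable s)
  have \<psi>d: "AE z in lborel. ((\<lambda>s. w (z + s *\<^sub>R b) * \<phi> (z + s *\<^sub>R b)) has_real_derivative ?D z) (at 0)"
    using D
  proof eventually_elim
    case (elim z)
    show ?case
    proof (cases "z \<in> S")
      case True
      have "((\<lambda>s. w (z + s *\<^sub>R b) * \<phi> (z + s *\<^sub>R b)) has_real_derivative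
          D z * \<phi> (z + 0 *\<^sub>R b) + ?d z * w (z + 0 *\<^sub>R b)) (at 0)"
        by (rule DERIV_mult[OF _ \<phi>d]) (use elim True in simp)
      moreover have "dird w b z = D z" using elim True by (intro dird_eq) simp
      ultimately show ?thesis using True by (simp add: algebra_simps)
    next
      case False
      then have "z \<notin> C" using C by blast
      have "((\<lambda>z. w z * \<phi> z) has_derivative (\<lambda>_. 0)) (at z)"
        by (rule frechet_derivative_outside(1)[OF compact_imp_closed[OF C(1)] _ \<open>z \<notin> C\<close>]) (simp add: C)
      from has_derivative_imp_directional[OF this, of b] False show ?thesis by simp
    qed
  qed
  have eq: "AE z in lborel. dird (\<lambda>z. w z * \<phi> z) b z = ?D z"
    using \<psi>d by eventually_elim (rule dird_eq)
  have Sb: "S \<in> sets borel" using S by simp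
  have d: "L2_on S ?d"
    using frechet_derivative_outside(2)[OF compact_imp_closed[OF C(1)] C(3)]
    by (intro L2_on_continuous_compact_support[OF smooth_continuous_on[OF smooth_partial[OF s b]] C(1) _ Sb]) simp
  have i: "set_integrable lborel S (\<lambda>z. w z * ?d z)" "set_integrable lborel S (\<lambda>z. \<phi> z * dird w b z)"
    by (intro L2_on_mult_integrable continuous_L2_on[OF _ Sb S(2)] dird_L2_on[OF w Sb S(2) D] d
        lipschitz_on_continuous_on[OF w] lipschitz_on_continuous_on[OF M])+
  have Dm: "?D \<in> borel_measurable lborel"
  proof -
    have "integrable lborel (\<lambda>z. indicator S z *\<^sub>R (w z * ?d z + \<phi> z * dird w b z))"
      using set_integral_add(1)[OF i] unfolding set_integrable_def .
    then show ?thesis by simp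
  qed
  have "0 = (LINT z|lborel. dird (\<lambda>z. w z * \<phi> z) b z)"
    by (rule integral_dird_eq_0(2)[OF N C(1) _ \<psi>d, symmetric]) (simp add: C)
  also have "\<dots> = (LINT z|lborel. ?D z)"
    using borel_measurable_dird[OF lipschitz_on_continuous_on[OF N]]
    by (intro integral_cong_AE[OF _ Dm eq]) simp
  also have "\<dots> = (LINT z:S|lborel. w z * ?d z + \<phi> z * dird w b z)" by (simp add: set_lebesgue_integral_def)
  also have "\<dots> = (LINT z:S|lborel. w z * ?d z) + (LINT z:S|lborel. \<phi> z * dird w b z)"
    by (rule set_integral_add[OF i])
  finally show ?thesis by simp
qed

definition dirgrad :: "('d::finite spacetime \<Rightarrow> real) \<Rightarrow> 'd spacetime \<Rightarrow> real ^ 'd" where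
  "dirgrad w z = (\<chi> i. dird w (axis i 1, 0) z)"

lemma dird_differentiable: "w differentiable (at z) \<Longrightarrow> dird w b z = frechet_derivative w (at z) b"
  by (intro dird_eq has_derivative_imp_directional differentiable_has_frechet)

lemma dirgrad_differentiable: "w differentiable (at z) \<Longrightarrow> dirgrad w z = grad_x w z"
  by (simp add: dirgrad_def grad_x_def dird_differentiable)

context
  fixes w :: "'d::finite spacetime \<Rightarrow> real" and L S
  assumes w: "L-lipschitz_on UNIV w" and S: "open S" "bounded S"
    and d: "AE z in lborel. z \<in> S \<longrightarrow> w differentiable (at z)"
begin

lemma ae_directional:
  "AE z in lborel. z \<in> S \<longrightarrow> ((\<lambda>s. w (z + s *\<^sub>R b)) has_real_derivative frechet_derivative w (at z) b) (at 0)"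
  using d by eventually_elim (blast intro: has_derivative_imp_directional differentiable_has_frechet)

lemma lipschitz_L2_on: "L2_on S w" "L2_on S (dird w b)" "L2_on S (dirgrad w)"
proof -
  show "L2_on S w" using S by (intro continuous_L2_on lipschitz_on_continuous_on[OF w]) auto
  show *: "L2_on S (dird w b)" for b using S by (intro dird_L2_on[OF w _ _ ae_directional]) auto
  show "L2_on S (dirgrad w)" by (rule L2_on_vec) (simp add: dirgrad_def *)
qed

lemma lipschitz_has_weak_dt: "has_weak_dt S w (dird w (0, 1))"
  unfolding has_weak_dt_def dt_def
  using lipschitz_integration_by_parts[OF w S ae_directional _ spatial_Basis(2)] lipschitz_L2_on by blast

lemma lipschitz_has_weak_grad_x: "has_weak_grad_x S w (dirgrad w)"
  unfolding has_weak_grad_x_def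
proof (intro conjI allI impI lipschitz_L2_on)
  fix \<phi> :: "'d spacetime \<Rightarrow> real" assume \<phi>: "test_function S \<phi>"
  have i: "set_integrable lborel S (\<lambda>z. w z *\<^sub>R grad_x \<phi> z)" "set_integrable lborel S (\<lambda>z. \<phi> z *\<^sub>R dirgrad w z)"
    using S by (intro L2_on_scaleR_integrable test_function_L2[OF \<phi>] lipschitz_L2_on; simp)+
  show "(LINT z:S|lborel. w z *\<^sub>R grad_x \<phi> z) = - (LINT z:S|lborel. \<phi> z *\<^sub>R dirgrad w z)"
  proof (rule vec_eq_iff[THEN iffD2, rule_format])
    fix i
    show "(LINT z:S|lborel. w z *\<^sub>R grad_x \<phi> z) $ i = (- (LINT z:S|lborel. \<phi> z *\<^sub>R dirgrad w z)) $ i"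
      using lipschitz_integration_by_parts[OF w S ae_directional \<phi> spatial_Basis(1)[of i]]
      unfolding vector_uminus_component set_integral_nth[OF i(1)] set_integral_nth[OF i(2)]
      by (simp add: grad_x_def dirgrad_def)
  qed
qed

end

subsection \<open>Mollification\<close>

lemma mollifier_exists:
  obtains \<rho> :: "'a::euclidean_space \<Rightarrow> real"
  where "smooth \<rho>" "\<And>z. z \<notin> cball 0 1 \<Longrightarrow> \<rho> z = 0" "(LINT z|lborel. \<rho> z) = 1"
proof -
  \<comment> \<open>The l1 norm dominates the Euclidean norm, so a half-width of 1 over the
    dimension keeps the box inside the unit ball.\<close>
  define c where "c = 1 / real DIM('a)"
  define q where "q = c *\<^sub>R (One :: 'a)"
  define b where "b = bump 1 (- q) q"
  have c: "c > 0" by (simp add: c_def)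
  have out: "b z = 0" if "z \<notin> cball 0 1" for z
  proof -
    have "z \<notin> box (- q) q"
    proof
      assume z: "z \<in> box (- q) q"
      have "norm z \<le> (\<Sum>i\<in>Basis. \<bar>z \<bullet> i\<bar>)" by (rule norm_le_l1)
      also have "\<dots> \<le> (\<Sum>i\<in>(Basis::'a set). c)"
        using z by (intro sum_mono) (auto simp: mem_box q_def abs_le_iff dest!: bspec)
      also have "\<dots> = 1" by (simp add: c_def)
      finally show False using that by simp
    qed
    then show ?thesis by (simp add: b_def bump_eq_0_iff)
  qed
  have s: "smooth b" by (simp add: b_def smooth_bump)
  have i: "integrable lborel b"
    by (rule integrable_continuous_compact_support[OF smooth_continuous_on[OF s] compact_cball out])
  have "(LINT z|lborel. b z) \<noteq> 0"
  proof
    assume "(LINT z|lborel. b z) = 0"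
    then have "AE z in lborel. b z = 0"
      by (subst (asm) integral_nonneg_eq_0_iff_AE[OF i]) (auto simp: b_def bump_nonneg)
    then have "AE z in lborel. z \<notin> box (- q) q"
      by eventually_elim (simp add: b_def bump_eq_0_iff)
    then have "emeasure lborel (box (- q) q) = 0" by (subst (asm) AE_iff_measurable[OF _ refl]) auto
    moreover have "emeasure lborel (box (- q) q) = (\<Prod>j\<in>Basis. (q - (- q)) \<bullet> j)"
      using c by (intro emeasure_lborel_box) (auto simp: q_def)
    moreover have "(\<Prod>j\<in>(Basis::'a set). (q - (- q)) \<bullet> j) > 0"
      using c by (intro prod_pos) (auto simp: q_def inner_simps)
    ultimately show False by (simp add: ennreal_eq_0_iff)
  qed
  then show ?thesis
    by (intro that[of "\<lambda>z. inverse (LINT z|lborel. b z) * b z"])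
       (auto intro: smooth_mult smooth_const s simp: out)
qed

text \<open>The derivative falls on \<rho>, so continuity of \<open>W\<close> suffices. Integrating
  over a fixed compact box brings the Leibniz rule within reach.\<close>

lemma has_derivative_convolution:
  fixes W \<rho> :: "'a::euclidean_space \<Rightarrow> real"
  assumes W: "continuous_on UNIV W" and \<rho>: "smooth \<rho>"
  shows "((\<lambda>z. integral (cbox p q) (\<lambda>y. W y * \<rho> (z - y))) has_derivative
    (\<lambda>b. integral (cbox p q) (\<lambda>y. W y * frechet_derivative \<rho> (at (z - y)) b))) (at z)"
proof -
  let ?B = "\<lambda>z. Blinfun (frechet_derivative \<rho> (at z))"
  have \<rho>d: "(\<rho> has_derivative frechet_derivative \<rho> (at z)) (at z)" for z
    by (rule differentiable_has_frechet[OF smooth_differentiable[OF \<rho>]])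
  have bl: "bounded_linear (frechet_derivative \<rho> (at z))" for z
    by (rule has_derivative_bounded_linear[OF \<rho>d])
  have B: "continuous_on UNIV ?B" by (rule smooth_continuous_derivative[OF \<rho>])
  have c: "continuous_on (UNIV \<times> cbox p q) (\<lambda>(z, y). W y *\<^sub>R ?B (z - y))"
    unfolding split_def
    by (intro continuous_on_scaleR continuous_on_compose2[OF W] continuous_on_compose2[OF B]
        continuous_on_diff continuous_on_fst continuous_on_snd continuous_on_id subset_UNIV)
  have cz: "continuous_on (cbox p q) (\<lambda>y. W y *\<^sub>R ?B (z - y))" for z
    by (intro continuous_on_scaleR continuous_on_subset[OF W subset_UNIV] continuous_on_compose2[OF B]
        continuous_on_diff continuous_on_const continuous_on_id subset_UNIV)
  have "((\<lambda>z. integral (cbox p q) (\<lambda>y. W y * \<rho> (z - y))) has_derivative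
      blinfun_apply (integral (cbox p q) (\<lambda>y. W y *\<^sub>R ?B (z - y)))) (at z within UNIV)"
  proof (rule leibniz_rule[where fx = "\<lambda>z y. W y *\<^sub>R ?B (z - y)"])
    fix x y :: 'a
    have "((\<lambda>z. \<rho> (z - y)) has_derivative frechet_derivative \<rho> (at (x - y))) (at x)"
      by (rule has_derivative_compose[where f="\<lambda>z. z - y" and f'="\<lambda>z. z", OF _ \<rho>d])
         (auto intro!: derivative_eq_intros)
    then have "((\<lambda>z. W y * \<rho> (z - y)) has_derivative (\<lambda>b. W y * frechet_derivative \<rho> (at (x - y)) b)) (at x)"
      by (rule has_derivative_mult_right)
    moreover have "blinfun_apply (W y *\<^sub>R ?B (x - y)) = (\<lambda>b. W y * frechet_derivative \<rho> (at (x - y)) b)"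
      by (simp add: fun_eq_iff scaleR_blinfun.rep_eq bounded_linear_Blinfun_apply[OF bl])
    ultimately show "((\<lambda>z. W y * \<rho> (z - y)) has_derivative blinfun_apply (W y *\<^sub>R ?B (x - y))) (at x within UNIV)"
      by simp
  next
    fix x :: 'a
    have "continuous_on (cbox p q) (\<lambda>y. W y * \<rho> (x - y))"
      by (intro continuous_on_mult continuous_on_subset[OF W subset_UNIV]
          continuous_on_compose2[OF smooth_continuous_on[OF \<rho>, of UNIV]]
          continuous_on_diff continuous_on_const continuous_on_id subset_UNIV)
    then show "(\<lambda>y. W y * \<rho> (x - y)) integrable_on cbox p q" by (rule integrable_continuous)
  qed (use c in auto)
  moreover have "blinfun_apply (integral (cbox p q) (\<lambda>y. W y *\<^sub>R ?B (z - y))) =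
      (\<lambda>b. integral (cbox p q) (\<lambda>y. W y * frechet_derivative \<rho> (at (z - y)) b))"
    by (rule ext, subst blinfun_apply_integral[OF integrable_continuous[OF cz]])
       (simp add: scaleR_blinfun.rep_eq bounded_linear_Blinfun_apply[OF bl])
  ultimately show ?thesis by simp
qed

text \<open>A partial derivative of the convolution is the convolution with a partial derivative of
  \<rho>, which is smooth again; hence the induction has to leave \<rho> arbitrary.\<close>

lemma smooth_convolution:
  fixes W \<rho> :: "'a::euclidean_space \<Rightarrow> real"
  assumes W: "continuous_on UNIV W" and \<rho>: "smooth \<rho>"
  shows "smooth (\<lambda>z. integral (cbox p q) (\<lambda>y. W y * \<rho> (z - y)))"
proof -
  have "C_k k (\<lambda>z. integral (cbox p q) (\<lambda>y. W y * \<rho> (z - y)))" if "smooth \<rho>" for k and \<rho> :: "'a \<Rightarrow> real"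
    using that
  proof (induction k arbitrary: \<rho>)
    case 0
    have "isCont (\<lambda>z. integral (cbox p q) (\<lambda>y. W y * \<rho> (z - y))) z" for z
      by (rule has_derivative_continuous[OF has_derivative_convolution[OF W 0]])
    then show ?case by (simp add: continuous_at_imp_continuous_on)
  next
    case (Suc k)
    note d = has_derivative_convolution[OF W Suc.prems, of p q]
    show ?case
      unfolding C_k.simps
    proof (intro conjI allI ballI)
      show "(\<lambda>z. integral (cbox p q) (\<lambda>y. W y * \<rho> (z - y))) differentiable at z" for z
        using d differentiableI by blast
      fix b :: 'a assume "b \<in> Basis"
      from Suc.IH[OF smooth_partial[OF Suc.prems this]]
      show "C_k k (\<lambda>z. frechet_derivative (\<lambda>z. integral (cbox p q) (\<lambda>y. W y * \<rho> (z - y))) (at z) b)"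
        by (simp add: frechet_derivative_eqI[OF d])
    qed
  qed
  then show ?thesis using \<rho> by (simp add: smooth_def)
qed

text \<open>Substitution y = z - r u, with Jacobian \<open>r ^ DIM('a)\<close>. The restriction to
  the box is invisible because the box contains the ball in which the rescaled \<open>g\<close>
  lives.\<close>

lemma integral_scaled_convolution:
  fixes W g :: "'a::euclidean_space \<Rightarrow> real"
  assumes W: "continuous_on UNIV W" and g: "continuous_on UNIV g" "\<And>u. u \<notin> cball 0 1 \<Longrightarrow> g u = 0"
    and r: "r > 0" "cball z r \<subseteq> cbox p q"
  shows "integral (cbox p q) (\<lambda>y. W y * g (inverse r *\<^sub>R (z - y))) = r ^ DIM('a) * (LINT u|lborel. W (z - r *\<^sub>R u) * g u)"
proof -
  let ?f = "\<lambda>y. W y * g (inverse r *\<^sub>R (z - y))"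
  have out: "?f y = 0" if "y \<notin> cball z r" for y
  proof -
    have "norm (z - y) > r" using that by (simp add: dist_norm)
    then have "inverse r * norm (z - y) > inverse r * r" using r by (intro mult_strict_left_mono) auto
    then have "norm (inverse r *\<^sub>R (z - y)) > 1" using r by simp
    then show ?thesis using g(2)[of "inverse r *\<^sub>R (z - y)"] by simp
  qed
  have c: "continuous_on UNIV ?f"
    by (intro continuous_on_mult W continuous_on_compose2[OF g(1)] continuous_on_scaleR
        continuous_on_diff continuous_on_const continuous_on_id subset_UNIV)
  have i: "integrable lborel ?f"
    by (rule integrable_continuous_compact_support[OF c compact_cball out])
  have "integral (cbox p q) ?f = integral UNIV (\<lambda>y. if y \<in> cbox p q then ?f y else 0)"
    by (rule Henstock_Kurzweil_Integration.integral_restrict_UNIV[symmetric])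
  also have "(\<lambda>y. if y \<in> cbox p q then ?f y else 0) = ?f"
  proof
    fix y
    show "(if y \<in> cbox p q then ?f y else 0) = ?f y"
    proof (cases "y \<in> cbox p q")
      case False
      then have "y \<notin> cball z r" using r(2) by blast
      then show ?thesis using out False by simp
    qed simp
  qed
  also have "integral UNIV ?f = (LINT y|lborel. ?f y)" by (rule integral_lborel[OF i])
  also have "\<dots> = (LINT y|density (distr lborel borel (\<lambda>u. z + (- r) *\<^sub>R u)) (\<lambda>_. ennreal (r ^ DIM('a))). ?f y)"
    using lborel_affine[of "- r" z] r by simp
  also have "\<dots> = (LINT y|distr lborel borel (\<lambda>u. z + (- r) *\<^sub>R u). r ^ DIM('a) *\<^sub>R ?f y)"
    using c r by (intro integral_density) (auto intro: borel_measurable_continuous_onI)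
  also have "\<dots> = (LINT u|lborel. r ^ DIM('a) *\<^sub>R ?f (z + (- r) *\<^sub>R u))"
    using borel_measurable_continuous_onI[OF c] by (intro integral_distr) auto
  also have "(\<lambda>u. r ^ DIM('a) *\<^sub>R ?f (z + (- r) *\<^sub>R u)) = (\<lambda>u. r ^ DIM('a) * (W (z - r *\<^sub>R u) * g u))"
    using r by simp
  finally show ?thesis by simp
qed

lemma tendsto_sqrt_ennreal_0:
  assumes "a \<longlonglongrightarrow> (0::real)" "\<And>n. b n = ennreal (a n)"
  shows "(\<lambda>n. sqrt_ennreal (b n)) \<longlonglongrightarrow> 0"
proof -
  have "(\<lambda>n. ennreal (sqrt (max 0 (a n)))) \<longlonglongrightarrow> ennreal (sqrt (max 0 0))"
    by (intro tendsto_ennrealI tendsto_real_sqrt tendsto_max tendsto_const assms)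
  moreover have "sqrt_ennreal (b n) = ennreal (sqrt (max 0 (a n)))" for n
    by (cases "a n \<ge> 0") (auto simp: sqrt_ennreal_def assms(2) ennreal_neg)
  ultimately show ?thesis by simp
qed

lemma L2_norm_on_tendsto_0:
  fixes f :: "nat \<Rightarrow> 'a::euclidean_space \<Rightarrow> 'b::euclidean_space"
  assumes S: "S \<in> sets borel" "bounded S" and m: "\<And>n. f n \<in> borel_measurable borel"
    and b: "\<And>n. AE z in lborel. z \<in> S \<longrightarrow> norm (f n z) \<le> B"
    and l: "AE z in lborel. z \<in> S \<longrightarrow> (\<lambda>n. f n z) \<longlonglongrightarrow> 0"
  shows "(\<lambda>n. L2_norm_on S (f n)) \<longlonglongrightarrow> 0"
proof -
  have L2: "L2_on S (f n)" for n by (rule L2_on_bounded[OF S borel_set_measurable[OF S(1) m] b])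
  have one: "integrable lborel (\<lambda>z. indicator S z * B\<^sup>2 :: real)"
    using S emeasure_bounded_finite[OF S(2)] by (intro integrable_mult_left integrable_real_indicator) auto
  have "(\<lambda>n. LINT z|lborel. indicator S z *\<^sub>R (norm (f n z))\<^sup>2) \<longlonglongrightarrow> (LINT z|(lborel :: 'a measure). 0)"
  proof (rule integral_dominated_convergence[where w="\<lambda>z. indicator S z * B\<^sup>2"])
    show "integrable lborel (\<lambda>z. indicator S z * B\<^sup>2)" by (rule one)
    show "(\<lambda>z. indicator S z *\<^sub>R (norm (f n z))\<^sup>2) \<in> borel_measurable lborel" for n
      using m S by (intro borel_measurable_scaleR borel_measurable_power borel_measurable_norm) auto
    show "AE z in lborel. (\<lambda>n. indicator S z *\<^sub>R (norm (f n z))\<^sup>2) \<longlonglongrightarrow> 0"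
      using l
    proof eventually_elim
      case (elim z)
      show ?case
      proof (cases "z \<in> S")
        case True
        then have "(\<lambda>n. (norm (f n z))\<^sup>2) \<longlonglongrightarrow> (norm (0::'b))\<^sup>2"
          using elim by (intro tendsto_power tendsto_norm) simp
        then show ?thesis using True by simp
      qed simp
    qed
    show "AE z in lborel. norm (indicator S z *\<^sub>R (norm (f n z))\<^sup>2) \<le> indicator S z * B\<^sup>2" for n
      using b[of n] by eventually_elim (auto simp: indicator_def intro: power_mono)
  qed simp
  then show ?thesis
    unfolding L2_norm_on_def using L2_sq_eq_integral[OF L2]
    by (intro tendsto_sqrt_ennreal_0) (auto simp: set_lebesgue_integral_def)
qed

text \<open>Clamping is non-expansive jointly in the value and in the bound, so a clamped function
  inherits the larger of the two Lipschitz constants.\<close>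

lemma clamp_bound:
  fixes w w' M M' K :: real
  assumes "\<bar>w - w'\<bar> \<le> K" "\<bar>M - M'\<bar> \<le> K"
  shows "\<bar>max (- M) (min M w) - max (- M') (min M' w')\<bar> \<le> K"
  using assms by (simp add: max_def min_def abs_le_iff)

text \<open>
  The mollified difference quotient picks up the derivative at every point of differentiability,
  since \<open>\<integral> w'(u) \<partial>\<^sub>b\<rho>(u) du = - w'(b)\<close> by partial integration.
\<close>

lemma mollified_derivative_tendsto:
  fixes w \<rho> :: "'a::euclidean_space \<Rightarrow> real" and r :: "nat \<Rightarrow> real"
  assumes \<rho>: "smooth \<rho>" "\<And>u. u \<notin> cball 0 1 \<Longrightarrow> \<rho> u = 0" "(LINT u|lborel. \<rho> u) = 1"
    and b: "b \<in> Basis"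
    and W: "\<And>n. L-lipschitz_on UNIV (W n)" and r: "\<And>n. r n > 0" "r \<longlonglongrightarrow> 0"
    and loc: "\<And>n. inverse (r n) * (LINT u|lborel. W n (z - r n *\<^sub>R u) * frechet_derivative \<rho> (at u) b) = d n"
  shows "\<bar>d n\<bar> \<le> L * (LINT u|lborel. \<bar>frechet_derivative \<rho> (at u) b\<bar>)"
    and "(w has_derivative w') (at z) \<Longrightarrow>
      eventually (\<lambda>n. \<forall>u\<in>cball 0 1. W n (z - r n *\<^sub>R u) = w (z - r n *\<^sub>R u)) sequentially \<Longrightarrow> d \<longlonglongrightarrow> w' b"
proof -
  let ?g = "\<lambda>u. frechet_derivative \<rho> (at u) b"
  have g0: "?g u = 0" if "u \<notin> cball 0 1" for u
    using frechet_derivative_outside(2)[OF closed_cball[of 0 1] \<rho>(2) that] by simp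
  have gc: "continuous_on UNIV ?g" by (rule smooth_continuous_on[OF smooth_partial[OF \<rho>(1) b]])
  obtain M where M: "M-lipschitz_on UNIV \<rho>"
    using smooth_compact_support_lipschitz[OF \<rho>(1) compact_cball[of 0 1] \<rho>(2)] by blast
  have gi: "integrable lborel ?g" by (rule integrable_continuous_compact_support[OF gc compact_cball[of 0 1] g0])
  have gd: "((\<lambda>s. \<rho> (u + s *\<^sub>R b)) has_real_derivative ?g u) (at 0)" for u
    by (rule has_derivative_imp_directional[OF differentiable_has_frechet[OF smooth_differentiable[OF \<rho>(1)]]])
  have "dird \<rho> b = ?g" using dird_eq[OF gd] by (rule ext)
  then have gint: "(LINT u|lborel. ?g u) = 0"
    using integral_dird_eq_0(2)[OF M compact_cball[of 0 1] \<rho>(2), where b=b and D="?g"] gd by simp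
  \<comment> \<open>As the derivative of \<rho> has integral 0, the value \<open>W n z\<close> may
    be subtracted; the resulting difference quotient is bounded by \<open>L\<close> on the unit
    ball.\<close>
  let ?h = "\<lambda>n u. inverse (r n) * (W n (z - r n *\<^sub>R u) - W n z) * ?g u"
  have Wc: "continuous_on UNIV (\<lambda>u. W n (z - r n *\<^sub>R u))" for n
    by (intro continuous_on_compose2[OF lipschitz_on_continuous_on[OF W[of n]]]
        continuous_on_diff continuous_on_scaleR continuous_on_const continuous_on_id subset_UNIV)
  have i1: "integrable lborel (\<lambda>u. W n (z - r n *\<^sub>R u) * ?g u)" for n
    by (rule integrable_continuous_compact_support[OF continuous_on_mult[OF Wc gc] compact_cball[of 0 1]])
       (simp add: g0)
  have hm: "?h n \<in> borel_measurable lborel" for n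
    unfolding measurable_lborel2
    by (intro borel_measurable_continuous_onI continuous_on_mult continuous_on_diff Wc gc continuous_on_const)
  have d: "d n = (LINT u|lborel. ?h n u)" for n
  proof -
    have "(LINT u|lborel. ?h n u) =
        (LINT u|lborel. inverse (r n) * (W n (z - r n *\<^sub>R u) * ?g u) - inverse (r n) * W n z * ?g u)"
      by (simp add: algebra_simps)
    also have "\<dots> = inverse (r n) * (LINT u|lborel. W n (z - r n *\<^sub>R u) * ?g u) - inverse (r n) * W n z * (LINT u|lborel. ?g u)"
      using i1[of n] gi by (subst Bochner_Integration.integral_diff) auto
    finally show ?thesis by (simp add: loc[symmetric] gint)
  qed
  have L0: "L \<ge> 0" using W lipschitz_on_nonneg by blast
  have hb: "\<bar>?h n u\<bar> \<le> L * \<bar>?g u\<bar>" for n u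
  proof (cases "u \<in> cball 0 1")
    case True
    have "\<bar>W n (z - r n *\<^sub>R u) - W n z\<bar> \<le> L * (r n * norm u)"
      using lipschitz_onD[OF W[of n], of "z - r n *\<^sub>R u" z] r(1)[of n] by (simp add: dist_real_def dist_norm)
    also have "\<dots> \<le> L * (r n * 1)" using True L0 r(1)[of n] by (intro mult_left_mono) auto
    finally have "inverse (r n) * \<bar>W n (z - r n *\<^sub>R u) - W n z\<bar> \<le> inverse (r n) * (L * (r n * 1))"
      using r(1)[of n] by (intro mult_left_mono) auto
    also have "inverse (r n) * (L * (r n * 1)) = L" using r(1)[of n] by simp
    finally have "inverse (r n) * \<bar>W n (z - r n *\<^sub>R u) - W n z\<bar> \<le> L" .
    then have "inverse (r n) * \<bar>W n (z - r n *\<^sub>R u) - W n z\<bar> * \<bar>?g u\<bar> \<le> L * \<bar>?g u\<bar>"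
      by (rule mult_right_mono) simp
    then show ?thesis using r(1)[of n] by (simp add: abs_mult)
  next
    case False then show ?thesis using g0 by simp
  qed
  have hi: "integrable lborel (?h n)" for n
    by (rule Bochner_Integration.integrable_bound[of _ "\<lambda>u. L * \<bar>?g u\<bar>"])
       (use gi hm hb L0 in \<open>auto simp: abs_mult\<close>)
  show "\<bar>d n\<bar> \<le> L * (LINT u|lborel. \<bar>?g u\<bar>)"
  proof -
    have "\<bar>LINT u|lborel. ?h n u\<bar> \<le> (LINT u|lborel. \<bar>?h n u\<bar>)" by (rule integral_abs_bound)
    also have "\<dots> \<le> (LINT u|lborel. L * \<bar>?g u\<bar>)"
      using hi[of n] gi hb by (intro integral_mono integrable_abs integrable_mult_right) auto
    finally show ?thesis by (simp add: d)
  qed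
  assume w: "(w has_derivative w') (at z)"
    and ev: "eventually (\<lambda>n. \<forall>u\<in>cball 0 1. W n (z - r n *\<^sub>R u) = w (z - r n *\<^sub>R u)) sequentially"
  have lim: "(\<lambda>n. ?h n u) \<longlonglongrightarrow> - w' u * ?g u" for u
  proof (cases "u \<in> cball 0 1")
    case True
    have "((\<lambda>s. w (z + s *\<^sub>R (- u))) has_real_derivative w' (- u)) (at 0)"
      by (rule has_derivative_imp_directional[OF w])
    then have "((\<lambda>s. (w (z + s *\<^sub>R (- u)) - w z) / s) \<longlongrightarrow> w' (- u)) (at 0)" by (simp add: DERIV_def)
    moreover have "filterlim r (at 0) sequentially"
      using r by (auto simp: filterlim_at intro!: always_eventually) (metis less_irrefl)
    ultimately have "(\<lambda>n. (w (z + r n *\<^sub>R (- u)) - w z) / r n) \<longlonglongrightarrow> w' (- u)"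
      by (rule filterlim_compose)
    then have "(\<lambda>n. inverse (r n) * (w (z - r n *\<^sub>R u) - w z)) \<longlonglongrightarrow> - w' u"
      using linear_neg[OF has_derivative_linear[OF w]] by (simp add: divide_inverse mult.commute)
    then have "(\<lambda>n. inverse (r n) * (W n (z - r n *\<^sub>R u) - W n z)) \<longlonglongrightarrow> - w' u"
    proof (rule Lim_transform_eventually)
      show "eventually (\<lambda>n. inverse (r n) * (w (z - r n *\<^sub>R u) - w z) = inverse (r n) * (W n (z - r n *\<^sub>R u) - W n z)) sequentially"
        using ev
      proof eventually_elim
        case (elim n)
        have "W n (z - r n *\<^sub>R 0) = w (z - r n *\<^sub>R 0)" by (rule bspec[OF elim]) simp
        then show ?case using bspec[OF elim True] by simp
      qed
    qed
    then show ?thesis by (intro tendsto_mult tendsto_const)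
  next
    case False then show ?thesis using g0 by simp
  qed
  obtain K where K: "K-lipschitz_on UNIV w'"
    using bounded_linear.lipschitz_boundE[OF has_derivative_bounded_linear[OF w]] by blast
  have wc: "continuous_on UNIV w'" by (rule lipschitz_on_continuous_on[OF K])
  have w'd: "((\<lambda>s. w' (u + s *\<^sub>R b)) has_real_derivative w' b) (at 0)" for u
    by (rule has_derivative_imp_directional[OF bounded_linear_imp_has_derivative[OF has_derivative_bounded_linear[OF w]]])
  have "d \<longlonglongrightarrow> (LINT u|lborel. - w' u * ?g u)"
    unfolding d
  proof (rule integral_dominated_convergence[where w="\<lambda>u. L * \<bar>?g u\<bar>"])
    show "(\<lambda>u. - w' u * ?g u) \<in> borel_measurable lborel"
      unfolding measurable_lborel2
      by (intro borel_measurable_continuous_onI continuous_on_mult continuous_on_minus wc gc)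
  qed (use gi hm hb lim in auto)
  moreover have "(LINT u|lborel. - w' u * ?g u) = w' b"
  proof -
    \<comment> \<open>On any ball larger than the unit ball \<rho> is a test function. Since
      \<open>w'\<close> is linear, its directional derivative is the constant
      \<open>w' b\<close>.\<close>
    let ?S = "ball (0::'a) 2"
    have sub: "cball (0::'a) 1 \<subseteq> ?S" by auto
    have t: "test_function ?S \<rho>"
      unfolding test_function_def using \<rho> sub by (intro conjI exI[of _ "cball 0 1"]) auto
    have "(LINT u:?S|lborel. w' u * ?g u) = - (LINT u:?S|lborel. \<rho> u * dird w' b u)"
      by (rule lipschitz_integration_by_parts[OF K _ _ _ t b]) (auto intro: w'd)
    also have "(LINT u:?S|lborel. w' u * ?g u) = (LINT u|lborel. w' u * ?g u)"
      unfolding set_lebesgue_integral_def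
      by (intro Bochner_Integration.integral_cong refl) (use g0 sub in \<open>auto simp: indicator_def subset_iff\<close>)
    also have "(LINT u:?S|lborel. \<rho> u * dird w' b u) = (LINT u|lborel. \<rho> u * w' b)"
      unfolding set_lebesgue_integral_def dird_eq[OF w'd]
      by (intro Bochner_Integration.integral_cong refl) (use \<rho>(2) sub in \<open>auto simp: indicator_def subset_iff\<close>)
    finally show ?thesis using \<rho>(3) by simp
  qed
  ultimately show "d \<longlonglongrightarrow> w' b" by simp
qed

lemma open_cylinder: "open \<Omega> \<Longrightarrow> open (cylinder \<Omega> T)"
  by (simp add: cylinder_def open_Times)

lemma bounded_cylinder: "bounded \<Omega> \<Longrightarrow> bounded (cylinder \<Omega> T)"
  by (simp add: cylinder_def bounded_Times)

text \<open>
  Clamping \<open>w\<close> between \<open>\<plusminus>2L (dist(x, \<partial>\<Omega>) - 1/n)\<close> makes it vanish near \<open>\<Sigma>\<close> without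
  changing it where \<open>dist(x, \<partial>\<Omega>) \<ge> 2/n\<close> and with Lipschitz constants bounded in \<open>n\<close>.
\<close>

lemma lipschitz_H10_0:
  fixes w :: "'d::finite spacetime \<Rightarrow> real"
  assumes \<Omega>: "open \<Omega>" "bounded \<Omega>" and w: "L-lipschitz_on UNIV w"
    and zero: "\<And>x t. x \<notin> \<Omega> \<Longrightarrow> w (x, t) = 0"
    and d: "AE z in lborel. z \<in> cylinder \<Omega> T \<longrightarrow> w differentiable (at z)"
  shows "w \<in> H10_0 \<Omega> T"
proof -
  let ?Q = "cylinder \<Omega> T" and ?d = "\<lambda>z::'d spacetime. infdist (fst z) (- \<Omega>)"
  note Q = open_cylinder[OF \<Omega>(1)] bounded_cylinder[OF \<Omega>(2)]
  have Qb: "?Q \<in> sets borel" using Q by simp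
  \<comment> \<open>The distance to the empty set is 0 by convention, so the complement has to be
    non-empty for \<open>?d\<close> to measure anything; boundedness of \<Omega> ensures it.\<close>
  have ne: "- \<Omega> \<noteq> {}" using \<Omega>(2) by (metis Compl_empty_eq double_compl not_bounded_UNIV)
  \<comment> \<open>By \<open>wd\<close> below, |w| is at most L times the distance d to the
    complement of \<Omega>. With slope 2 L, the clamp bound 2 L (d - a) reaches L d as soon as d is
    at least 2 a.\<close>
  define M where "M n z = 2 * L * max 0 (?d z - inverse (real (Suc n)))" for n z
  define W where "W n z = max (- M n z) (min (M n z) (w z))" for n z
  \<comment> \<open>Half the width of the strip where \<open>W n\<close> vanishes: mollification
    with this radius leaves a strip of width \<open>r n\<close> in which the approximant still
    vanishes.\<close>
  define r where "r n = inverse (real (Suc n)) / 2" for n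
  have L: "L \<ge> 0" by (rule lipschitz_on_nonneg[OF w])
  have r: "r n > 0" "r n \<le> 1 / 2" "inverse (real (Suc n)) = 2 * r n" for n
    by (auto simp: r_def inverse_le_1_iff)
  have r0: "r \<longlonglongrightarrow> 0"
    unfolding r_def[abs_def] using tendsto_divide[OF LIMSEQ_inverse_real_of_nat tendsto_const[of 2]] by simp
  have dd: "\<bar>?d z - ?d z'\<bar> \<le> dist z z'" for z z' :: "'d spacetime"
    using infdist_triangle_abs[of "fst z" "- \<Omega>" "fst z'"] dist_fst_le[of z z'] by linarith
  have M0: "M n z \<ge> 0" for n z using L by (simp add: M_def)
  have wdiff: "\<bar>w z - w z'\<bar> \<le> L * dist z z'" for z z'
    using lipschitz_onD[OF w, of z z'] by (simp add: dist_real_def)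
  have Wdiff: "\<bar>W n z - W n z'\<bar> \<le> 2 * L * dist z z'" for n z z'
    unfolding W_def
  proof (rule clamp_bound)
    show "\<bar>w z - w z'\<bar> \<le> 2 * L * dist z z'"
      using wdiff[of z z'] mult_nonneg_nonneg[OF L zero_le_dist[of z z']] by linarith
    have "\<bar>max 0 (?d z - inverse (real (Suc n))) - max 0 (?d z' - inverse (real (Suc n)))\<bar> \<le> dist z z'"
      using dd[of z z'] by linarith
    then have "2 * L * \<bar>max 0 (?d z - inverse (real (Suc n))) - max 0 (?d z' - inverse (real (Suc n)))\<bar> \<le> 2 * L * dist z z'"
      using L by (intro mult_left_mono) auto
    then show "\<bar>M n z - M n z'\<bar> \<le> 2 * L * dist z z'"
      unfolding M_def right_diff_distrib[symmetric] abs_mult using L by simp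
  qed
  have WL: "(2 * L)-lipschitz_on UNIV (W n)" for n
    by (rule lipschitz_onI) (use Wdiff L in \<open>auto simp: dist_real_def\<close>)
  \<comment> \<open>Compare with the nearest point of the complement at the same time, where
    \<open>w\<close> vanishes.\<close>
  have wd: "\<bar>w z\<bar> \<le> L * ?d z" for z
  proof -
    obtain y where y: "y \<in> - \<Omega>" "?d z = dist (fst z) y"
      using infdist_attains_inf[of "- \<Omega>" "fst z"] \<Omega>(1) ne by auto
    have "w (y, snd z) = 0" using y(1) zero by simp
    moreover have "dist z (y, snd z) = dist (fst z) y" by (simp add: dist_prod_def)
    ultimately show ?thesis using wdiff[of z "(y, snd z)"] y(2) by simp
  qed
  have Wle: "\<bar>W n z\<bar> \<le> \<bar>w z\<bar>" for n z using M0[of n z] unfolding W_def by (auto simp: max_def min_def)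
  have Weq: "W n z = w z" if "2 * inverse (real (Suc n)) \<le> ?d z" for n z
  proof -
    have aux: "2 * a \<le> x \<Longrightarrow> x \<le> 2 * (x - a)" for a x :: real by simp
    have "L * ?d z \<le> L * (2 * (?d z - inverse (real (Suc n))))"
      by (rule mult_left_mono[OF aux[OF that] L])
    also have "\<dots> = 2 * L * (?d z - inverse (real (Suc n)))" by (simp only: ac_simps)
    also have "\<dots> \<le> M n z" unfolding M_def using L by (intro mult_left_mono) auto
    finally have "L * ?d z \<le> M n z" .
    with wd[of z] show ?thesis unfolding W_def by linarith
  qed
  have W0: "W n z = 0" if "?d z \<le> inverse (real (Suc n))" for n z
    using that by (simp add: W_def M_def max_def min_def)
  obtain B where B: "\<And>z. z \<in> ?Q \<Longrightarrow> norm z \<le> B" using Q(2) unfolding bounded_iff by blast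
  \<comment> \<open>One box contains the balls of radius \<open>r n\<close> around all points of the
    cylinder, so a single domain of integration serves every \<open>n\<close> and
    \<open>z\<close>.\<close>
  obtain a where a: "cball (0::'d spacetime) (B + 1) \<subseteq> cbox (- a) a"
    using bounded_subset_cbox_symmetric[OF bounded_cball] by blast
  have box: "cball z (r n) \<subseteq> cbox (- a) a" if "z \<in> ?Q" for z n
  proof -
    have "cball z (r n) \<subseteq> cball 0 (B + 1)"
      using B[OF that] r(2)[of n] by (intro cball_subset_cball_iff[THEN iffD2]) simp
    with a show ?thesis by blast
  qed
  obtain \<rho> :: "'d spacetime \<Rightarrow> real" where \<rho>: "smooth \<rho>" "\<And>z. z \<notin> cball 0 1 \<Longrightarrow> \<rho> z = 0" "(LINT z|lborel. \<rho> z) = 1"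
    using mollifier_exists by blast
  let ?N = "DIM('d spacetime)"
  define c where "c n = r n ^ ?N" for n
  have c: "c n > 0" for n using r(1) by (simp add: c_def)
  let ?\<rho> = "\<lambda>n v. \<rho> (inverse (r n) *\<^sub>R v)"
  \<comment> \<open>Integration over a fixed box makes the approximant smooth on all of space-time;
    only at points of the cylinder is it identified with the full convolution.\<close>
  define \<phi> where "\<phi> n z = inverse (c n) * integral (cbox (- a) a) (\<lambda>y. W n y * ?\<rho> n (z - y))" for n z
  have Wc: "continuous_on UNIV (W n)" for n by (rule lipschitz_on_continuous_on[OF WL])
  have \<rho>s: "smooth (?\<rho> n)" for n by (rule smooth_compose_scale[OF \<rho>(1)])
  have \<rho>d: "frechet_derivative (?\<rho> n) (at v) = (\<lambda>b. inverse (r n) * frechet_derivative \<rho> (at (inverse (r n) *\<^sub>R v)) b)" for n v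
  proof (rule frechet_derivative_eqI)
    have \<rho>': "(\<rho> has_derivative frechet_derivative \<rho> (at (inverse (r n) *\<^sub>R v))) (at (inverse (r n) *\<^sub>R v))"
      by (rule differentiable_has_frechet[OF smooth_differentiable[OF \<rho>(1)]])
    have "(?\<rho> n has_derivative (\<lambda>b. frechet_derivative \<rho> (at (inverse (r n) *\<^sub>R v)) (inverse (r n) *\<^sub>R b))) (at v)"
      by (rule has_derivative_compose[where f="\<lambda>v. inverse (r n) *\<^sub>R v" and f'="\<lambda>v. inverse (r n) *\<^sub>R v", OF _ \<rho>'])
         (auto intro!: derivative_eq_intros)
    then show "(?\<rho> n has_derivative (\<lambda>b. inverse (r n) * frechet_derivative \<rho> (at (inverse (r n) *\<^sub>R v)) b)) (at v)"
      by (simp only: linear_cmul[OF has_derivative_linear[OF \<rho>']] real_scaleR_def)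
  qed
  have \<phi>s: "smooth (\<phi> n)" for n
    unfolding \<phi>_def[abs_def] by (intro smooth_mult smooth_const smooth_convolution Wc \<rho>s)
  have \<phi>d: "frechet_derivative (\<phi> n) (at z) b = inverse (c n) *
      integral (cbox (- a) a) (\<lambda>y. W n y * (inverse (r n) * frechet_derivative \<rho> (at (inverse (r n) *\<^sub>R (z - y))) b))" for n z b
  proof -
    have "(\<phi> n has_derivative (\<lambda>b. inverse (c n) *
      integral (cbox (- a) a) (\<lambda>y. W n y * frechet_derivative (?\<rho> n) (at (z - y)) b))) (at z)"
      unfolding \<phi>_def[abs_def] by (intro has_derivative_mult_right has_derivative_convolution Wc \<rho>s)
    from frechet_derivative_eqI[OF this] show ?thesis by (simp add: \<rho>d)
  qed
  have \<phi>eq: "\<phi> n z = (LINT u|lborel. W n (z - r n *\<^sub>R u) * \<rho> u)" if "z \<in> ?Q" for n z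
  proof -
    have "integral (cbox (- a) a) (\<lambda>y. W n y * ?\<rho> n (z - y)) = c n * (LINT u|lborel. W n (z - r n *\<^sub>R u) * \<rho> u)"
      unfolding c_def
      by (rule integral_scaled_convolution[OF Wc smooth_continuous_on[OF \<rho>(1)] \<rho>(2) r(1) box[OF that]])
    then show ?thesis unfolding \<phi>_def using c[of n] by simp
  qed
  have \<phi>deq: "frechet_derivative (\<phi> n) (at z) b =
      inverse (r n) * (LINT u|lborel. W n (z - r n *\<^sub>R u) * frechet_derivative \<rho> (at u) b)" if "z \<in> ?Q" "b \<in> Basis" for n z b
  proof -
    have g0: "frechet_derivative \<rho> (at u) b = 0" if "u \<notin> cball 0 1" for u
      using frechet_derivative_outside(2)[OF closed_cball[of 0 1] \<rho>(2) that] by simp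
    have "integral (cbox (- a) a) (\<lambda>y. W n y * (inverse (r n) * frechet_derivative \<rho> (at (inverse (r n) *\<^sub>R (z - y))) b)) =
        inverse (r n) * integral (cbox (- a) a) (\<lambda>y. W n y * frechet_derivative \<rho> (at (inverse (r n) *\<^sub>R (z - y))) b)"
      by (subst mult.left_commute) (rule Henstock_Kurzweil_Integration.integral_mult_right)
    also have "integral (cbox (- a) a) (\<lambda>y. W n y * frechet_derivative \<rho> (at (inverse (r n) *\<^sub>R (z - y))) b) =
        c n * (LINT u|lborel. W n (z - r n *\<^sub>R u) * frechet_derivative \<rho> (at u) b)"
      unfolding c_def
      by (rule integral_scaled_convolution[OF Wc smooth_continuous_on[OF smooth_partial[OF \<rho>(1) that(2)]] g0 r(1) box[OF that(1)]])
    finally show ?thesis unfolding \<phi>d using c[of n] by simp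
  qed
  have supp: "compact {x. r n \<le> infdist x (- \<Omega>)}" "{x. r n \<le> infdist x (- \<Omega>)} \<subseteq> \<Omega>"
    "x \<notin> {x. r n \<le> infdist x (- \<Omega>)} \<Longrightarrow> \<phi> n (x, t) = 0" for n x t
  proof -
    show s: "{x. r n \<le> infdist x (- \<Omega>)} \<subseteq> \<Omega>"
    proof
      fix x assume "x \<in> {x. r n \<le> infdist x (- \<Omega>)}"
      then show "x \<in> \<Omega>" using r(1)[of n] infdist_zero[of x "- \<Omega>"] by fastforce
    qed
    have "closed {x. r n \<le> infdist x (- \<Omega>)}" by (intro closed_Collect_le continuous_intros)
    then show "compact {x. r n \<le> infdist x (- \<Omega>)}"
      using bounded_subset[OF \<Omega>(2) s] by (simp add: compact_eq_bounded_closed)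
    assume x: "x \<notin> {x. r n \<le> infdist x (- \<Omega>)}"
    have "W n y * ?\<rho> n ((x, t) - y) = 0" for y
    proof (cases "inverse (r n) *\<^sub>R ((x, t) - y) \<in> cball 0 1")
      case True
      then have "inverse (r n) * norm ((x, t) - y) \<le> 1" using r(1)[of n] by simp
      then have "r n * (inverse (r n) * norm ((x, t) - y)) \<le> r n * 1" using r(1)[of n] by (intro mult_left_mono) auto
      also have "r n * (inverse (r n) * norm ((x, t) - y)) = dist (x, t) y" using r(1)[of n] by (simp add: dist_norm)
      finally have "dist (x, t) y \<le> r n" by simp
      then have "?d y \<le> inverse (real (Suc n))" using dd[of "(x, t)" y] x r(3)[of n] by simp
      then show ?thesis using W0 by simp
    next
      case False then show ?thesis using \<rho>(2) by simp
    qed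
    then have "(\<lambda>y. W n y * ?\<rho> n ((x, t) - y)) = (\<lambda>y. 0)" by (rule ext)
    then show "\<phi> n (x, t) = 0" unfolding \<phi>_def by simp
  qed
  have dpos: "?d z > 0" if "z \<in> ?Q" for z
  proof -
    have "fst z \<notin> - \<Omega>" using that by (auto simp: cylinder_def)
    then have "?d z \<noteq> 0" using in_closed_iff_infdist_zero[OF closed_Compl[OF \<Omega>(1)] ne] by blast
    then show ?thesis using infdist_nonneg[of "fst z" "- \<Omega>"] by linarith
  qed
  have ev: "eventually (\<lambda>n. \<forall>u\<in>cball 0 1. W n (z - r n *\<^sub>R u) = w (z - r n *\<^sub>R u)) sequentially" if "z \<in> ?Q" for z
  proof -
    \<comment> \<open>\<open>W n\<close> and \<open>w\<close> agree at distance at least 4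
      \<open>r n\<close> from the complement of \<Omega>, and the shift by
      \<open>r n *\<^sub>R u\<close> can cost another \<open>r n\<close>; hence the divisor
      5.\<close>
    have "eventually (\<lambda>n. r n < ?d z / 5) sequentially"
      using order_tendstoD(2)[OF r0, of "?d z / 5"] dpos[OF that] by simp
    then show ?thesis
    proof eventually_elim
      case (elim n)
      show ?case
      proof
        fix u :: "'d spacetime" assume "u \<in> cball 0 1"
        then have "r n * norm u \<le> r n * 1" using r(1)[of n] by (intro mult_left_mono) auto
        then have "dist z (z - r n *\<^sub>R u) \<le> r n" using r(1)[of n] by (simp add: dist_norm)
        then have "?d (z - r n *\<^sub>R u) \<ge> 2 * inverse (real (Suc n))"
          using dd[of z "z - r n *\<^sub>R u"] elim unfolding r(3) by linarith
        then show "W n (z - r n *\<^sub>R u) = w (z - r n *\<^sub>R u)" by (rule Weq)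
      qed
    qed
  qed
  have evz: "eventually (\<lambda>n. W n z = w z) sequentially" if "z \<in> ?Q" for z
    using ev[OF that] by eventually_elim (auto dest: bspec[of _ _ 0])
  define R where "R = (LINT u|lborel. \<bar>\<rho> u\<bar>)"
  have \<phi>W: "\<bar>\<phi> n z - W n z\<bar> \<le> 2 * L * r n * R" if "z \<in> ?Q" for n z
  proof -
    have \<rho>c: "continuous_on UNIV \<rho>" by (rule smooth_continuous_on[OF \<rho>(1)])
    have \<rho>i: "integrable lborel \<rho>" by (rule integrable_continuous_compact_support[OF \<rho>c compact_cball[of 0 1] \<rho>(2)])
    have Wc': "continuous_on UNIV (\<lambda>u. W n (z - r n *\<^sub>R u))"
      by (intro continuous_on_compose2[OF Wc] continuous_on_diff continuous_on_scaleR continuous_on_const continuous_on_id subset_UNIV)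
    have i: "integrable lborel (\<lambda>u. W n (z - r n *\<^sub>R u) * \<rho> u)"
      by (rule integrable_continuous_compact_support[OF continuous_on_mult[OF Wc' \<rho>c] compact_cball[of 0 1]]) (simp add: \<rho>(2))
    have "\<phi> n z - W n z = (LINT u|lborel. W n (z - r n *\<^sub>R u) * \<rho> u) - (LINT u|lborel. W n z * \<rho> u)"
      using \<rho>(3) by (simp add: \<phi>eq[OF that])
    also have "\<dots> = (LINT u|lborel. W n (z - r n *\<^sub>R u) * \<rho> u - W n z * \<rho> u)"
      using i \<rho>i by (intro Bochner_Integration.integral_diff[symmetric]) auto
    finally have eq: "\<phi> n z - W n z = (LINT u|lborel. W n (z - r n *\<^sub>R u) * \<rho> u - W n z * \<rho> u)" .
    have "\<bar>\<phi> n z - W n z\<bar> \<le> (LINT u|lborel. \<bar>W n (z - r n *\<^sub>R u) * \<rho> u - W n z * \<rho> u\<bar>)"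
      unfolding eq by (rule integral_abs_bound)
    also have "\<dots> \<le> (LINT u|lborel. 2 * L * r n * \<bar>\<rho> u\<bar>)"
    proof (rule integral_mono)
      fix u
      show "\<bar>W n (z - r n *\<^sub>R u) * \<rho> u - W n z * \<rho> u\<bar> \<le> 2 * L * r n * \<bar>\<rho> u\<bar>"
      proof (cases "u \<in> cball 0 1")
        case True
        have "\<bar>W n (z - r n *\<^sub>R u) - W n z\<bar> \<le> 2 * L * (r n * norm u)"
          using Wdiff[of n "z - r n *\<^sub>R u" z] r(1)[of n] by (simp add: dist_norm)
        also have "\<dots> \<le> 2 * L * (r n * 1)"
          using True L r(1)[of n] by (intro mult_left_mono) auto
        finally have "\<bar>W n (z - r n *\<^sub>R u) - W n z\<bar> * \<bar>\<rho> u\<bar> \<le> 2 * L * (r n * 1) * \<bar>\<rho> u\<bar>"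
          by (rule mult_right_mono) simp
        then show ?thesis by (simp add: abs_mult[symmetric] left_diff_distrib mult.assoc)
      next
        case False then show ?thesis using \<rho>(2) by simp
      qed
    qed (use i \<rho>i in auto)
    finally show ?thesis by (simp add: R_def)
  qed
  obtain Bw where Bw: "\<And>z. z \<in> closure ?Q \<Longrightarrow> norm (w z) \<le> Bw"
    using bounded_on_compact[OF continuous_on_subset[OF lipschitz_on_continuous_on[OF w] subset_UNIV]
        compact_closure[THEN iffD2, OF Q(2)]] by blast
  have R0: "R \<ge> 0" by (simp add: R_def)
  have conv0: "(\<lambda>n. L2_norm_on ?Q (\<lambda>z. w z - \<phi> n z)) \<longlonglongrightarrow> 0"
  proof (rule L2_norm_on_tendsto_0[OF Qb Q(2)])
    show "(\<lambda>z. w z - \<phi> n z) \<in> borel_measurable borel" for n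
      by (intro borel_measurable_diff lipschitz_measurable[OF w] borel_measurable_continuous_onI smooth_continuous_on \<phi>s)
    show "AE z in lborel. z \<in> ?Q \<longrightarrow> norm (w z - \<phi> n z) \<le> 2 * Bw + 2 * L * R" for n
    proof (intro AE_I2 impI)
      fix z assume z: "z \<in> ?Q"
      have "\<bar>w z\<bar> \<le> Bw" using Bw[of z] z closure_subset by auto
      moreover have "\<bar>W n z\<bar> \<le> Bw" using Wle[of n z] calculation by simp
      moreover have "2 * L * r n * R \<le> 2 * L * 1 * R"
        using r(2)[of n] L R0 by (intro mult_right_mono mult_left_mono) auto
      ultimately show "norm (w z - \<phi> n z) \<le> 2 * Bw + 2 * L * R" using \<phi>W[OF z, of n] by simp
    qed
    show "AE z in lborel. z \<in> ?Q \<longrightarrow> (\<lambda>n. w z - \<phi> n z) \<longlonglongrightarrow> 0"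
    proof (intro AE_I2 impI)
      fix z assume z: "z \<in> ?Q"
      have "(\<lambda>n. 2 * L * r n * R) \<longlonglongrightarrow> 2 * L * 0 * R" by (intro tendsto_mult tendsto_const r0)
      then have lim0: "(\<lambda>n. 2 * L * r n * R) \<longlonglongrightarrow> 0" by simp
      have "(\<lambda>n. W n z - \<phi> n z) \<longlonglongrightarrow> 0"
      proof (rule Lim_null_comparison[OF always_eventually lim0], rule allI)
        show "norm (W n z - \<phi> n z) \<le> 2 * L * r n * R" for n
          using \<phi>W[OF z, of n] by (simp add: abs_minus_commute)
      qed
      then show "(\<lambda>n. w z - \<phi> n z) \<longlonglongrightarrow> 0"
      proof (rule Lim_transform_eventually)
        show "eventually (\<lambda>n. W n z - \<phi> n z = w z - \<phi> n z) sequentially"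
          using evz[OF z] by eventually_elim simp
      qed
    qed
  qed
  define D where "D b = (LINT u|lborel. \<bar>frechet_derivative \<rho> (at u) b\<bar>)" for b
  let ?e = "\<lambda>i::'d. (axis i 1, 0) :: 'd spacetime"
  have grad: "\<bar>frechet_derivative (\<phi> n) (at z) (?e i)\<bar> \<le> 2 * L * D (?e i)" if "z \<in> ?Q" for n z i
    unfolding D_def
    by (rule mollified_derivative_tendsto(1)[OF \<rho> spatial_Basis(1) WL r(1) r0 \<phi>deq[OF that spatial_Basis(1), symmetric]])
  have gradlim: "(\<lambda>n. frechet_derivative (\<phi> n) (at z) (?e i)) \<longlonglongrightarrow> frechet_derivative w (at z) (?e i)"
    if "z \<in> ?Q" "w differentiable (at z)" for z i
    by (rule mollified_derivative_tendsto(2)[OF \<rho> spatial_Basis(1) WL r(1) r0 \<phi>deq[OF that(1) spatial_Basis(1), symmetric]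
        differentiable_has_frechet[OF that(2)] ev[OF that(1)]])
  note G = lipschitz_has_weak_grad_x[OF w Q d]
  have conv1: "(\<lambda>n. L2_norm_on ?Q (\<lambda>z. dirgrad w z - grad_x (\<phi> n) z)) \<longlonglongrightarrow> 0"
  proof (rule L2_norm_on_tendsto_0[OF Qb Q(2)])
    have "dirgrad w = (\<lambda>z. \<Sum>i\<in>UNIV. dird w (?e i) z *\<^sub>R axis i 1)"
      by (intro ext) (simp add: dirgrad_def vec_eq_iff axis_def if_distrib cong: if_cong)
    then have "dirgrad w \<in> borel_measurable borel"
      by (simp only:) (intro borel_measurable_sum borel_measurable_scaleR borel_measurable_const
          borel_measurable_dird lipschitz_on_continuous_on[OF w])
    then show "(\<lambda>z. dirgrad w z - grad_x (\<phi> n) z) \<in> borel_measurable borel" for n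
      by (rule borel_measurable_diff) (rule borel_measurable_continuous_onI[OF continuous_on_grad_x[OF \<phi>s]])
    show "AE z in lborel. z \<in> ?Q \<longrightarrow> norm (dirgrad w z - grad_x (\<phi> n) z) \<le> (\<Sum>i\<in>UNIV. L + 2 * L * D (?e i))" for n
      using d
    proof eventually_elim
      case (elim z)
      show ?case
      proof
        assume z: "z \<in> ?Q"
        then have wz: "w differentiable (at z)" using elim by blast
        have "norm (dirgrad w z - grad_x (\<phi> n) z) \<le> (\<Sum>i\<in>UNIV. \<bar>(dirgrad w z - grad_x (\<phi> n) z) $ i\<bar>)" by (rule norm_le_l1_cart)
        also have "\<dots> \<le> (\<Sum>i\<in>UNIV. L + 2 * L * D (?e i))"
        proof (rule sum_mono)
          fix i
          have "\<bar>dird w (?e i) z\<bar> \<le> L * norm (?e i)"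
            by (rule dird_bound[OF w has_derivative_imp_directional[OF differentiable_has_frechet[OF wz]]])
          also have "norm (?e i) = 1" by (simp add: norm_Pair)
          finally show "\<bar>(dirgrad w z - grad_x (\<phi> n) z) $ i\<bar> \<le> L + 2 * L * D (?e i)"
            using grad[OF z, of n i] by (simp add: dirgrad_def grad_x_def)
        qed
        finally show "norm (dirgrad w z - grad_x (\<phi> n) z) \<le> (\<Sum>i\<in>UNIV. L + 2 * L * D (?e i))" .
      qed
    qed
    show "AE z in lborel. z \<in> ?Q \<longrightarrow> (\<lambda>n. dirgrad w z - grad_x (\<phi> n) z) \<longlonglongrightarrow> 0"
      using d
    proof eventually_elim
      case (elim z)
      show ?case
      proof
        assume z: "z \<in> ?Q"
        then have wz: "w differentiable (at z)" using elim by blast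
        have "(\<lambda>n. dirgrad w z - grad_x (\<phi> n) z) \<longlonglongrightarrow> dirgrad w z - grad_x w z"
          unfolding grad_x_def by (intro tendsto_diff tendsto_const tendsto_vec_lambda gradlim z wz)
        then show "(\<lambda>n. dirgrad w z - grad_x (\<phi> n) z) \<longlonglongrightarrow> 0" by (simp add: dirgrad_differentiable[OF wz])
      qed
    qed
  qed
  have "L2_norm_on ?Q (\<lambda>z. weak_grad_x ?Q w z - grad_x (\<phi> n) z) = L2_norm_on ?Q (\<lambda>z. dirgrad w z - grad_x (\<phi> n) z)" for n
    by (rule L2_norm_on_cong_AE) (use weak_grad_x_AE[OF Q G] in eventually_elim, simp)
  with conv1 have conv2: "(\<lambda>n. L2_norm_on ?Q (\<lambda>z. weak_grad_x ?Q w z - grad_x (\<phi> n) z)) \<longlonglongrightarrow> 0" by simp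
  have cs: "\<exists>C. compact C \<and> C \<subseteq> \<Omega> \<and> (\<forall>x t. x \<notin> C \<longrightarrow> \<phi> n (x, t) = 0)" for n
    by (intro exI[of _ "{x. r n \<le> infdist x (- \<Omega>)}"] conjI allI impI supp(1) supp(2) supp(3))
  show ?thesis
    unfolding H10_0_def mem_Collect_eq
  proof (intro conjI exI[of _ \<phi>] allI)
    show "\<exists>G. has_weak_grad_x ?Q w G" using G by blast
  qed (fact \<phi>s cs conv0 conv2)+
qed

subsection \<open>Time traces\<close>

lemma AE_real_obtain:
  fixes a b :: real
  assumes "AE t in lborel. P t" "a < b" obtains t where "a < t" "t < b" "P t"
proof -
  have "\<exists>t. a < t \<and> t < b \<and> P t"
  proof (rule ccontr)
    assume "\<not> ?thesis"
    then have "AE t in lborel. t \<notin> {a<..<b}" using assms(1) by (auto elim: eventually_mono)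
    then have "{a<..<b} \<in> null_sets lborel" by (subst AE_iff_null_sets) auto
    then have "emeasure lborel {a<..<b} = 0" by (rule null_setsD1)
    then show False using assms(2) by simp
  qed
  then show ?thesis using that by blast
qed

lemma L2_norm_on_less_iff:
  assumes "e > 0" shows "L2_norm_on S f < ennreal e \<longleftrightarrow> L2_sq S f < ennreal (e\<^sup>2)"
proof (cases "L2_sq S f")
  case (real r)
  have "ennreal (sqrt r) < ennreal e \<longleftrightarrow> ennreal r < ennreal (e\<^sup>2)"
    using real(1) assms real_sqrt_less_iff[of r "e\<^sup>2"] by (simp add: ennreal_less_iff)
  then show ?thesis using real by (simp add: L2_norm_on_def sqrt_ennreal_def)
next
  case top
  then show ?thesis by (simp add: L2_norm_on_def sqrt_ennreal_def)
qed

lemma L2_sq_indicator: "L2_sq S f = (\<integral>\<^sup>+z. ennreal ((norm (indicator S z *\<^sub>R f z))\<^sup>2) \<partial>lborel)"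
  unfolding L2_sq_def by (intro nn_integral_cong) (auto split: split_indicator)

lemma sq_add_scaled_le: "(a + c * b)\<^sup>2 \<le> 2 * a\<^sup>2 + 2 * c\<^sup>2 * b\<^sup>2" for a b c :: real
  using sum_squares_bound[of a "c * b"] unfolding power2_sum power_mult_distrib by linarith

lemma L2_sq_add_scaled_le:
  fixes f g :: "'a::euclidean_space \<Rightarrow> real"
  assumes "set_borel_measurable lborel S f" "set_borel_measurable lborel S g" "S \<in> sets borel"
  shows "L2_sq S (\<lambda>z. f z + c * g z) \<le> 2 * L2_sq S f + ennreal (2 * c\<^sup>2) * L2_sq S g"
proof -
  let ?f = "\<lambda>z. indicator S z *\<^sub>R f z" and ?g = "\<lambda>z. indicator S z *\<^sub>R g z"
  have m: "?f \<in> borel_measurable lborel" "?g \<in> borel_measurable lborel"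
    using assms by (simp_all add: set_borel_measurable_def)
  have e: "L2_sq S h = (\<integral>\<^sup>+z. ennreal ((indicator S z *\<^sub>R h z)\<^sup>2) \<partial>lborel)" for h :: "'a \<Rightarrow> real"
    unfolding L2_sq_def by (intro nn_integral_cong) (auto split: split_indicator)
  have "L2_sq S (\<lambda>z. f z + c * g z) \<le> (\<integral>\<^sup>+z. 2 * ennreal ((?f z)\<^sup>2) + ennreal (2 * c\<^sup>2) * ennreal ((?g z)\<^sup>2) \<partial>lborel)"
    unfolding e
  proof (rule nn_integral_mono)
    fix z
    have "(?f z + c * ?g z)\<^sup>2 \<le> 2 * (?f z)\<^sup>2 + 2 * c\<^sup>2 * (?g z)\<^sup>2"
      by (rule sq_add_scaled_le)
    then have "ennreal ((?f z + c * ?g z)\<^sup>2) \<le> ennreal (2 * (?f z)\<^sup>2 + 2 * c\<^sup>2 * (?g z)\<^sup>2)" by (rule ennreal_leI)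
    also have "\<dots> = 2 * ennreal ((?f z)\<^sup>2) + ennreal (2 * c\<^sup>2) * ennreal ((?g z)\<^sup>2)"
      by (simp add: ennreal_plus ennreal_mult)
    finally show "ennreal ((indicator S z *\<^sub>R (f z + c * g z))\<^sup>2) \<le> 2 * ennreal ((?f z)\<^sup>2) + ennreal (2 * c\<^sup>2) * ennreal ((?g z)\<^sup>2)"
      by (simp add: algebra_simps)
  qed
  also have "\<dots> = 2 * L2_sq S f + ennreal (2 * c\<^sup>2) * L2_sq S g"
    unfolding e using m by (subst nn_integral_add) (auto simp: nn_integral_cmult)
  finally show ?thesis .
qed

lemma slice_measurable:
  fixes w :: "'d::finite spacetime \<Rightarrow> real"
  assumes "set_borel_measurable lborel (cylinder \<Omega> T) w" "0 < t" "t < T"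
  shows "set_borel_measurable lborel \<Omega> (\<lambda>x. w (x, t))"
proof -
  have "(\<lambda>z. indicator (cylinder \<Omega> T) z *\<^sub>R w z) \<in> borel_measurable borel"
    using assms(1) by (simp add: set_borel_measurable_def)
  moreover have "(\<lambda>x. (x, t)) \<in> borel \<rightarrow>\<^sub>M borel"
    by (intro borel_measurable_continuous_onI continuous_intros)
  ultimately have "(\<lambda>x. indicator (cylinder \<Omega> T) (x, t) *\<^sub>R w (x, t)) \<in> borel_measurable borel"
    by (rule measurable_compose[rotated])
  moreover have "(\<lambda>x. indicator (cylinder \<Omega> T) (x, t) *\<^sub>R w (x, t)) = (\<lambda>x. indicator \<Omega> x *\<^sub>R w (x, t))"
    using assms(2,3) by (auto simp: cylinder_def indicator_def)
  ultimately show ?thesis by (simp add: set_borel_measurable_def)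
qed

lemma set_borel_measurable_add_scaled:
  fixes f g :: "'a::euclidean_space \<Rightarrow> real"
  assumes "set_borel_measurable lborel S f" "set_borel_measurable lborel S g"
  shows "set_borel_measurable lborel S (\<lambda>z. f z + c * g z)"
proof -
  have "(\<lambda>z. indicator S z *\<^sub>R f z + c * (indicator S z *\<^sub>R g z)) \<in> borel_measurable lborel"
    using assms unfolding set_borel_measurable_def by (intro borel_measurable_add borel_measurable_times) auto
  then show ?thesis by (simp add: set_borel_measurable_def algebra_simps)
qed

lemma L2_on_set_measurable: "L2_on S f \<Longrightarrow> set_borel_measurable lborel S f"
  by (simp add: L2_on_def)

lemma has_time_trace_add_scaled:
  fixes w1 w2 :: "'d::finite spacetime \<Rightarrow> real"
  assumes \<Omega>: "open \<Omega>" and w: "has_time_trace \<Omega> T w1 s g1" "has_time_trace \<Omega> T w2 s g2"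
    and m: "set_borel_measurable lborel (cylinder \<Omega> T) w1" "set_borel_measurable lborel (cylinder \<Omega> T) w2"
  shows "has_time_trace \<Omega> T (\<lambda>z. w1 z + c * w2 z) s (\<lambda>x. g1 x + c * g2 x)"
  unfolding has_time_trace_def
proof (intro conjI allI impI)
  have g: "L2_on \<Omega> g1" "L2_on \<Omega> g2" using w unfolding has_time_trace_def by blast+
  show "L2_on \<Omega> (\<lambda>x. g1 x + c * g2 x)" by (intro L2_on_add L2_on_mult g)
  fix e :: real assume e: "e > 0"
  \<comment> \<open>With k = |c| + 1, \<open>L2_sq_add_scaled_le\<close> yields the bound 2 (1 +
    c^2) e'^2, which is at most 2 k^2 e'^2 = e^2 / 2.\<close>
  define e' where "e' = e / (2 * (\<bar>c\<bar> + 1))"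
  have e': "e' > 0" using e by (simp add: e'_def)
  have bound: "2 * e'\<^sup>2 + 2 * c\<^sup>2 * e'\<^sup>2 < e\<^sup>2"
  proof -
    define k E where "k = \<bar>c\<bar> + 1" and "E = e'\<^sup>2"
    have "k > 0" by (simp add: k_def)
    then have "e = 2 * k * e'" unfolding e'_def k_def[symmetric] by simp
    then have eE: "e\<^sup>2 = 4 * (k\<^sup>2 * E)" by (simp add: power_mult_distrib E_def)
    have "1 + c\<^sup>2 \<le> k\<^sup>2" by (simp add: k_def power2_sum)
    then have "(1 + c\<^sup>2) * E \<le> k\<^sup>2 * E" by (rule mult_right_mono) (simp add: E_def)
    moreover have "0 < k\<^sup>2 * E" using \<open>k > 0\<close> e' by (simp add: E_def)
    moreover have "2 * E + 2 * c\<^sup>2 * E = 2 * ((1 + c\<^sup>2) * E)" by (simp add: distrib_right)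
    ultimately show ?thesis unfolding eE E_def[symmetric] by linarith
  qed
  obtain d1 where d1: "d1 > 0" "AE t in lborel. 0 < t \<and> t < T \<and> \<bar>t - s\<bar> < d1 \<longrightarrow>
      L2_norm_on \<Omega> (\<lambda>x. w1 (x, t) - g1 x) < ennreal e'"
    using w(1) e' unfolding has_time_trace_def by blast
  obtain d2 where d2: "d2 > 0" "AE t in lborel. 0 < t \<and> t < T \<and> \<bar>t - s\<bar> < d2 \<longrightarrow>
      L2_norm_on \<Omega> (\<lambda>x. w2 (x, t) - g2 x) < ennreal e'"
    using w(2) e' unfolding has_time_trace_def by blast
  show "\<exists>\<delta>>0. AE t in lborel. 0 < t \<and> t < T \<and> \<bar>t - s\<bar> < \<delta> \<longrightarrow>
      L2_norm_on \<Omega> (\<lambda>x. w1 (x, t) + c * w2 (x, t) - (g1 x + c * g2 x)) < ennreal e"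
  proof (intro exI[of _ "min d1 d2"] conjI)
    show "min d1 d2 > 0" using d1 d2 by simp
    show "AE t in lborel. 0 < t \<and> t < T \<and> \<bar>t - s\<bar> < min d1 d2 \<longrightarrow>
      L2_norm_on \<Omega> (\<lambda>x. w1 (x, t) + c * w2 (x, t) - (g1 x + c * g2 x)) < ennreal e"
      using d1(2) d2(2)
    proof eventually_elim
      case (elim t)
      show ?case
      proof
        assume t: "0 < t \<and> t < T \<and> \<bar>t - s\<bar> < min d1 d2"
        let ?f = "\<lambda>x. w1 (x, t) - g1 x" and ?g = "\<lambda>x. w2 (x, t) - g2 x"
        have fg: "L2_sq \<Omega> ?f < ennreal (e'\<^sup>2)" "L2_sq \<Omega> ?g < ennreal (e'\<^sup>2)"
          using elim t by (simp_all add: L2_norm_on_less_iff[OF e'])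
        have "set_borel_measurable lborel \<Omega> (\<lambda>x. w1 (x, t) + (- 1) * g1 x)"
          "set_borel_measurable lborel \<Omega> (\<lambda>x. w2 (x, t) + (- 1) * g2 x)"
          using t by (intro set_borel_measurable_add_scaled slice_measurable[OF m(1)] slice_measurable[OF m(2)]
              L2_on_set_measurable g; simp)+
        then have mm: "set_borel_measurable lborel \<Omega> ?f" "set_borel_measurable lborel \<Omega> ?g" by simp_all
        have "L2_sq \<Omega> (\<lambda>x. ?f x + c * ?g x) \<le> 2 * L2_sq \<Omega> ?f + ennreal (2 * c\<^sup>2) * L2_sq \<Omega> ?g"
          by (rule L2_sq_add_scaled_le[OF mm]) (use \<Omega> in simp)
        also have "\<dots> \<le> 2 * ennreal (e'\<^sup>2) + ennreal (2 * c\<^sup>2) * ennreal (e'\<^sup>2)"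
          using fg by (intro add_mono mult_left_mono) auto
        also have "\<dots> = ennreal (2 * e'\<^sup>2 + 2 * c\<^sup>2 * e'\<^sup>2)"
          by (simp add: ennreal_plus ennreal_mult)
        also have "\<dots> < ennreal (e\<^sup>2)" by (rule ennreal_lessI[OF _ bound]) (use e in simp)
        also have "(\<lambda>x. ?f x + c * ?g x) = (\<lambda>x. w1 (x, t) + c * w2 (x, t) - (g1 x + c * g2 x))"
          by (simp add: fun_eq_iff algebra_simps)
        finally show "L2_norm_on \<Omega> (\<lambda>x. w1 (x, t) + c * w2 (x, t) - (g1 x + c * g2 x)) < ennreal e"
          by (simp add: L2_norm_on_less_iff[OF e])
      qed
    qed
  qed
qed

text \<open>Subtracting \<open>w\<close> from itself shows that g1 - g2 is a trace of the zero
  function, so its norm lies below every positive bound.\<close>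

lemma has_time_trace_unique:
  fixes w :: "'d::finite spacetime \<Rightarrow> real"
  assumes \<Omega>: "open \<Omega>" and T: "T > 0" and s: "0 \<le> s" "s \<le> T"
    and w: "has_time_trace \<Omega> T w s g1" "has_time_trace \<Omega> T w s g2"
    and m: "set_borel_measurable lborel (cylinder \<Omega> T) w"
  shows "AE x in lborel. x \<in> \<Omega> \<longrightarrow> g1 x = g2 x"
proof -
  have "has_time_trace \<Omega> T (\<lambda>z. w z + (- 1) * w z) s (\<lambda>x. g1 x + (- 1) * g2 x)"
    by (rule has_time_trace_add_scaled[OF \<Omega> w m m])
  then have tr: "has_time_trace \<Omega> T (\<lambda>z. 0) s (\<lambda>x. g1 x - g2 x)" by simp
  then have L: "L2_on \<Omega> (\<lambda>x. g1 x - g2 x)" unfolding has_time_trace_def by blast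
  have "L2_sq \<Omega> (\<lambda>x. g1 x - g2 x) \<le> 0"
  proof (rule ennreal_le_epsilon)
    fix e :: real assume e: "e > 0"
    obtain d where d: "d > 0" "AE t in lborel. 0 < t \<and> t < T \<and> \<bar>t - s\<bar> < d \<longrightarrow>
        L2_norm_on \<Omega> (\<lambda>x. 0 - (g1 x - g2 x)) < ennreal (sqrt e)"
    proof -
      have "sqrt e > 0" using e by simp
      with tr show ?thesis using that unfolding has_time_trace_def by blast
    qed
    \<comment> \<open>This interval is non-empty also for s = 0 and s = T. One admissible instant
      suffices, because the norm in question does not depend on t.\<close>
    obtain t where "max 0 (s - d) < t" "t < min T (s + d)" "0 < t \<and> t < T \<and> \<bar>t - s\<bar> < d \<longrightarrow>
        L2_norm_on \<Omega> (\<lambda>x. 0 - (g1 x - g2 x)) < ennreal (sqrt e)"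
      using AE_real_obtain[OF d(2), of "max 0 (s - d)" "min T (s + d)"] T s d(1) by auto
    then have "L2_norm_on \<Omega> (\<lambda>x. 0 - (g1 x - g2 x)) < ennreal (sqrt e)" by auto
    then have "L2_sq \<Omega> (\<lambda>x. 0 - (g1 x - g2 x)) < ennreal e"
      using L2_norm_on_less_iff[of "sqrt e" \<Omega> "\<lambda>x. 0 - (g1 x - g2 x)"] e by simp
    also have "L2_sq \<Omega> (\<lambda>x. 0 - (g1 x - g2 x)) = L2_sq \<Omega> (\<lambda>x. g1 x - g2 x)"
      unfolding L2_sq_def by (simp add: power2_commute)
    finally show "L2_sq \<Omega> (\<lambda>x. g1 x - g2 x) \<le> 0 + ennreal e" by simp
  qed
  then have "(\<integral>\<^sup>+x. ennreal ((norm (indicator \<Omega> x *\<^sub>R (g1 x - g2 x)))\<^sup>2) \<partial>lborel) = 0"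
    unfolding L2_sq_indicator[symmetric] by simp
  moreover have "(\<lambda>x. ennreal ((norm (indicator \<Omega> x *\<^sub>R (g1 x - g2 x)))\<^sup>2)) \<in> borel_measurable lborel"
    unfolding measurable_lborel2 by (rule measurable_compose[OF L2_on_measurable[OF L]]) measurable
  ultimately have "AE x in lborel. ennreal ((norm (indicator \<Omega> x *\<^sub>R (g1 x - g2 x)))\<^sup>2) = 0"
    by (subst (asm) nn_integral_0_iff_AE)
  then show ?thesis by eventually_elim (auto simp: indicator_def)
qed

lemma time_trace: "has_time_trace \<Omega> T w s g \<Longrightarrow> has_time_trace \<Omega> T w s (time_trace \<Omega> T w s)"
  unfolding time_trace_def by (rule someI[of "has_time_trace \<Omega> T w s"])

lemma time_trace_AE:
  assumes "open \<Omega>" "T > 0" "0 \<le> s" "s \<le> T" "has_time_trace \<Omega> T w s g"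
    "set_borel_measurable lborel (cylinder \<Omega> T) w"
  shows "AE x in lborel. x \<in> \<Omega> \<longrightarrow> time_trace \<Omega> T w s x = g x"
  using has_time_trace_unique[OF assms(1-4) time_trace[OF assms(5)] assms(5,6)] .

lemma has_time_trace_cong:
  assumes "\<And>z. z \<in> cylinder \<Omega> T \<Longrightarrow> v z = w z"
  shows "has_time_trace \<Omega> T v s = has_time_trace \<Omega> T w s"
proof -
  have "L2_norm_on \<Omega> (\<lambda>x. v (x, t) - g x) = L2_norm_on \<Omega> (\<lambda>x. w (x, t) - g x)" if "0 < t" "t < T" for t g
    using assms that by (intro L2_norm_on_cong_AE) (auto simp: cylinder_def)
  then have *: "(0 < t \<and> t < T \<and> \<bar>t - s\<bar> < \<delta> \<longrightarrow> L2_norm_on \<Omega> (\<lambda>x. v (x, t) - g x) < ennreal e) =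
      (0 < t \<and> t < T \<and> \<bar>t - s\<bar> < \<delta> \<longrightarrow> L2_norm_on \<Omega> (\<lambda>x. w (x, t) - g x) < ennreal e)" for t g \<delta> e
    by (cases "0 < t \<and> t < T") auto
  show ?thesis by (rule ext) (simp only: has_time_trace_def *)
qed

lemma lipschitz_has_time_trace:
  fixes w :: "'d::finite spacetime \<Rightarrow> real"
  assumes \<Omega>: "open \<Omega>" "bounded \<Omega>" and w: "L-lipschitz_on UNIV w"
  shows "has_time_trace \<Omega> T w s (\<lambda>x. w (x, s))"
  unfolding has_time_trace_def
proof (intro conjI allI impI)
  have "continuous_on UNIV (\<lambda>x. w (x, s))"
    by (intro continuous_on_compose2[OF lipschitz_on_continuous_on[OF w]] continuous_on_Pair
        continuous_on_id continuous_on_const subset_UNIV)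
  then show "L2_on \<Omega> (\<lambda>x. w (x, s))" using \<Omega> by (intro continuous_L2_on) auto
  fix e :: real assume e: "e > 0"
  have L: "L \<ge> 0" by (rule lipschitz_on_nonneg[OF w])
  define m where "m = measure lborel \<Omega>"
  have fin: "emeasure lborel \<Omega> = ennreal m"
    unfolding m_def using emeasure_bounded_finite[OF \<Omega>(2)] by (simp add: emeasure_eq_ennreal_measure top.not_eq_extremum)
  have m0: "m \<ge> 0" by (simp add: m_def)
  \<comment> \<open>This majorizes L times the square root of the measure of \<Omega>; adding 1 to
    either factor keeps the divisor of e positive.\<close>
  define q where "q = (L + 1) * (sqrt m + 1)"
  define \<delta> where "\<delta> = e / q"
  have pos: "q > 0" unfolding q_def using L m0 by (intro mult_pos_pos add_nonneg_pos) auto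
  show "\<exists>\<delta>>0. AE t in lborel. 0 < t \<and> t < T \<and> \<bar>t - s\<bar> < \<delta> \<longrightarrow>
      L2_norm_on \<Omega> (\<lambda>x. w (x, t) - w (x, s)) < ennreal e"
  proof (intro exI[of _ \<delta>] conjI AE_I2 impI)
    show "\<delta> > 0" using e pos by (simp add: \<delta>_def)
    fix t assume t: "0 < t \<and> t < T \<and> \<bar>t - s\<bar> < \<delta>"
    have "L2_sq \<Omega> (\<lambda>x. w (x, t) - w (x, s)) \<le> (\<integral>\<^sup>+x. ennreal ((L * \<bar>t - s\<bar>)\<^sup>2) * indicator \<Omega> x \<partial>lborel)"
      unfolding L2_sq_def
    proof (intro nn_integral_mono mult_right_mono ennreal_leI power_mono)
      fix x
      show "norm (w (x, t) - w (x, s)) \<le> L * \<bar>t - s\<bar>"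
        using lipschitz_onD[OF w, of "(x, t)" "(x, s)"] by (simp add: dist_prod_def dist_real_def)
    qed auto
    also have "\<dots> = ennreal ((L * \<bar>t - s\<bar>)\<^sup>2) * ennreal m"
      using \<Omega>(1) by (simp add: nn_integral_cmult_indicator fin)
    also have "\<dots> = ennreal ((L * \<bar>t - s\<bar> * sqrt m)\<^sup>2)"
      using m0 by (simp add: ennreal_mult[symmetric] power_mult_distrib)
    also have "\<dots> < ennreal (e\<^sup>2)"
    proof -
      have "L * \<bar>t - s\<bar> * sqrt m \<le> (L + 1) * \<bar>t - s\<bar> * (sqrt m + 1)"
        using L m0 by (intro mult_mono) auto
      also have "\<dots> = \<bar>t - s\<bar> * q" by (simp add: q_def)
      also have "\<dots> < \<delta> * q" using t pos by (intro mult_strict_right_mono) auto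
      also have "\<dots> = e" using pos by (simp add: \<delta>_def)
      finally have "L * \<bar>t - s\<bar> * sqrt m < e" .
      then have "(L * \<bar>t - s\<bar> * sqrt m)\<^sup>2 < e\<^sup>2" by (rule power_strict_mono) (use L m0 in auto)
      then show ?thesis by (rule ennreal_lessI[rotated]) (use e in simp)
    qed
    finally show "L2_norm_on \<Omega> (\<lambda>x. w (x, t) - w (x, s)) < ennreal e" by (simp add: L2_norm_on_less_iff[OF e])
  qed
qed

subsection \<open>Lipschitz domains and simplicial meshes\<close>

text \<open>Near a frontier point the domain is the strict epigraph of a continuous function, so a
  small step against the direction \<open>e\<close> leads to an open set disjoint from
  \<open>S\<close>. A frontier point therefore cannot be interior to the closure.\<close>

lemma interior_closure_lipschitz_domain:
  fixes S :: "'a::euclidean_space set"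
  assumes "lipschitz_domain S" shows "interior (closure S) = S"
proof
  have S: "open S" using assms unfolding lipschitz_domain_def by blast
  show "S \<subseteq> interior (closure S)" by (rule interior_maximal[OF closure_subset S])
  show "interior (closure S) \<subseteq> S"
  proof (rule subsetI, rule ccontr)
    fix p assume p: "p \<in> interior (closure S)" "p \<notin> S"
    then have "p \<in> frontier S" using interior_subset[of "closure S"] S by (auto simp: frontier_def interior_open)
    then obtain e r L and g :: "'a \<Rightarrow> real" where e: "norm e = 1" and r: "r > 0" and g: "L-lipschitz_on UNIV g"
      and graph: "\<forall>x\<in>ball p r. x \<in> S \<longleftrightarrow> g (x - (x \<bullet> e) *\<^sub>R e) < x \<bullet> e"
      using assms unfolding lipschitz_domain_def by blast
    obtain r' where r': "r' > 0" "ball p r' \<subseteq> interior (closure S)"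
      using p(1) open_interior open_contains_ball by blast
    define s where "s = min r r' / 2"
    have s: "s > 0" "s < r" "s < r'" using r r'(1) by (auto simp: s_def)
    define q where "q = p - s *\<^sub>R e"
    have ee: "e \<bullet> e = 1" using e by (simp add: norm_eq_1)
    have qe: "q \<bullet> e = p \<bullet> e - s" by (simp add: q_def inner_diff_left ee)
    have qg: "q - (q \<bullet> e) *\<^sub>R e = p - (p \<bullet> e) *\<^sub>R e" unfolding qe by (simp add: q_def algebra_simps)
    have dq: "dist p q = s" using s(1) e by (simp add: q_def dist_norm)
    have "\<not> g (p - (p \<bullet> e) *\<^sub>R e) < p \<bullet> e" using graph p(2) r by auto
    then have hq: "g (q - (q \<bullet> e) *\<^sub>R e) > q \<bullet> e" using s(1) qe unfolding qg by linarith
    let ?U = "{x. x \<bullet> e < g (x - (x \<bullet> e) *\<^sub>R e)} \<inter> ball p r"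
    have "continuous_on UNIV (\<lambda>x. g (x - (x \<bullet> e) *\<^sub>R e))"
      by (rule continuous_on_compose2[OF lipschitz_on_continuous_on[OF g]]) (auto intro!: continuous_intros)
    then have U: "open ?U" by (intro open_Int open_Collect_less open_ball) (auto intro!: continuous_intros)
    have "q \<in> ?U" using hq dq s(2) by simp
    moreover have "q \<in> ball p r'" using dq s(3) by simp
    then have "q \<in> closure S" using r'(2) interior_subset[of "closure S"] by blast
    ultimately have "?U \<inter> S \<noteq> {}" using open_Int_closure_eq_empty[OF U, of S] by blast
    then show False using graph by force
  qed
qed

lemma reference_simplex_compact_convex:
  "compact (reference_simplex :: 'a::euclidean_space set)" "convex (reference_simplex :: 'a set)"
  unfolding reference_simplex_def by (auto intro: finite_imp_compact_convex_hull)

context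
  fixes Q :: "'d::finite spacetime set" and \<sigma> \<T> X
  assumes mesh: "simplicial_mesh Q \<sigma> \<T> X"
begin

lemma mesh_finite: "finite \<T>"
  using mesh[unfolded simplicial_mesh_def triangulation_def] by (elim conjE)

lemma mesh_closure: "closure Q = \<Union>\<T>"
  using mesh[unfolded simplicial_mesh_def triangulation_def] by (elim conjE)

lemma mesh_face: "K \<in> \<T> \<Longrightarrow> K' \<in> \<T> \<Longrightarrow> (K \<inter> K') face_of K"
  using mesh[unfolded simplicial_mesh_def triangulation_def] by (elim conjE) simp

lemma mesh_element:
  assumes "K \<in> \<T>"
  shows "int DIM('d spacetime) simplex K"
    and "\<exists>z r. r > 0 \<and> cball z r \<subseteq> K \<and> diameter K \<le> \<sigma> * r"
    and "\<exists>A b. linear A \<and> X K = (\<lambda>\<xi>. A \<xi> + b)" and "X K ` reference_simplex = K"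
proof -
  have "\<forall>K\<in>\<T>. int DIM('d spacetime) simplex K \<and>
        (\<exists>z r. r > 0 \<and> cball z r \<subseteq> K \<and> diameter K \<le> \<sigma> * r) \<and>
        (\<exists>A b. linear A \<and> X K = (\<lambda>\<xi>. A \<xi> + b)) \<and> X K ` reference_simplex = K"
    using mesh[unfolded simplicial_mesh_def] by (elim conjE)
  from bspec[OF this assms] show "int DIM('d spacetime) simplex K"
    "\<exists>z r. r > 0 \<and> cball z r \<subseteq> K \<and> diameter K \<le> \<sigma> * r"
    "\<exists>A b. linear A \<and> X K = (\<lambda>\<xi>. A \<xi> + b)" "X K ` reference_simplex = K"
    by simp_all
qed

lemma mesh_compact_convex:
  assumes "K \<in> \<T>" shows "compact K" "convex K"
proof -
  obtain C where "finite C" "K = convex hull C" using mesh_element(1)[OF assms] unfolding simplex by blast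
  then show "compact K" "convex K" by (auto intro: finite_imp_compact_convex_hull)
qed

lemma mesh_ball:
  assumes "K \<in> \<T>" obtains z r where "r > 0" "cball z r \<subseteq> K"
  using mesh_element(2)[OF assms] by blast

lemma mesh_interior_nonempty: assumes "K \<in> \<T>" shows "interior K \<noteq> {}"
proof -
  obtain z r where r: "r > 0" "cball z r \<subseteq> K" by (rule mesh_ball[OF assms])
  have "ball z r \<subseteq> interior K"
    by (rule interior_maximal[OF subset_trans[OF ball_subset_cball r(2)] open_ball])
  then show ?thesis using r(1) centre_in_ball by blast
qed

lemma mesh_diameter_pos: assumes "K \<in> \<T>" shows "diameter K > 0"
proof -
  obtain z r where r: "r > 0" "cball z r \<subseteq> K" by (rule mesh_ball[OF assms])
  obtain b :: "'d spacetime" where b: "b \<in> Basis" using nonempty_Basis by blast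
  have "z \<in> K" "z + r *\<^sub>R b \<in> K" using r b by (auto intro!: subsetD[OF r(2)] simp: dist_norm)
  then have "dist z (z + r *\<^sub>R b) \<le> diameter K"
    using diameter_bounded_bound[OF compact_imp_bounded[OF mesh_compact_convex(1)[OF assms]]] by blast
  then show ?thesis using r b by (simp add: dist_norm)
qed

text \<open>A proper face of \<open>K\<close> misses the interior of \<open>K\<close>. If the common
  face is all of \<open>K\<close>, then it is a proper face of \<open>K'\<close> and misses the
  interior of \<open>K'\<close>, which contains that of \<open>K\<close>; the latter is then
  empty.\<close>

lemma mesh_interior_disjoint:
  assumes K: "K \<in> \<T>" "K' \<in> \<T>" "K \<noteq> K'" shows "K' \<inter> interior K = {}"
proof (cases "K \<inter> K' = K")
  case False
  then have "K \<inter> K' \<inter> interior K = {}" by (rule face_of_disjoint_interior[OF mesh_face[OF K(1,2)]])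
  then show ?thesis using interior_subset[of K] by blast
next
  case True
  have "K' \<inter> K \<noteq> K'" using True K(3) by blast
  then have "K' \<inter> K \<inter> interior K' = {}" by (rule face_of_disjoint_interior[OF mesh_face[OF K(2,1)]])
  then have "K \<inter> interior K' = {}" using True by blast
  moreover have "interior K \<subseteq> interior K'" using True by (intro interior_mono) blast
  ultimately have "interior K = {}" using interior_subset[of K] by blast
  then show ?thesis by simp
qed

lemma mesh_bounded_interior: "K \<in> \<T> \<Longrightarrow> bounded (interior K)"
  using bounded_subset[OF compact_imp_bounded[OF mesh_compact_convex(1)] interior_subset] .

text \<open>Frontiers of convex sets are negligible, and there are finitely many elements.\<close>

lemma mesh_AE: "AE z in lborel. z \<in> closure Q \<longrightarrow> z \<in> (\<Union>K\<in>\<T>. interior K)"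
proof -
  have "negligible (\<Union>K\<in>\<T>. frontier K)"
    by (intro negligible_Union finite_imageI mesh_finite)
       (auto intro: negligible_convex_frontier mesh_compact_convex(2))
  moreover have "closed (\<Union>K\<in>\<T>. frontier K)" using mesh_finite by (intro closed_UN) auto
  ultimately have "(\<Union>K\<in>\<T>. frontier K) \<in> null_sets lborel"
    by (simp add: negligible_iff_null_sets null_sets_completion_iff)
  then show ?thesis
  proof (rule AE_I')
    show "{z \<in> space lborel. \<not> (z \<in> closure Q \<longrightarrow> z \<in> (\<Union>K\<in>\<T>. interior K))} \<subseteq> (\<Union>K\<in>\<T>. frontier K)"
    proof
      fix z assume "z \<in> {z \<in> space lborel. \<not> (z \<in> closure Q \<longrightarrow> z \<in> (\<Union>K\<in>\<T>. interior K))}"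
      then obtain K where "K \<in> \<T>" "z \<in> K" "z \<notin> interior K" unfolding mesh_closure by auto
      then show "z \<in> (\<Union>K\<in>\<T>. frontier K)" using closure_subset[of K] by (auto simp: frontier_def)
    qed
  qed
qed

lemma mesh_set_integral:
  fixes h :: "'d spacetime \<Rightarrow> real"
  assumes Q: "\<And>K. K \<in> \<T> \<Longrightarrow> interior K \<subseteq> Q" and h: "set_integrable lborel Q h"
  shows "(LINT z:Q|lborel. h z) = (\<Sum>K\<in>\<T>. LINT z:interior K|lborel. h z)"
proof -
  have hK: "set_integrable lborel (interior K) h" if "K \<in> \<T>" for K
    by (rule set_integrable_subset[OF h _ Q[OF that]]) simp
  have "AE z in lborel. indicator Q z *\<^sub>R h z = (\<Sum>K\<in>\<T>. indicator (interior K) z *\<^sub>R h z)"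
    using mesh_AE
  proof eventually_elim
    case (elim z)
    show ?case
    proof (cases "\<exists>K\<in>\<T>. z \<in> interior K")
      case True
      then obtain K where K: "K \<in> \<T>" "z \<in> interior K" by blast
      have "indicator (interior K') z *\<^sub>R h z = (if K' = K then h z else 0)" if "K' \<in> \<T>" for K'
        using mesh_interior_disjoint[OF K(1) that] K(2) interior_subset[of K'] by (auto simp: indicator_def)
      then have "(\<Sum>K'\<in>\<T>. indicator (interior K') z *\<^sub>R h z) = (\<Sum>K'\<in>\<T>. if K' = K then h z else 0)"
        by (intro sum.cong) auto
      also have "\<dots> = h z" using K(1) mesh_finite by simp
      finally show ?thesis using subsetD[OF Q[OF K(1)] K(2)] by simp
    next
      case False
      then have "z \<notin> Q" using elim closure_subset[of Q] by blast
      moreover have "(\<Sum>K\<in>\<T>. indicator (interior K) z *\<^sub>R h z) = 0"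
        using False by (intro sum.neutral ballI) auto
      ultimately show ?thesis by simp
    qed
  qed
  then have "(LINT z:Q|lborel. h z) = (LINT z|lborel. (\<Sum>K\<in>\<T>. indicator (interior K) z *\<^sub>R h z))"
    unfolding set_lebesgue_integral_def
    using h hK by (intro integral_cong_AE borel_measurable_sum) (auto simp: set_integrable_def)
  also have "\<dots> = (\<Sum>K\<in>\<T>. LINT z:interior K|lborel. h z)"
    unfolding set_lebesgue_integral_def
    using hK by (intro Bochner_Integration.integral_sum) (auto simp: set_integrable_def)
  finally show ?thesis .
qed

text \<open>An interior point of \<open>K\<close> lies in the closure of some subdomain, which is a
  union of elements. No element other than \<open>K\<close> contains the point, so \<open>K\<close>
  is among them; passing to interiors then uses that a Lipschitz domain is the interior of its
  closure.\<close>

lemma mesh_interior_subset_subdomain: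
  assumes dec: "decomposition_of Q m Qs" and al: "aligned_with \<T> m Qs" and K: "K \<in> \<T>"
  obtains i where "i \<in> {1..m}" "interior K \<subseteq> Qs i"
proof -
  obtain z where z: "z \<in> interior K" using mesh_interior_nonempty[OF K] by blast
  then have "z \<in> closure Q" using K interior_subset[of K] unfolding mesh_closure by blast
  then obtain i where i: "i \<in> {1..m}" "z \<in> closure (Qs i)"
    using dec unfolding decomposition_of_def by blast
  obtain S where S: "S \<subseteq> \<T>" "closure (Qs i) = \<Union>S" using al i(1) unfolding aligned_with_def by blast
  then obtain K' where K': "K' \<in> S" "z \<in> K'" using i(2) by blast
  then have "K' = K" using mesh_interior_disjoint[OF K, of K'] S(1) z by blast
  then have "K \<subseteq> closure (Qs i)" using K'(1) S(2) by blast
  then have "interior K \<subseteq> interior (closure (Qs i))" by (rule interior_mono)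
  also have "\<dots> = Qs i"
    using dec i(1) unfolding decomposition_of_def by (intro interior_closure_lipschitz_domain) blast
  finally show ?thesis using that i(1) by blast
qed

end

lemma closure_cylinder: "T > 0 \<Longrightarrow> closure (cylinder \<Omega> T) = closure \<Omega> \<times> {0..T}"
  by (simp add: cylinder_def closure_Times)

lemma mesh_interior_subset_cylinder:
  assumes mesh: "simplicial_mesh (cylinder \<Omega> T) \<sigma> \<T> X" and \<Omega>: "lipschitz_domain \<Omega>" and T: "T > 0" and K: "K \<in> \<T>"
  shows "interior K \<subseteq> cylinder \<Omega> T"
proof -
  have "K \<subseteq> closure \<Omega> \<times> {0..T}" using mesh_closure[OF mesh] K closure_cylinder[OF T] by blast
  then have "interior K \<subseteq> interior (closure \<Omega> \<times> {0..T})" by (rule interior_mono)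
  also have "\<dots> = cylinder \<Omega> T"
    by (simp add: interior_Times interior_closure_lipschitz_domain[OF \<Omega>] cylinder_def)
  finally show ?thesis .
qed

subsection \<open>The finite element space\<close>

lemma smooth_sum: "finite I \<Longrightarrow> (\<And>i. i \<in> I \<Longrightarrow> smooth (f i)) \<Longrightarrow> smooth (\<lambda>z. \<Sum>i\<in>I. f i z)"
  by (induction I rule: finite_induct) (auto intro: smooth_const smooth_add)

lemma smooth_inner: "smooth (\<lambda>z. z \<bullet> b)"
  unfolding smooth_def
proof
  fix k
  have d: "((\<lambda>z. z \<bullet> b) has_derivative (\<lambda>v. v \<bullet> b)) (at z)" for z :: 'a by (auto intro!: derivative_eq_intros)
  show "C_k k (\<lambda>z::'a. z \<bullet> b)"
  proof (cases k)
    case 0 then show ?thesis by (auto intro!: continuous_intros)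
  next
    case (Suc j)
    then show ?thesis using d by (auto simp: frechet_derivative_eqI[OF d] C_k_const differentiable_def)
  qed
qed

lemma smooth_power: "smooth f \<Longrightarrow> smooth (\<lambda>z. f z ^ n)" for f :: "'a::euclidean_space \<Rightarrow> real"
  by (induction n) (auto intro: smooth_const smooth_mult)

lemma polys_smooth: assumes "P \<in> polys p" shows "smooth P"
proof -
  obtain c where P: "P = (\<lambda>z. \<Sum>\<alpha> | \<alpha> \<in> Basis \<rightarrow>\<^sub>E {..p} \<and> sum \<alpha> Basis \<le> p. c \<alpha> * (\<Prod>b\<in>Basis. (z \<bullet> b) ^ \<alpha> b))"
    using assms unfolding polys_def by blast
  have "finite {\<alpha>. \<alpha> \<in> (Basis :: 'a set) \<rightarrow>\<^sub>E {..p} \<and> sum \<alpha> Basis \<le> p}"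
    by (rule finite_subset[OF _ finite_PiE[of Basis "\<lambda>_. {..p}"]]) auto
  then show ?thesis unfolding P
    by (intro smooth_sum smooth_mult smooth_const smooth_prod smooth_power smooth_inner) auto
qed

lemma polys_add_scaled:
  assumes "P1 \<in> polys p" "P2 \<in> polys p" shows "(\<lambda>z. P1 z + c * P2 z) \<in> polys p"
proof -
  let ?I = "{\<alpha>. \<alpha> \<in> (Basis :: 'a set) \<rightarrow>\<^sub>E {..p} \<and> sum \<alpha> Basis \<le> p}"
  obtain c1 c2 where P: "P1 = (\<lambda>z. \<Sum>\<alpha>\<in>?I. c1 \<alpha> * (\<Prod>b\<in>Basis. (z \<bullet> b) ^ \<alpha> b))"
    "P2 = (\<lambda>z. \<Sum>\<alpha>\<in>?I. c2 \<alpha> * (\<Prod>b\<in>Basis. (z \<bullet> b) ^ \<alpha> b))"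
    using assms unfolding polys_def by blast
  have "(\<lambda>z. P1 z + c * P2 z) = (\<lambda>z. \<Sum>\<alpha>\<in>?I. (c1 \<alpha> + c * c2 \<alpha>) * (\<Prod>b\<in>Basis. (z \<bullet> b) ^ \<alpha> b))"
    unfolding P by (simp add: sum_distrib_left sum.distrib[symmetric] distrib_right mult.assoc)
  then show ?thesis unfolding polys_def by (intro CollectI exI[of _ "\<lambda>\<alpha>. c1 \<alpha> + c * c2 \<alpha>"])
qed

lemma V_0h_add_scaled:
  assumes "u \<in> V_0h \<Omega> T p \<T> X" "v \<in> V_0h \<Omega> T p \<T> X"
  shows "(\<lambda>z. u z + c * v z) \<in> V_0h \<Omega> T p \<T> X"
  unfolding V_0h_def mem_Collect_eq
proof (intro conjI ballI)
  show "continuous_on (closure (cylinder \<Omega> T)) (\<lambda>z. u z + c * v z)"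
    using assms unfolding V_0h_def by (intro continuous_on_add continuous_on_mult continuous_on_const) blast+
  show "u z + c * v z = 0" if "z \<in> closure (frontier \<Omega> \<times> {0<..<T})" for z
    using assms that unfolding V_0h_def by simp
  fix K assume "K \<in> \<T>"
  then obtain P1 P2 where "P1 \<in> polys p" "\<forall>\<xi>\<in>reference_simplex. u (X K \<xi>) = P1 \<xi>"
    "P2 \<in> polys p" "\<forall>\<xi>\<in>reference_simplex. v (X K \<xi>) = P2 \<xi>"
    using assms unfolding V_0h_def by blast
  then show "\<exists>P\<in>polys p. \<forall>\<xi>\<in>reference_simplex. u (X K \<xi>) + c * v (X K \<xi>) = P \<xi>"
    by (intro bexI[of _ "\<lambda>z. P1 z + c * P2 z"] polys_add_scaled) auto
qed

text \<open>The polynomial is pulled back along the inverse of the affine element map. The piece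
  \<open>g\<close> is differentiable on the whole space, so its derivative transfers to
  \<open>v\<close> inside the element; a Lipschitz bound is available on \<open>K\<close> because
  the reference simplex is compact and convex.\<close>

lemma V_0h_piece:
  fixes v :: "'d::finite spacetime \<Rightarrow> real"
  assumes mesh: "simplicial_mesh Q \<sigma> \<T> X" and v: "v \<in> V_0h \<Omega> T p \<T> X" and K: "K \<in> \<T>"
  obtains g L where "\<And>z. g differentiable (at z)" "L-lipschitz_on K g" "\<And>z. z \<in> K \<Longrightarrow> v z = g z"
proof -
  obtain P where P: "P \<in> polys p" "\<And>\<xi>. \<xi> \<in> reference_simplex \<Longrightarrow> v (X K \<xi>) = P \<xi>"
    using v K unfolding V_0h_def by blast
  obtain A b where A: "linear A" "X K = (\<lambda>\<xi>. A \<xi> + b)" and XK: "X K ` reference_simplex = K"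
    using mesh_element(3,4)[OF mesh K] by blast
  \<comment> \<open>\<open>K\<close> contains a ball, so every direction is a multiple of a
    difference of two points of \<open>K\<close>, and such differences lie in the range of
    \<open>A\<close>.\<close>
  have "surj A"
  proof -
    obtain z r where r: "r > 0" "cball z r \<subseteq> K" by (rule mesh_ball[OF mesh K])
    have "y \<in> range A" for y
    proof (cases "y = 0")
      case True then show ?thesis using linear_0[OF A(1)] by (metis rangeI)
    next
      case False
      let ?y = "(r / norm y) *\<^sub>R y"
      have "z \<in> K" "z + ?y \<in> K" using r False by (auto intro!: subsetD[OF r(2)] simp: dist_norm)
      then obtain a1 a2 where "z = A a1 + b" "z + ?y = A a2 + b" 
      proof -
        have "z \<in> X K ` reference_simplex" "z + ?y \<in> X K ` reference_simplex"
          using XK \<open>z \<in> K\<close> \<open>z + ?y \<in> K\<close> by simp_all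
        then show ?thesis using that A(2) by auto
      qed
      then have "A (a2 - a1) = ?y" by (simp add: linear_diff[OF A(1)] algebra_simps)
      then have "A ((norm y / r) *\<^sub>R (a2 - a1)) = (norm y / r) *\<^sub>R ?y" by (simp only: linear_cmul[OF A(1)])
      also have "\<dots> = y" using r False by simp
      finally show ?thesis by (metis rangeI)
    qed
    then show ?thesis by blast
  qed
  then have inj: "inj A" by (rule linear_surjective_imp_injective[OF A(1)]) simp
  then obtain A' where A': "linear A'" "\<And>x. A' (A x) = x"
    using linear_injective_left_inverse[OF A(1)] by (metis comp_apply id_apply)
  define g where "g z = P (A' (z - b))" for z
  have inv: "A' (z - b) \<in> reference_simplex" "v z = g z" if "z \<in> K" for z
  proof -
    have "z \<in> X K ` reference_simplex" using that XK by simp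
    then obtain \<xi> where \<xi>: "\<xi> \<in> reference_simplex" "z = X K \<xi>" by auto
    have "A' (z - b) = \<xi>" using \<xi>(2) A(2) A'(2) by simp
    then show "A' (z - b) \<in> reference_simplex" "v z = g z" using P(2) \<xi> by (simp_all add: g_def)
  qed
  have s: "smooth P" by (rule polys_smooth[OF P(1)])
  have bl: "bounded_linear A'" using A'(1) linear_conv_bounded_linear by blast
  have "(\<lambda>z. A' (z - b)) differentiable (at z)" for z
    using bounded_linear_imp_differentiable[OF bl] differentiable_compose[of A' "\<lambda>z. z - b" z UNIV] by simp
  then have gd: "g differentiable (at z)" for z
    unfolding g_def[abs_def] using differentiable_compose[of P "\<lambda>z. A' (z - b)" z UNIV] smooth_differentiable[OF s] by simp
  obtain B where B: "B \<ge> 0" "\<And>z. z \<in> reference_simplex \<Longrightarrow> norm (Blinfun (frechet_derivative P (at z))) \<le> B"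
    using bounded_on_compact[OF smooth_continuous_derivative[OF s] reference_simplex_compact_convex(1)] by blast
  have Pd: "(P has_derivative frechet_derivative P (at z)) (at z)" for z
    by (rule differentiable_has_frechet[OF smooth_differentiable[OF s]])
  have PL: "B-lipschitz_on reference_simplex P"
  proof (rule bounded_derivative_imp_lipschitz[OF has_derivative_at_withinI[OF Pd] reference_simplex_compact_convex(2)])
    fix z :: "'d spacetime" assume "z \<in> reference_simplex"
    from B(2)[OF this] show "onorm (frechet_derivative P (at z)) \<le> B"
      by (simp add: norm_blinfun.rep_eq bounded_linear_Blinfun_apply[OF has_derivative_bounded_linear[OF Pd]])
  qed (rule B(1))
  obtain M where M: "M-lipschitz_on UNIV A'" using bounded_linear.lipschitz_boundE[OF bl] by blast
  have gl: "(B * M)-lipschitz_on K g"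
  proof (rule lipschitz_onI)
    fix x y assume xy: "x \<in> K" "y \<in> K"
    have "dist (g x) (g y) \<le> B * dist (A' (x - b)) (A' (y - b))"
      unfolding g_def by (rule lipschitz_onD[OF PL inv(1)[OF xy(1)] inv(1)[OF xy(2)]])
    also have "\<dots> \<le> B * (M * dist (x - b) (y - b))"
      using lipschitz_onD[OF M, of "x - b" "y - b"] B(1) by (intro mult_left_mono) auto
    finally show "dist (g x) (g y) \<le> B * M * dist x y" by (simp add: dist_norm)
  qed (use B(1) lipschitz_on_nonneg[OF M] in simp)
  show ?thesis by (rule that[of g "B * M"]) (fact gd gl inv(2))+
qed

text \<open>
  Extension of a finite element function by zero in \<open>x\<close> and by its end values in \<open>t\<close>; it is Lipschitz
  on the whole space because it is so on every element.
\<close>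

definition fe_ext :: "(real ^ 'd) set \<Rightarrow> real \<Rightarrow> ('d::finite spacetime \<Rightarrow> real) \<Rightarrow> 'd spacetime \<Rightarrow> real" where
  "fe_ext \<Omega> T v z = (if fst z \<in> closure \<Omega> then v (fst z, max 0 (min T (snd z))) else 0)"

context
  fixes \<Omega> :: "(real ^ 'd::finite) set" and T \<sigma> :: real and \<T> X p and v :: "'d spacetime \<Rightarrow> real"
  assumes \<Omega>: "lipschitz_domain \<Omega>" and T: "T > 0"
    and mesh: "simplicial_mesh (cylinder \<Omega> T) \<sigma> \<T> X"
    and v: "v \<in> V_0h \<Omega> T p \<T> X"
begin

lemma fe_ext_eq: "z \<in> closure (cylinder \<Omega> T) \<Longrightarrow> fe_ext \<Omega> T v z = v z"
  using T by (cases z) (auto simp: closure_cylinder fe_ext_def max_def min_def)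

lemma fe_ext_eq_cylinder: "z \<in> cylinder \<Omega> T \<Longrightarrow> fe_ext \<Omega> T v z = v z"
  using fe_ext_eq closure_subset[of "cylinder \<Omega> T"] by blast

text \<open>The clamped time lies in [0, T], so a frontier point of \<Omega> is taken into the
  closure of the open lateral boundary, where \<open>v\<close> vanishes also at the end
  times.\<close>

lemma fe_ext_outside: "x \<notin> \<Omega> \<Longrightarrow> fe_ext \<Omega> T v (x, t) = 0"
proof (cases "x \<in> closure \<Omega>")
  case True
  assume "x \<notin> \<Omega>"
  then have "x \<in> frontier \<Omega>" using True \<Omega> by (simp add: frontier_def lipschitz_domain_def interior_open)
  moreover have "max 0 (min T t) \<in> {0..T}" using T by auto
  ultimately have "(x, max 0 (min T t)) \<in> closure (frontier \<Omega> \<times> {0<..<T})"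
    using T by (simp add: closure_Times)
  then show ?thesis using v True by (simp add: V_0h_def fe_ext_def)
qed (simp add: fe_ext_def)

text \<open>In the interior of an element the extension coincides with a differentiable piece, and
  the remaining points of the cylinder form a null set.\<close>

lemma fe_ext_differentiable: "AE z in lborel. z \<in> cylinder \<Omega> T \<longrightarrow> fe_ext \<Omega> T v differentiable (at z)"
  using mesh_AE[OF mesh]
proof eventually_elim
  case (elim z)
  show ?case
  proof
    assume "z \<in> cylinder \<Omega> T"
    then have "z \<in> closure (cylinder \<Omega> T)" using closure_subset[of "cylinder \<Omega> T"] by blast
    then obtain K where K: "K \<in> \<T>" "z \<in> interior K" using elim by blast
    obtain g L where g: "\<And>z. g differentiable (at z)" "\<And>z. z \<in> K \<Longrightarrow> v z = g z"
      using V_0h_piece[OF mesh v K(1)] by metis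
    have "g z = fe_ext \<Omega> T v z" if "z \<in> interior K" for z
    proof -
      have "z \<in> closure (cylinder \<Omega> T)" "z \<in> K"
        using that interior_subset[of K] K(1) unfolding mesh_closure[OF mesh] by blast+
      then show ?thesis using g(2) fe_ext_eq by simp
    qed
    then show "fe_ext \<Omega> T v differentiable (at z)"
      using has_derivative_transform_within_open[OF differentiable_has_frechet[OF g(1)] open_interior K(2),
          THEN differentiableI] by blast
  qed
qed

text \<open>A segment between two points may leave the domain or cross many elements. The preimages
  of the elements and of the complement of \<Omega> on the segment form a finite closed cover of
  [0, 1], and a common constant on all pieces, the sum of the element constants, carries over to the
  whole segment.\<close>

lemma fe_ext_lipschitz: obtains L where "L-lipschitz_on UNIV (fe_ext \<Omega> T v)"
proof -
  let ?w = "fe_ext \<Omega> T v"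
  have "\<exists>L. L-lipschitz_on K v" if K: "K \<in> \<T>" for K
  proof -
    obtain g L where g: "L-lipschitz_on K g" "\<And>z. z \<in> K \<Longrightarrow> v z = g z"
      using V_0h_piece[OF mesh v K] by metis
    have "L-lipschitz_on K v" using lipschitz_on_transform[OF g(1)] g(2) by metis
    then show ?thesis by blast
  qed
  then obtain LK where LK: "\<And>K. K \<in> \<T> \<Longrightarrow> (LK K)-lipschitz_on K v" by metis
  define L where "L = (\<Sum>K\<in>\<T>. LK K)"
  have nn: "LK K \<ge> 0" if "K \<in> \<T>" for K by (rule lipschitz_on_nonneg[OF LK[OF that]])
  have L: "L \<ge> 0" unfolding L_def by (intro sum_nonneg nn)
  have LL: "LK K \<le> L" if "K \<in> \<T>" for K unfolding L_def by (rule member_le_sum[OF that _ mesh_finite[OF mesh]]) (simp add: nn)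
  have slab: "\<bar>?w a - ?w b\<bar> \<le> L * dist a b" if ab: "snd a \<in> {0..T}" "snd b \<in> {0..T}" for a b
  proof -
    define \<gamma> where "\<gamma> s = a + s *\<^sub>R (b - a)" for s :: real
    have \<gamma>c: "continuous_on UNIV \<gamma>" unfolding \<gamma>_def by (intro continuous_intros)
    have \<gamma>d: "dist (\<gamma> s) (\<gamma> s') = dist a b * dist s s'" for s s'
      by (simp add: \<gamma>_def dist_norm scaleR_diff_left[symmetric] norm_minus_commute)
    \<comment> \<open>\<open>None\<close> indexes the part of the segment that lies outside
      \<Omega>, where the extension vanishes.\<close>
    define U where "U K = (case K of None \<Rightarrow> \<gamma> -` ((- \<Omega>) \<times> UNIV) | Some K \<Rightarrow> \<gamma> -` K)" for K
    have "(L * dist a b)-lipschitz_on {0..1} (\<lambda>s. ?w (\<gamma> s))"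
    proof (rule lipschitz_on_closed_Union[where I="insert None (Some ` \<T>)" and U=U])
      show "finite (insert None (Some ` \<T>))" using mesh_finite[OF mesh] by simp
      show "0 \<le> L * dist a b" using L by simp
      fix i assume "i \<in> insert None (Some ` \<T>)"
      then consider "i = None" | K where "i = Some K" "K \<in> \<T>" by blast
      then have "closed (U i) \<and> (L * dist a b)-lipschitz_on (U i) (\<lambda>s. ?w (\<gamma> s))"
      proof cases
        case 1
        have "closed ((- \<Omega>) \<times> (UNIV :: real set))"
          using \<Omega> unfolding lipschitz_domain_def by (intro closed_Times) auto
        then have "closed (U i)" using continuous_closed_vimage[OF _ ] \<gamma>c 1
          by (simp add: U_def continuous_on_closed_vimage[of UNIV, simplified])
        moreover have "?w (\<gamma> s) = 0" if "s \<in> U i" for s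
          using that 1 fe_ext_outside[of "fst (\<gamma> s)" "snd (\<gamma> s)"] by (auto simp: U_def)
        then have "(L * dist a b)-lipschitz_on (U i) (\<lambda>s. ?w (\<gamma> s))"
          by (intro lipschitz_onI) (use L in auto)
        ultimately show ?thesis by blast
      next
        case 2
        have "closed (U i)" using \<gamma>c 2 compact_imp_closed[OF mesh_compact_convex(1)[OF mesh 2(2)]]
          by (simp add: U_def continuous_on_closed_vimage[of UNIV, simplified])
        moreover have "(L * dist a b)-lipschitz_on (U i) (\<lambda>s. ?w (\<gamma> s))"
        proof (rule lipschitz_onI)
          fix s s' assume "s \<in> U i" "s' \<in> U i"
          then have K: "\<gamma> s \<in> K" "\<gamma> s' \<in> K" using 2 by (auto simp: U_def)
          then have "\<gamma> s \<in> closure (cylinder \<Omega> T)" "\<gamma> s' \<in> closure (cylinder \<Omega> T)"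
            using 2(2) unfolding mesh_closure[OF mesh] by blast+
          then have "dist (?w (\<gamma> s)) (?w (\<gamma> s')) \<le> LK K * dist (\<gamma> s) (\<gamma> s')"
            using lipschitz_onD[OF LK[OF 2(2)] K] by (simp add: fe_ext_eq)
          also have "\<dots> \<le> L * dist (\<gamma> s) (\<gamma> s')" using LL[OF 2(2)] by (intro mult_right_mono) auto
          finally show "dist (?w (\<gamma> s)) (?w (\<gamma> s')) \<le> L * dist a b * dist s s'" by (simp add: \<gamma>d)
        qed (use L in simp)
        ultimately show ?thesis by blast
      qed
      then show "closed (U i)" "(L * dist a b)-lipschitz_on (U i) (\<lambda>s. ?w (\<gamma> s))" by blast+
    next
      show "{0..1} \<subseteq> (\<Union>i\<in>insert None (Some ` \<T>). U i)"
      proof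
        fix s :: real assume s: "s \<in> {0..1}"
        show "s \<in> (\<Union>i\<in>insert None (Some ` \<T>). U i)"
        proof (cases "fst (\<gamma> s) \<in> \<Omega>")
          case False
          then have "s \<in> U None" by (simp add: U_def mem_Times_iff)
          then show ?thesis by blast
        next
          case True
          have "snd (\<gamma> s) = (1 - s) * snd a + s * snd b" by (simp add: \<gamma>_def algebra_simps)
          moreover have "0 \<le> (1 - s) * snd a + s * snd b" using s ab by simp
          moreover have "(1 - s) * snd a + s * snd b \<le> T" using s ab by (intro convex_bound_le) auto
          ultimately have "\<gamma> s \<in> closure (cylinder \<Omega> T)"
            using True closure_subset[of \<Omega>] by (auto simp: closure_cylinder[OF T] mem_Times_iff)
          then obtain K where "K \<in> \<T>" "\<gamma> s \<in> K" unfolding mesh_closure[OF mesh] by blast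
          then have "s \<in> U (Some K)" "Some K \<in> insert None (Some ` \<T>)" by (simp_all add: U_def)
          then show ?thesis by blast
        qed
      qed
    qed
    from lipschitz_onD[OF this, of 0 1] show ?thesis by (simp add: \<gamma>_def dist_real_def)
  qed
  have "L-lipschitz_on UNIV ?w"
  proof (rule lipschitz_onI)
    fix a b :: "'d spacetime"
    \<comment> \<open>Clamping the time leaves the extension unchanged and is non-expansive, which
      reduces arbitrary points to those with time in [0, T].\<close>
    let ?c = "\<lambda>z::'d spacetime. (fst z, max 0 (min T (snd z)))"
    have "?w a = ?w (?c a)" "?w b = ?w (?c b)" using T by (auto simp: fe_ext_def)
    moreover have "\<bar>?w (?c a) - ?w (?c b)\<bar> \<le> L * dist (?c a) (?c b)"
      using T by (intro slab) auto
    moreover have "dist (?c a) (?c b) \<le> dist a b"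
    proof -
      have "\<bar>max 0 (min T (snd a)) - max 0 (min T (snd b))\<bar> \<le> \<bar>snd a - snd b\<bar>" by linarith
      then show ?thesis
        unfolding dist_prod_def fst_conv snd_conv dist_real_def
        by (intro real_sqrt_le_mono add_left_mono power_mono) auto
    qed
    then have "L * dist (?c a) (?c b) \<le> L * dist a b" using L by (rule mult_left_mono)
    ultimately show "dist (?w a) (?w b) \<le> L * dist a b" by (simp add: dist_real_def)
  qed (rule L)
  then show ?thesis by (rule that)
qed

end

subsection \<open>Integrals over slabs\<close>

lemma slab_integral:
  fixes F :: "'d::finite spacetime \<Rightarrow> real"
  assumes F: "set_integrable lborel (A \<times> B) F"
  shows "(LINT z:A \<times> B|lborel. F z) = (LINT t:B|lborel. (LINT x:A|lborel. F (x, t)))"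
    and "set_integrable lborel B (\<lambda>t. LINT x:A|lborel. F (x, t))"
proof -
  let ?F = "\<lambda>x t. indicator (A \<times> B) (x, t) *\<^sub>R F (x, t)"
  have i: "integrable (lborel \<Otimes>\<^sub>M lborel) (\<lambda>(x, t). ?F x t)"
    using F unfolding set_integrable_def lborel_prod by (simp add: split_def)
  have s: "(LINT x|lborel. ?F x t) = indicator B t *\<^sub>R (LINT x:A|lborel. F (x, t))" for t
    unfolding set_lebesgue_integral_def
    by (cases "t \<in> B") (auto intro!: Bochner_Integration.integral_cong simp: indicator_def)
  have "(LINT z:A \<times> B|lborel. F z) = integral\<^sup>L (lborel \<Otimes>\<^sub>M lborel) (\<lambda>(x, t). ?F x t)"
    unfolding set_lebesgue_integral_def lborel_prod by (simp add: split_def)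
  also have "\<dots> = (LINT t|lborel. (LINT x|lborel. ?F x t))"
    by (rule lborel_pair.integral_snd[OF i, symmetric])
  finally show "(LINT z:A \<times> B|lborel. F z) = (LINT t:B|lborel. (LINT x:A|lborel. F (x, t)))"
    unfolding s by (simp only: set_lebesgue_integral_def)
  show "set_integrable lborel B (\<lambda>t. LINT x:A|lborel. F (x, t))"
    using lborel_pair.integrable_snd[OF i] unfolding s set_integrable_def .
qed

lemma young_abs: "e > 0 \<Longrightarrow> \<bar>a\<bar> \<le> (e + a\<^sup>2 / e) / 2" for a e :: real
  using sum_squares_bound[of "\<bar>a\<bar>" e] by (simp add: field_simps power2_eq_square)

lemma L2_on_if_finite:
  fixes f :: "'a::euclidean_space \<Rightarrow> real"
  assumes "set_borel_measurable lborel S f" "L2_sq S f < ennreal c"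
  shows "L2_on S f" "(LINT z:S|lborel. (f z)\<^sup>2) \<le> c"
proof -
  have m: "(\<lambda>z. indicator S z *\<^sub>R f z) \<in> borel_measurable borel"
    using assms(1) by (simp add: set_borel_measurable_def)
  show L: "L2_on S f"
  proof (rule L2_onI[OF m], rule integrableI_nonneg)
    show "(\<lambda>z. (norm (indicator S z *\<^sub>R f z))\<^sup>2) \<in> borel_measurable lborel"
      unfolding measurable_lborel2 by (rule measurable_compose[OF m]) measurable
    show "(\<integral>\<^sup>+ z. ennreal ((norm (indicator S z *\<^sub>R f z))\<^sup>2) \<partial>lborel) < \<infinity>"
      unfolding L2_sq_indicator[symmetric] using order.strict_trans[OF assms(2) ennreal_less_top] by simp
  qed simp
  have "ennreal (LINT z:S|lborel. (norm (f z))\<^sup>2) \<le> ennreal c"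
    using assms(2) unfolding L2_sq_eq_integral[OF L] by simp
  moreover have "c > 0" using assms(2) by (cases "c > 0") (auto simp: ennreal_neg not_less)
  ultimately show "(LINT z:S|lborel. (f z)\<^sup>2) \<le> c" by (simp add: ennreal_le_iff)
qed

lemma set_integral_abs_bound:
  fixes f :: "'a::euclidean_space \<Rightarrow> real"
  assumes "set_integrable lborel S f" "set_integrable lborel S h" "\<And>z. z \<in> S \<Longrightarrow> \<bar>f z\<bar> \<le> h z"
  shows "\<bar>LINT z:S|lborel. f z\<bar> \<le> (LINT z:S|lborel. h z)"
proof -
  have "\<bar>LINT z:S|lborel. f z\<bar> \<le> (LINT z|lborel. \<bar>indicator S z *\<^sub>R f z\<bar>)"
    unfolding set_lebesgue_integral_def by (rule integral_abs_bound)
  also have "\<dots> \<le> (LINT z|lborel. indicator S z *\<^sub>R h z)"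
    using assms unfolding set_integrable_def by (intro integral_mono integrable_abs) (auto simp: indicator_def)
  finally show ?thesis by (simp add: set_lebesgue_integral_def)
qed

text \<open>The left side is the mean, over a final time layer of length 1 / \<open>k n\<close>, of
  the spatial integrals of u w. These come uniformly close to the end value, up to a null set of
  times, by closeness of the slices of \<open>u\<close> to \<open>g\<close> and by the Lipschitz
  bound on \<open>w\<close>.\<close>

lemma trace_average_tendsto:
  fixes u w :: "'d::finite spacetime \<Rightarrow> real" and k :: "nat \<Rightarrow> real"
  assumes \<Omega>: "open \<Omega>" "bounded \<Omega>" and T: "T > 0"
    and u: "L2_on (cylinder \<Omega> T) u" and g: "has_time_trace \<Omega> T u T g"
    and w: "L-lipschitz_on UNIV w" and M: "\<And>z. \<bar>w z\<bar> \<le> M"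
    and k: "filterlim k at_top sequentially" "\<And>n. 1 / T \<le> k n"
  shows "(\<lambda>n. k n * (LINT z:\<Omega> \<times> {T - 1 / k n<..<T}|lborel. u z * w z)) \<longlonglongrightarrow> (LINT x:\<Omega>|lborel. g x * w (x, T))"
proof -
  let ?Q = "cylinder \<Omega> T"
  define h where "h t = (LINT x:\<Omega>|lborel. u (x, t) * w (x, t))" for t
  define c where "c = (LINT x:\<Omega>|lborel. g x * w (x, T))"
  have \<Omega>b: "\<Omega> \<in> sets borel" using \<Omega> by simp
  have Q: "?Q \<in> sets borel" "bounded ?Q" using open_cylinder[OF \<Omega>(1)] bounded_cylinder[OF \<Omega>(2)] by auto
  have gL: "L2_on \<Omega> g" using g unfolding has_time_trace_def by blast
  have L: "L \<ge> 0" by (rule lipschitz_on_nonneg[OF w])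
  have M0: "M \<ge> 0" using M[of 0] by linarith
  have wslice: "L2_on \<Omega> (\<lambda>x. w (x, t))" for t
  proof (rule continuous_L2_on[OF _ \<Omega>b \<Omega>(2)])
    show "continuous_on UNIV (\<lambda>x. w (x, t))"
      by (rule continuous_on_compose2[OF lipschitz_on_continuous_on[OF w]])
         (auto intro!: continuous_intros)
  qed
  define m where "m = (LINT x:\<Omega>|lborel. (1::real))"
  define G where "G = (LINT x:\<Omega>|lborel. \<bar>g x\<bar>)"
  have one: "set_integrable lborel \<Omega> (\<lambda>x. 1::real)"
    by (rule L2_on_integrable[OF L2_on_const_one[OF \<Omega>b \<Omega>(2)] \<Omega>b \<Omega>(2)])
  have gi: "set_integrable lborel \<Omega> (\<lambda>x. \<bar>g x\<bar>)"
    using set_integrable_abs[OF L2_on_integrable[OF gL \<Omega>b \<Omega>(2)]] .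
  have m0: "m \<ge> 0" unfolding m_def set_lebesgue_integral_def by (intro integral_nonneg_AE) auto
  have G0: "G \<ge> 0" unfolding G_def set_lebesgue_integral_def by (intro integral_nonneg_AE) auto
  have kpos: "k n > 0" for n using k(2)[of n] T by (smt (verit) divide_pos_pos)
  have slab: "\<Omega> \<times> {T - 1 / k n<..<T} \<subseteq> ?Q" for n
  proof -
    have "1 / k n \<le> T" using k(2)[of n] T kpos[of n] by (simp add: field_simps)
    then show ?thesis by (auto simp: cylinder_def)
  qed
  have uw: "set_integrable lborel ?Q (\<lambda>z. u z * w z)"
    by (rule L2_on_mult_integrable[OF u continuous_L2_on[OF lipschitz_on_continuous_on[OF w] Q]])
  have uwn: "set_integrable lborel (\<Omega> \<times> {T - 1 / k n<..<T}) (\<lambda>z. u z * w z)" for n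
    by (rule set_integrable_subset[OF uw _ slab]) (use \<Omega>(1) in \<open>simp add: borel_open open_Times\<close>)
  have slice: "\<bar>h t - c\<bar> \<le> M * ((e * m + e) / 2) + L * \<delta> * G"
    if e: "e > 0" and t: "0 < t" "t < T" "T - t \<le> \<delta>" and close: "L2_norm_on \<Omega> (\<lambda>x. u (x, t) - g x) < ennreal e" for t e \<delta>
  proof -
    let ?a = "\<lambda>x. u (x, t) - g x"
    have "set_borel_measurable lborel \<Omega> (\<lambda>x. u (x, t) + (- 1) * g x)"
      by (intro set_borel_measurable_add_scaled slice_measurable[OF L2_on_set_measurable[OF u] t(1,2)] L2_on_set_measurable[OF gL])
    then have am: "set_borel_measurable lborel \<Omega> ?a" by simp
    have asq: "L2_sq \<Omega> ?a < ennreal (e\<^sup>2)" using close by (simp add: L2_norm_on_less_iff[OF e])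
    note a = L2_on_if_finite[OF am asq]
    have ai: "set_integrable lborel \<Omega> (\<lambda>x. (?a x)\<^sup>2)" using a(1) unfolding L2_on_def by simp
    have i1: "set_integrable lborel \<Omega> (\<lambda>x. ?a x * w (x, t))" by (rule L2_on_mult_integrable[OF a(1) wslice])
    have i2: "set_integrable lborel \<Omega> (\<lambda>x. g x * (w (x, t) - w (x, T)))"
      by (rule L2_on_mult_integrable[OF gL L2_on_diff[OF wslice wslice]])
    have i3: "set_integrable lborel \<Omega> (\<lambda>x. g x * w (x, T))" by (rule L2_on_mult_integrable[OF gL wslice])
    \<comment> \<open>Split u(t) w(t) into (u(t) - g) w(t) + g (w(t) - w(T)) + g w(T). The first
      term is handled by Young's inequality with weight \<open>e\<close>, the second by the
      Lipschitz bound.\<close>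
    have "h t = (LINT x:\<Omega>|lborel. (?a x * w (x, t) + g x * (w (x, t) - w (x, T))) + g x * w (x, T))"
      unfolding h_def by (intro set_integral_eq_on) (simp add: algebra_simps)
    also have "\<dots> = (LINT x:\<Omega>|lborel. ?a x * w (x, t)) + (LINT x:\<Omega>|lborel. g x * (w (x, t) - w (x, T))) + c"
      unfolding c_def by (simp only: set_integral_add[OF set_integral_add(1)[OF i1 i2] i3] set_integral_add[OF i1 i2])
    finally have hc: "h t - c = (LINT x:\<Omega>|lborel. ?a x * w (x, t)) + (LINT x:\<Omega>|lborel. g x * (w (x, t) - w (x, T)))"
      by simp
    have j1: "set_integrable lborel \<Omega> (\<lambda>x. M * ((e * 1 + (1 / e) * (?a x)\<^sup>2) * (1 / 2)))"
      by (intro set_integrable_mult_right set_integrable_mult_left set_integral_add one ai)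
    have "\<bar>LINT x:\<Omega>|lborel. ?a x * w (x, t)\<bar> \<le> (LINT x:\<Omega>|lborel. M * ((e * 1 + (1 / e) * (?a x)\<^sup>2) * (1 / 2)))"
    proof (rule set_integral_abs_bound[OF i1 j1])
      fix x
      have "\<bar>?a x * w (x, t)\<bar> \<le> \<bar>?a x\<bar> * M" unfolding abs_mult by (rule mult_left_mono[OF M]) simp
      also have "\<dots> \<le> (e + (?a x)\<^sup>2 / e) / 2 * M" by (rule mult_right_mono[OF young_abs[OF e] M0])
      finally show "\<bar>?a x * w (x, t)\<bar> \<le> M * ((e * 1 + (1 / e) * (?a x)\<^sup>2) * (1 / 2))" by (simp add: mult.commute)
    qed
    also have "\<dots> = M * ((e * m + (1 / e) * (LINT x:\<Omega>|lborel. (?a x)\<^sup>2)) * (1 / 2))"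
      unfolding m_def
      by (simp only: set_integral_mult_right set_integral_mult_left
          set_integral_add[OF set_integrable_mult_right[OF one, of e] set_integrable_mult_right[OF ai, of "1 / e"]])
    also have "\<dots> \<le> M * ((e * m + (1 / e) * e\<^sup>2) * (1 / 2))"
      using a(2) e M0 by (intro mult_left_mono mult_right_mono add_left_mono) auto
    also have "\<dots> = M * ((e * m + e) / 2)" using e by (simp add: power2_eq_square)
    finally have b1: "\<bar>LINT x:\<Omega>|lborel. ?a x * w (x, t)\<bar> \<le> M * ((e * m + e) / 2)" .
    have "\<bar>LINT x:\<Omega>|lborel. g x * (w (x, t) - w (x, T))\<bar> \<le> (LINT x:\<Omega>|lborel. L * \<delta> * \<bar>g x\<bar>)"
    proof (rule set_integral_abs_bound[OF i2 set_integrable_mult_right[OF gi]])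
      fix x
      have "\<bar>w (x, t) - w (x, T)\<bar> \<le> L * \<bar>t - T\<bar>"
        using lipschitz_onD[OF w, of "(x, t)" "(x, T)"] by (simp add: dist_prod_def dist_real_def)
      also have "\<dots> \<le> L * \<delta>" using t by (intro mult_left_mono L) auto
      finally have "\<bar>g x\<bar> * \<bar>w (x, t) - w (x, T)\<bar> \<le> \<bar>g x\<bar> * (L * \<delta>)" by (rule mult_left_mono) simp
      then show "\<bar>g x * (w (x, t) - w (x, T))\<bar> \<le> L * \<delta> * \<bar>g x\<bar>" by (simp add: abs_mult mult.commute)
    qed
    also have "\<dots> = L * \<delta> * G" by (simp only: G_def set_integral_mult_right)
    finally show ?thesis unfolding hc using b1 by linarith
  qed
  have bound: "\<bar>k n * (LINT z:\<Omega> \<times> {T - 1 / k n<..<T}|lborel. u z * w z) - c\<bar> \<le> B"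
    if ae: "AE t in lborel. T - 1 / k n < t \<and> t < T \<longrightarrow> \<bar>h t - c\<bar> \<le> B" for n B
  proof -
    let ?I = "{T - 1 / k n<..<T}"
    have hi: "set_integrable lborel ?I h" unfolding h_def by (rule slab_integral(2)[OF uwn])
    have ci: "set_integrable lborel ?I (\<lambda>t. d)" for d :: real
      unfolding set_integrable_def by (intro integrable_scaleR_left integrable_real_indicator) (use kpos[of n] in simp_all)
    have len: "(LINT t:?I|lborel. d) = d / k n" for d :: real
      using kpos[of n] by (simp add: set_lebesgue_integral_def)
    have "(LINT z:\<Omega> \<times> ?I|lborel. u z * w z) - c / k n = (LINT t:?I|lborel. h t) - (LINT t:?I|lborel. c)"
      unfolding len h_def using slab_integral(1)[OF uwn[of n]] by simp
    also have "\<dots> = (LINT t:?I|lborel. h t - c)" by (rule set_integral_diff(2)[OF hi ci, symmetric])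
    finally have eq: "(LINT z:\<Omega> \<times> ?I|lborel. u z * w z) - c / k n = (LINT t:?I|lborel. h t - c)" .
    have "\<bar>LINT t:?I|lborel. h t - c\<bar> \<le> (LINT t|lborel. \<bar>indicator ?I t *\<^sub>R (h t - c)\<bar>)"
      unfolding set_lebesgue_integral_def by (rule integral_abs_bound)
    also have "\<dots> \<le> (LINT t|lborel. indicator ?I t *\<^sub>R B)"
    proof (rule integral_mono_AE)
      show "integrable lborel (\<lambda>t. \<bar>indicator ?I t *\<^sub>R (h t - c)\<bar>)"
        using set_integral_diff(1)[OF hi ci] unfolding set_integrable_def by (rule integrable_abs)
      show "integrable lborel (\<lambda>t. indicator ?I t *\<^sub>R B)" using ci unfolding set_integrable_def .
      show "AE t in lborel. \<bar>indicator ?I t *\<^sub>R (h t - c)\<bar> \<le> indicator ?I t *\<^sub>R B"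
        using ae by eventually_elim (auto simp: indicator_def)
    qed
    also have "\<dots> = B / k n" using len[of B] by (simp add: set_lebesgue_integral_def)
    finally have "\<bar>(LINT z:\<Omega> \<times> ?I|lborel. u z * w z) - c / k n\<bar> \<le> B / k n" unfolding eq .
    then have "k n * \<bar>(LINT z:\<Omega> \<times> ?I|lborel. u z * w z) - c / k n\<bar> \<le> k n * (B / k n)"
      using kpos[of n] by (intro mult_left_mono) auto
    then have "\<bar>k n * ((LINT z:\<Omega> \<times> ?I|lborel. u z * w z) - c / k n)\<bar> \<le> B"
      using kpos[of n] by (simp add: abs_mult)
    then show ?thesis using kpos[of n] by (simp add: right_diff_distrib)
  qed
  show ?thesis
    unfolding c_def[symmetric]
  proof (rule LIMSEQ_I)
    fix \<epsilon> :: real assume \<epsilon>: "\<epsilon> > 0"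
    \<comment> \<open>With layer length at most \<open>e\<close> and slices \<open>e\<close>-close
      to \<open>g\<close>, the bound from \<open>slice\<close> equals e (C - 1); the summand 1 makes
      \<open>C\<close> positive.\<close>
    define C where "C = M * ((m + 1) / 2) + L * G + 1"
    have C: "C > 0" unfolding C_def using M0 m0 L G0 by (intro add_nonneg_pos add_nonneg_nonneg mult_nonneg_nonneg) auto
    define e where "e = \<epsilon> / (2 * C)"
    have e: "e > 0" using \<epsilon> C by (simp add: e_def)
    obtain d where d: "d > 0" "AE t in lborel. 0 < t \<and> t < T \<and> \<bar>t - T\<bar> < d \<longrightarrow> L2_norm_on \<Omega> (\<lambda>x. u (x, t) - g x) < ennreal e"
      using g e unfolding has_time_trace_def by blast
    have "eventually (\<lambda>n. k n > max (1 / d) (1 / e)) sequentially"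
      using k(1) unfolding filterlim_at_top_dense by blast
    then obtain N where N: "\<And>n. n \<ge> N \<Longrightarrow> k n > max (1 / d) (1 / e)" unfolding eventually_sequentially by blast
    show "\<exists>N. \<forall>n\<ge>N. norm (k n * (LINT z:\<Omega> \<times> {T - 1 / k n<..<T}|lborel. u z * w z) - c) < \<epsilon>"
    proof (intro exI allI impI)
      fix n assume n: "n \<ge> N"
      have kd: "1 / k n < d" "1 / k n < e" using N[OF n] d(1) e kpos[of n] by (simp_all add: field_simps)
      have kT: "1 / k n \<le> T" using k(2)[of n] T kpos[of n] by (simp add: field_simps)
      have "AE t in lborel. T - 1 / k n < t \<and> t < T \<longrightarrow> \<bar>h t - c\<bar> \<le> M * ((e * m + e) / 2) + L * e * G"
        using d(2)
      proof eventually_elim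
        case (elim t)
        show ?case
        proof
          assume t: "T - 1 / k n < t \<and> t < T"
          then have "0 < t" "\<bar>t - T\<bar> < d" "T - t \<le> e" using kd kT by linarith+
          then show "\<bar>h t - c\<bar> \<le> M * ((e * m + e) / 2) + L * e * G" using t elim by (intro slice[OF e]) auto
        qed
      qed
      from bound[OF this] have "\<bar>k n * (LINT z:\<Omega> \<times> {T - 1 / k n<..<T}|lborel. u z * w z) - c\<bar> \<le> M * ((e * m + e) / 2) + L * e * G" .
      also have "\<dots> = e * (C - 1)" by (simp add: C_def algebra_simps add_divide_distrib)
      also have "\<dots> < e * (2 * C)" using e C by (intro mult_strict_left_mono) auto
      also have "\<dots> = \<epsilon>" using C by (simp add: e_def)
      finally show "norm (k n * (LINT z:\<Omega> \<times> {T - 1 / k n<..<T}|lborel. u z * w z) - c) < \<epsilon>" by simp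
    qed
  qed
qed

lemma set_integral_cong_AE_integrable:
  fixes f g :: "'a \<Rightarrow> real"
  assumes "set_integrable M S f" "set_integrable M S g" "AE z in M. z \<in> S \<longrightarrow> f z = g z"
  shows "(LINT z:S|M. f z) = (LINT z:S|M. g z)"
  using assms unfolding set_integrable_def
  by (intro set_lebesgue_integral_cong_AE') (simp_all add: set_borel_measurable_def)

text \<open>The flux of a sum contains the gradient chosen for the sum, which agrees with the sum of
  the chosen gradients only almost everywhere.\<close>

lemma has_weak_div_cong_AE:
  assumes V: "has_weak_div S V g" and S: "open S" and V': "L2_on S V'" and eq: "AE z in lborel. z \<in> S \<longrightarrow> V z = V' z"
  shows "has_weak_div S V' g"
  unfolding has_weak_div_def
proof (intro conjI allI impI V')
  have L: "L2_on S V" "L2_on S g" using V unfolding has_weak_div_def by blast+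
  show "L2_on S g" by (rule L(2))
  fix \<phi> assume \<phi>: "test_function S \<phi>"
  have Sb: "S \<in> sets borel" using S by simp
  have "(LINT z:S|lborel. V' z \<bullet> (grad_x \<phi> z, dt \<phi> z)) = (LINT z:S|lborel. V z \<bullet> (grad_x \<phi> z, dt \<phi> z))"
    by (intro set_integral_cong_AE_integrable L2_on_inner_integrable V' L(1) test_function_L2(4)[OF \<phi> Sb])
       (use eq in eventually_elim, simp)
  also have "\<dots> = - (LINT z:S|lborel. \<phi> z * g z)" using V \<phi> unfolding has_weak_div_def by blast
  finally show "(LINT z:S|lborel. V' z \<bullet> (grad_x \<phi> z, dt \<phi> z)) = - (LINT z:S|lborel. \<phi> z * g z)" .
qed

section \<open>The discrete setting and linearity of the bilinear form\<close>

locale space_time_fem =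
  fixes \<Omega> :: "(real ^ 'd::finite) set" and T \<sigma> \<nu>_lo \<nu>_hi :: real and \<nu> :: "'d spacetime \<Rightarrow> real"
    and \<T> :: "'d spacetime set set" and X and p :: nat and \<theta> :: "'d spacetime set \<Rightarrow> real"
  assumes domain: "lipschitz_domain \<Omega>" and T_pos: "T > 0"
    and nu_measurable: "set_borel_measurable lborel (cylinder \<Omega> T) \<nu>"
    and nu_lo_pos: "0 < \<nu>_lo"
    and nu_bounds: "AE z in lborel. z \<in> cylinder \<Omega> T \<longrightarrow> \<nu>_lo \<le> \<nu> z \<and> \<nu> z \<le> \<nu>_hi"
    and mesh: "simplicial_mesh (cylinder \<Omega> T) \<sigma> \<T> X"
    and theta_pos: "\<And>K. K \<in> \<T> \<Longrightarrow> \<theta> K > 0"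
begin

abbreviation "Q \<equiv> cylinder \<Omega> T"
abbreviation "V \<equiv> V_0h \<Omega> T p \<T> X"

lemma domain_open: "open \<Omega>" and domain_bounded: "bounded \<Omega>"
  using domain unfolding lipschitz_domain_def by blast+

lemma Q_open: "open Q" and Q_bounded: "bounded Q" and Q_borel: "Q \<in> sets borel"
  using open_cylinder[OF domain_open] bounded_cylinder[OF domain_bounded] by simp_all

lemma elem_subset: "K \<in> \<T> \<Longrightarrow> interior K \<subseteq> Q"
  by (rule mesh_interior_subset_cylinder[OF mesh domain T_pos])

lemma elem_bounded: "K \<in> \<T> \<Longrightarrow> bounded (interior K)"
  by (rule mesh_bounded_interior[OF mesh])

lemma diameter_pos: "K \<in> \<T> \<Longrightarrow> diameter K > 0"
  by (rule mesh_diameter_pos[OF mesh])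

lemma nu_bound: "S \<subseteq> Q \<Longrightarrow> AE z in lborel. z \<in> S \<longrightarrow> \<bar>\<nu> z\<bar> \<le> \<nu>_hi"
  using nu_bounds nu_lo_pos by (auto elim!: eventually_mono)

lemma nu_set_measurable: "S \<subseteq> Q \<Longrightarrow> open S \<Longrightarrow> set_borel_measurable lborel S \<nu>"
  by (rule set_borel_measurable_subset[OF nu_measurable]) auto

lemma nu_L2_on: "S \<subseteq> Q \<Longrightarrow> open S \<Longrightarrow> L2_on S G \<Longrightarrow> L2_on S (\<lambda>z. \<nu> z *\<^sub>R G z)"
  by (rule L2_on_mult_bounded[OF _ nu_set_measurable nu_bound])

lemma flux_L2_on:
  "S \<subseteq> Q \<Longrightarrow> open S \<Longrightarrow> L2_on S G \<Longrightarrow> L2_on S w \<Longrightarrow> L2_on S (\<lambda>z. (- (\<nu> z *\<^sub>R G z), w z))"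
  by (rule L2_on_Pair[OF L2_on_uminus[OF nu_L2_on]])

subsubsection \<open>Derivatives of finite element functions\<close>

text \<open>Fixed representatives on all of space-time: the same two functions serve as weak
  derivatives on the cylinder and on every element, which allows integrals over elements to be
  summed.\<close>

definition "fe_dt v = dird (fe_ext \<Omega> T v) (0, 1)"
definition "fe_grad v = dirgrad (fe_ext \<Omega> T v)"

context
  fixes v assumes v: "v \<in> V"
begin

lemma fe_weak:
  assumes S: "open S" "S \<subseteq> Q"
  shows "has_weak_grad_x S v (fe_grad v)" "has_weak_dt S v (fe_dt v)"
    "L2_on S v" "L2_on S (fe_grad v)" "L2_on S (fe_dt v)"
proof -
  obtain L where L: "L-lipschitz_on UNIV (fe_ext \<Omega> T v)"
    by (rule fe_ext_lipschitz[OF domain T_pos mesh v])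
  have b: "bounded S" by (rule bounded_subset[OF Q_bounded S(2)])
  have d: "AE z in lborel. z \<in> S \<longrightarrow> fe_ext \<Omega> T v differentiable (at z)"
    using fe_ext_differentiable[OF domain T_pos mesh v] by eventually_elim (use S(2) in auto)
  have eq: "v z = fe_ext \<Omega> T v z" if "z \<in> S" for z
    using fe_ext_eq_cylinder[OF domain T_pos mesh v subsetD[OF S(2) that]] by simp
  show g: "has_weak_grad_x S v (fe_grad v)"
  proof -
    have "has_weak_grad_x S v = has_weak_grad_x S (fe_ext \<Omega> T v)" by (rule has_weak_grad_x_cong, rule eq)
    then show ?thesis unfolding fe_grad_def using lipschitz_has_weak_grad_x[OF L S(1) b d] by simp
  qed
  show t: "has_weak_dt S v (fe_dt v)"
  proof -
    have "has_weak_dt S v = has_weak_dt S (fe_ext \<Omega> T v)" by (rule has_weak_dt_cong, rule eq)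
    then show ?thesis unfolding fe_dt_def using lipschitz_has_weak_dt[OF L S(1) b d] by simp
  qed
  show "L2_on S v" "L2_on S (fe_grad v)" using g unfolding has_weak_grad_x_def by blast+
  show "L2_on S (fe_dt v)" using t unfolding has_weak_dt_def by blast
qed

lemma fe_weak_AE:
  assumes S: "open S" "S \<subseteq> Q"
  shows "AE z in lborel. z \<in> S \<longrightarrow> weak_grad_x S v z = fe_grad v z"
    "AE z in lborel. z \<in> S \<longrightarrow> weak_dt S v z = fe_dt v z"
    "L2_on S (weak_grad_x S v)" "L2_on S (weak_dt S v)"
proof -
  have b: "bounded S" by (rule bounded_subset[OF Q_bounded S(2)])
  show "AE z in lborel. z \<in> S \<longrightarrow> weak_grad_x S v z = fe_grad v z"
    by (rule weak_grad_x_AE[OF S(1) b fe_weak(1)[OF S]])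
  show "AE z in lborel. z \<in> S \<longrightarrow> weak_dt S v z = fe_dt v z"
    by (rule weak_dt_AE[OF S(1) b fe_weak(2)[OF S]])
  show "L2_on S (weak_grad_x S v)" using weak_grad_x[OF fe_weak(1)[OF S]] unfolding has_weak_grad_x_def by blast
  show "L2_on S (weak_dt S v)" using weak_dt[OF fe_weak(2)[OF S]] unfolding has_weak_dt_def by blast
qed

lemma fe_trace: "has_time_trace \<Omega> T v s (\<lambda>x. fe_ext \<Omega> T v (x, s))"
proof -
  obtain L where L: "L-lipschitz_on UNIV (fe_ext \<Omega> T v)"
    by (rule fe_ext_lipschitz[OF domain T_pos mesh v])
  have eq: "v z = fe_ext \<Omega> T v z" if "z \<in> Q" for z
    using fe_ext_eq_cylinder[OF domain T_pos mesh v that] by simp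
  have "has_time_trace \<Omega> T v s = has_time_trace \<Omega> T (fe_ext \<Omega> T v) s" by (rule has_time_trace_cong, rule eq)
  then show ?thesis using lipschitz_has_time_trace[OF domain_open domain_bounded L] by simp
qed

lemma fe_ext_slice: "x \<in> \<Omega> \<Longrightarrow> 0 \<le> s \<Longrightarrow> s \<le> T \<Longrightarrow> fe_ext \<Omega> T v (x, s) = v (x, s)"
  using fe_ext_eq[OF domain T_pos mesh v, of "(x, s)"] closure_subset[of \<Omega>]
  by (auto simp: closure_cylinder[OF T_pos])

lemma fe_trace_AE: "0 \<le> s \<Longrightarrow> s \<le> T \<Longrightarrow> AE x in lborel. x \<in> \<Omega> \<longrightarrow> time_trace \<Omega> T v s x = v (x, s)"
  using time_trace_AE[OF domain_open T_pos _ _ fe_trace L2_on_set_measurable[OF fe_weak(3)[OF Q_open order_refl]], of s]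
  by (auto elim!: eventually_mono simp: fe_ext_slice)

lemma fe_slice_L2_on:
  assumes "0 \<le> s" "s \<le> T" shows "L2_on \<Omega> (\<lambda>x. v (x, s))"
proof -
  have "L2_on \<Omega> (\<lambda>x. fe_ext \<Omega> T v (x, s))" using fe_trace unfolding has_time_trace_def by blast
  then show ?thesis by (subst L2_on_cong[of \<Omega> _ "\<lambda>x. fe_ext \<Omega> T v (x, s)"]) (simp_all add: fe_ext_slice assms)
qed

end

lemma fe_ext_bounded:
  assumes v: "v \<in> V" obtains M where "\<And>z. \<bar>fe_ext \<Omega> T v z\<bar> \<le> M"
proof -
  have c: "continuous_on (closure Q) v" using v unfolding V_0h_def by blast
  obtain M where M: "M \<ge> 0" "\<And>z. z \<in> closure Q \<Longrightarrow> norm (v z) \<le> M"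
    using bounded_on_compact[OF c compact_closure[THEN iffD2, OF Q_bounded]] by blast
  have "\<bar>fe_ext \<Omega> T v z\<bar> \<le> M" for z
  proof (cases "fst z \<in> closure \<Omega>")
    case True
    then have "(fst z, max 0 (min T (snd z))) \<in> closure Q" using T_pos by (simp add: closure_cylinder)
    from M(2)[OF this] show ?thesis using True by (simp add: fe_ext_def)
  next
    case False then show ?thesis using M(1) by (simp add: fe_ext_def)
  qed
  then show ?thesis by (rule that)
qed

subsubsection \<open>Linearity of the bilinear form\<close>

lemma has_parabolic_div_L2:
  assumes "has_parabolic_div S \<nu> y g"
  shows "L2_on S y" "L2_on S (weak_grad_x S y)" "L2_on S g"
    "L2_on S (parabolic_div S \<nu> y)"
proof -
  obtain G where G: "has_weak_grad_x S y G" using assms unfolding has_parabolic_div_def by blast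
  show "L2_on S y" "L2_on S (weak_grad_x S y)"
    using weak_grad_x[OF G] unfolding has_weak_grad_x_def by blast+
  show "L2_on S g" using assms unfolding has_parabolic_div_def has_weak_div_def by blast
  show "L2_on S (parabolic_div S \<nu> y)"
    using parabolic_div[OF assms] unfolding has_parabolic_div_def has_weak_div_def by blast
qed

lemma has_parabolic_div_add_scaled:
  assumes S: "open S" "S \<subseteq> Q" and y: "has_parabolic_div S \<nu> y1 g1" "has_parabolic_div S \<nu> y2 g2"
  shows "has_parabolic_div S \<nu> (\<lambda>z. y1 z + c * y2 z) (\<lambda>z. g1 z + c * g2 z)"
    and "AE z in lborel. z \<in> S \<longrightarrow> weak_grad_x S (\<lambda>z. y1 z + c * y2 z) z = weak_grad_x S y1 z + c *\<^sub>R weak_grad_x S y2 z"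
proof -
  let ?y = "\<lambda>z. y1 z + c * y2 z"
  have b: "bounded S" by (rule bounded_subset[OF Q_bounded S(2)])
  obtain G1 G2 where "has_weak_grad_x S y1 G1" "has_weak_grad_x S y2 G2"
    using y unfolding has_parabolic_div_def by blast
  then have G: "has_weak_grad_x S ?y (\<lambda>z. weak_grad_x S y1 z + c *\<^sub>R weak_grad_x S y2 z)"
    by (intro has_weak_grad_x_add_scaled[OF S(1)] weak_grad_x)
  show eq: "AE z in lborel. z \<in> S \<longrightarrow> weak_grad_x S ?y z = weak_grad_x S y1 z + c *\<^sub>R weak_grad_x S y2 z"
    by (rule weak_grad_x_AE[OF S(1) b G])
  have d: "has_weak_div S (\<lambda>z. (- (\<nu> z *\<^sub>R weak_grad_x S y1 z), y1 z)) g1"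
    "has_weak_div S (\<lambda>z. (- (\<nu> z *\<^sub>R weak_grad_x S y2 z), y2 z)) g2"
    using y unfolding has_parabolic_div_def by blast+
  have "has_weak_div S (\<lambda>z. (- (\<nu> z *\<^sub>R weak_grad_x S ?y z), ?y z)) (\<lambda>z. g1 z + c * g2 z)"
  proof (rule has_weak_div_cong_AE[OF has_weak_div_add_scaled[OF S(1) d] S(1)])
    show "L2_on S (\<lambda>z. (- (\<nu> z *\<^sub>R weak_grad_x S ?y z), ?y z))"
      using weak_grad_x[OF G] unfolding has_weak_grad_x_def by (intro flux_L2_on[OF S(2,1)]) blast+
    show "AE z in lborel. z \<in> S \<longrightarrow> (- (\<nu> z *\<^sub>R weak_grad_x S y1 z), y1 z) + c *\<^sub>R (- (\<nu> z *\<^sub>R weak_grad_x S y2 z), y2 z) =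
        (- (\<nu> z *\<^sub>R weak_grad_x S ?y z), ?y z)"
      using eq by eventually_elim (simp add: algebra_simps)
  qed
  with G show "has_parabolic_div S \<nu> ?y (\<lambda>z. g1 z + c * g2 z)"
    unfolding has_parabolic_div_def by (intro conjI exI)
qed

definition elem_form where
  "elem_form K y v = (LINT z:interior K|lborel. \<nu> z * (weak_grad_x (interior K) y z \<bullet> weak_grad_x (interior K) v z)
     - y z * weak_dt (interior K) v z
     + \<theta> K * diameter K * parabolic_div (interior K) \<nu> y z * weak_dt (interior K) v z)"

lemma a_h_elem_form:
  "a_h \<Omega> T \<nu> \<T> \<theta> y v = (\<Sum>K\<in>\<T>. elem_form K y v) + (LINT x:\<Omega>|lborel. time_trace \<Omega> T y T x * v (x, T))"
  by (simp add: a_h_def elem_form_def Let_def)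

lemma elem_integrand_integrable:
  assumes K: "K \<in> \<T>" and y: "has_parabolic_div (interior K) \<nu> y g" and v: "v \<in> V"
  shows "set_integrable lborel (interior K) (\<lambda>z. \<nu> z * (weak_grad_x (interior K) y z \<bullet> weak_grad_x (interior K) v z)
     - y z * weak_dt (interior K) v z
     + \<theta> K * diameter K * parabolic_div (interior K) \<nu> y z * weak_dt (interior K) v z)"
proof -
  let ?E = "interior K"
  note S = open_interior[of K] elem_subset[OF K]
  note y = has_parabolic_div_L2[OF y]
  have "set_integrable lborel ?E (\<lambda>z. (\<nu> z *\<^sub>R weak_grad_x ?E y z) \<bullet> weak_grad_x ?E v z)"
    by (rule L2_on_inner_integrable[OF nu_L2_on[OF S(2,1) y(2)] fe_weak_AE(3)[OF v S]])
  moreover have "set_integrable lborel ?E (\<lambda>z. y z * weak_dt ?E v z)"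
    by (rule L2_on_mult_integrable[OF y(1) fe_weak_AE(4)[OF v S]])
  moreover have "set_integrable lborel ?E (\<lambda>z. (\<theta> K * diameter K * parabolic_div ?E \<nu> y z) * weak_dt ?E v z)"
    by (rule L2_on_mult_integrable[OF L2_on_mult[OF y(4)] fe_weak_AE(4)[OF v S]])
  ultimately have "set_integrable lborel ?E (\<lambda>z. (\<nu> z *\<^sub>R weak_grad_x ?E y z) \<bullet> weak_grad_x ?E v z - y z * weak_dt ?E v z
     + (\<theta> K * diameter K * parabolic_div ?E \<nu> y z) * weak_dt ?E v z)"
    by (intro set_integral_add(1) set_integral_diff(1))
  then show ?thesis by simp
qed

lemma elem_form_add_scaled:
  assumes K: "K \<in> \<T>" and y: "has_parabolic_div (interior K) \<nu> y1 g1" "has_parabolic_div (interior K) \<nu> y2 g2" and v: "v \<in> V"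
  shows "elem_form K (\<lambda>z. y1 z + c * y2 z) v = elem_form K y1 v + c * elem_form K y2 v"
proof -
  let ?E = "interior K" and ?y = "\<lambda>z. y1 z + c * y2 z"
  note S = open_interior[of K] elem_subset[OF K]
  have b: "bounded ?E" by (rule elem_bounded[OF K])
  let ?I = "\<lambda>y z. \<nu> z * (weak_grad_x ?E y z \<bullet> weak_grad_x ?E v z) - y z * weak_dt ?E v z
     + \<theta> K * diameter K * parabolic_div ?E \<nu> y z * weak_dt ?E v z"
  note sum = has_parabolic_div_add_scaled[OF S y, of c]
  have i: "set_integrable lborel ?E (?I y1)" "set_integrable lborel ?E (?I y2)" "set_integrable lborel ?E (?I ?y)"
    by (rule elem_integrand_integrable[OF K y(1) v] elem_integrand_integrable[OF K y(2) v] elem_integrand_integrable[OF K sum(1) v])+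
  have pd: "AE z in lborel. z \<in> ?E \<longrightarrow> parabolic_div ?E \<nu> ?y z = parabolic_div ?E \<nu> y1 z + c * parabolic_div ?E \<nu> y2 z"
    by (rule parabolic_div_AE[OF S(1) b has_parabolic_div_add_scaled(1)[OF S parabolic_div[OF y(1)] parabolic_div[OF y(2)]]])
  have "elem_form K ?y v = (LINT z:?E|lborel. ?I y1 z + c * ?I y2 z)"
    unfolding elem_form_def
  proof (rule set_integral_cong_AE_integrable[OF i(3)])
    show "set_integrable lborel ?E (\<lambda>z. ?I y1 z + c * ?I y2 z)"
      by (rule set_integral_add(1)[OF i(1) set_integrable_mult_right[OF i(2)]])
    show "AE z in lborel. z \<in> ?E \<longrightarrow> ?I ?y z = ?I y1 z + c * ?I y2 z"
      using sum(2) pd by eventually_elim (simp add: algebra_simps inner_add_left)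
  qed
  also have "\<dots> = elem_form K y1 v + c * elem_form K y2 v"
    unfolding elem_form_def
    by (simp only: set_integral_add(2)[OF i(1) set_integrable_mult_right[OF i(2)]] set_integral_mult_right)
  finally show ?thesis .
qed

text \<open>The functions on which \<open>a\<^sub>h(\<cdot>, v)\<close> is well-defined.\<close>

definition regular where
  "regular y \<longleftrightarrow> L2_on Q y \<and> (\<forall>K\<in>\<T>. \<exists>g. has_parabolic_div (interior K) \<nu> y g) \<and> (\<exists>g. has_time_trace \<Omega> T y T g)"

lemma time_trace_add_scaled_AE:
  assumes "has_time_trace \<Omega> T y1 s g1" "has_time_trace \<Omega> T y2 s g2" "L2_on Q y1" "L2_on Q y2" "0 \<le> s" "s \<le> T"
  shows "has_time_trace \<Omega> T (\<lambda>z. y1 z + c * y2 z) s (\<lambda>x. time_trace \<Omega> T y1 s x + c * time_trace \<Omega> T y2 s x)"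
    and "AE x in lborel. x \<in> \<Omega> \<longrightarrow> time_trace \<Omega> T (\<lambda>z. y1 z + c * y2 z) s x = time_trace \<Omega> T y1 s x + c * time_trace \<Omega> T y2 s x"
proof -
  note m = L2_on_set_measurable[OF assms(3)] L2_on_set_measurable[OF assms(4)]
  show *: "has_time_trace \<Omega> T (\<lambda>z. y1 z + c * y2 z) s (\<lambda>x. time_trace \<Omega> T y1 s x + c * time_trace \<Omega> T y2 s x)"
    by (rule has_time_trace_add_scaled[OF domain_open time_trace[OF assms(1)] time_trace[OF assms(2)] m])
  show "AE x in lborel. x \<in> \<Omega> \<longrightarrow> time_trace \<Omega> T (\<lambda>z. y1 z + c * y2 z) s x = time_trace \<Omega> T y1 s x + c * time_trace \<Omega> T y2 s x"
    by (rule time_trace_AE[OF domain_open T_pos assms(5,6) * set_borel_measurable_add_scaled[OF m]])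
qed

text \<open>With c = - 1 this expands the form at the differences in the error estimate. Gradients,
  divergences and traces of the sum equal the sums of the chosen ones only almost
  everywhere.\<close>

lemma a_h_add_scaled:
  assumes y: "regular y1" "regular y2" and v: "v \<in> V"
  shows "a_h \<Omega> T \<nu> \<T> \<theta> (\<lambda>z. y1 z + c * y2 z) v = a_h \<Omega> T \<nu> \<T> \<theta> y1 v + c * a_h \<Omega> T \<nu> \<T> \<theta> y2 v"
proof -
  let ?y = "\<lambda>z. y1 z + c * y2 z"
  have L: "L2_on Q y1" "L2_on Q y2" using y unfolding regular_def by blast+
  obtain g1 g2 where g: "has_time_trace \<Omega> T y1 T g1" "has_time_trace \<Omega> T y2 T g2"
    using y unfolding regular_def by blast
  note tr = time_trace_add_scaled_AE[OF g L less_imp_le[OF T_pos] order_refl, of c]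
  have L2: "L2_on \<Omega> (time_trace \<Omega> T y1 T)" "L2_on \<Omega> (time_trace \<Omega> T y2 T)" "L2_on \<Omega> (time_trace \<Omega> T ?y T)"
    using time_trace[OF g(1)] time_trace[OF g(2)] time_trace[OF tr(1)] unfolding has_time_trace_def by blast+
  note vT = fe_slice_L2_on[OF v less_imp_le[OF T_pos] order_refl]
  have i: "set_integrable lborel \<Omega> (\<lambda>x. time_trace \<Omega> T y1 T x * v (x, T))"
    "set_integrable lborel \<Omega> (\<lambda>x. time_trace \<Omega> T y2 T x * v (x, T))"
    "set_integrable lborel \<Omega> (\<lambda>x. time_trace \<Omega> T ?y T x * v (x, T))"
    by (rule L2_on_mult_integrable[OF L2(1) vT] L2_on_mult_integrable[OF L2(2) vT] L2_on_mult_integrable[OF L2(3) vT])+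
  have "(LINT x:\<Omega>|lborel. time_trace \<Omega> T ?y T x * v (x, T)) =
      (LINT x:\<Omega>|lborel. time_trace \<Omega> T y1 T x * v (x, T) + c * (time_trace \<Omega> T y2 T x * v (x, T)))"
  proof (rule set_integral_cong_AE_integrable[OF i(3) set_integral_add(1)[OF i(1) set_integrable_mult_right[OF i(2)]]])
    show "AE x in lborel. x \<in> \<Omega> \<longrightarrow> time_trace \<Omega> T ?y T x * v (x, T) =
        time_trace \<Omega> T y1 T x * v (x, T) + c * (time_trace \<Omega> T y2 T x * v (x, T))"
      using tr(2) by eventually_elim (simp add: algebra_simps)
  qed
  also have "\<dots> = (LINT x:\<Omega>|lborel. time_trace \<Omega> T y1 T x * v (x, T)) + c * (LINT x:\<Omega>|lborel. time_trace \<Omega> T y2 T x * v (x, T))"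
    by (simp only: set_integral_add(2)[OF i(1) set_integrable_mult_right[OF i(2)]] set_integral_mult_right)
  finally have tt: "(LINT x:\<Omega>|lborel. time_trace \<Omega> T ?y T x * v (x, T)) =
      (LINT x:\<Omega>|lborel. time_trace \<Omega> T y1 T x * v (x, T)) + c * (LINT x:\<Omega>|lborel. time_trace \<Omega> T y2 T x * v (x, T))" .
  have "(\<Sum>K\<in>\<T>. elem_form K ?y v) = (\<Sum>K\<in>\<T>. elem_form K y1 v + c * elem_form K y2 v)"
  proof (rule sum.cong[OF refl])
    fix K assume K: "K \<in> \<T>"
    then obtain g1 g2 where "has_parabolic_div (interior K) \<nu> y1 g1" "has_parabolic_div (interior K) \<nu> y2 g2"
      using y unfolding regular_def by blast
    then show "elem_form K ?y v = elem_form K y1 v + c * elem_form K y2 v"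
      by (rule elem_form_add_scaled[OF K _ _ v])
  qed
  then show ?thesis unfolding a_h_elem_form tt by (simp add: sum.distrib sum_distrib_left algebra_simps)
qed

end

subsection \<open>Consistency\<close>

locale space_time_solution = space_time_fem \<Omega> T \<sigma> \<nu>_lo \<nu>_hi \<nu> \<T> X p \<theta>
  for \<Omega> :: "(real ^ 'd::finite) set" and T \<sigma> \<nu>_lo \<nu>_hi :: real and \<nu> :: "'d spacetime \<Rightarrow> real"
    and \<T> :: "'d spacetime set set" and X and p :: nat and \<theta> :: "'d spacetime set \<Rightarrow> real" +
  fixes f u :: "'d spacetime \<Rightarrow> real" and F :: "'d spacetime \<Rightarrow> real ^ 'd" and u0 :: "real ^ 'd \<Rightarrow> real"
    and m :: nat and Qs :: "nat \<Rightarrow> 'd spacetime set"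
  assumes f_L2: "L2_on (cylinder \<Omega> T) f" and F_L2: "L2_on (cylinder \<Omega> T) F" and u0_L2: "L2_on \<Omega> u0"
    and decomp: "decomposition_of (cylinder \<Omega> T) m Qs"
    and F_div: "\<And>i. i \<in> {1..m} \<Longrightarrow> \<exists>g. has_weak_div_x (Qs i) F g"
    and aligned: "aligned_with \<T> m Qs"
    and u_H10_0: "u \<in> H10_0 \<Omega> T"
    and u_variational: "variational_solution \<Omega> T \<nu> f F u0 u"
begin

abbreviation "uG \<equiv> weak_grad_x (cylinder \<Omega> T) u"

lemma u_weak: "has_weak_grad_x Q u uG" "L2_on Q u" "L2_on Q uG"
proof -
  obtain G where "has_weak_grad_x Q u G" using u_H10_0 unfolding H10_0_def by blast
  then show G: "has_weak_grad_x Q u uG" by (rule weak_grad_x)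
  show "L2_on Q u" "L2_on Q uG" using G unfolding has_weak_grad_x_def by blast+
qed

text \<open>The gateway to the variational problem: \<open>w\<close> is admissible by
  \<open>lipschitz_H10_0\<close> and its zero end values, and the chosen weak derivatives and
  initial trace are then exchanged for explicit ones. Both element test functions and cut-off finite
  element functions are used through it.\<close>

lemma variational_lipschitz:
  assumes w: "L-lipschitz_on UNIV w" and zero: "\<And>x t. x \<notin> \<Omega> \<Longrightarrow> w (x, t) = 0"
    and d: "AE z in lborel. z \<in> Q \<longrightarrow> w differentiable (at z)" and wT: "\<And>x. x \<in> \<Omega> \<Longrightarrow> w (x, T) = 0"
  shows "(LINT z:Q|lborel. - (u z * dird w (0, 1) z) + \<nu> z * (uG z \<bullet> dirgrad w z)) =
    (LINT z:Q|lborel. f z * w z + F z \<bullet> dirgrad w z) + (LINT x:\<Omega>|lborel. u0 x * w (x, 0))"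
proof -
  note wd = lipschitz_has_weak_dt[OF w Q_open Q_bounded d] lipschitz_has_weak_grad_x[OF w Q_open Q_bounded d]
  note L2 = lipschitz_L2_on[OF w Q_open Q_bounded d]
  have tr: "has_time_trace \<Omega> T w s (\<lambda>x. w (x, s))" for s
    by (rule lipschitz_has_time_trace[OF domain_open domain_bounded w])
  have "(\<lambda>x. w (x, T)) = (\<lambda>x. 0)" using zero wT by (intro ext) metis
  with tr[of T] have trT: "has_time_trace \<Omega> T w T (\<lambda>x. 0)" by simp
  have H10: "w \<in> H10_0 \<Omega> T" by (rule lipschitz_H10_0[OF domain_open domain_bounded w zero d])
  have "w \<in> H11_0_0 \<Omega> T" unfolding H11_0_0_def using H10 wd(1) trT by blast
  with u_variational have eq:
    "(LINT z:Q|lborel. - (u z * weak_dt Q w z) + \<nu> z * (uG z \<bullet> weak_grad_x Q w z)) =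
       (LINT z:Q|lborel. f z * w z + F z \<bullet> weak_grad_x Q w z) + (LINT x:\<Omega>|lborel. u0 x * time_trace \<Omega> T w 0 x)"
    unfolding variational_solution_def Let_def by blast
  note ae = weak_dt_AE[OF Q_open Q_bounded wd(1)] weak_grad_x_AE[OF Q_open Q_bounded wd(2)]
  have W2: "L2_on Q (weak_dt Q w)" "L2_on Q (weak_grad_x Q w)"
    using weak_dt[OF wd(1)] weak_grad_x[OF wd(2)] unfolding has_weak_dt_def has_weak_grad_x_def by blast+
  have i1: "set_integrable lborel Q (\<lambda>z. - (u z * a z) + \<nu> z * (uG z \<bullet> G z))" if "L2_on Q a" "L2_on Q G" for a G
  proof -
    have "set_integrable lborel Q (\<lambda>z. (- u z) * a z + (\<nu> z *\<^sub>R uG z) \<bullet> G z)"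
      by (intro set_integral_add(1) L2_on_mult_integrable L2_on_inner_integrable L2_on_uminus u_weak
          nu_L2_on[OF order_refl Q_open] that)
    then show ?thesis by simp
  qed
  have i2: "set_integrable lborel Q (\<lambda>z. f z * w z + F z \<bullet> G z)" if "L2_on Q G" for G
    by (intro set_integral_add(1) L2_on_mult_integrable L2_on_inner_integrable f_L2 F_L2 L2(1) that)
  have e1: "(LINT z:Q|lborel. - (u z * weak_dt Q w z) + \<nu> z * (uG z \<bullet> weak_grad_x Q w z)) =
      (LINT z:Q|lborel. - (u z * dird w (0, 1) z) + \<nu> z * (uG z \<bullet> dirgrad w z))"
    by (rule set_integral_cong_AE_integrable[OF i1[OF W2] i1[OF L2(2,3)]])
       (use ae in eventually_elim, simp)
  have e2: "(LINT z:Q|lborel. f z * w z + F z \<bullet> weak_grad_x Q w z) = (LINT z:Q|lborel. f z * w z + F z \<bullet> dirgrad w z)"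
    by (rule set_integral_cong_AE_integrable[OF i2[OF W2(2)] i2[OF L2(3)]])
       (use ae in eventually_elim, simp)
  have t0: "L2_on \<Omega> (time_trace \<Omega> T w 0)" "L2_on \<Omega> (\<lambda>x. w (x, 0))"
    using time_trace[OF tr[of 0]] tr[of 0] unfolding has_time_trace_def by blast+
  have tae: "AE x in lborel. x \<in> \<Omega> \<longrightarrow> time_trace \<Omega> T w 0 x = w (x, 0)"
    by (rule time_trace_AE[OF domain_open T_pos order_refl less_imp_le[OF T_pos] tr L2_on_set_measurable[OF L2(1)]])
  have e3: "(LINT x:\<Omega>|lborel. u0 x * time_trace \<Omega> T w 0 x) = (LINT x:\<Omega>|lborel. u0 x * w (x, 0))"
    by (rule set_integral_cong_AE_integrable[OF L2_on_mult_integrable[OF u0_L2 t0(1)] L2_on_mult_integrable[OF u0_L2 t0(2)]])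
       (use tae in eventually_elim, simp)
  from eq show ?thesis unfolding e1 e2 e3 .
qed

lemma F_div_elem:
  assumes K: "K \<in> \<T>" shows "has_weak_div_x (interior K) F (weak_div_x (interior K) F)"
proof -
  obtain i where i: "i \<in> {1..m}" "interior K \<subseteq> Qs i"
    by (rule mesh_interior_subset_subdomain[OF mesh decomp aligned K])
  obtain g where "has_weak_div_x (Qs i) F g" using F_div[OF i(1)] by blast
  from has_weak_div_x_subset[OF this open_interior i(2)] show ?thesis by (rule weak_div_x)
qed

text \<open>
  Test functions of an element are admissible in the variational problem, which therefore
  determines the space-time divergence of the solution on that element.
\<close>

lemma u_parabolic_div:
  assumes K: "K \<in> \<T>"
  shows "has_parabolic_div (interior K) \<nu> u (\<lambda>z. f z - weak_div_x (interior K) F z)"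
proof -
  let ?E = "interior K"
  let ?g = "weak_div_x ?E F"
  note S = open_interior[of K] elem_subset[OF K]
  have Sb: "?E \<in> sets borel" by simp
  have G: "has_weak_grad_x ?E u uG" by (rule has_weak_grad_x_subset[OF u_weak(1) S])
  note Gw = weak_grad_x[OF G]
  have GL: "L2_on ?E u" "L2_on ?E (weak_grad_x ?E u)" "L2_on ?E uG" using Gw G unfolding has_weak_grad_x_def by blast+
  have ae: "AE z in lborel. z \<in> ?E \<longrightarrow> weak_grad_x ?E u z = uG z"
    by (rule weak_grad_x_AE[OF S(1) elem_bounded[OF K] G])
  have gL: "L2_on ?E ?g" using F_div_elem[OF K] unfolding has_weak_div_x_def by blast
  have fL: "L2_on ?E f" "L2_on ?E F" by (rule L2_on_subset[OF f_L2 S(2) Sb] L2_on_subset[OF F_L2 S(2) Sb])+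
  have "has_weak_div ?E (\<lambda>z. (- (\<nu> z *\<^sub>R weak_grad_x ?E u z), u z)) (\<lambda>z. f z - ?g z)"
    unfolding has_weak_div_def
  proof (intro conjI allI impI)
    show "L2_on ?E (\<lambda>z. (- (\<nu> z *\<^sub>R weak_grad_x ?E u z), u z))" by (rule flux_L2_on[OF S(2,1) GL(2,1)])
    show "L2_on ?E (\<lambda>z. f z - ?g z)" by (rule L2_on_diff[OF fL(1) gL])
    fix \<phi> :: "'d spacetime \<Rightarrow> real" assume \<phi>: "test_function ?E \<phi>"
    obtain C where C: "compact C" "C \<subseteq> ?E" "\<And>z. z \<notin> C \<Longrightarrow> \<phi> z = 0"
      "\<And>z. z \<notin> C \<Longrightarrow> dt \<phi> z = 0" "\<And>z. z \<notin> C \<Longrightarrow> grad_x \<phi> z = 0"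
      using test_function_supportE[OF \<phi>] by blast
    note s = test_function_smooth[OF \<phi>]
    obtain L where L: "L-lipschitz_on UNIV \<phi>" by (rule smooth_compact_support_lipschitz[OF s C(1,3)])
    have out: "\<phi> z = 0" if "z \<notin> Q" for z
    proof -
      have "z \<notin> C" using that C(2) S(2) by blast
      then show ?thesis by (rule C(3))
    qed
    have d: "dird \<phi> (0, 1) = dt \<phi>" "dirgrad \<phi> = grad_x \<phi>"
      by (rule ext, simp add: dird_differentiable[OF smooth_differentiable[OF s]] dt_def)
         (rule ext, rule dirgrad_differentiable[OF smooth_differentiable[OF s]])
    have "(LINT z:Q|lborel. - (u z * dird \<phi> (0, 1) z) + \<nu> z * (uG z \<bullet> dirgrad \<phi> z)) =
      (LINT z:Q|lborel. f z * \<phi> z + F z \<bullet> dirgrad \<phi> z) + (LINT x:\<Omega>|lborel. u0 x * \<phi> (x, 0))"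
      by (rule variational_lipschitz[OF L]) (auto intro!: out smooth_differentiable[OF s] simp: cylinder_def)
    \<comment> \<open>Points with t = 0 lie outside the open cylinder, so the initial term drops
      out.\<close>
    moreover have "\<phi> (x, 0) = 0" for x by (rule out) (simp add: cylinder_def)
    ultimately have var: "(LINT z:Q|lborel. - (u z * dt \<phi> z) + \<nu> z * (uG z \<bullet> grad_x \<phi> z)) =
        (LINT z:Q|lborel. f z * \<phi> z + F z \<bullet> grad_x \<phi> z)"
      unfolding d by (simp add: set_lebesgue_integral_def)
    have outE: "\<phi> z = 0" "dt \<phi> z = 0" "grad_x \<phi> z = 0" if "z \<notin> ?E" for z
    proof -
      have "z \<notin> C" using that C(2) by blast
      then show "\<phi> z = 0" "dt \<phi> z = 0" "grad_x \<phi> z = 0" by (rule C(3) C(4) C(5))+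
    qed
    have r1: "(LINT z:Q|lborel. - (u z * dt \<phi> z) + \<nu> z * (uG z \<bullet> grad_x \<phi> z)) =
        (LINT z:?E|lborel. - (u z * dt \<phi> z) + \<nu> z * (uG z \<bullet> grad_x \<phi> z))"
      by (rule set_integral_support[OF S(2)]) (simp add: outE)
    have r2: "(LINT z:Q|lborel. f z * \<phi> z + F z \<bullet> grad_x \<phi> z) = (LINT z:?E|lborel. f z * \<phi> z + F z \<bullet> grad_x \<phi> z)"
      by (rule set_integral_support[OF S(2)]) (simp add: outE)
    note \<phi>L = test_function_L2[OF \<phi> Sb]
    have i: "set_integrable lborel ?E (\<lambda>z. - (u z * dt \<phi> z) + \<nu> z * (G z \<bullet> grad_x \<phi> z))" if "L2_on ?E G" for G
    proof -
      have "set_integrable lborel ?E (\<lambda>z. (- u z) * dt \<phi> z + (\<nu> z *\<^sub>R G z) \<bullet> grad_x \<phi> z)"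
        by (intro set_integral_add(1) L2_on_mult_integrable L2_on_inner_integrable L2_on_uminus GL(1) \<phi>L
            nu_L2_on[OF S(2,1)] that)
      then show ?thesis by simp
    qed
    have j: "set_integrable lborel ?E (\<lambda>z. \<phi> z * f z)" "set_integrable lborel ?E (\<lambda>z. \<phi> z * ?g z)"
      "set_integrable lborel ?E (\<lambda>z. F z \<bullet> grad_x \<phi> z)"
      by (intro L2_on_mult_integrable L2_on_inner_integrable \<phi>L fL gL)+
    have "(LINT z:?E|lborel. (- (\<nu> z *\<^sub>R weak_grad_x ?E u z), u z) \<bullet> (grad_x \<phi> z, dt \<phi> z)) =
        (LINT z:?E|lborel. (- 1) * (- (u z * dt \<phi> z) + \<nu> z * (weak_grad_x ?E u z \<bullet> grad_x \<phi> z)))"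
      by (rule set_integral_eq_on) simp
    also have "\<dots> = - (LINT z:?E|lborel. - (u z * dt \<phi> z) + \<nu> z * (weak_grad_x ?E u z \<bullet> grad_x \<phi> z))"
      by (subst set_integral_mult_right) simp
    also have "(LINT z:?E|lborel. - (u z * dt \<phi> z) + \<nu> z * (weak_grad_x ?E u z \<bullet> grad_x \<phi> z)) =
        (LINT z:?E|lborel. - (u z * dt \<phi> z) + \<nu> z * (uG z \<bullet> grad_x \<phi> z))"
      by (rule set_integral_cong_AE_integrable[OF i[OF GL(2)] i[OF GL(3)]])
         (use ae in eventually_elim, simp)
    also have "\<dots> = (LINT z:?E|lborel. \<phi> z * f z + F z \<bullet> grad_x \<phi> z)"
      using var unfolding r1 r2 by (simp only: mult.commute)
    also have "\<dots> = (LINT z:?E|lborel. \<phi> z * f z) + (LINT z:?E|lborel. F z \<bullet> grad_x \<phi> z)"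
      by (rule set_integral_add(2)[OF j(1,3)])
    also have "(LINT z:?E|lborel. F z \<bullet> grad_x \<phi> z) = - (LINT z:?E|lborel. \<phi> z * ?g z)"
      using F_div_elem[OF K] \<phi> unfolding has_weak_div_x_def by blast
    also have "(LINT z:?E|lborel. \<phi> z * f z) + - (LINT z:?E|lborel. \<phi> z * ?g z) =
        (LINT z:?E|lborel. \<phi> z * f z - \<phi> z * ?g z)"
      by (subst set_integral_diff(2)[OF j(1,2)]) simp
    also have "(LINT z:?E|lborel. \<phi> z * f z - \<phi> z * ?g z) = (LINT z:?E|lborel. \<phi> z * (f z - ?g z))"
      by (simp only: right_diff_distrib)
    finally show "(LINT z:?E|lborel. (- (\<nu> z *\<^sub>R weak_grad_x ?E u z), u z) \<bullet> (grad_x \<phi> z, dt \<phi> z)) =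
        - (LINT z:?E|lborel. \<phi> z * (f z - ?g z))" .
  qed
  then show ?thesis unfolding has_parabolic_div_def using G by blast
qed

text \<open>
  Finite element functions need not vanish at \<open>t = T\<close>; they are cut off in time by \<open>\<eta> n\<close>, and the
  derivative of the cut-off produces the trace of the solution at \<open>T\<close>.
\<close>

lemma variational_fe:
  assumes v: "v \<in> V" and g: "has_time_trace \<Omega> T u T g"
  shows "(LINT z:Q|lborel. - (u z * fe_dt v z) + \<nu> z * (uG z \<bullet> fe_grad v z) - (f z * v z + F z \<bullet> fe_grad v z)) =
    (LINT x:\<Omega>|lborel. u0 x * v (x, 0)) - (LINT x:\<Omega>|lborel. g x * v (x, T))"
    and "set_integrable lborel Q (\<lambda>z. - (u z * fe_dt v z) + \<nu> z * (uG z \<bullet> fe_grad v z) - (f z * v z + F z \<bullet> fe_grad v z))"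
proof -
  let ?w = "fe_ext \<Omega> T v"
  obtain L where L: "L-lipschitz_on UNIV ?w" by (rule fe_ext_lipschitz[OF domain T_pos mesh v])
  obtain M where M: "\<And>z. \<bar>?w z\<bar> \<le> M" using fe_ext_bounded[OF v] by metis
  have L0: "L \<ge> 0" by (rule lipschitz_on_nonneg[OF L])
  have M0: "M \<ge> 0" using M[of 0] by linarith
  note wd = fe_ext_differentiable[OF domain T_pos mesh v]
  \<comment> \<open>The ramp of the cut-off occupies the last 1 / \<open>k n\<close> of the time
    interval. Starting with slope 1 / T keeps it inside [0, T], so that
    \<open>\<eta> n 0 = 1\<close> for every \<open>n\<close>.\<close>
  define k where "k n = (real n + 1) / T" for n
  define \<eta> where "\<eta> n t = max 0 (min 1 ((T - t) * k n))" for n t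
  \<comment> \<open>The derivative of \<open>\<eta> n\<close> before T, away from the kink at T - 1
    / \<open>k n\<close>.\<close>
  define \<eta>' where "\<eta>' n t = (if T - 1 / k n < t then - k n else 0)" for n t
  define W where "W n z = ?w z * \<eta> n (snd z)" for n z
  have k: "k n > 0" "1 / T \<le> k n" for n using T_pos by (simp_all add: k_def divide_right_mono)
  have klim: "filterlim k at_top sequentially"
    unfolding filterlim_at_top
  proof
    fix Z
    show "eventually (\<lambda>n. Z \<le> k n) sequentially"
      using eventually_ge_at_top[of "nat \<lceil>Z * T\<rceil>"]
    proof eventually_elim
      case (elim n)
      then have "Z * T \<le> real n + 1" by linarith
      then show ?case using T_pos by (simp add: k_def pos_le_divide_eq)
    qed
  qed
  have \<eta>b: "0 \<le> \<eta> n t" "\<eta> n t \<le> 1" for n t by (auto simp: \<eta>_def)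
  have \<eta>l: "\<bar>\<eta> n t - \<eta> n s\<bar> \<le> k n * \<bar>t - s\<bar>" for n t s
  proof -
    have "\<bar>\<eta> n t - \<eta> n s\<bar> \<le> \<bar>(T - t) * k n - (T - s) * k n\<bar>" unfolding \<eta>_def by linarith
    also have "(T - t) * k n - (T - s) * k n = k n * (s - t)" by (simp add: algebra_simps)
    also have "\<bar>k n * (s - t)\<bar> = k n * \<bar>t - s\<bar>" using k(1)[of n] by (simp add: abs_mult abs_minus_commute)
    finally show ?thesis .
  qed
  have "(k n)-lipschitz_on UNIV (\<lambda>z::'d spacetime. \<eta> n (snd z))" for n
  proof (rule lipschitz_onI)
    fix a b :: "'d spacetime"
    have "\<bar>\<eta> n (snd a) - \<eta> n (snd b)\<bar> \<le> k n * \<bar>snd a - snd b\<bar>" by (rule \<eta>l)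
    also have "\<dots> \<le> k n * dist a b"
      using dist_snd_le[of a b] k(1)[of n] by (intro mult_left_mono) (auto simp: dist_real_def)
    finally show "dist (\<eta> n (snd a)) (\<eta> n (snd b)) \<le> k n * dist a b" by (simp add: dist_real_def)
  qed (use k(1)[of n] in simp)
  from lipschitz_mult_bounded[OF L M this, where B = 1] have WL: "(M * k n + 1 * L)-lipschitz_on UNIV (W n)" for n
    unfolding W_def[abs_def] using \<eta>b by fastforce
  have Wder: "(W n has_derivative (\<lambda>h. ?w z * (\<eta>' n (snd z) * snd h) + frechet_derivative ?w (at z) h * \<eta> n (snd z))) (at z)"
    if z: "z \<in> Q" "?w differentiable (at z)" "snd z \<noteq> T - 1 / k n" for n z
  proof -
    have "((\<lambda>z. \<eta> n (snd z)) has_derivative (\<lambda>h. \<eta>' n (snd z) * snd h)) (at z)"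
    proof (cases "T - 1 / k n < snd z")
      case True
      let ?U = "{z::'d spacetime. T - 1 / k n < snd z \<and> snd z < T}"
      have "open {z::'d spacetime. T - 1 / k n < snd z}" "open {z::'d spacetime. snd z < T}"
        by (intro open_Collect_less continuous_intros)+
      then have U: "open ?U" by (rule open_Collect_conj)
      have "((\<lambda>z. (T - snd z) * k n) has_derivative (\<lambda>h. \<eta>' n (snd z) * snd h)) (at z)"
        using True by (auto intro!: derivative_eq_intros simp: \<eta>'_def)
      then show ?thesis
      proof (rule has_derivative_transform_within_open[OF _ U])
        show "z \<in> ?U" using True z(1) by (auto simp: cylinder_def)
        fix y assume y: "y \<in> ?U"
        then have "(T - snd y) * k n \<le> (1 / k n) * k n" using k(1)[of n] by (intro mult_right_mono) auto
        then have "(T - snd y) * k n \<le> 1" using k(1)[of n] by simp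
        moreover have "0 \<le> (T - snd y) * k n" using y k(1)[of n] by simp
        ultimately show "(T - snd y) * k n = \<eta> n (snd y)" by (simp add: \<eta>_def)
      qed
    next
      case False
      let ?U = "{z::'d spacetime. snd z < T - 1 / k n}"
      have U: "open ?U" by (intro open_Collect_less continuous_intros)
      have "((\<lambda>z. 1) has_derivative (\<lambda>h. \<eta>' n (snd z) * snd h)) (at z)" using False by (simp add: \<eta>'_def)
      then show ?thesis
      proof (rule has_derivative_transform_within_open[OF _ U])
        show "z \<in> ?U" using False z(3) by simp
        fix y assume "y \<in> ?U"
        then have "(1 / k n) * k n \<le> (T - snd y) * k n" using k(1)[of n] by (intro mult_right_mono) auto
        then have "1 \<le> (T - snd y) * k n" using k(1)[of n] by simp
        then show "1 = \<eta> n (snd y)" by (simp add: \<eta>_def)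
      qed
    qed
    from has_derivative_mult[OF differentiable_has_frechet[OF z(2)] this] show ?thesis unfolding W_def[abs_def] .
  qed
  let ?H = "\<lambda>z. - (u z * fe_dt v z) + \<nu> z * (uG z \<bullet> fe_grad v z) - (f z * v z + F z \<bullet> fe_grad v z)"
  note fe = fe_weak[OF v Q_open order_refl]
  have "set_integrable lborel Q (\<lambda>z. (- u z) * fe_dt v z + (\<nu> z *\<^sub>R uG z) \<bullet> fe_grad v z - (f z * v z + F z \<bullet> fe_grad v z))"
    by (intro set_integral_add(1) set_integral_diff(1) L2_on_mult_integrable L2_on_inner_integrable L2_on_uminus
        u_weak(2,3) f_L2 F_L2 fe nu_L2_on[OF order_refl Q_open])
  then show H: "set_integrable lborel Q ?H" by simp
  define S where "S n = \<Omega> \<times> {T - 1 / k n<..<T}" for n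
  have kT: "1 / k n \<le> T" for n using k(1)[of n] k(2)[of n] T_pos by (simp add: field_simps)
  have SQ: "S n \<subseteq> Q" for n using kT[of n] by (auto simp: S_def cylinder_def)
  have Sb: "S n \<in> sets lborel" for n
    unfolding S_def using domain_open by (simp add: borel_open open_Times)
  have uw: "set_integrable lborel (S n) (\<lambda>z. u z * ?w z)" for n
  proof (rule set_integrable_subset[OF _ Sb SQ])
    show "set_integrable lborel Q (\<lambda>z. u z * ?w z)"
      by (rule L2_on_mult_integrable[OF u_weak(2) continuous_L2_on[OF lipschitz_on_continuous_on[OF L] Q_borel Q_bounded]])
  qed
  \<comment> \<open>The term with the derivative of the cut-off lives on the last layer
    \<open>S n\<close>, where it is - \<open>k n\<close> times u w: up to sign, a mean over a
    shrinking layer.\<close>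
  have cut: "(\<lambda>z. indicator Q z *\<^sub>R (u z * ?w z * \<eta>' n (snd z))) = (\<lambda>z. (- k n) * (indicator (S n) z *\<^sub>R (u z * ?w z)))" for n
  proof
    fix z
    have "z \<in> S n \<longleftrightarrow> z \<in> Q \<and> T - 1 / k n < snd z"
      using kT[of n] by (auto simp: S_def cylinder_def)
    then show "indicator Q z *\<^sub>R (u z * ?w z * \<eta>' n (snd z)) = (- k n) * (indicator (S n) z *\<^sub>R (u z * ?w z))"
      by (auto simp: \<eta>'_def indicator_def)
  qed
  have cut_i: "set_integrable lborel Q (\<lambda>z. u z * ?w z * \<eta>' n (snd z))" for n
    unfolding set_integrable_def cut by (rule integrable_mult_right) (use uw[of n] in \<open>simp only: set_integrable_def\<close>)
  have cut_int: "(LINT z:Q|lborel. u z * ?w z * \<eta>' n (snd z)) = - (k n * (LINT z:S n|lborel. u z * ?w z))" for n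
    unfolding set_lebesgue_integral_def cut by (subst integral_mult_right_zero) simp
  have \<eta>m: "(\<lambda>z::'d spacetime. \<eta> n (snd z)) \<in> borel_measurable borel" for n
    unfolding \<eta>_def by (intro borel_measurable_continuous_onI continuous_intros)
  have Hm: "(\<lambda>z. indicator Q z *\<^sub>R ?H z) \<in> borel_measurable borel"
    using H unfolding set_integrable_def by (intro borel_measurable_integrable[of lborel, simplified])
  let ?s = "\<lambda>n z. \<eta> n (snd z) * (indicator Q z *\<^sub>R ?H z)"
  have sm: "?s n \<in> borel_measurable lborel" for n
    unfolding measurable_lborel2 by (rule borel_measurable_times[OF \<eta>m Hm])
  have sb: "norm (?s n z) \<le> norm (indicator Q z *\<^sub>R ?H z)" for n z
    unfolding norm_mult by (rule mult_left_le_one_le) (use \<eta>b in auto)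
  have Hi: "integrable lborel (\<lambda>z. indicator Q z *\<^sub>R ?H z)" using H unfolding set_integrable_def .
  have si: "integrable lborel (?s n)" for n
    by (rule Bochner_Integration.integrable_bound[OF Hi sm]) (intro AE_I2 sb)
  have \<eta>H: "set_integrable lborel Q (\<lambda>z. \<eta> n (snd z) * ?H z)" for n
    using si[of n] by (simp add: set_integrable_def mult.left_commute)
  have Wd: "AE z in lborel. z \<in> Q \<longrightarrow> W n differentiable (at z)" for n
    using wd AE_snd_neq[of "T - 1 / k n"] by eventually_elim (use Wder differentiableI in blast)
  have Wdir: "AE z in lborel. z \<in> Q \<longrightarrow> dird (W n) (0, 1) z = ?w z * \<eta>' n (snd z) + fe_dt v z * \<eta> n (snd z) \<and>
      dirgrad (W n) z = \<eta> n (snd z) *\<^sub>R fe_grad v z" for n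
    using wd AE_snd_neq[of "T - 1 / k n"]
  proof eventually_elim
    case (elim z)
    show ?case
    proof
      assume z: "z \<in> Q"
      then have wz: "?w differentiable (at z)" using elim by blast
      have *: "dird (W n) b z = ?w z * (\<eta>' n (snd z) * snd b) + dird ?w b z * \<eta> n (snd z)" for b
        unfolding dird_differentiable[OF wz]
        by (rule dird_eq[OF has_derivative_imp_directional[OF Wder[OF z wz elim(2)]]])
      show "dird (W n) (0, 1) z = ?w z * \<eta>' n (snd z) + fe_dt v z * \<eta> n (snd z) \<and>
        dirgrad (W n) z = \<eta> n (snd z) *\<^sub>R fe_grad v z"
        by (simp add: * fe_dt_def fe_grad_def dirgrad_def vec_eq_iff)
    qed
  qed
  \<comment> \<open>Testing with \<open>W n\<close>: the product rule splits the time derivative,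
    and the part that falls on the cut-off becomes the mean over \<open>S n\<close>.\<close>
  have eq_n: "(LINT z:Q|lborel. \<eta> n (snd z) * ?H z) + k n * (LINT z:S n|lborel. u z * ?w z) = (LINT x:\<Omega>|lborel. u0 x * v (x, 0))" for n
  proof -
    let ?X = "\<lambda>z. - (u z * dird (W n) (0, 1) z) + \<nu> z * (uG z \<bullet> dirgrad (W n) z)"
    let ?Y = "\<lambda>z. f z * W n z + F z \<bullet> dirgrad (W n) z"
    note WL2 = lipschitz_L2_on[OF WL Q_open Q_bounded Wd, of n]
    have "set_integrable lborel Q (\<lambda>z. (- u z) * dird (W n) (0, 1) z + (\<nu> z *\<^sub>R uG z) \<bullet> dirgrad (W n) z)"
      by (intro set_integral_add(1) L2_on_mult_integrable L2_on_inner_integrable L2_on_uminus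
          u_weak(2,3) WL2 nu_L2_on[OF order_refl Q_open])
    then have X: "set_integrable lborel Q ?X" by simp
    have Y: "set_integrable lborel Q ?Y"
      by (intro set_integral_add(1) L2_on_mult_integrable L2_on_inner_integrable f_L2 F_L2 WL2)
    have \<eta>T: "\<eta> n T = 0" by (simp add: \<eta>_def)
    have "T * k n \<ge> 1" using T_pos by (simp add: k_def)
    then have \<eta>0: "\<eta> n 0 = 1" by (simp add: \<eta>_def)
    have "(LINT z:Q|lborel. ?X z) = (LINT z:Q|lborel. ?Y z) + (LINT x:\<Omega>|lborel. u0 x * W n (x, 0))"
      by (rule variational_lipschitz[OF WL _ Wd])
         (simp_all add: W_def \<eta>T fe_ext_outside[OF domain T_pos mesh v])
    moreover have "(LINT x:\<Omega>|lborel. u0 x * W n (x, 0)) = (LINT x:\<Omega>|lborel. u0 x * v (x, 0))"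
      using T_pos by (intro set_integral_eq_on) (simp add: W_def \<eta>0 fe_ext_slice[OF v])
    moreover have "(LINT z:Q|lborel. ?X z) - (LINT z:Q|lborel. ?Y z) = (LINT z:Q|lborel. ?X z - ?Y z)"
      by (rule set_integral_diff(2)[OF X Y, symmetric])
    moreover have "(LINT z:Q|lborel. ?X z - ?Y z) = (LINT z:Q|lborel. \<eta> n (snd z) * ?H z - u z * ?w z * \<eta>' n (snd z))"
    proof (rule set_integral_cong_AE_integrable[OF set_integral_diff(1)[OF X Y] set_integral_diff(1)[OF \<eta>H cut_i]])
      show "AE z in lborel. z \<in> Q \<longrightarrow> ?X z - ?Y z = \<eta> n (snd z) * ?H z - u z * ?w z * \<eta>' n (snd z)"
        using Wdir[of n]
      proof eventually_elim
        case (elim z)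
        show ?case
        proof
          assume z: "z \<in> Q"
          then have vz: "v z = ?w z" using fe_ext_eq_cylinder[OF domain T_pos mesh v] by simp
          have dz: "dird (W n) (0, 1) z = ?w z * \<eta>' n (snd z) + fe_dt v z * \<eta> n (snd z)"
            "dirgrad (W n) z = \<eta> n (snd z) *\<^sub>R fe_grad v z" using elim z by blast+
          show "?X z - ?Y z = \<eta> n (snd z) * ?H z - u z * ?w z * \<eta>' n (snd z)"
            unfolding dz vz W_def by (simp add: algebra_simps)
        qed
      qed
    qed
    moreover have "\<dots> = (LINT z:Q|lborel. \<eta> n (snd z) * ?H z) - (LINT z:Q|lborel. u z * ?w z * \<eta>' n (snd z))"
      by (rule set_integral_diff(2)[OF \<eta>H cut_i])
    ultimately show ?thesis unfolding cut_int by linarith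
  qed
  have lim1: "(\<lambda>n. LINT z:Q|lborel. \<eta> n (snd z) * ?H z) \<longlonglongrightarrow> (LINT z:Q|lborel. ?H z)"
  proof -
    have "(\<lambda>n. LINT z|lborel. ?s n z) \<longlonglongrightarrow> (LINT z|lborel. indicator Q z *\<^sub>R ?H z)"
    proof (rule integral_dominated_convergence[where w="\<lambda>z. norm (indicator Q z *\<^sub>R ?H z)"])
      show "(\<lambda>z. indicator Q z *\<^sub>R ?H z) \<in> borel_measurable lborel" using Hi by simp
      show "integrable lborel (\<lambda>z. norm (indicator Q z *\<^sub>R ?H z))" using Hi by (rule integrable_norm)
      show "AE z in lborel. (\<lambda>n. ?s n z) \<longlonglongrightarrow> indicator Q z *\<^sub>R ?H z"
      proof (rule AE_I2)
        fix z
        show "(\<lambda>n. ?s n z) \<longlonglongrightarrow> indicator Q z *\<^sub>R ?H z"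
        proof (cases "z \<in> Q")
          case True
          then have t: "snd z < T" by (auto simp: cylinder_def)
          have "eventually (\<lambda>n. 1 / (T - snd z) \<le> k n) sequentially" using klim unfolding filterlim_at_top by blast
          then have "eventually (\<lambda>n. indicator Q z *\<^sub>R ?H z = ?s n z) sequentially"
          proof eventually_elim
            case (elim n)
            then have "1 \<le> (T - snd z) * k n" using t by (simp add: field_simps)
            then have "\<eta> n (snd z) = 1" by (simp add: \<eta>_def)
            then show ?case by simp
          qed
          then show ?thesis by (rule Lim_transform_eventually[OF tendsto_const])
        qed simp
      qed
    qed (use sm sb in auto)
    then show ?thesis by (simp add: set_lebesgue_integral_def mult.left_commute)
  qed
  have lim2: "(\<lambda>n. k n * (LINT z:S n|lborel. u z * ?w z)) \<longlonglongrightarrow> (LINT x:\<Omega>|lborel. g x * ?w (x, T))"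
    unfolding S_def by (rule trace_average_tendsto[OF domain_open domain_bounded T_pos u_weak(2) g L M klim k(2)])
  have "(\<lambda>n. (LINT z:Q|lborel. \<eta> n (snd z) * ?H z) + k n * (LINT z:S n|lborel. u z * ?w z)) \<longlonglongrightarrow>
      (LINT z:Q|lborel. ?H z) + (LINT x:\<Omega>|lborel. g x * ?w (x, T))"
    by (rule tendsto_add[OF lim1 lim2])
  then have "(LINT x:\<Omega>|lborel. u0 x * v (x, 0)) = (LINT z:Q|lborel. ?H z) + (LINT x:\<Omega>|lborel. g x * ?w (x, T))"
    unfolding eq_n by (simp add: LIMSEQ_const_iff)
  moreover have "(LINT x:\<Omega>|lborel. g x * ?w (x, T)) = (LINT x:\<Omega>|lborel. g x * v (x, T))"
    using T_pos by (intro set_integral_eq_on) (simp add: fe_ext_slice[OF v])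
  ultimately show "(LINT z:Q|lborel. ?H z) = (LINT x:\<Omega>|lborel. u0 x * v (x, 0)) - (LINT x:\<Omega>|lborel. g x * v (x, T))"
    by simp
qed

lemma u_regular: "has_time_trace \<Omega> T u T g \<Longrightarrow> regular u"
  unfolding regular_def using u_weak(2) u_parabolic_div by blast

text \<open>Inserting f - div_x F for the divergence of \<open>u\<close>, the stabilization terms of
  both forms cancel and the element integrands differ by \<open>?H\<close>. Summed over the mesh,
  \<open>variational_fe\<close> evaluates what is left: the initial term of \<open>l_h\<close> minus
  the final-time term of \<open>a_h\<close>.\<close>

lemma consistency:
  assumes v: "v \<in> V" and g: "has_time_trace \<Omega> T u T g"
  shows "a_h \<Omega> T \<nu> \<T> \<theta> u v = l_h \<Omega> \<T> \<theta> f F u0 v"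
proof -
  let ?H = "\<lambda>z. - (u z * fe_dt v z) + \<nu> z * (uG z \<bullet> fe_grad v z) - (f z * v z + F z \<bullet> fe_grad v z)"
  note H = variational_fe[OF v g]
  let ?I = "\<lambda>K z. f z * v z + F z \<bullet> weak_grad_x (interior K) v z
          + \<theta> K * diameter K * f z * weak_dt (interior K) v z
          - \<theta> K * diameter K * weak_div_x (interior K) F z * weak_dt (interior K) v z"
  have elem: "elem_form K u v = (LINT z:interior K|lborel. ?I K z) + (LINT z:interior K|lborel. ?H z)" if K: "K \<in> \<T>" for K
  proof -
    let ?E = "interior K"
    note S = open_interior[of K] elem_subset[OF K]
    have Sb: "?E \<in> sets borel" by simp
    note pd = u_parabolic_div[OF K]
    note fL = L2_on_subset[OF f_L2 S(2) Sb] L2_on_subset[OF F_L2 S(2) Sb]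
    have gL: "L2_on ?E (weak_div_x ?E F)" using F_div_elem[OF K] unfolding has_weak_div_x_def by blast
    note vL = fe_weak(3)[OF v S] fe_weak_AE(3,4)[OF v S]
    have "set_integrable lborel ?E (\<lambda>z. f z * v z + F z \<bullet> weak_grad_x ?E v z
          + (\<theta> K * diameter K * f z) * weak_dt ?E v z
          - (\<theta> K * diameter K * weak_div_x ?E F z) * weak_dt ?E v z)"
      by (intro set_integral_add(1) set_integral_diff(1) L2_on_mult_integrable L2_on_inner_integrable L2_on_mult fL gL vL)
    then have I: "set_integrable lborel ?E (?I K)" by simp
    have HE: "set_integrable lborel ?E ?H" by (rule set_integrable_subset[OF H(2) _ S(2)]) simp
    have "elem_form K u v = (LINT z:?E|lborel. ?I K z + ?H z)"
      unfolding elem_form_def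
    proof (rule set_integral_cong_AE_integrable[OF elem_integrand_integrable[OF K pd v] set_integral_add(1)[OF I HE]])
      show "AE z in lborel. z \<in> ?E \<longrightarrow> \<nu> z * (weak_grad_x ?E u z \<bullet> weak_grad_x ?E v z) - u z * weak_dt ?E v z
          + \<theta> K * diameter K * parabolic_div ?E \<nu> u z * weak_dt ?E v z = ?I K z + ?H z"
        using fe_weak_AE(1,2)[OF v S] parabolic_div_AE[OF S(1) elem_bounded[OF K] pd]
          weak_grad_x_AE[OF S(1) elem_bounded[OF K] has_weak_grad_x_subset[OF u_weak(1) S]]
      proof eventually_elim
        case (elim z)
        show ?case
        proof
          assume z: "z \<in> ?E"
          have e: "weak_grad_x ?E v z = fe_grad v z" "weak_dt ?E v z = fe_dt v z"
            "parabolic_div ?E \<nu> u z = f z - weak_div_x ?E F z" "weak_grad_x ?E u z = uG z"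
            using elim z by blast+
          show "\<nu> z * (weak_grad_x ?E u z \<bullet> weak_grad_x ?E v z) - u z * weak_dt ?E v z
          + \<theta> K * diameter K * parabolic_div ?E \<nu> u z * weak_dt ?E v z = ?I K z + ?H z"
            unfolding e by (simp add: algebra_simps)
        qed
      qed
    qed
    also have "\<dots> = (LINT z:?E|lborel. ?I K z) + (LINT z:?E|lborel. ?H z)" by (rule set_integral_add(2)[OF I HE])
    finally show ?thesis .
  qed
  have "(\<Sum>K\<in>\<T>. elem_form K u v) = (\<Sum>K\<in>\<T>. LINT z:interior K|lborel. ?I K z) + (\<Sum>K\<in>\<T>. LINT z:interior K|lborel. ?H z)"
    by (simp add: elem sum.distrib)
  also have "(\<Sum>K\<in>\<T>. LINT z:interior K|lborel. ?H z) = (LINT z:Q|lborel. ?H z)"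
    by (rule mesh_set_integral[OF mesh elem_subset H(2), symmetric])
  finally have sum: "(\<Sum>K\<in>\<T>. elem_form K u v) = (\<Sum>K\<in>\<T>. LINT z:interior K|lborel. ?I K z)
      + ((LINT x:\<Omega>|lborel. u0 x * v (x, 0)) - (LINT x:\<Omega>|lborel. g x * v (x, T)))"
    unfolding H(1) .
  note vT = fe_slice_L2_on[OF v less_imp_le[OF T_pos] order_refl]
  have tL: "L2_on \<Omega> (time_trace \<Omega> T u T)" "L2_on \<Omega> g" using time_trace[OF g] g unfolding has_time_trace_def by blast+
  have "(LINT x:\<Omega>|lborel. time_trace \<Omega> T u T x * v (x, T)) = (LINT x:\<Omega>|lborel. g x * v (x, T))"
    by (rule set_integral_cong_AE_integrable[OF L2_on_mult_integrable[OF tL(1) vT] L2_on_mult_integrable[OF tL(2) vT]])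
       (use time_trace_AE[OF domain_open T_pos less_imp_le[OF T_pos] order_refl g L2_on_set_measurable[OF u_weak(2)]] in eventually_elim, simp)
  then show ?thesis unfolding a_h_elem_form sum l_h_def Let_def by simp
qed

end

subsection \<open>Coercivity\<close>

context space_time_fem
begin

text \<open>
  The constant extension in time, multiplied by a cut-off that is \<open>1\<close> on \<open>[0, T]\<close>, has a time
  derivative with vanishing integral; the slabs above \<open>T\<close> and below \<open>0\<close> contribute the end values.
\<close>

lemma fe_energy:
  assumes v: "v \<in> V"
  shows "(LINT z:Q|lborel. v z * fe_dt v z) =
    ((LINT x:\<Omega>|lborel. (v (x, T))\<^sup>2) - (LINT x:\<Omega>|lborel. (v (x, 0))\<^sup>2)) / 2"
proof -
  let ?w = "fe_ext \<Omega> T v"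
  obtain L where L: "L-lipschitz_on UNIV ?w" by (rule fe_ext_lipschitz[OF domain T_pos mesh v])
  obtain M where M: "\<And>z. \<bar>?w z\<bar> \<le> M" using fe_ext_bounded[OF v] by metis
  \<comment> \<open>The ramps have length and slope 1, so that each outer slab contributes its
    squared end value with factor exactly 1.\<close>
  define \<tau> where "\<tau> t = max 0 (min 1 (min (t + 1) (T + 1 - t)))" for t :: real
  have \<tau>b: "\<bar>\<tau> t\<bar> \<le> 1" for t by (auto simp: \<tau>_def)
  have \<tau>L: "1-lipschitz_on UNIV (\<lambda>z::'d spacetime. \<tau> (snd z))"
  proof (rule lipschitz_onI)
    fix a b :: "'d spacetime"
    have "\<bar>\<tau> (snd a) - \<tau> (snd b)\<bar> \<le> \<bar>snd a - snd b\<bar>" unfolding \<tau>_def by linarith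
    also have "\<dots> \<le> dist a b" using dist_snd_le[of a b] by (simp add: dist_real_def)
    finally show "dist (\<tau> (snd a)) (\<tau> (snd b)) \<le> 1 * dist a b" by (simp add: dist_real_def)
  qed simp
  have MM: "\<bar>?w z * ?w z\<bar> \<le> M * M" for z
    unfolding abs_mult using M[of z] by (intro mult_mono) auto
  note w2L = lipschitz_mult_bounded[OF L M L M]
  note \<psi>L = lipschitz_mult_bounded[OF w2L MM \<tau>L \<tau>b]
  let ?\<psi> = "\<lambda>z. ?w z * ?w z * \<tau> (snd z)"
  let ?U = "\<Omega> \<times> {T<..<T + 1}" and ?B = "\<Omega> \<times> {- 1<..<0::real}"
  \<comment> \<open>The time derivative of the squared extension times \<tau>: in the cylinder
    \<tau> is 1, and in the unit layers above and below only \<tau> varies, with slope - 1 and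
    1.\<close>
  let ?D = "\<lambda>z. indicator Q z *\<^sub>R (2 * (v z * fe_dt v z)) - indicator ?U z *\<^sub>R (?w z * ?w z) + indicator ?B z *\<^sub>R (?w z * ?w z)"
  let ?C = "closure \<Omega> \<times> {- 1..T + 1}"
  have C: "compact ?C" using domain_bounded by (intro compact_Times) auto
  have out: "?w z = 0" if "fst z \<notin> \<Omega>" for z
    using fe_ext_outside[OF domain T_pos mesh v that, of "snd z"] by simp
  have \<psi>0: "?\<psi> z = 0" if "z \<notin> ?C" for z
  proof (cases "fst z \<in> \<Omega>")
    case True
    then have "snd z \<notin> {- 1..T + 1}" using that closure_subset[of \<Omega>] by (cases z) auto
    then have "\<tau> (snd z) = 0" by (auto simp: \<tau>_def)
    then show ?thesis by simp
  next
    case False then show ?thesis by (simp add: out)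
  qed
  \<comment> \<open>Only the behaviour along the time line through \<open>z\<close> matters.
    Differentiability in all variables is available in the cylinder, but in the outer layers the
    formula in t with x fixed is enough.\<close>
  have local_eq: "((\<lambda>s. ?\<psi> (z + s *\<^sub>R (0, 1))) has_real_derivative D) (at 0)"
    if "open I" "snd z \<in> I" "\<And>t. t \<in> I \<Longrightarrow> ?\<psi> (fst z, t) = q t" "(q has_real_derivative D) (at (snd z))" for z q I D
  proof -
    have "((\<lambda>s. q (snd z + s)) has_real_derivative D) (at 0)"
      using that(4) DERIV_at_within_shift[of q D "snd z" 0 UNIV] by (simp add: DERIV_shift)
    then show ?thesis
    proof (rule has_field_derivative_transform_within_open)
      show "open ((\<lambda>s. snd z + s) -` I)" using that(1) by (intro open_vimage continuous_intros)
      show "0 \<in> (\<lambda>s. snd z + s) -` I" using that(2) by simp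
      fix s assume "s \<in> (\<lambda>s. snd z + s) -` I"
      then have "?\<psi> (fst z, snd z + s) = q (snd z + s)" by (intro that(3)) simp
      moreover have "z + s *\<^sub>R (0, 1) = (fst z, snd z + s)" by (simp add: prod_eq_iff)
      ultimately show "q (snd z + s) = ?\<psi> (z + s *\<^sub>R (0, 1))" by simp
    qed
  qed
  have der: "AE z in lborel. ((\<lambda>s. ?\<psi> (z + s *\<^sub>R (0, 1))) has_real_derivative ?D z) (at 0)"
    using fe_ext_differentiable[OF domain T_pos mesh v] AE_snd_neq[of 0] AE_snd_neq[of T] AE_snd_neq[of "- 1"] AE_snd_neq[of "T + 1"]
  proof eventually_elim
    case (elim z)
    show ?case
    proof (cases "fst z \<in> \<Omega>")
      case False
      then have "?D z = 0" by (cases z) (auto simp: cylinder_def)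
      moreover have "((\<lambda>s. ?\<psi> (z + s *\<^sub>R (0, 1))) has_real_derivative 0) (at 0)"
        using False by (intro local_eq[of UNIV _ "\<lambda>_. 0"]) (simp_all add: out)
      ultimately show ?thesis by simp
    next
      case True
      consider "snd z < - 1" | "- 1 < snd z" "snd z < 0" | "0 < snd z" "snd z < T" | "T < snd z" "snd z < T + 1" | "T + 1 < snd z"
        using elim by linarith
      then show ?thesis
      proof cases
        case 1
        then have "?D z = 0" using T_pos by (cases z) (auto simp: cylinder_def)
        moreover have "((\<lambda>s. ?\<psi> (z + s *\<^sub>R (0, 1))) has_real_derivative 0) (at 0)"
          using 1 by (intro local_eq[of "{..<- 1}" _ "\<lambda>_. 0"]) (simp_all add: \<tau>_def)
        ultimately show ?thesis by simp
      next
        case 5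
        then have "?D z = 0" using T_pos by (cases z) (auto simp: cylinder_def)
        moreover have "((\<lambda>s. ?\<psi> (z + s *\<^sub>R (0, 1))) has_real_derivative 0) (at 0)"
          using 5 by (intro local_eq[of "{T + 1<..}" _ "\<lambda>_. 0"]) (simp_all add: \<tau>_def)
        ultimately show ?thesis by simp
      next
        case 2
        let ?c = "?w z * ?w z"
        have "?D z = ?c" using 2 True T_pos by (cases z) (auto simp: cylinder_def)
        moreover have "((\<lambda>s. ?\<psi> (z + s *\<^sub>R (0, 1))) has_real_derivative ?c) (at 0)"
        proof (rule local_eq[of "{- 1<..<0}" _ "\<lambda>t. ?c * (t + 1)"])
          fix t :: real assume t: "t \<in> {- 1<..<0}"
          have "?w (fst z, t) = ?w z" using t 2 T_pos by (simp add: fe_ext_def)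
          moreover have "\<tau> t = t + 1" using t T_pos by (simp add: \<tau>_def)
          ultimately show "?\<psi> (fst z, t) = ?c * (t + 1)" by simp
        qed (use 2 in \<open>auto intro!: derivative_eq_intros\<close>)
        ultimately show ?thesis by simp
      next
        case 4
        let ?c = "?w z * ?w z"
        have "?D z = - ?c" using 4 True T_pos by (cases z) (auto simp: cylinder_def)
        moreover have "((\<lambda>s. ?\<psi> (z + s *\<^sub>R (0, 1))) has_real_derivative - ?c) (at 0)"
        proof (rule local_eq[of "{T<..<T + 1}" _ "\<lambda>t. ?c * (T + 1 - t)"])
          fix t :: real assume t: "t \<in> {T<..<T + 1}"
          have "?w (fst z, t) = ?w z" using t 4 T_pos by (simp add: fe_ext_def)
          moreover have "\<tau> t = T + 1 - t" using t T_pos by (simp add: \<tau>_def)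
          ultimately show "?\<psi> (fst z, t) = ?c * (T + 1 - t)" by simp
        qed (use 4 in \<open>auto intro!: derivative_eq_intros\<close>)
        ultimately show ?thesis by simp
      next
        case 3
        then have z: "z \<in> Q" using True by (cases z) (simp add: cylinder_def)
        then have wz: "?w differentiable (at z)" using elim by blast
        have wd: "((\<lambda>s. ?w (z + s *\<^sub>R (0, 1))) has_real_derivative fe_dt v z) (at 0)"
          unfolding fe_dt_def dird_differentiable[OF wz]
          by (rule has_derivative_imp_directional[OF differentiable_has_frechet[OF wz]])
        have "((\<lambda>s. ?w (z + s *\<^sub>R (0, 1)) * ?w (z + s *\<^sub>R (0, 1))) has_real_derivative
            fe_dt v z * ?w (z + 0 *\<^sub>R (0, 1)) + fe_dt v z * ?w (z + 0 *\<^sub>R (0, 1))) (at 0)"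
          by (rule DERIV_mult[OF wd wd])
        then have w2: "((\<lambda>s. ?w (z + s *\<^sub>R (0, 1)) * ?w (z + s *\<^sub>R (0, 1))) has_real_derivative 2 * (v z * fe_dt v z)) (at 0)"
          using fe_ext_eq_cylinder[OF domain T_pos mesh v z] by (simp add: zero_prod_def[symmetric] mult.commute)
        have "?D z = 2 * (v z * fe_dt v z)" using z 3 by (cases z) auto
        moreover have "((\<lambda>s. ?\<psi> (z + s *\<^sub>R (0, 1))) has_real_derivative 2 * (v z * fe_dt v z)) (at 0)"
          using w2
        proof (rule has_field_derivative_transform_within_open[where S="{- snd z<..<T - snd z}"])
          fix s assume "s \<in> {- snd z<..<T - snd z}"
          then have "\<tau> (snd (z + s *\<^sub>R (0, 1))) = 1" by (simp add: \<tau>_def)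
          then show "?w (z + s *\<^sub>R (0, 1)) * ?w (z + s *\<^sub>R (0, 1)) = ?\<psi> (z + s *\<^sub>R (0, 1))" by simp
        qed (use 3 in auto)
        ultimately show ?thesis by simp
      qed
    qed
  qed
  have wc: "continuous_on UNIV (\<lambda>z. ?w z * ?w z)" by (rule lipschitz_on_continuous_on[OF w2L])
  have slab: "set_integrable lborel (\<Omega> \<times> {a<..<b}) (\<lambda>z. ?w z * ?w z)" for a b :: real
  proof (rule L2_on_integrable[OF continuous_L2_on[OF wc]])
    show "\<Omega> \<times> {a<..<b} \<in> sets borel" "\<Omega> \<times> {a<..<b} \<in> sets borel"
      using domain_open by (simp_all add: borel_open open_Times)
    show "bounded (\<Omega> \<times> {a<..<b})" "bounded (\<Omega> \<times> {a<..<b})" using domain_bounded by (simp_all add: bounded_Times)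
  qed
  note fe = fe_weak[OF v Q_open order_refl]
  have Qi: "set_integrable lborel Q (\<lambda>z. 2 * (v z * fe_dt v z))"
    by (rule set_integrable_mult_right[OF L2_on_mult_integrable[OF fe(3,5)]])
  have ints: "integrable lborel (\<lambda>z. indicator Q z *\<^sub>R (2 * (v z * fe_dt v z)))"
    "integrable lborel (\<lambda>z. indicator ?U z *\<^sub>R (?w z * ?w z))" "integrable lborel (\<lambda>z. indicator ?B z *\<^sub>R (?w z * ?w z))"
    using Qi slab unfolding set_integrable_def by blast+
  have Dm: "?D \<in> borel_measurable lborel"
    using Bochner_Integration.integrable_add[OF Bochner_Integration.integrable_diff[OF ints(1,2)] ints(3)]
    by (rule borel_measurable_integrable)
  have "0 = (LINT z|lborel. dird ?\<psi> (0, 1) z)"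
    by (rule integral_dird_eq_0(2)[OF \<psi>L C \<psi>0 der, symmetric])
  also have "\<dots> = (LINT z|lborel. ?D z)"
  proof (rule integral_cong_AE[OF _ Dm])
    show "dird ?\<psi> (0, 1) \<in> borel_measurable lborel"
      using borel_measurable_dird[OF lipschitz_on_continuous_on[OF \<psi>L]] by simp
    show "AE z in lborel. dird ?\<psi> (0, 1) z = ?D z" using der by eventually_elim (rule dird_eq)
  qed
  also have "\<dots> = (LINT z:Q|lborel. 2 * (v z * fe_dt v z)) - (LINT z:?U|lborel. ?w z * ?w z) + (LINT z:?B|lborel. ?w z * ?w z)"
    unfolding set_lebesgue_integral_def
    by (subst Bochner_Integration.integral_add[OF Bochner_Integration.integrable_diff[OF ints(1,2)] ints(3)],
        subst Bochner_Integration.integral_diff[OF ints(1,2)]) simp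
  also have "(LINT z:?U|lborel. ?w z * ?w z) = (LINT t:{T<..<T + 1}|lborel. (LINT x:\<Omega>|lborel. (v (x, T))\<^sup>2))"
    unfolding slab_integral(1)[OF slab]
  proof (rule set_integral_eq_on)
    fix t assume t: "t \<in> {T<..<T + 1}"
    show "(LINT x:\<Omega>|lborel. ?w (x, t) * ?w (x, t)) = (LINT x:\<Omega>|lborel. (v (x, T))\<^sup>2)"
    proof (rule set_integral_eq_on)
      fix x assume x: "x \<in> \<Omega>"
      have "?w (x, t) = ?w (x, T)" using t T_pos by (simp add: fe_ext_def)
      also have "\<dots> = v (x, T)" using fe_ext_slice[OF v x] T_pos by simp
      finally show "?w (x, t) * ?w (x, t) = (v (x, T))\<^sup>2" by (simp add: power2_eq_square)
    qed
  qed
  also have "\<dots> = (LINT x:\<Omega>|lborel. (v (x, T))\<^sup>2)" by (subst set_lebesgue_integral_def) simp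
  also have "(LINT z:?B|lborel. ?w z * ?w z) = (LINT t:{- 1<..<0::real}|lborel. (LINT x:\<Omega>|lborel. (v (x, 0))\<^sup>2))"
    unfolding slab_integral(1)[OF slab]
  proof (rule set_integral_eq_on)
    fix t :: real assume t: "t \<in> {- 1<..<0}"
    show "(LINT x:\<Omega>|lborel. ?w (x, t) * ?w (x, t)) = (LINT x:\<Omega>|lborel. (v (x, 0))\<^sup>2)"
    proof (rule set_integral_eq_on)
      fix x assume x: "x \<in> \<Omega>"
      have "?w (x, t) = ?w (x, 0)" using t T_pos by (simp add: fe_ext_def)
      also have "\<dots> = v (x, 0)" using fe_ext_slice[OF v x] T_pos by simp
      finally show "?w (x, t) * ?w (x, t) = (v (x, 0))\<^sup>2" by (simp add: power2_eq_square)
    qed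
  qed
  also have "\<dots> = (LINT x:\<Omega>|lborel. (v (x, 0))\<^sup>2)" by (subst set_lebesgue_integral_def) simp
  also have "(LINT z:Q|lborel. 2 * (v z * fe_dt v z)) = 2 * (LINT z:Q|lborel. v z * fe_dt v z)"
    by (rule set_integral_mult_right)
  finally show ?thesis by simp
qed

end

section \<open>Minkowski's inequality for extended-valued norms\<close>

lemma sqrt_ennreal_eq: "r \<ge> 0 \<Longrightarrow> sqrt_ennreal (ennreal r) = ennreal (sqrt r)"
  by (simp add: sqrt_ennreal_def)

lemma sqrt_ennreal_top: "sqrt_ennreal top = top"
  by (simp add: sqrt_ennreal_def)

lemma set_integral_nonneg_real:
  fixes f :: "'a \<Rightarrow> real"
  assumes "\<And>z. z \<in> S \<Longrightarrow> 0 \<le> f z" shows "0 \<le> (LINT z:S|M. f z)"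
  unfolding set_lebesgue_integral_def using assms by (intro integral_nonneg_AE AE_I2) (simp add: indicator_def)

lemma L2_norm_on_eq:
  assumes "L2_on S f" shows "L2_norm_on S f = ennreal (sqrt (LINT z:S|lborel. (norm (f z))\<^sup>2))"
  unfolding L2_norm_on_def L2_sq_eq_integral[OF assms] by (rule sqrt_ennreal_eq[OF set_integral_nonneg_real]) simp

text \<open>The defect is (s a - b)^2 / s, which is non-negative.\<close>

lemma weighted_sq_sum_le:
  fixes a b s :: real assumes "s > 0" shows "(a + b)\<^sup>2 \<le> (1 + s) * a\<^sup>2 + (1 + 1 / s) * b\<^sup>2"
proof -
  have "0 \<le> (s * a - b)\<^sup>2 / s" using assms by simp
  also have "\<dots> = s * a\<^sup>2 - 2 * a * b + b\<^sup>2 / s"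
    using assms by (simp add: power2_eq_square field_simps)
  finally show ?thesis by (simp add: power2_sum algebra_simps)
qed

text \<open>Unlike the triangle inequality, this form is linear in the squares, so it can be added
  over elements and terms before any root is taken; the weight is optimized only at the end.\<close>

lemma L2_sq_weighted_le:
  assumes f: "L2_on S f" and g: "L2_on S g" and s: "s > 0"
  shows "L2_sq S (\<lambda>z. f z + g z) \<le> ennreal (1 + s) * L2_sq S f + ennreal (1 + 1 / s) * L2_sq S g"
proof -
  let ?f = "\<lambda>z. indicator S z *\<^sub>R f z" and ?g = "\<lambda>z. indicator S z *\<^sub>R g z"
  have m: "(\<lambda>z. ennreal ((norm (?f z))\<^sup>2)) \<in> borel_measurable lborel"
    unfolding measurable_lborel2 by (rule measurable_compose[OF L2_on_measurable[OF f]]) measurable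
  have m': "(\<lambda>z. ennreal ((norm (?g z))\<^sup>2)) \<in> borel_measurable lborel"
    unfolding measurable_lborel2 by (rule measurable_compose[OF L2_on_measurable[OF g]]) measurable
  have "L2_sq S (\<lambda>z. f z + g z) \<le>
      (\<integral>\<^sup>+z. ennreal (1 + s) * ennreal ((norm (?f z))\<^sup>2) + ennreal (1 + 1 / s) * ennreal ((norm (?g z))\<^sup>2) \<partial>lborel)"
    unfolding L2_sq_indicator
  proof (rule nn_integral_mono)
    fix z
    have "(norm (?f z + ?g z))\<^sup>2 \<le> (norm (?f z) + norm (?g z))\<^sup>2"
      by (intro power_mono norm_triangle_ineq) simp
    also have "\<dots> \<le> (1 + s) * (norm (?f z))\<^sup>2 + (1 + 1 / s) * (norm (?g z))\<^sup>2"
      by (rule weighted_sq_sum_le[OF s])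
    finally have "ennreal ((norm (?f z + ?g z))\<^sup>2) \<le> ennreal ((1 + s) * (norm (?f z))\<^sup>2 + (1 + 1 / s) * (norm (?g z))\<^sup>2)"
      by (rule ennreal_leI)
    also have "\<dots> = ennreal (1 + s) * ennreal ((norm (?f z))\<^sup>2) + ennreal (1 + 1 / s) * ennreal ((norm (?g z))\<^sup>2)"
      using s by (subst ennreal_plus) (simp_all add: ennreal_mult)
    finally show "ennreal ((norm (indicator S z *\<^sub>R (f z + g z)))\<^sup>2) \<le>
        ennreal (1 + s) * ennreal ((norm (?f z))\<^sup>2) + ennreal (1 + 1 / s) * ennreal ((norm (?g z))\<^sup>2)"
      by (simp only: scaleR_add_right)
  qed
  also have "\<dots> = ennreal (1 + s) * L2_sq S f + ennreal (1 + 1 / s) * L2_sq S g"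
    unfolding L2_sq_indicator using m m'
    by (subst nn_integral_add) (simp_all add: nn_integral_cmult borel_measurable_times_ennreal del: ennreal_plus)
  finally show ?thesis .
qed

text \<open>
  Minkowski's inequality for a quadratic form, from its weighted form for all weights \<open>s\<close>.
\<close>

lemma sqrt_ennreal_triangle:
  assumes C: "\<And>s. s > 0 \<Longrightarrow> C \<le> ennreal (1 + s) * A + ennreal (1 + 1 / s) * B"
  shows "sqrt_ennreal C \<le> sqrt_ennreal A + sqrt_ennreal B"
proof (cases A)
  case top
  then show ?thesis by (simp add: sqrt_ennreal_top)
next
  case A: (real a)
  show ?thesis
  proof (cases B)
    case top
    then show ?thesis by (simp add: sqrt_ennreal_top)
  next
    case B: (real b)
    have Cs: "C \<le> ennreal ((1 + s) * a + (1 + 1 / s) * b)" if "s > 0" for s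
      using C[OF that] A B that by (simp add: ennreal_mult[symmetric] ennreal_plus[symmetric] del: ennreal_plus)
    then have "C < top" using Cs[of 1] by (simp add: order.strict_trans1 ennreal_less_top)
    then obtain c where c: "c \<ge> 0" "C = ennreal c" by (cases C) auto
    have cs: "c \<le> (1 + s) * a + (1 + 1 / s) * b" if "s > 0" for s
      using Cs[OF that] c A(1) B(1) that by (subst (asm) c(2), subst (asm) ennreal_le_iff) (auto intro!: add_nonneg_nonneg mult_nonneg_nonneg)
    have "sqrt c \<le> sqrt a + sqrt b"
    proof (rule field_le_epsilon)
      fix e :: real assume e: "e > 0"
      \<comment> \<open>Enlarging both roots by e / 2 permits the weight y / x, close to the optimal
        one, even if \<open>a\<close> or \<open>b\<close> is 0.\<close>
      define x y where "x = sqrt a + e / 2" and "y = sqrt b + e / 2"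
      have xy: "x > 0" "y > 0" using e A(1) B(1) by (auto simp: x_def y_def intro: add_nonneg_pos)
      have "a \<le> x\<^sup>2" "b \<le> y\<^sup>2"
        using power_mono[of "sqrt a" x 2] power_mono[of "sqrt b" y 2] e A(1) B(1) by (simp_all add: x_def y_def)
      then have "c \<le> (1 + y / x) * x\<^sup>2 + (1 + 1 / (y / x)) * y\<^sup>2"
        using cs[of "y / x"] xy by (intro order.trans[OF cs[of "y / x"]] add_mono mult_left_mono) auto
      also have "\<dots> = (x + y)\<^sup>2" using xy by (simp add: power2_eq_square field_simps)
      finally have "sqrt c \<le> x + y" using xy by (intro real_le_lsqrt) auto
      then show "sqrt c \<le> sqrt a + sqrt b + e" by (simp add: x_def y_def)
    qed
    then have "ennreal (sqrt c) \<le> ennreal (sqrt a) + ennreal (sqrt b)"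
      using A(1) B(1) by (simp add: ennreal_plus[symmetric] ennreal_leI del: ennreal_plus)
    then show ?thesis using A B c by (simp add: sqrt_ennreal_eq)
  qed
qed

section \<open>Triangle inequality for the discrete norm, energies and the coercivity proof\<close>

context space_time_fem
begin

lemma nu_sqrt_L2_on:
  assumes S: "open S" "S \<subseteq> Q" and G: "L2_on S G"
  shows "L2_on S (\<lambda>z. sqrt (\<nu> z) *\<^sub>R G z)"
    and "AE z in lborel. z \<in> S \<longrightarrow> (norm (sqrt (\<nu> z) *\<^sub>R G z))\<^sup>2 = \<nu> z * (G z \<bullet> G z)"
proof -
  show "L2_on S (\<lambda>z. sqrt (\<nu> z) *\<^sub>R G z)"
  proof (rule L2_on_mult_bounded[OF G])
    have "(\<lambda>z. sqrt (indicator S z *\<^sub>R \<nu> z)) \<in> borel_measurable lborel"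
      using nu_set_measurable[OF S(2,1)] unfolding set_borel_measurable_def
      by (rule measurable_compose)
         (intro borel_measurable_continuous_onI continuous_on_real_sqrt continuous_on_id)
    moreover have "(\<lambda>z. sqrt (indicator S z *\<^sub>R \<nu> z)) = (\<lambda>z. indicator S z *\<^sub>R sqrt (\<nu> z))"
      by (rule ext) (simp add: indicator_def)
    ultimately show "set_borel_measurable lborel S (\<lambda>z. sqrt (\<nu> z))" by (simp add: set_borel_measurable_def)
    show "AE z in lborel. z \<in> S \<longrightarrow> \<bar>sqrt (\<nu> z)\<bar> \<le> sqrt \<nu>_hi"
      using nu_bounds
    proof eventually_elim
      case (elim z)
      show ?case
      proof
        assume "z \<in> S"
        then have "\<nu>_lo \<le> \<nu> z" "\<nu> z \<le> \<nu>_hi" using elim S(2) by blast+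
        then show "\<bar>sqrt (\<nu> z)\<bar> \<le> sqrt \<nu>_hi" using nu_lo_pos by simp
      qed
    qed
  qed
  show "AE z in lborel. z \<in> S \<longrightarrow> (norm (sqrt (\<nu> z) *\<^sub>R G z))\<^sup>2 = \<nu> z * (G z \<bullet> G z)"
    using nu_bounds
  proof eventually_elim
    case (elim z)
    show ?case
    proof
      assume "z \<in> S"
      then have "\<nu>_lo \<le> \<nu> z" using elim S(2) by blast
      then show "(norm (sqrt (\<nu> z) *\<^sub>R G z))\<^sup>2 = \<nu> z * (G z \<bullet> G z)"
        using nu_lo_pos by (simp add: power_mult_distrib power2_norm_eq_inner)
    qed
  qed
qed

text \<open>If a gradient on the right is missing, its term is infinite by definition and so is the
  right side; otherwise the weak gradient of the sum exists and is the sum almost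
  everywhere.\<close>

lemma sq_grad_term_weighted_le:
  assumes K: "K \<in> \<T>" and s: "s > 0"
  shows "sq_grad_term \<nu> (interior K) (\<lambda>z. y1 z + y2 z) \<le>
    ennreal (1 + s) * sq_grad_term \<nu> (interior K) y1 + ennreal (1 + 1 / s) * sq_grad_term \<nu> (interior K) y2"
proof (cases "(\<exists>G. has_weak_grad_x (interior K) y1 G) \<and> (\<exists>G. has_weak_grad_x (interior K) y2 G)")
  case True
  let ?E = "interior K"
  note S = open_interior[of K] elem_subset[OF K]
  have G: "has_weak_grad_x ?E y1 (weak_grad_x ?E y1)" "has_weak_grad_x ?E y2 (weak_grad_x ?E y2)"
    using True weak_grad_x by blast+
  have Gs: "has_weak_grad_x ?E (\<lambda>z. y1 z + y2 z) (\<lambda>z. weak_grad_x ?E y1 z + weak_grad_x ?E y2 z)"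
    using has_weak_grad_x_add_scaled[OF S(1) G, of 1] by simp
  have L: "L2_on ?E (weak_grad_x ?E y1)" "L2_on ?E (weak_grad_x ?E y2)" using G unfolding has_weak_grad_x_def by blast+
  have "sq_grad_term \<nu> ?E (\<lambda>z. y1 z + y2 z) = L2_sq ?E (\<lambda>z. sqrt (\<nu> z) *\<^sub>R weak_grad_x ?E (\<lambda>z. y1 z + y2 z) z)"
    unfolding sq_grad_term_def using Gs by (meson)
  also have "\<dots> = L2_sq ?E (\<lambda>z. sqrt (\<nu> z) *\<^sub>R weak_grad_x ?E y1 z + sqrt (\<nu> z) *\<^sub>R weak_grad_x ?E y2 z)"
    by (rule L2_sq_cong_AE)
       (use weak_grad_x_AE[OF S(1) elem_bounded[OF K] Gs] in eventually_elim, simp add: scaleR_add_right)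
  also have "\<dots> \<le> ennreal (1 + s) * L2_sq ?E (\<lambda>z. sqrt (\<nu> z) *\<^sub>R weak_grad_x ?E y1 z) + ennreal (1 + 1 / s) * L2_sq ?E (\<lambda>z. sqrt (\<nu> z) *\<^sub>R weak_grad_x ?E y2 z)"
    by (rule L2_sq_weighted_le[OF nu_sqrt_L2_on(1)[OF S L(1)] nu_sqrt_L2_on(1)[OF S L(2)] s])
  finally show ?thesis using True by (simp add: sq_grad_term_def)
next
  case False
  then have "sq_grad_term \<nu> (interior K) y1 = \<infinity> \<or> sq_grad_term \<nu> (interior K) y2 = \<infinity>"
    by (auto simp: sq_grad_term_def)
  then show ?thesis using s by (auto simp: ennreal_mult_top add_pos_pos)
qed

lemma sq_dt_term_weighted_le:
  assumes K: "K \<in> \<T>" and s: "s > 0"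
  shows "sq_dt_term (interior K) (\<lambda>z. y1 z + y2 z) \<le>
    ennreal (1 + s) * sq_dt_term (interior K) y1 + ennreal (1 + 1 / s) * sq_dt_term (interior K) y2"
proof (cases "(\<exists>g. has_weak_dt (interior K) y1 g) \<and> (\<exists>g. has_weak_dt (interior K) y2 g)")
  case True
  let ?E = "interior K"
  note S = open_interior[of K]
  have G: "has_weak_dt ?E y1 (weak_dt ?E y1)" "has_weak_dt ?E y2 (weak_dt ?E y2)"
    using True weak_dt by blast+
  have Gs: "has_weak_dt ?E (\<lambda>z. y1 z + y2 z) (\<lambda>z. weak_dt ?E y1 z + weak_dt ?E y2 z)"
    using has_weak_dt_add_scaled[OF S G, of 1] by simp
  have L: "L2_on ?E (weak_dt ?E y1)" "L2_on ?E (weak_dt ?E y2)" using G unfolding has_weak_dt_def by blast+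
  have "sq_dt_term ?E (\<lambda>z. y1 z + y2 z) = L2_sq ?E (weak_dt ?E (\<lambda>z. y1 z + y2 z))"
    unfolding sq_dt_term_def using Gs by (meson)
  also have "\<dots> = L2_sq ?E (\<lambda>z. weak_dt ?E y1 z + weak_dt ?E y2 z)"
    by (rule L2_sq_cong_AE[OF weak_dt_AE[OF S elem_bounded[OF K] Gs]])
  also have "\<dots> \<le> ennreal (1 + s) * L2_sq ?E (weak_dt ?E y1) + ennreal (1 + 1 / s) * L2_sq ?E (weak_dt ?E y2)"
    by (rule L2_sq_weighted_le[OF L s])
  finally show ?thesis using True by (simp add: sq_dt_term_def)
next
  case False
  then have "sq_dt_term (interior K) y1 = \<infinity> \<or> sq_dt_term (interior K) y2 = \<infinity>"
    by (auto simp: sq_dt_term_def)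
  then show ?thesis using s by (auto simp: ennreal_mult_top add_pos_pos)
qed

lemma sq_trace_term_weighted_le:
  assumes y: "L2_on Q y1" "L2_on Q y2" and t: "0 \<le> t" "t \<le> T" and s: "s > 0"
  shows "sq_trace_term \<Omega> T (\<lambda>z. y1 z + y2 z) t \<le>
    ennreal (1 + s) * sq_trace_term \<Omega> T y1 t + ennreal (1 + 1 / s) * sq_trace_term \<Omega> T y2 t"
proof (cases "(\<exists>g. has_time_trace \<Omega> T y1 t g) \<and> (\<exists>g. has_time_trace \<Omega> T y2 t g)")
  case True
  then obtain g1 g2 where g: "has_time_trace \<Omega> T y1 t g1" "has_time_trace \<Omega> T y2 t g2" by blast
  have tr: "has_time_trace \<Omega> T (\<lambda>z. y1 z + y2 z) t (\<lambda>x. time_trace \<Omega> T y1 t x + time_trace \<Omega> T y2 t x)"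
    "AE x in lborel. x \<in> \<Omega> \<longrightarrow> time_trace \<Omega> T (\<lambda>z. y1 z + y2 z) t x = time_trace \<Omega> T y1 t x + time_trace \<Omega> T y2 t x"
    using time_trace_add_scaled_AE[OF g y t, of 1] by simp_all
  have L: "L2_on \<Omega> (time_trace \<Omega> T y1 t)" "L2_on \<Omega> (time_trace \<Omega> T y2 t)"
    using time_trace[OF g(1)] time_trace[OF g(2)] unfolding has_time_trace_def by blast+
  have "sq_trace_term \<Omega> T (\<lambda>z. y1 z + y2 z) t = L2_sq \<Omega> (time_trace \<Omega> T (\<lambda>z. y1 z + y2 z) t)"
    unfolding sq_trace_term_def using tr(1) by (meson)
  also have "\<dots> = L2_sq \<Omega> (\<lambda>x. time_trace \<Omega> T y1 t x + time_trace \<Omega> T y2 t x)" by (rule L2_sq_cong_AE[OF tr(2)])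
  also have "\<dots> \<le> ennreal (1 + s) * L2_sq \<Omega> (time_trace \<Omega> T y1 t) + ennreal (1 + 1 / s) * L2_sq \<Omega> (time_trace \<Omega> T y2 t)"
    by (rule L2_sq_weighted_le[OF L s])
  finally show ?thesis using True by (simp add: sq_trace_term_def)
next
  case False
  then have "sq_trace_term \<Omega> T y1 t = \<infinity> \<or> sq_trace_term \<Omega> T y2 t = \<infinity>"
    by (auto simp: sq_trace_term_def)
  then show ?thesis using s by (auto simp: ennreal_mult_top add_pos_pos)
qed

lemma norm_h_triangle:
  assumes y: "L2_on Q y1" "L2_on Q y2"
  shows "norm_h \<Omega> T \<nu> \<T> \<theta> (\<lambda>z. y1 z + y2 z) \<le> norm_h \<Omega> T \<nu> \<T> \<theta> y1 + norm_h \<Omega> T \<nu> \<T> \<theta> y2"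
  unfolding norm_h_def
proof (rule sqrt_ennreal_triangle)
  fix s :: real assume s: "s > 0"
  let ?a = "ennreal (1 + s)" and ?b = "ennreal (1 + 1 / s)"
  let ?S = "\<lambda>y. \<Sum>K\<in>\<T>. sq_grad_term \<nu> (interior K) y + ennreal (\<theta> K * diameter K) * sq_dt_term (interior K) y"
  have "?S (\<lambda>z. y1 z + y2 z) \<le> (\<Sum>K\<in>\<T>. ?a * (sq_grad_term \<nu> (interior K) y1 + ennreal (\<theta> K * diameter K) * sq_dt_term (interior K) y1)
      + ?b * (sq_grad_term \<nu> (interior K) y2 + ennreal (\<theta> K * diameter K) * sq_dt_term (interior K) y2))"
  proof (rule sum_mono)
    fix K assume K: "K \<in> \<T>"
    let ?c = "ennreal (\<theta> K * diameter K)"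
    have "sq_grad_term \<nu> (interior K) (\<lambda>z. y1 z + y2 z) + ?c * sq_dt_term (interior K) (\<lambda>z. y1 z + y2 z) \<le>
      (?a * sq_grad_term \<nu> (interior K) y1 + ?b * sq_grad_term \<nu> (interior K) y2) +
      ?c * (?a * sq_dt_term (interior K) y1 + ?b * sq_dt_term (interior K) y2)"
      by (intro add_mono mult_left_mono sq_grad_term_weighted_le[OF K s] sq_dt_term_weighted_le[OF K s]) simp
    then show "sq_grad_term \<nu> (interior K) (\<lambda>z. y1 z + y2 z) + ?c * sq_dt_term (interior K) (\<lambda>z. y1 z + y2 z) \<le>
      ?a * (sq_grad_term \<nu> (interior K) y1 + ?c * sq_dt_term (interior K) y1)
      + ?b * (sq_grad_term \<nu> (interior K) y2 + ?c * sq_dt_term (interior K) y2)"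
      by (simp only: distrib_left ac_simps)
  qed
  also have "\<dots> = ?a * ?S y1 + ?b * ?S y2" unfolding sum_distrib_left by (rule sum.distrib)
  finally have S: "?S (\<lambda>z. y1 z + y2 z) \<le> ?a * ?S y1 + ?b * ?S y2" .
  have "?S (\<lambda>z. y1 z + y2 z) + sq_trace_term \<Omega> T (\<lambda>z. y1 z + y2 z) T + sq_trace_term \<Omega> T (\<lambda>z. y1 z + y2 z) 0 \<le>
    (?a * ?S y1 + ?b * ?S y2) + (?a * sq_trace_term \<Omega> T y1 T + ?b * sq_trace_term \<Omega> T y2 T)
    + (?a * sq_trace_term \<Omega> T y1 0 + ?b * sq_trace_term \<Omega> T y2 0)"
    using T_pos by (intro add_mono S sq_trace_term_weighted_le[OF y _ _ s]) auto
  also have "\<dots> = ?a * (?S y1 + sq_trace_term \<Omega> T y1 T + sq_trace_term \<Omega> T y1 0)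
    + ?b * (?S y2 + sq_trace_term \<Omega> T y2 T + sq_trace_term \<Omega> T y2 0)"
    by (simp only: distrib_left ac_simps)
  finally show "?S (\<lambda>z. y1 z + y2 z) + sq_trace_term \<Omega> T (\<lambda>z. y1 z + y2 z) T + sq_trace_term \<Omega> T (\<lambda>z. y1 z + y2 z) 0 \<le>
    ?a * (?S y1 + sq_trace_term \<Omega> T y1 T + sq_trace_term \<Omega> T y1 0)
    + ?b * (?S y2 + sq_trace_term \<Omega> T y2 T + sq_trace_term \<Omega> T y2 0)" .
qed

subsubsection \<open>Energy of finite element functions\<close>

definition "grad_energy K v = (LINT z:interior K|lborel. \<nu> z * (weak_grad_x (interior K) v z \<bullet> weak_grad_x (interior K) v z))"
definition "dt_energy K v = (LINT z:interior K|lborel. (weak_dt (interior K) v z)\<^sup>2)"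

lemma L2_sq_nu_grad:
  assumes K: "K \<in> \<T>" and v: "v \<in> V"
  shows "(LINT z:interior K|lborel. (norm (sqrt (\<nu> z) *\<^sub>R weak_grad_x (interior K) v z))\<^sup>2) = grad_energy K v" "0 \<le> grad_energy K v"
proof -
  let ?E = "interior K"
  note S = open_interior[of K] elem_subset[OF K]
  note G = fe_weak_AE(3)[OF v S]
  note r = nu_sqrt_L2_on[OF S G]
  have "set_integrable lborel ?E (\<lambda>z. (\<nu> z *\<^sub>R weak_grad_x ?E v z) \<bullet> weak_grad_x ?E v z)"
    by (rule L2_on_inner_integrable[OF nu_L2_on[OF S(2,1) G] G])
  then have i: "set_integrable lborel ?E (\<lambda>z. \<nu> z * (weak_grad_x ?E v z \<bullet> weak_grad_x ?E v z))" by simp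
  have j: "set_integrable lborel ?E (\<lambda>z. (norm (sqrt (\<nu> z) *\<^sub>R weak_grad_x ?E v z))\<^sup>2)" using r(1) unfolding L2_on_def by blast
  show eq: "(LINT z:?E|lborel. (norm (sqrt (\<nu> z) *\<^sub>R weak_grad_x ?E v z))\<^sup>2) = grad_energy K v"
    unfolding grad_energy_def by (rule set_integral_cong_AE_integrable[OF j i r(2)])
  show "0 \<le> grad_energy K v" unfolding eq[symmetric] by (rule set_integral_nonneg_real) simp
qed

lemma dt_energy_nonneg: "0 \<le> dt_energy K v"
  unfolding dt_energy_def by (rule set_integral_nonneg_real) simp

text \<open>Every existence test in the norm succeeds for a finite element function, so its norm is
  a real number; this is what allows cancelling it in the error estimate.\<close>

lemma norm_h_fe:
  assumes v: "v \<in> V"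
  shows "norm_h \<Omega> T \<nu> \<T> \<theta> v = ennreal (sqrt ((\<Sum>K\<in>\<T>. grad_energy K v + \<theta> K * diameter K * dt_energy K v)
    + (LINT x:\<Omega>|lborel. (v (x, T))\<^sup>2) + (LINT x:\<Omega>|lborel. (v (x, 0))\<^sup>2)))"
proof -
  have g: "sq_grad_term \<nu> (interior K) v + ennreal (\<theta> K * diameter K) * sq_dt_term (interior K) v
      = ennreal (grad_energy K v + \<theta> K * diameter K * dt_energy K v)"
    and nn: "0 \<le> grad_energy K v + \<theta> K * diameter K * dt_energy K v" if K: "K \<in> \<T>" for K
  proof -
    note S = open_interior[of K] elem_subset[OF K]
    have "sq_grad_term \<nu> (interior K) v = L2_sq (interior K) (\<lambda>z. sqrt (\<nu> z) *\<^sub>R weak_grad_x (interior K) v z)"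
      unfolding sq_grad_term_def using fe_weak(1)[OF v S] by meson
    also have "\<dots> = ennreal (grad_energy K v)"
      unfolding L2_sq_eq_integral[OF nu_sqrt_L2_on(1)[OF S fe_weak_AE(3)[OF v S]]] L2_sq_nu_grad(1)[OF K v] ..
    finally have 1: "sq_grad_term \<nu> (interior K) v = ennreal (grad_energy K v)" .
    have "sq_dt_term (interior K) v = L2_sq (interior K) (weak_dt (interior K) v)"
      unfolding sq_dt_term_def using fe_weak(2)[OF v S] by meson
    also have "\<dots> = ennreal (dt_energy K v)"
      unfolding L2_sq_eq_integral[OF fe_weak_AE(4)[OF v S]] dt_energy_def by simp
    finally have 2: "sq_dt_term (interior K) v = ennreal (dt_energy K v)" .
    have c: "0 \<le> \<theta> K * diameter K" using theta_pos[OF K] diameter_pos[OF K] by simp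
    show "sq_grad_term \<nu> (interior K) v + ennreal (\<theta> K * diameter K) * sq_dt_term (interior K) v
      = ennreal (grad_energy K v + \<theta> K * diameter K * dt_energy K v)"
      unfolding 1 2
      by (simp only: ennreal_mult[OF c dt_energy_nonneg] ennreal_plus[OF L2_sq_nu_grad(2)[OF K v] mult_nonneg_nonneg[OF c dt_energy_nonneg]])
    show "0 \<le> grad_energy K v + \<theta> K * diameter K * dt_energy K v"
      by (intro add_nonneg_nonneg mult_nonneg_nonneg[OF c] dt_energy_nonneg L2_sq_nu_grad(2)[OF K v])
  qed
  have t: "sq_trace_term \<Omega> T v s = ennreal (LINT x:\<Omega>|lborel. (v (x, s))\<^sup>2)" if s: "0 \<le> s" "s \<le> T" for s
  proof -
    have "sq_trace_term \<Omega> T v s = L2_sq \<Omega> (time_trace \<Omega> T v s)"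
      unfolding sq_trace_term_def using fe_trace[OF v] by meson
    also have "\<dots> = L2_sq \<Omega> (\<lambda>x. v (x, s))" by (rule L2_sq_cong_AE[OF fe_trace_AE[OF v s]])
    also have "\<dots> = ennreal (LINT x:\<Omega>|lborel. (v (x, s))\<^sup>2)"
      unfolding L2_sq_eq_integral[OF fe_slice_L2_on[OF v s]] by simp
    finally show ?thesis .
  qed
  have tn: "0 \<le> (LINT x:\<Omega>|lborel. (v (x, s))\<^sup>2)" for s by (rule set_integral_nonneg_real) simp
  have "(\<Sum>K\<in>\<T>. sq_grad_term \<nu> (interior K) v + ennreal (\<theta> K * diameter K) * sq_dt_term (interior K) v) =
      ennreal (\<Sum>K\<in>\<T>. grad_energy K v + \<theta> K * diameter K * dt_energy K v)"
    by (subst sum_ennreal[symmetric]) (use nn g in \<open>auto intro: sum.cong\<close>)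
  then have "norm_h \<Omega> T \<nu> \<T> \<theta> v = sqrt_ennreal (ennreal ((\<Sum>K\<in>\<T>. grad_energy K v + \<theta> K * diameter K * dt_energy K v)
    + (LINT x:\<Omega>|lborel. (v (x, T))\<^sup>2) + (LINT x:\<Omega>|lborel. (v (x, 0))\<^sup>2)))"
    unfolding norm_h_def using T_pos t[of T] t[of 0] tn nn
    by (simp add: ennreal_plus sum_nonneg add_nonneg_nonneg)
  also have "\<dots> = ennreal (sqrt ((\<Sum>K\<in>\<T>. grad_energy K v + \<theta> K * diameter K * dt_energy K v)
    + (LINT x:\<Omega>|lborel. (v (x, T))\<^sup>2) + (LINT x:\<Omega>|lborel. (v (x, 0))\<^sup>2)))"
    by (rule sqrt_ennreal_eq) (intro add_nonneg_nonneg sum_nonneg tn nn)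
  finally show ?thesis .
qed

text \<open>The coefficient \<nu> is merely bounded and measurable, so even for a polynomial the
  flux \<nu> \<nabla> v need not have a divergence. Its existence in L2 is read off from the inverse
  inequality, and the space-time divergence is then the time derivative minus it.\<close>

lemma fe_parabolic_div:
  assumes K: "K \<in> \<T>" and v: "v \<in> V" and inv: "inverse_inequality \<nu> V K c"
  defines "g \<equiv> weak_div_x (interior K) (\<lambda>z. \<nu> z *\<^sub>R weak_grad_x (interior K) v z)"
  shows "has_parabolic_div (interior K) \<nu> v (\<lambda>z. weak_dt (interior K) v z - g z)" "L2_on (interior K) g"
    "L2_norm_on (interior K) g \<le> ennreal (c / diameter K) * L2_norm_on (interior K) (\<lambda>z. sqrt (\<nu> z) *\<^sub>R weak_grad_x (interior K) v z)"
proof -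
  let ?E = "interior K" and ?G = "weak_grad_x (interior K) v"
  note S = open_interior[of K] elem_subset[OF K]
  have Sb: "?E \<in> sets borel" by simp
  obtain h where "has_weak_div_x ?E (\<lambda>z. \<nu> z *\<^sub>R ?G z) h"
    using inv v unfolding inverse_inequality_def Let_def by blast
  then have g: "has_weak_div_x ?E (\<lambda>z. \<nu> z *\<^sub>R ?G z) g" unfolding g_def by (rule weak_div_x)
  then show gL: "L2_on ?E g" unfolding has_weak_div_x_def by blast
  show "L2_norm_on ?E g \<le> ennreal (c / diameter K) * L2_norm_on ?E (\<lambda>z. sqrt (\<nu> z) *\<^sub>R ?G z)"
    using inv v unfolding inverse_inequality_def Let_def g_def by blast
  note vL = fe_weak(3)[OF v S] fe_weak_AE(3,4)[OF v S]
  note fl = nu_L2_on[OF S(2,1) vL(2)]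
  have "has_weak_div ?E (\<lambda>z. (- (\<nu> z *\<^sub>R ?G z), v z)) (\<lambda>z. weak_dt ?E v z - g z)"
    unfolding has_weak_div_def
  proof (intro conjI allI impI)
    show "L2_on ?E (\<lambda>z. (- (\<nu> z *\<^sub>R ?G z), v z))" by (rule flux_L2_on[OF S(2,1) vL(2,1)])
    show "L2_on ?E (\<lambda>z. weak_dt ?E v z - g z)" by (rule L2_on_diff[OF vL(3) gL])
    fix \<phi> :: "'d spacetime \<Rightarrow> real" assume \<phi>: "test_function ?E \<phi>"
    note \<phi>L = test_function_L2[OF \<phi> Sb]
    have i: "set_integrable lborel ?E (\<lambda>z. v z * dt \<phi> z)" "set_integrable lborel ?E (\<lambda>z. (\<nu> z *\<^sub>R ?G z) \<bullet> grad_x \<phi> z)"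
      "set_integrable lborel ?E (\<lambda>z. \<phi> z * weak_dt ?E v z)" "set_integrable lborel ?E (\<lambda>z. \<phi> z * g z)"
      by (intro L2_on_mult_integrable L2_on_inner_integrable \<phi>L vL gL fl)+
    have "(LINT z:?E|lborel. (- (\<nu> z *\<^sub>R ?G z), v z) \<bullet> (grad_x \<phi> z, dt \<phi> z)) =
        (LINT z:?E|lborel. v z * dt \<phi> z - (\<nu> z *\<^sub>R ?G z) \<bullet> grad_x \<phi> z)"
      by (rule set_integral_eq_on) simp
    also have "\<dots> = (LINT z:?E|lborel. v z * dt \<phi> z) - (LINT z:?E|lborel. (\<nu> z *\<^sub>R ?G z) \<bullet> grad_x \<phi> z)"
      by (rule set_integral_diff(2)[OF i(1,2)])
    also have "(LINT z:?E|lborel. v z * dt \<phi> z) = - (LINT z:?E|lborel. \<phi> z * weak_dt ?E v z)"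
      using weak_dt[OF fe_weak(2)[OF v S]] \<phi> unfolding has_weak_dt_def by blast
    also have "(LINT z:?E|lborel. (\<nu> z *\<^sub>R ?G z) \<bullet> grad_x \<phi> z) = - (LINT z:?E|lborel. \<phi> z * g z)"
      using g \<phi> unfolding has_weak_div_x_def by blast
    also have "- (LINT z:?E|lborel. \<phi> z * weak_dt ?E v z) - - (LINT z:?E|lborel. \<phi> z * g z) =
        - ((LINT z:?E|lborel. \<phi> z * weak_dt ?E v z) - (LINT z:?E|lborel. \<phi> z * g z))" by simp
    also have "\<dots> = - (LINT z:?E|lborel. \<phi> z * weak_dt ?E v z - \<phi> z * g z)"
      by (simp only: set_integral_diff(2)[OF i(3,4)])
    also have "\<dots> = - (LINT z:?E|lborel. \<phi> z * (weak_dt ?E v z - g z))" by (simp only: right_diff_distrib)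
    finally show "(LINT z:?E|lborel. (- (\<nu> z *\<^sub>R ?G z), v z) \<bullet> (grad_x \<phi> z, dt \<phi> z)) =
        - (LINT z:?E|lborel. \<phi> z * (weak_dt ?E v z - g z))" .
  qed
  then show "has_parabolic_div ?E \<nu> v (\<lambda>z. weak_dt ?E v z - g z)"
    unfolding has_parabolic_div_def using fe_weak(1)[OF v S] by blast
qed

lemma fe_regular:
  assumes v: "v \<in> V" and inv: "\<And>K. K \<in> \<T> \<Longrightarrow> inverse_inequality \<nu> V K (c K)"
  shows "regular v"
  unfolding regular_def using fe_weak(3)[OF v Q_open order_refl] fe_trace[OF v] fe_parabolic_div(1)[OF _ v inv] by blast

text \<open>With g the spatial divergence of the flux and d the time derivative, (d - g) d is at
  least (d^2 - g^2) / 2. The loss from g^2 is absorbed by half of the gradient energy, by the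
  inverse inequality and the smallness of \<open>\<theta> K\<close>.\<close>

lemma elem_form_coercive:
  assumes K: "K \<in> \<T>" and v: "v \<in> V" and inv: "inverse_inequality \<nu> V K c" and c: "c > 0"
    and small: "\<theta> K \<le> diameter K / c\<^sup>2"
  shows "elem_form K v v \<ge> grad_energy K v / 2 + \<theta> K * diameter K * dt_energy K v / 2
    - (LINT z:interior K|lborel. v z * weak_dt (interior K) v z)"
proof -
  let ?E = "interior K" and ?G = "weak_grad_x (interior K) v" and ?d = "weak_dt (interior K) v"
  define g where "g = weak_div_x ?E (\<lambda>z. \<nu> z *\<^sub>R ?G z)"
  define h where "h = diameter K"
  define B where "B = (LINT z:?E|lborel. (g z)\<^sup>2)"
  note pd = fe_parabolic_div[OF K v inv, folded g_def]
  note S = open_interior[of K] elem_subset[OF K]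
  note vL = fe_weak(3)[OF v S] fe_weak_AE(3,4)[OF v S]
  have h: "h > 0" unfolding h_def by (rule diameter_pos[OF K])
  have \<theta>: "\<theta> K > 0" by (rule theta_pos[OF K])
  note A0 = L2_sq_nu_grad[OF K v]
  have B0: "B \<ge> 0" unfolding B_def by (rule set_integral_nonneg_real) simp
  have "ennreal (sqrt B) \<le> ennreal (c / h) * ennreal (sqrt (grad_energy K v))"
    using pd(3) unfolding L2_norm_on_eq[OF pd(2)] L2_norm_on_eq[OF nu_sqrt_L2_on(1)[OF S vL(2)]] A0(1)
    by (simp add: B_def h_def)
  also have "\<dots> = ennreal (c / h * sqrt (grad_energy K v))" using c h A0(2) by (intro ennreal_mult[symmetric]) auto
  finally have "sqrt B \<le> c / h * sqrt (grad_energy K v)" using c h A0(2) by (simp add: ennreal_le_iff)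
  then have "(sqrt B)\<^sup>2 \<le> (c / h * sqrt (grad_energy K v))\<^sup>2" using B0 by (intro power_mono) auto
  then have B: "B \<le> (c / h)\<^sup>2 * grad_energy K v" using B0 A0(2) by (simp only: power_mult_distrib real_sqrt_pow2)
  \<comment> \<open>Here the bound on \<open>\<theta> K\<close> is spent: the product h^2 / c^2
    cancels (c / h)^2.\<close>
  have "\<theta> K * h * B \<le> (h / c\<^sup>2) * h * ((c / h)\<^sup>2 * grad_energy K v)"
    using small h \<theta> B B0 A0(2) c unfolding h_def[symmetric] by (intro mult_mono) auto
  also have "\<dots> = grad_energy K v" using c h by (simp add: power2_eq_square field_simps)
  finally have key: "\<theta> K * h * B \<le> grad_energy K v" .
  have i: "set_integrable lborel ?E (\<lambda>z. \<nu> z * (?G z \<bullet> ?G z))"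
    "set_integrable lborel ?E (\<lambda>z. v z * ?d z)" "set_integrable lborel ?E (\<lambda>z. (?d z)\<^sup>2)" "set_integrable lborel ?E (\<lambda>z. (g z)\<^sup>2)"
  proof -
    show "set_integrable lborel ?E (\<lambda>z. \<nu> z * (?G z \<bullet> ?G z))"
      using L2_on_inner_integrable[OF nu_L2_on[OF S(2,1) vL(2)] vL(2)] by simp
    show "set_integrable lborel ?E (\<lambda>z. v z * ?d z)" by (rule L2_on_mult_integrable[OF vL(1,3)])
    show "set_integrable lborel ?E (\<lambda>z. (?d z)\<^sup>2)" "set_integrable lborel ?E (\<lambda>z. (g z)\<^sup>2)"
      using L2_on_mult_integrable[OF vL(3,3)] L2_on_mult_integrable[OF pd(2,2)] by (simp_all add: power2_eq_square)
  qed
  let ?k = "\<theta> K * h / 2"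
  let ?R = "\<lambda>z. ((\<nu> z * (?G z \<bullet> ?G z) - v z * ?d z) + ?k * (?d z)\<^sup>2) - ?k * (g z)\<^sup>2"
  note s1 = set_integral_diff[OF i(1,2)]
  note s2 = set_integral_add[OF s1(1) set_integrable_mult_right[OF i(3), of ?k]]
  note s3 = set_integral_diff[OF s2(1) set_integrable_mult_right[OF i(4), of ?k]]
  note I = elem_integrand_integrable[OF K pd(1) v]
  have "(LINT z:?E|lborel. ?R z) \<le> elem_form K v v"
    unfolding elem_form_def set_lebesgue_integral_def
  proof (rule integral_mono_AE)
    show "integrable lborel (\<lambda>z. indicator ?E z *\<^sub>R ?R z)" using s3(1) unfolding set_integrable_def .
    show "integrable lborel (\<lambda>z. indicator ?E z *\<^sub>R (\<nu> z * (?G z \<bullet> ?G z) - v z * ?d z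
        + \<theta> K * diameter K * parabolic_div ?E \<nu> v z * ?d z))"
      using I unfolding set_integrable_def .
    show "AE z in lborel. indicator ?E z *\<^sub>R ?R z \<le> indicator ?E z *\<^sub>R (\<nu> z * (?G z \<bullet> ?G z) - v z * ?d z
        + \<theta> K * diameter K * parabolic_div ?E \<nu> v z * ?d z)"
      using parabolic_div_AE[OF S(1) elem_bounded[OF K] pd(1)]
    proof eventually_elim
      case (elim z)
      show ?case
      proof (cases "z \<in> ?E")
        case True
        have "?d z * g z \<le> ((?d z)\<^sup>2 + (g z)\<^sup>2) / 2" using sum_squares_bound[of "?d z" "g z"] by simp
        then have "(?d z)\<^sup>2 / 2 - (g z)\<^sup>2 / 2 \<le> (?d z - g z) * ?d z"
          by (simp add: power2_eq_square algebra_simps)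
        then have "\<theta> K * h * ((?d z)\<^sup>2 / 2 - (g z)\<^sup>2 / 2) \<le> \<theta> K * h * ((?d z - g z) * ?d z)"
          using \<theta> h by (intro mult_left_mono) auto
        moreover have "\<theta> K * h * ((?d z)\<^sup>2 / 2 - (g z)\<^sup>2 / 2) = ?k * (?d z)\<^sup>2 - ?k * (g z)\<^sup>2"
          by (simp add: algebra_simps)
        moreover have "\<theta> K * h * ((?d z - g z) * ?d z) = \<theta> K * diameter K * parabolic_div ?E \<nu> v z * ?d z"
          using elim True by (simp add: h_def)
        ultimately show ?thesis using True by simp
      next
        case False then show ?thesis by simp
      qed
    qed
  qed
  moreover have "(LINT z:?E|lborel. ?R z) = grad_energy K v - (LINT z:?E|lborel. v z * ?d z) + ?k * dt_energy K v - ?k * B"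
    unfolding s3(2) s2(2) s1(2) set_integral_mult_right grad_energy_def dt_energy_def B_def ..
  moreover have "?k * B \<le> grad_energy K v / 2" using key by simp
  ultimately show ?thesis unfolding h_def[symmetric] by simp
qed

text \<open>The mixed terms of all elements add up to minus half the squared end value at T plus
  half the one at 0. The final-time term of the form adds the full square at T, so half of both end
  values remains, beside half of the element energies.\<close>

lemma coercive:
  assumes inv: "\<And>K. K \<in> \<T> \<Longrightarrow> c K > 0 \<and> inverse_inequality \<nu> V K (c K)"
    and small: "\<And>K. K \<in> \<T> \<Longrightarrow> \<theta> K \<le> diameter K / (c K)\<^sup>2"
  shows "coercivity_estimate \<Omega> T \<nu> \<T> \<theta> V (1 / 2)"
  unfolding coercivity_estimate_def
proof
  fix v assume v: "v \<in> V"
  let ?T = "LINT x:\<Omega>|lborel. (v (x, T))\<^sup>2" and ?Z = "LINT x:\<Omega>|lborel. (v (x, 0))\<^sup>2"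
  let ?N = "\<Sum>K\<in>\<T>. grad_energy K v + \<theta> K * diameter K * dt_energy K v"
  note fe = fe_weak[OF v Q_open order_refl]
  have i: "set_integrable lborel Q (\<lambda>z. v z * fe_dt v z)" by (rule L2_on_mult_integrable[OF fe(3,5)])
  have "(\<Sum>K\<in>\<T>. LINT z:interior K|lborel. v z * weak_dt (interior K) v z) = (\<Sum>K\<in>\<T>. LINT z:interior K|lborel. v z * fe_dt v z)"
  proof (rule sum.cong[OF refl])
    fix K assume K: "K \<in> \<T>"
    note S = open_interior[of K] elem_subset[OF K]
    show "(LINT z:interior K|lborel. v z * weak_dt (interior K) v z) = (LINT z:interior K|lborel. v z * fe_dt v z)"
      by (rule set_integral_cong_AE_integrable[OF L2_on_mult_integrable[OF fe_weak(3)[OF v S] fe_weak_AE(4)[OF v S]]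
            L2_on_mult_integrable[OF fe_weak(3)[OF v S] fe_weak(5)[OF v S]]])
         (use fe_weak_AE(2)[OF v S] in eventually_elim, simp)
  qed
  also have "\<dots> = (LINT z:Q|lborel. v z * fe_dt v z)" by (rule mesh_set_integral[OF mesh elem_subset i, symmetric])
  also have "\<dots> = (?T - ?Z) / 2" by (rule fe_energy[OF v])
  finally have vd: "(\<Sum>K\<in>\<T>. LINT z:interior K|lborel. v z * weak_dt (interior K) v z) = (?T - ?Z) / 2" .
  have "(\<Sum>K\<in>\<T>. elem_form K v v) \<ge> (\<Sum>K\<in>\<T>. (grad_energy K v + \<theta> K * diameter K * dt_energy K v) / 2
      - (LINT z:interior K|lborel. v z * weak_dt (interior K) v z))"
    using elem_form_coercive[OF _ v] inv small by (intro sum_mono) (fastforce simp: add_divide_distrib)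
  also have "(\<Sum>K\<in>\<T>. (grad_energy K v + \<theta> K * diameter K * dt_energy K v) / 2
      - (LINT z:interior K|lborel. v z * weak_dt (interior K) v z)) = ?N / 2 - (?T - ?Z) / 2"
    unfolding sum_subtractf vd by (simp only: sum_divide_distrib)
  finally have E: "?N / 2 - (?T - ?Z) / 2 \<le> (\<Sum>K\<in>\<T>. elem_form K v v)" .
  have T0: "0 \<le> T" "T \<le> T" using T_pos by simp_all
  note vT = fe_slice_L2_on[OF v T0]
  have tL: "L2_on \<Omega> (time_trace \<Omega> T v T)" using time_trace[OF fe_trace[OF v, of T]] unfolding has_time_trace_def by blast
  have "(LINT x:\<Omega>|lborel. time_trace \<Omega> T v T x * v (x, T)) = (LINT x:\<Omega>|lborel. v (x, T) * v (x, T))"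
    by (rule set_integral_cong_AE_integrable[OF L2_on_mult_integrable[OF tL vT] L2_on_mult_integrable[OF vT vT]])
       (use fe_trace_AE[OF v T0] in eventually_elim, simp)
  then have a: "a_h \<Omega> T \<nu> \<T> \<theta> v v = (\<Sum>K\<in>\<T>. elem_form K v v) + ?T"
    unfolding a_h_elem_form by (simp add: power2_eq_square)
  have nn: "0 \<le> ?N + ?T + ?Z"
  proof (intro add_nonneg_nonneg sum_nonneg)
    show "0 \<le> ?T" "0 \<le> ?Z" by (rule set_integral_nonneg_real, simp)+
    fix K assume K: "K \<in> \<T>"
    show "0 \<le> grad_energy K v" by (rule L2_sq_nu_grad(2)[OF K v])
    show "0 \<le> \<theta> K * diameter K * dt_energy K v"
      using theta_pos[OF K] diameter_pos[OF K] dt_energy_nonneg[of K v] by simp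
  qed
  have aux: "n / 2 - (t - z) / 2 \<le> s \<Longrightarrow> (n + t + z) / 2 \<le> s + t" for n t z s :: real by (simp add: field_simps)
  have "enn2ereal ((norm_h \<Omega> T \<nu> \<T> \<theta> v)\<^sup>2) = ereal (?N + ?T + ?Z)"
    unfolding norm_h_fe[OF v] using nn by (simp add: ennreal_power)
  moreover have "(?N + ?T + ?Z) / 2 \<le> a_h \<Omega> T \<nu> \<T> \<theta> v v" unfolding a by (rule aux[OF E])
  ultimately show "ereal (1 / 2) * enn2ereal ((norm_h \<Omega> T \<nu> \<T> \<theta> v)\<^sup>2) \<le> ereal (a_h \<Omega> T \<nu> \<T> \<theta> v v)" by simp
qed

end

subsection \<open>The error estimate\<close>

context space_time_solution
begin

lemma error_estimate:
  assumes inv: "\<And>K. K \<in> \<T> \<Longrightarrow> inverse_inequality \<nu> V K (c K)"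
    and uh: "u_h \<in> V" and galerkin: "\<And>v. v \<in> V \<Longrightarrow> a_h \<Omega> T \<nu> \<T> \<theta> u_h v = l_h \<Omega> \<T> \<theta> f F u0 v"
    and \<mu>: "\<mu> > 0" and coer: "coercivity_estimate \<Omega> T \<nu> \<T> \<theta> V \<mu>"
    and bdd: "boundedness_estimate \<Omega> T \<nu> \<T> \<theta> W V 1" and v: "v \<in> V" and W: "(\<lambda>z. u z - v z) \<in> W"
  shows "norm_h \<Omega> T \<nu> \<T> \<theta> (\<lambda>z. u z - u_h z) \<le>
    norm_h \<Omega> T \<nu> \<T> \<theta> (\<lambda>z. u z - v z) + ennreal (1 / \<mu>) * norm_h_star \<Omega> T \<nu> \<T> \<theta> (\<lambda>z. u z - v z)"
proof (cases "norm_h \<Omega> T \<nu> \<T> \<theta> (\<lambda>z. u z - v z) = top \<or> norm_h_star \<Omega> T \<nu> \<T> \<theta> (\<lambda>z. u z - v z) = top")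
  case True
  then have "norm_h \<Omega> T \<nu> \<T> \<theta> (\<lambda>z. u z - v z) + ennreal (1 / \<mu>) * norm_h_star \<Omega> T \<nu> \<T> \<theta> (\<lambda>z. u z - v z) = top"
    using \<mu> by (auto simp: ennreal_mult_top)
  then show ?thesis by (simp only: top_greatest)
next
  case False
  let ?a = "a_h \<Omega> T \<nu> \<T> \<theta>" and ?n = "norm_h \<Omega> T \<nu> \<T> \<theta>"
  let ?e = "\<lambda>z. u z - v z" and ?w = "\<lambda>z. v z - u_h z"
  have w: "?w \<in> V" using V_0h_add_scaled[OF v uh, of "- 1"] by simp
  note vL = fe_weak(3)[OF v Q_open order_refl] and wL = fe_weak(3)[OF w Q_open order_refl]
  have eL: "L2_on Q ?e" by (rule L2_on_diff[OF u_weak(2) vL])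
  \<comment> \<open>Consistency requires a trace of \<open>u\<close> at T. A finite norm of u - v
    provides one for the difference, and \<open>v\<close> has one as a finite element
    function.\<close>
  obtain g where g: "has_time_trace \<Omega> T u T g"
  proof -
    have "sq_trace_term \<Omega> T ?e T \<noteq> \<infinity>"
    proof
      assume "sq_trace_term \<Omega> T ?e T = \<infinity>"
      then have "?n ?e = top" by (simp add: norm_h_def sqrt_ennreal_top)
      then show False using False by blast
    qed
    then obtain g where g: "has_time_trace \<Omega> T ?e T g" unfolding sq_trace_term_def by metis
    have "has_time_trace \<Omega> T (\<lambda>z. ?e z + 1 * v z) T (\<lambda>x. g x + 1 * fe_ext \<Omega> T v (x, T))"
      by (rule has_time_trace_add_scaled[OF domain_open g fe_trace[OF v] L2_on_set_measurable[OF eL] L2_on_set_measurable[OF vL]])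
    then have "has_time_trace \<Omega> T u T (\<lambda>x. g x + fe_ext \<Omega> T v (x, T))" by simp
    then show ?thesis by (rule that)
  qed
  note reg = u_regular[OF g] fe_regular[OF v inv] fe_regular[OF uh inv]
  have aw: "?a ?w ?w = ?a v ?w - ?a u_h ?w" using a_h_add_scaled[OF reg(2,3) w, of "- 1"] by simp
  have ae: "?a ?e ?w = ?a u ?w - ?a v ?w" using a_h_add_scaled[OF reg(1,2) w, of "- 1"] by simp
  have "?a u_h ?w = ?a u ?w" using galerkin[OF w] consistency[OF w g] by simp
  then have orth: "?a ?w ?w = - ?a ?e ?w" using aw ae by simp
  define n where "n = enn2real (?n ?w)"
  have n: "?n ?w = ennreal n" "n \<ge> 0" unfolding n_def by (simp_all add: norm_h_fe[OF w])
  define r where "r = enn2real (norm_h_star \<Omega> T \<nu> \<T> \<theta> ?e)"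
  have r: "norm_h_star \<Omega> T \<nu> \<T> \<theta> ?e = ennreal r" "r \<ge> 0"
    unfolding r_def using False by (simp_all add: top.not_eq_extremum)
  have "ereal \<mu> * enn2ereal ((?n ?w)\<^sup>2) \<le> ereal (?a ?w ?w)"
    using coer w unfolding coercivity_estimate_def by blast
  then have lower: "\<mu> * n\<^sup>2 \<le> ?a ?w ?w" using n by (simp add: ennreal_power)
  have "ennreal \<bar>?a ?e ?w\<bar> \<le> ennreal 1 * norm_h_star \<Omega> T \<nu> \<T> \<theta> ?e * ?n ?w"
    using bdd W w unfolding boundedness_estimate_def by blast
  then have "ennreal \<bar>?a ?e ?w\<bar> \<le> ennreal (r * n)" using n r by (simp add: ennreal_mult)
  then have upper: "\<bar>?a ?e ?w\<bar> \<le> r * n" using n(2) r(2) by (simp add: ennreal_le_iff)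
  have "\<mu> * n\<^sup>2 \<le> r * n" using lower upper unfolding orth by linarith
  then have "n * (\<mu> * n) \<le> n * r" by (simp add: power2_eq_square ac_simps)
  \<comment> \<open>Cancelling the factor n is possible for n > 0; for n = 0 the claim is that r is
    non-negative.\<close>
  then have "\<mu> * n \<le> r" using n(2) r(2) \<mu> by (cases "n = 0") (auto simp: mult_le_cancel_left)
  then have "n \<le> 1 / \<mu> * r" using \<mu> by (simp add: pos_le_divide_eq mult.commute)
  then have wn: "?n ?w \<le> ennreal (1 / \<mu>) * norm_h_star \<Omega> T \<nu> \<T> \<theta> ?e"
    using \<mu> r unfolding n(1) r(1) by (subst ennreal_mult[symmetric]) (auto intro: ennreal_leI)
  have "?n (\<lambda>z. ?e z + ?w z) \<le> ?n ?e + ?n ?w" by (rule norm_h_triangle[OF eL wL])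
  also have "\<dots> \<le> ?n ?e + ennreal (1 / \<mu>) * norm_h_star \<Omega> T \<nu> \<T> \<theta> ?e" by (rule add_left_mono[OF wn])
  finally show ?thesis by simp
qed

end

theorem lemma4:
  fixes \<Omega> :: "(real ^ 'd::finite) set"
    and T \<nu>_lo \<nu>_hi \<sigma> :: real
    and \<nu> f u u_h :: "'d spacetime \<Rightarrow> real"
    and F :: "'d spacetime \<Rightarrow> real ^ 'd"
    and u0 :: "real ^ 'd \<Rightarrow> real"
    and m p :: nat
    and Qs :: "nat \<Rightarrow> 'd spacetime set"
    and \<T> :: "'d spacetime set set"
    and X :: "'d spacetime set \<Rightarrow> 'd spacetime \<Rightarrow> 'd spacetime"
    and \<theta> c_I :: "'d spacetime set \<Rightarrow> real"
  defines "Q \<equiv> cylinder \<Omega> T"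
    and "V \<equiv> V_0h \<Omega> T p \<T> X"
  assumes dim: "CARD('d) \<in> {1, 2, 3}"
    and domain: "lipschitz_domain \<Omega>" "T > 0"
    and nu: "set_borel_measurable lborel Q \<nu>" "0 < \<nu>_lo" "0 < \<nu>_hi"
      "AE z in lborel. z \<in> Q \<longrightarrow> \<nu>_lo \<le> \<nu> z \<and> \<nu> z \<le> \<nu>_hi"
    and data: "L2_on Q f" "L2_on Q F" "L2_on \<Omega> u0"
    and decomp: "decomposition_of Q m Qs"
    and F_div: "\<And>i. i \<in> {1..m} \<Longrightarrow> \<exists>g. has_weak_div_x (Qs i) F g"
    and mesh: "simplicial_mesh Q \<sigma> \<T> X" "aligned_with \<T> m Qs"
    and degree: "p \<ge> 1"
    and inverse_ineq: "\<And>K. K \<in> \<T> \<Longrightarrow> c_I K > 0 \<and> inverse_inequality \<nu> V K (c_I K)"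
    and theta: "\<And>K. K \<in> \<T> \<Longrightarrow> \<theta> K > 0"
    and u: "u \<in> HL_0 \<Omega> T \<nu> m Qs" "variational_solution \<Omega> T \<nu> f F u0 u"
    and u_h: "u_h \<in> V" "\<And>v. v \<in> V \<Longrightarrow> a_h \<Omega> T \<nu> \<T> \<theta> u_h v = l_h \<Omega> \<T> \<theta> f F u0 v"
  shows "((\<forall>K\<in>\<T>. \<theta> K \<le> diameter K / (c_I K)\<^sup>2) \<longrightarrow>
      coercivity_estimate \<Omega> T \<nu> \<T> \<theta> V (1 / 2)) \<and>
    (\<forall>\<mu>_c \<mu>_b. \<mu>_c > 0 \<longrightarrow> coercivity_estimate \<Omega> T \<nu> \<T> \<theta> V \<mu>_c \<longrightarrow>
      \<mu>_b = 1 \<longrightarrow>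
      boundedness_estimate \<Omega> T \<nu> \<T> \<theta> (V_0h_star \<Omega> T \<nu> m Qs p \<T> X) V \<mu>_b \<longrightarrow>
      norm_h \<Omega> T \<nu> \<T> \<theta> (\<lambda>z. u z - u_h z) \<le>
        (INF v\<in>V. norm_h \<Omega> T \<nu> \<T> \<theta> (\<lambda>z. u z - v z)
          + ennreal (\<mu>_b / \<mu>_c) * norm_h_star \<Omega> T \<nu> \<T> \<theta> (\<lambda>z. u z - v z)))"
proof -
  interpret fem: space_time_solution \<Omega> T \<sigma> \<nu>_lo \<nu>_hi \<nu> \<T> X p \<theta> f u F u0 m Qs
  proof unfold_locales
    show "set_borel_measurable lborel (cylinder \<Omega> T) \<nu>"
      "AE z in lborel. z \<in> cylinder \<Omega> T \<longrightarrow> \<nu>_lo \<le> \<nu> z \<and> \<nu> z \<le> \<nu>_hi"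
      using nu(1,4) unfolding Q_def by blast+
    show "simplicial_mesh (cylinder \<Omega> T) \<sigma> \<T> X" using mesh(1) unfolding Q_def .
    show "L2_on (cylinder \<Omega> T) f" "L2_on (cylinder \<Omega> T) F" using data(1,2) unfolding Q_def .
    show "decomposition_of (cylinder \<Omega> T) m Qs" using decomp unfolding Q_def .
    show "u \<in> H10_0 \<Omega> T" using u(1) unfolding HL_0_def by blast
  qed (fact domain nu(2) data(3) F_div mesh(2) u(2) theta)+
  show ?thesis
  proof (intro conjI impI allI)
    assume "\<forall>K\<in>\<T>. \<theta> K \<le> diameter K / (c_I K)\<^sup>2"
    then show "coercivity_estimate \<Omega> T \<nu> \<T> \<theta> V (1 / 2)"
      using inverse_ineq unfolding V_def by (intro fem.coercive[of c_I]) auto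
  next
    fix \<mu>_c \<mu>_b :: real
    assume \<mu>: "\<mu>_c > 0" "coercivity_estimate \<Omega> T \<nu> \<T> \<theta> V \<mu>_c" "\<mu>_b = 1"
      and bdd: "boundedness_estimate \<Omega> T \<nu> \<T> \<theta> (V_0h_star \<Omega> T \<nu> m Qs p \<T> X) V \<mu>_b"
    show "norm_h \<Omega> T \<nu> \<T> \<theta> (\<lambda>z. u z - u_h z) \<le>
        (INF v\<in>V. norm_h \<Omega> T \<nu> \<T> \<theta> (\<lambda>z. u z - v z)
          + ennreal (\<mu>_b / \<mu>_c) * norm_h_star \<Omega> T \<nu> \<T> \<theta> (\<lambda>z. u z - v z))"
    proof (rule INF_greatest)
      fix v assume v: "v \<in> V"
      \<comment> \<open>Only closure under scaled sums is at hand, so - v is written as v - 2 v; it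
        is needed because \<open>V_0h_star\<close> is a set of sums.\<close>
      have "(\<lambda>z. v z + (- 2) * v z) \<in> V" using v unfolding V_def by (intro V_0h_add_scaled)
      then have "(\<lambda>z. - v z) \<in> V" by simp
      then have "(\<lambda>z. u z + - v z) \<in> V_0h_star \<Omega> T \<nu> m Qs p \<T> X"
        using u(1) unfolding V_0h_star_def V_def by (intro CollectI exI[of _ u] exI[of _ "\<lambda>z. - v z"]) simp
      then have W: "(\<lambda>z. u z - v z) \<in> V_0h_star \<Omega> T \<nu> m Qs p \<T> X" by simp
      show "norm_h \<Omega> T \<nu> \<T> \<theta> (\<lambda>z. u z - u_h z) \<le> norm_h \<Omega> T \<nu> \<T> \<theta> (\<lambda>z. u z - v z)
          + ennreal (\<mu>_b / \<mu>_c) * norm_h_star \<Omega> T \<nu> \<T> \<theta> (\<lambda>z. u z - v z)"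
        unfolding \<mu>(3)
        by (rule fem.error_estimate[of c_I, OF _ _ _ \<mu>(1) _ _ _ W])
           (use inverse_ineq u_h \<mu>(2) bdd v in \<open>simp_all add: V_def \<mu>(3)\<close>)
    qed
  qed
qed

end
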